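(* Let $\omega\subset\mathbb{R}^2$ be a bounded open connected set, let $\beta$ be a real constant, and let $\theta:\mathbb{R}\to\mathbb{R}$ be given by $\dot\theta(x_1)=\beta+\varepsilon(x_1)$, where $\varepsilon:\mathbb{R}\to\mathbb{R}$ is a bounded function. Assume $\beta\varepsilon\geq 0$ and $\beta\varepsilon\neq 0$ (i.e. $\beta\varepsilon$ is not identically equal to zero). Suppose that $\omega$ is not rotationally invariant (with respect to the origin in $\mathbb{R}^2$) and that its boundary $\partial\omega$ is of class $C^4$. Let $\Omega$ be the corresponding twisted tube. There exist positive constants $\beta^*=\beta^*(\omega)$, $\varepsilon^*=\varepsilon^*(\beta,\varepsilon,\omega)$ and $c=c(\beta,\varepsilon,\omega)$ such that if $|\beta|\leq\beta^*$ and $\|\varepsilon\|_\infty\leq\varepsilon^*$ then $$\forall \psi\in H_0^1(\Omega)\,,\qquad \int_\Omega|\nabla\psi(x)|^2\,dx-\lambda_1\int_\Omega|\psi(x)|^2\,dx\ \geq\ c\int_\Omega\frac{|\psi(x)|^2}{1+|x|^2}\,dx\,.$$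
   Context: Points of $\mathbb{R}\times\omega$ are written $(x_1,x_2,x_3)$ with $x_1\in\mathbb{R}$ and $x'=(x_2,x_3)\in\omega$. The twisted tube with cross-section $\omega$ and twisting angle $\theta$ is $$\Omega:=\left\{\begin{pmatrix}1&0&0\\ 0&\cos\theta(x_1)&\sin\theta(x_1)\\ 0&-\sin\theta(x_1)&\cos\theta(x_1)\end{pmatrix}\begin{pmatrix}x_1\\ x_2\\ x_3\end{pmatrix}\ :\ (x_1,x_2,x_3)\in\mathbb{R}\times\omega\right\}\subset\mathbb{R}^3.$$ In the inequality, $|x|$ is the Euclidean norm of the point $x\in\Omega\subset\mathbb{R}^3$, and $\|\cdot\|_\infty$ is the supremum norm. Set $\nabla':=(\partial_2,\partial_3)$ (transverse gradient) and $\partial_\tau:=x_3\partial_2-x_2\partial_3$ (transverse angular derivative). The number $\lambda_1$ is the lowest eigenvalue of the operator $-\Delta_D^\omega-\beta^2\partial_\tau^2$ in $L^2(\omega)$, where $-\Delta_D^\omega$ is the Dirichlet Laplacian in $\omega$; equivalently, $$\lambda_1=\inf_{\chi\in C_0^\infty(\omega)\setminus\{0\}}\frac{\|\nabla'\chi\|_{L^2(\omega)}^2+\beta^2\|\partial_\tau\chi\|_{L^2(\omega)}^2}{\|\chi\|_{L^2(\omega)}^2}\,.$$ *)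

theory Defs
  imports "HOL-Analysis.Analysis"
begin

fun Ck_on :: "nat \<Rightarrow> 'a::euclidean_space set \<Rightarrow> ('a \<Rightarrow> 'b::real_normed_vector) \<Rightarrow> bool" where
  "Ck_on 0 U f \<longleftrightarrow> continuous_on U f"
| "Ck_on (Suc k) U f \<longleftrightarrow>
     (\<forall>x\<in>U. f differentiable (at x)) \<and>
     (\<forall>v. Ck_on k U (\<lambda>x. frechet_derivative f (at x) v))"

definition test_functions :: "(real ^ 'n) set \<Rightarrow> (real ^ 'n \<Rightarrow> complex) set" where
  "test_functions U = {\<phi>. (\<forall>k. Ck_on k UNIV \<phi>) \<and>
     compact (closure {x. \<phi> x \<noteq> 0}) \<and> closure {x. \<phi> x \<noteq> 0} \<subseteq> U}"

definition grad :: "(real ^ 'n \<Rightarrow> complex) \<Rightarrow> real ^ 'n \<Rightarrow> complex ^ 'n" where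
  "grad f x = (\<chi> i. frechet_derivative f (at x) (axis i 1))"

definition square_integrable_on ::
    "(real ^ 'n) set \<Rightarrow> (real ^ 'n \<Rightarrow> 'b::euclidean_space) \<Rightarrow> bool" where
  "square_integrable_on U f \<longleftrightarrow>
     f \<in> borel_measurable (lebesgue_on U) \<and> integrable (lebesgue_on U) (\<lambda>x. (norm (f x))\<^sup>2)"

definition locally_integrable_on ::
    "(real ^ 'n) set \<Rightarrow> (real ^ 'n \<Rightarrow> 'b::euclidean_space) \<Rightarrow> bool" where
  "locally_integrable_on U f \<longleftrightarrow>
     (\<forall>K. compact K \<and> K \<subseteq> U \<longrightarrow> integrable (lebesgue_on K) f)"

definition has_weak_gradient ::
    "(real ^ 'n) set \<Rightarrow> (real ^ 'n \<Rightarrow> complex) \<Rightarrow> (real ^ 'n \<Rightarrow> complex ^ 'n) \<Rightarrow> bool" where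
  "has_weak_gradient U f G \<longleftrightarrow>
     locally_integrable_on U f \<and> locally_integrable_on U G \<and>
     (\<forall>\<phi>\<in>test_functions U. \<forall>i.
        (LINT x|lebesgue_on U. f x * grad \<phi> x $ i) =
        - (LINT x|lebesgue_on U. G x $ i * \<phi> x))"

text \<open>The Sobolev space \<open>H\<^sup>1\<^sub>0(U)\<close>: the closure of the test functions in \<open>H\<^sup>1(U)\<close>.
  Its elements are represented by functions on the whole space; only the values on \<open>U\<close> matter.\<close>

definition H1_0 :: "(real ^ 'n) set \<Rightarrow> (real ^ 'n \<Rightarrow> complex) set" where
  "H1_0 U = {f. \<exists>G. square_integrable_on U f \<and> square_integrable_on U G \<and>
     has_weak_gradient U f G \<and>
     (\<exists>\<phi>. (\<forall>n::nat. \<phi> n \<in> test_functions U) \<and>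
        (\<lambda>n. (LINT x|lebesgue_on U. (norm (\<phi> n x - f x))\<^sup>2) +
             (LINT x|lebesgue_on U. (norm (grad (\<phi> n) x - G x))\<^sup>2)) \<longlonglongrightarrow> 0)}"

definition rotationally_invariant :: "(real ^ 2) set \<Rightarrow> bool" where
  "rotationally_invariant \<omega> \<longleftrightarrow>
     (\<forall>\<alpha>::real. (\<lambda>y. vector [vector [cos \<alpha>, sin \<alpha>], vector [- sin \<alpha>, cos \<alpha>]] *v y) ` \<omega> = \<omega>)"

text \<open>The boundary is of class \<open>C\<^sup>k\<close> if, in suitable Cartesian coordinates near each of its
  points, the set is the strict epigraph of a \<open>C\<^sup>k\<close> function; \<open>(u, v)\<close> is the orthonormal
  frame of these coordinates.\<close>

definition Ck_boundary :: "nat \<Rightarrow> (real ^ 2) set \<Rightarrow> bool" where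
  "Ck_boundary k \<omega> \<longleftrightarrow>
     (\<forall>p\<in>frontier \<omega>. \<exists>r>0. \<exists>u v. \<exists>\<gamma>::real \<Rightarrow> real.
        norm u = 1 \<and> norm v = 1 \<and> u \<bullet> v = 0 \<and> Ck_on k UNIV \<gamma> \<and>
        \<omega> \<inter> ball p r = {x \<in> ball p r. \<gamma> (u \<bullet> x) < v \<bullet> x})"

text \<open>A point of the cross-section has components \<open>y $ 1 = x\<^sub>2\<close> and \<open>y $ 2 = x\<^sub>3\<close>.\<close>

definition twisted_tube :: "(real ^ 2) set \<Rightarrow> (real \<Rightarrow> real) \<Rightarrow> (real ^ 3) set" where
  "twisted_tube \<omega> \<theta> =
     {vector [vector [1, 0, 0],
              vector [0, cos (\<theta> x1), sin (\<theta> x1)],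
              vector [0, - sin (\<theta> x1), cos (\<theta> x1)]] *v (vector [x1, x2, x3] :: real ^ 3)
      | x1 x2 x3. (vector [x2, x3] :: real ^ 2) \<in> \<omega>}"

definition angular_deriv :: "(real ^ 2 \<Rightarrow> complex) \<Rightarrow> real ^ 2 \<Rightarrow> complex" where
  "angular_deriv f y =
     complex_of_real (y $ 2) * grad f y $ 1 - complex_of_real (y $ 1) * grad f y $ 2"

definition lambda1 :: "(real ^ 2) set \<Rightarrow> real \<Rightarrow> real" where
  "lambda1 \<omega> \<beta> = (INF u \<in> test_functions \<omega> - {\<lambda>_. 0}.
     ((LINT y|lebesgue_on \<omega>. (norm (grad u y))\<^sup>2) +
      \<beta>\<^sup>2 * (LINT y|lebesgue_on \<omega>. (norm (angular_deriv u y))\<^sup>2)) /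
     (LINT y|lebesgue_on \<omega>. (norm (u y))\<^sup>2))"

end

theory Submission
  imports Defs "HOL-Complex_Analysis.Great_Picard" "HOL-Real_Asymp.Real_Asymp"
begin

text \<open>Rotating the slice at height \<open>s\<close> back by \<open>\<theta> s\<close> straightens the tube: a function \<open>\<psi>\<close> on the tube
  becomes a family \<open>\<phi>\<^sub>s\<close> of functions on the fixed cross-section \<open>\<omega>\<close>, and its longitudinal derivative becomes
  \<open>\<partial>\<^sub>s \<phi> - (\<beta> + \<epsilon>) \<partial>\<^sub>\<tau> \<phi>\<close> (\<open>tube_Fubini\<close>, \<open>longitudinal_derivative\<close>). For \<open>\<epsilon> = 0\<close> the transverse part
  of the energy is the form of \<open>- \<Delta> - \<beta>\<^sup>2 \<partial>\<^sub>\<tau>\<^sup>2 - \<lambda>\<^sub>1\<close>, which is nonnegative. A twist with \<open>\<beta> \<epsilon> \<ge> 0\<close> adds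
  \<open>2 \<beta> \<epsilon> \<parallel>\<partial>\<^sub>\<tau> \<phi>\<parallel>\<^sup>2\<close>, a repulsive potential along the tube, and in one dimension a nonnegative
  potential that is not identically zero, together with the kinetic energy, dominates \<open>1 / (1 + s\<^sup>2)\<close>.

  On a slice, \<open>\<phi> = f \<xi> + \<eta>\<close> with \<open>\<xi>\<close> close to the ground state of \<open>\<omega>\<close> and \<open>\<eta>\<close> orthogonal to it. Three facts
  enter. First, \<open>\<eta>\<close> costs a fixed multiple of its norm and of its Dirichlet energy, uniformly for small
  \<open>\<beta>\<close> (\<open>transverse_gap\<close>); the smallness of \<open>\<beta>\<close> and of \<open>\<epsilon>\<close> relative to \<open>\<beta>\<close> lets this cost absorb
  all mixed terms except one. Secondly, the remaining mixed term is removed by adding the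
  \<open>s\<close>-derivative of \<open>2 \<beta> f \<langle>\<partial>\<^sub>\<tau> \<xi>, \<phi>\<rangle>\<close>, which integrates to zero (\<open>slice_inequality\<close>). Thirdly, \<open>\<parallel>\<partial>\<^sub>\<tau> \<xi>\<parallel>\<close> is bounded below because
  \<open>\<omega>\<close> is not rotationally invariant (\<open>angular_derivative_lower_bound\<close>), so \<open>f\<close> feels a potential comparable
  to \<open>\<beta> \<epsilon>\<close>, and \<open>hardy_with_potential\<close> applies. Integration over \<open>s\<close> gives the inequality for test functions
  (\<open>tube_inequality_test\<close>); it passes to \<open>H\<^sup>1\<^sub>0\<close> by density, the weak gradient being unique
  (\<open>weak_gradient_unique\<close>).

  No ground state is ever constructed. The function \<open>\<xi>\<close> is a near-minimizer of the Rayleigh quotient, which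
  produces an error \<open>\<kappa> f\<^sup>2\<close>, and \<open>\<kappa>\<close> tends to zero at the end, with \<open>\<psi>\<close> fixed. What replaces the spectral
  theorem is compactness (\<open>rellich\<close>) and the positivity of limits of minimizing sequences
  (\<open>minimizing_limit_sign\<close>). The latter rests on a logarithmic estimate: testing the approximate
  eigenvalue equation of a positive near-minimizer \<open>p\<close> with \<open>\<phi>\<^sup>2 / (p + \<delta>)\<close> bounds the gradient of
  \<open>ln (p + \<delta>)\<close> independently of \<open>\<delta>\<close>, so by the Poincare inequality a limit is either almost everywhere zero
  or almost everywhere positive on each small ball, and connectedness of \<open>\<omega>\<close> does the rest. Two
  orthogonal limits cannot both have a sign, which is the spectral gap; and a limit \<open>w\<close> with
  \<open>\<partial>\<^sub>\<tau> w = 0\<close> is invariant under rotations and nonzero exactly on \<open>\<omega>\<close>, up to null sets, so that \<open>\<omega>\<close> would be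
  rotationally invariant. The boundary regularity enters there, to exclude slits and punctures.\<close>

section \<open>Calculus of smooth functions\<close>

definition smooth :: "('a::euclidean_space \<Rightarrow> 'b::real_normed_vector) \<Rightarrow> bool" where
  "smooth f \<longleftrightarrow> (\<forall>k. Ck_on k UNIV f)"

lemma Ck_SucI:
  assumes "\<And>x. (f has_derivative f' x) (at x)" and "\<And>v. Ck_on k UNIV (\<lambda>x. f' x v)"
  shows "Ck_on (Suc k) UNIV f"
proof -
  have "frechet_derivative f (at x) = f' x" for x
    using assms(1) frechet_derivative_at by metis
  then show ?thesis using assms by (auto simp: differentiable_def)
qed

lemma Ck_Suc_has_derivative:
  assumes "Ck_on (Suc k) UNIV f"
  shows "(f has_derivative frechet_derivative f (at x)) (at x)"
  using assms by (auto simp: frechet_derivative_works)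

lemma Ck_Suc_D: "Ck_on (Suc k) UNIV f \<Longrightarrow> Ck_on k UNIV f"
proof (induction k arbitrary: f)
  case 0
  then show ?case
    by (auto intro!: differentiable_imp_continuous_on simp: differentiable_on_def)
next
  case (Suc k)
  then show ?case by auto
qed

lemma Ck_const: "Ck_on k UNIV (\<lambda>x. c)"
proof (induction k arbitrary: c)
  case (Suc k)
  show ?case by (rule Ck_SucI[where f'="\<lambda>x v. 0"]) (auto simp: Suc)
qed auto

lemma Ck_linear: assumes "bounded_linear f" shows "Ck_on k UNIV f"
proof (cases k)
  case 0
  then show ?thesis using assms by (simp add: linear_continuous_on)
next
  case (Suc k)
  show ?thesis unfolding Suc
    by (rule Ck_SucI[where f'="\<lambda>x. f"]) (auto intro: bounded_linear_imp_has_derivative assms Ck_const)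
qed

lemma Ck_add: "Ck_on k UNIV f \<Longrightarrow> Ck_on k UNIV g \<Longrightarrow> Ck_on k UNIV (\<lambda>x. f x + g x)"
proof (induction k arbitrary: f g)
  case 0
  then show ?case by (auto intro: continuous_intros)
next
  case (Suc k)
  show ?case
    by (rule Ck_SucI[OF has_derivative_add[OF Ck_Suc_has_derivative[OF Suc.prems(1)]
          Ck_Suc_has_derivative[OF Suc.prems(2)]]])
      (use Suc in auto)
qed

lemma Ck_linear_comp:
  assumes L: "bounded_linear L" shows "Ck_on k UNIV f \<Longrightarrow> Ck_on k UNIV (\<lambda>x. L (f x))"
proof (induction k arbitrary: f)
  case 0
  then show ?case using continuous_on_compose2[OF linear_continuous_on[OF L, of UNIV]] by auto
next
  case (Suc k)
  show ?case
    by (rule Ck_SucI[OF bounded_linear.has_derivative[OF L Ck_Suc_has_derivative[OF Suc.prems(1)]]])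
      (use Suc in auto)
qed

lemma Ck_affine:
  assumes A: "bounded_linear A" shows "Ck_on k UNIV f \<Longrightarrow> Ck_on k UNIV (\<lambda>x. f (c + A x))"
proof (induction k arbitrary: f)
  case 0
  then show ?case using linear_continuous_on[OF A]
    by (auto intro!: continuous_on_compose2[of UNIV f] continuous_intros)
next
  case (Suc k)
  have d: "((\<lambda>x. c + A x) has_derivative A) (at x)" for x
    using has_derivative_add[OF has_derivative_const bounded_linear_imp_has_derivative[OF A]] by auto
  show ?case
    by (rule Ck_SucI[OF has_derivative_compose[OF d Ck_Suc_has_derivative[OF Suc.prems(1)]]])
      (use Suc in auto)
qed

lemma Ck_mult:
  fixes f g :: "'a::euclidean_space \<Rightarrow> real"
  shows "Ck_on k UNIV f \<Longrightarrow> Ck_on k UNIV g \<Longrightarrow> Ck_on k UNIV (\<lambda>x. f x * g x)"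
proof (induction k arbitrary: f g)
  case 0
  then show ?case by (auto intro: continuous_intros)
next
  case (Suc k)
  show ?case
    by (rule Ck_SucI[OF has_derivative_mult[OF Ck_Suc_has_derivative[OF Suc.prems(1)]
          Ck_Suc_has_derivative[OF Suc.prems(2)]]])
      (use Suc in \<open>auto intro!: Ck_add Suc.IH intro: Ck_Suc_D\<close>)
qed

lemma Ck_inverse:
  fixes f :: "'a::euclidean_space \<Rightarrow> real"
  assumes "\<And>x. f x \<noteq> 0"
  shows "Ck_on k UNIV f \<Longrightarrow> Ck_on k UNIV (\<lambda>x. inverse (f x))"
proof (induction k)
  case 0
  then show ?case using assms by (auto intro!: continuous_intros)
next
  case (Suc k)
  have "Ck_on k UNIV (\<lambda>x. - (inverse (f x) * frechet_derivative f (at x) v * inverse (f x)))" for v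
    using Suc Ck_Suc_D[OF Suc.prems] by (intro Ck_linear_comp[where L=uminus] Ck_mult) (auto intro: bounded_linear_minus bounded_linear_ident)
  then show ?case
    by (intro Ck_SucI[OF Deriv.has_derivative_inverse[OF assms Ck_Suc_has_derivative[OF Suc.prems(1)]]])
qed

lemma Ck_sqrt:
  fixes f :: "'a::euclidean_space \<Rightarrow> real"
  assumes "\<And>x. f x > 0"
  shows "Ck_on k UNIV f \<Longrightarrow> Ck_on k UNIV (\<lambda>x. sqrt (f x))"
proof (induction k)
  case 0
  then show ?case using assms by (auto intro!: continuous_intros)
next
  case (Suc k)
  have nz: "sqrt (f x) \<noteq> 0" for x using assms[of x] by auto
  have d: "((\<lambda>x. sqrt (f x)) has_derivative
      (\<lambda>v. frechet_derivative f (at x) v * (inverse (sqrt (f x)) * (1/2)))) (at x)" for x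
    using has_derivative_compose[OF Ck_Suc_has_derivative[OF Suc.prems(1), of x]
        DERIV_real_sqrt[OF assms[of x], unfolded has_field_derivative_def]]
    by (simp add: field_simps)
  show ?case
    by (rule Ck_SucI[OF d])
      (intro Ck_mult Ck_inverse Ck_const Suc.IH Ck_Suc_D[OF Suc.prems] nz,
        use Suc.prems in auto)
qed

lemma smooth_continuous: "smooth f \<Longrightarrow> continuous_on S f"
  unfolding smooth_def using Ck_on.simps(1) continuous_on_subset by blast

lemma smooth_has_derivative: "smooth f \<Longrightarrow> (f has_derivative frechet_derivative f (at x)) (at x)"
  unfolding smooth_def using Ck_Suc_has_derivative by blast

lemma smooth_frechet: "smooth f \<Longrightarrow> smooth (\<lambda>x. frechet_derivative f (at x) v)"
  unfolding smooth_def using Ck_on.simps(2) by blast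

lemma smooth_const: "smooth (\<lambda>x. c)"
  and smooth_linear: "bounded_linear f \<Longrightarrow> smooth f"
  and smooth_add: "smooth f \<Longrightarrow> smooth g \<Longrightarrow> smooth (\<lambda>x. f x + g x)"
  and smooth_linear_comp: "bounded_linear L \<Longrightarrow> smooth f \<Longrightarrow> smooth (\<lambda>x. L (f x))"
  and smooth_affine: "bounded_linear A \<Longrightarrow> smooth f \<Longrightarrow> smooth (\<lambda>x. f (c + A x))"
  by (simp_all add: smooth_def Ck_const Ck_linear Ck_add Ck_linear_comp Ck_affine)

lemma smooth_mult: "smooth f \<Longrightarrow> smooth g \<Longrightarrow> smooth (\<lambda>x. f x * g x)"
  and smooth_inverse: "smooth f \<Longrightarrow> (\<And>x. f x \<noteq> 0) \<Longrightarrow> smooth (\<lambda>x. inverse (f x))"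
  and smooth_sqrt: "smooth f \<Longrightarrow> (\<And>x. f x > 0) \<Longrightarrow> smooth (\<lambda>x. sqrt (f x))"
  for f g :: "'a::euclidean_space \<Rightarrow> real"
  by (simp_all add: smooth_def Ck_mult Ck_inverse Ck_sqrt)

lemma smooth_cmult: "smooth f \<Longrightarrow> smooth (\<lambda>x. c * f x)"
  and smooth_diff: "smooth f \<Longrightarrow> smooth g \<Longrightarrow> smooth (\<lambda>x. f x - g x)"
  for f g :: "'a::euclidean_space \<Rightarrow> real"
  using smooth_add[of f "\<lambda>x. - 1 * g x"] smooth_mult[OF smooth_const[of "-1"], of g]
    smooth_mult[OF smooth_const[of c], of f] by auto

lemma smooth_prod:
  fixes f :: "'i \<Rightarrow> 'a::euclidean_space \<Rightarrow> real"
  assumes "\<And>i. i \<in> I \<Longrightarrow> smooth (f i)"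
  shows "smooth (\<lambda>x. \<Prod>i\<in>I. f i x)"
  using assms by (induction I rule: infinite_finite_induct) (auto intro: smooth_const smooth_mult)

definition flat :: "nat \<Rightarrow> real \<Rightarrow> real" where
  "flat m x = (if x \<le> 0 then 0 else exp (- 1 / x) / x ^ m)"

text \<open>The derivative is again a combination of functions of this family, also at \<open>0\<close>, where the
  exponential beats every power. Induction for all \<open>m\<close> at once then gives smoothness.\<close>

lemma flat_deriv: "(flat m has_real_derivative (flat (m + 2) x - real m * flat (m + 1) x)) (at x)"
proof -
  consider "x < 0" | "x > 0" | "x = 0" by linarith
  then show ?thesis
  proof cases
    case 1
    have "((\<lambda>x. 0) has_real_derivative 0) (at x)" by simp
    then show ?thesis using 1
      by (subst DERIV_cong_ev[OF refl _ refl, of _ "\<lambda>x. 0"])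
        (auto simp: flat_def intro: eventually_mono[OF eventually_nhds_in_open[of "{..<0}"]])
  next
    case 2
    have "((\<lambda>x. exp (- 1 / x) / x ^ m) has_real_derivative
        exp (- 1 / x) / x ^ (m + 2) - real m * (exp (- 1 / x) / x ^ (m + 1))) (at x)"
    proof (cases m)
      case 0
      then show ?thesis using 2
        by (auto intro!: derivative_eq_intros simp: field_simps power2_eq_square)
    next
      case (Suc k)
      have [simp]: "x ^ k = x * x ^ (k - Suc 0)" if "k \<noteq> 0"
        using that by (cases k) auto
      show ?thesis using 2 Suc
        by (cases "k = 0") (auto intro!: derivative_eq_intros simp: field_simps power2_eq_square)
    qed
    then show ?thesis using 2
      by (subst DERIV_cong_ev[OF refl _ refl, of _ "\<lambda>x. exp (- 1 / x) / x ^ m"])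
        (auto simp: flat_def intro: eventually_mono[OF eventually_nhds_in_open[of "{0<..}"]])
  next
    case 3
    have r: "((\<lambda>y::real. exp (- 1 / y) / y ^ (m + 1)) \<longlongrightarrow> 0) (at_right 0)"
    proof (subst filterlim_at_right_to_top, rule Lim_transform_eventually[OF tendsto_power_div_exp_0[of "m + 1"]])
      show "\<forall>\<^sub>F x :: real in at_top. x ^ (m + 1) / exp x = exp (- 1 / inverse x) / inverse x ^ (m + 1)"
        using eventually_gt_at_top[of "0 :: real"]
        by eventually_elim (simp add: exp_minus field_simps)
    qed
    have "((\<lambda>y. flat m y / y) \<longlongrightarrow> 0) (at_right 0)"
      by (rule Lim_transform_eventually[OF r]) (auto simp: flat_def eventually_at_right_less eventually_at_filter)
    moreover have "((\<lambda>y. flat m y / y) \<longlongrightarrow> 0) (at_left 0)"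
      by (rule Lim_transform_eventually[OF tendsto_const]) (auto simp: flat_def eventually_at_filter)
    ultimately have "((\<lambda>y. flat m y / y) \<longlongrightarrow> 0) (at 0)"
      using filterlim_split_at by blast
    then show ?thesis using 3 by (simp add: has_field_derivative_iff flat_def)
  qed
qed

lemma Ck_flat: "Ck_on k UNIV f \<Longrightarrow> Ck_on k UNIV (\<lambda>x. flat m (f x))" for f :: "'a::euclidean_space \<Rightarrow> real"
proof (induction k arbitrary: m)
  case 0
  have "continuous_on UNIV (flat m)"
    using DERIV_isCont[OF flat_deriv] by (simp add: continuous_on_eq_continuous_at)
  with 0 show ?case by (auto intro: continuous_on_compose2)
next
  case (Suc k)
  have d: "((\<lambda>x. flat m (f x)) has_derivative
      (\<lambda>v. frechet_derivative f (at x) v * (flat (m+2) (f x) + (- real m) * flat (m+1) (f x)))) (at x)" for x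
    using has_derivative_compose[OF Ck_Suc_has_derivative[OF Suc.prems(1), of x]
        flat_deriv[of m "f x", unfolded has_field_derivative_def]]
    by (simp add: mult.commute)
  show ?case
    by (rule Ck_SucI[OF d], intro Ck_mult Ck_add Ck_const Suc.IH Ck_Suc_D[OF Suc.prems])
      (use Suc.prems in auto)
qed

lemma smooth_flat: "smooth f \<Longrightarrow> smooth (\<lambda>x. flat m (f x))" for f :: "'a::euclidean_space \<Rightarrow> real"
  by (simp add: smooth_def Ck_flat)

definition bump :: "'a::euclidean_space \<Rightarrow> 'a \<Rightarrow> 'a \<Rightarrow> real" where
  "bump a b x = (\<Prod>i\<in>Basis. flat 0 (x \<bullet> i - a \<bullet> i) * flat 0 (b \<bullet> i - x \<bullet> i))"

lemma smooth_bump: "smooth (bump a b)"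
  unfolding bump_def
  by (intro smooth_prod smooth_mult smooth_flat smooth_diff smooth_const)
     (auto intro: smooth_linear bounded_linear_inner_left)

lemma bump_nonneg: "0 \<le> bump a b x"
  unfolding bump_def by (auto intro!: prod_nonneg simp: flat_def)

lemma bump_nonzero_iff: "bump a b x \<noteq> 0 \<longleftrightarrow> x \<in> box a b"
proof -
  have "flat 0 y \<noteq> 0 \<longleftrightarrow> 0 < y" for y by (auto simp: flat_def)
  then show ?thesis by (auto simp: bump_def box_def)
qed

lemma bump_pos_iff: "0 < bump a b x \<longleftrightarrow> x \<in> box a b"
  using bump_nonzero_iff[of a b x] bump_nonneg[of a b x] by linarith

section \<open>Gradients, test functions and integrals\<close>

text \<open>Complex test functions are handled through their real and imaginary parts; this is the gradient
  of such a part.\<close>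

definition gr :: "(real ^ 'n \<Rightarrow> real) \<Rightarrow> real ^ 'n \<Rightarrow> real ^ 'n" where
  "gr u x = (\<chi> i. frechet_derivative u (at x) (axis i 1))"

lemma gr_eq:
  assumes "(u has_derivative (\<lambda>v. g \<bullet> v)) (at x)"
  shows "gr u x = g"
  using frechet_derivative_at[OF assms, symmetric] by (auto simp: gr_def vec_eq_iff inner_axis)

lemma gr_has_derivative:
  assumes "u differentiable (at x)"
  shows "(u has_derivative (\<lambda>v. gr u x \<bullet> v)) (at x)"
proof -
  have d: "(u has_derivative frechet_derivative u (at x)) (at x)"
    using assms frechet_derivative_works by blast
  have lin: "linear (frechet_derivative u (at x))"
    using d has_derivative_linear by blast
  have "frechet_derivative u (at x) v = gr u x \<bullet> v" for v
  proof -
    have "frechet_derivative u (at x) v = frechet_derivative u (at x) (\<Sum>i\<in>UNIV. v $ i *s axis i 1)"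
      by (simp add: basis_expansion)
    also have "\<dots> = (\<Sum>i\<in>UNIV. v $ i * frechet_derivative u (at x) (axis i 1))"
      using lin by (simp add: linear_sum linear_scale scalar_mult_eq_scaleR o_def)
    finally show ?thesis by (simp add: gr_def inner_vec_def mult.commute)
  qed
  then show ?thesis using d by presburger
qed

lemma smooth_gr: "smooth u \<Longrightarrow> (u has_derivative (\<lambda>v. gr u x \<bullet> v)) (at x)"
  using gr_has_derivative smooth_has_derivative differentiable_def by blast

lemma gr_chain:
  assumes "smooth u" "(f has_real_derivative D) (at (u x))"
  shows "gr (\<lambda>x. f (u x)) x = D *\<^sub>R gr u x"
  by (rule gr_eq, use has_derivative_compose[OF smooth_gr[OF assms(1)]
      assms(2)[unfolded has_field_derivative_def]] in \<open>simp add: mult.commute\<close>)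

lemma gr_add: "smooth u \<Longrightarrow> smooth v \<Longrightarrow> gr (\<lambda>x. u x + v x) x = gr u x + gr v x"
  by (rule gr_eq, use has_derivative_add[OF smooth_gr smooth_gr, of u v] in \<open>simp add: inner_add_left\<close>)

lemma gr_diff: "smooth u \<Longrightarrow> smooth v \<Longrightarrow> gr (\<lambda>x. u x - v x) x = gr u x - gr v x"
  by (rule gr_eq, use has_derivative_diff[OF smooth_gr smooth_gr, of u v] in \<open>simp add: inner_diff_left\<close>)

lemma gr_cmult: "smooth u \<Longrightarrow> gr (\<lambda>x. c * u x) x = c *\<^sub>R gr u x"
  by (rule gr_eq, use has_derivative_mult_right[OF smooth_gr, of u] in simp)

lemma gr_mult: "smooth u \<Longrightarrow> smooth v \<Longrightarrow> gr (\<lambda>x. u x * v x) x = u x *\<^sub>R gr v x + v x *\<^sub>R gr u x"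
  by (rule gr_eq, use has_derivative_mult[OF smooth_gr smooth_gr, of u v] in
      \<open>simp add: inner_add_left mult.commute\<close>)

lemma continuous_gr: "smooth u \<Longrightarrow> continuous_on S (gr u)"
  unfolding gr_def by (intro continuous_on_vec_lambda smooth_continuous smooth_frechet)

lemma gr_zero_open: "open S \<Longrightarrow> x \<in> S \<Longrightarrow> (\<And>y. y \<in> S \<Longrightarrow> u y = 0) \<Longrightarrow> gr u x = 0"
  by (rule gr_eq) (auto intro: has_derivative_transform_within_open[of "\<lambda>_. 0"])

text \<open>Real test functions. Asking the gradient to vanish outside the same compact set is no restriction
  (\<open>rtestI\<close>), and it makes every expression in a function and its gradient compactly supported.\<close>

definition rtest :: "(real ^ 'n) set \<Rightarrow> (real ^ 'n \<Rightarrow> real) set" where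
  "rtest U = {u. smooth u \<and> (\<exists>K. compact K \<and> K \<subseteq> U \<and> (\<forall>x. x \<notin> K \<longrightarrow> u x = 0 \<and> gr u x = 0))}"

lemma rtestI:
  assumes "smooth u" "compact K" "K \<subseteq> U" "\<And>x. x \<notin> K \<Longrightarrow> u x = 0"
  shows "u \<in> rtest U"
proof -
  have "gr u x = 0" if "x \<notin> K" for x
    using that assms by (intro gr_zero_open[of "- K"]) (auto simp: open_Compl compact_imp_closed)
  then show ?thesis using assms by (auto simp: rtest_def)
qed

lemma rtest_smooth: "u \<in> rtest U \<Longrightarrow> smooth u"
  by (simp add: rtest_def)

lemma rtestE:
  assumes "u \<in> rtest U"
  obtains K where "compact K" "K \<subseteq> U" "\<And>x. x \<notin> K \<Longrightarrow> u x = 0" "\<And>x. x \<notin> K \<Longrightarrow> gr u x = 0"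
  using assms by (auto simp: rtest_def)

lemma rtest_zero_out: "u \<in> rtest U \<Longrightarrow> x \<notin> U \<Longrightarrow> u x = 0 \<and> gr u x = 0"
  by (auto simp: rtest_def)

lemma rtest_add: "u \<in> rtest U \<Longrightarrow> v \<in> rtest U \<Longrightarrow> (\<lambda>x. u x + v x) \<in> rtest U"
proof -
  assume uv: "u \<in> rtest U" "v \<in> rtest U"
  obtain K where K: "compact K" "K \<subseteq> U" "\<And>x. x \<notin> K \<Longrightarrow> u x = 0" by (rule rtestE[OF uv(1)]) blast
  obtain L where L: "compact L" "L \<subseteq> U" "\<And>x. x \<notin> L \<Longrightarrow> v x = 0" by (rule rtestE[OF uv(2)]) blast
  show "(\<lambda>x. u x + v x) \<in> rtest U"
    by (rule rtestI[of _ "K \<union> L"]) (use uv K L in \<open>auto intro: smooth_add rtest_smooth\<close>)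
qed

lemma rtest_smult: "smooth g \<Longrightarrow> u \<in> rtest U \<Longrightarrow> (\<lambda>x. g x * u x) \<in> rtest U"
proof -
  assume gu: "smooth g" "u \<in> rtest U"
  obtain K where K: "compact K" "K \<subseteq> U" "\<And>x. x \<notin> K \<Longrightarrow> u x = 0" by (rule rtestE[OF gu(2)]) blast
  show "(\<lambda>x. g x * u x) \<in> rtest U"
    by (rule rtestI[of _ K]) (use gu K in \<open>auto intro: smooth_mult rtest_smooth\<close>)
qed

lemma rtest_cmult: "u \<in> rtest U \<Longrightarrow> (\<lambda>x. c * u x) \<in> rtest U"
  by (rule rtest_smult[OF smooth_const])

lemma rtest_diff: "u \<in> rtest U \<Longrightarrow> v \<in> rtest U \<Longrightarrow> (\<lambda>x. u x - v x) \<in> rtest U"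
  using rtest_add[OF _ rtest_cmult[of v U "-1"], of u] by simp

lemma rtest_bump:
  assumes "cbox a b \<subseteq> U" shows "bump a b \<in> rtest U"
  by (rule rtestI[OF smooth_bump compact_cbox assms])
     (use bump_nonzero_iff[of a b] box_subset_cbox[of a b] in blast)

text \<open>The integrands built from test functions are continuous with compact support. The class is closed
  under the algebraic operations, so that membership settles integrability and measurability.\<close>

definition cc :: "('a::euclidean_space \<Rightarrow> real) set" where
  "cc = {u. continuous_on UNIV u \<and> (\<exists>K. compact K \<and> (\<forall>x. x \<notin> K \<longrightarrow> u x = 0))}"

lemma ccI: "continuous_on UNIV u \<Longrightarrow> compact K \<Longrightarrow> (\<And>x. x \<notin> K \<Longrightarrow> u x = 0) \<Longrightarrow> u \<in> cc"
  by (auto simp: cc_def)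

lemma cc_cont: "u \<in> cc \<Longrightarrow> continuous_on UNIV u"
  by (auto simp: cc_def)

lemma cc_add: "u \<in> cc \<Longrightarrow> v \<in> cc \<Longrightarrow> (\<lambda>x. u x + v x) \<in> cc"
  unfolding cc_def
proof clarify
  fix K L assume "continuous_on UNIV u" "continuous_on UNIV v" "compact K" "compact (L :: 'a set)"
    "\<forall>x. x \<notin> K \<longrightarrow> u x = 0" "\<forall>x. x \<notin> L \<longrightarrow> v x = 0"
  then show "continuous_on UNIV (\<lambda>x. u x + v x) \<and> (\<exists>K. compact K \<and> (\<forall>x. x \<notin> K \<longrightarrow> u x + v x = 0))"
    by (intro conjI exI[of _ "K \<union> L"]) (auto intro: continuous_intros)
qed

lemma cc_multc: "continuous_on UNIV g \<Longrightarrow> u \<in> cc \<Longrightarrow> (\<lambda>x. g x * u x) \<in> cc"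
  unfolding cc_def by (auto intro!: continuous_intros)

lemma cc_mult: "u \<in> cc \<Longrightarrow> v \<in> cc \<Longrightarrow> (\<lambda>x. u x * v x) \<in> cc"
  by (rule cc_multc[OF cc_cont])

lemma cc_cmult: "u \<in> cc \<Longrightarrow> (\<lambda>x. c * u x) \<in> cc"
  by (rule cc_multc) auto

lemma cc_diff: "u \<in> cc \<Longrightarrow> v \<in> cc \<Longrightarrow> (\<lambda>x. u x - v x) \<in> cc"
  using cc_add[OF _ cc_cmult[of v "-1"], of u] by simp

lemma cc_integrable: assumes "u \<in> cc" shows "integrable lborel u"
proof -
  obtain K where K: "compact K" "\<And>x. x \<notin> K \<Longrightarrow> u x = 0" using assms by (auto simp: cc_def)
  have "integrable lborel (\<lambda>x. indicator K x *\<^sub>R u x)"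
    using borel_integrable_compact[OF K(1)] cc_cont[OF assms] continuous_on_subset by blast
  moreover have "(\<lambda>x. indicator K x *\<^sub>R u x) = u"
    using K(2) by (auto simp: fun_eq_iff indicator_def)
  ultimately show ?thesis by simp
qed

lemma cc_borel: "u \<in> cc \<Longrightarrow> u \<in> borel_measurable borel"
  by (simp add: borel_measurable_continuous_onI cc_cont)

lemma cc_bounded: assumes "u \<in> cc" obtains B where "B > 0" "\<And>x. \<bar>u x\<bar> \<le> B"
proof -
  obtain K where K: "compact K" "\<And>x. x \<notin> K \<Longrightarrow> u x = 0" using assms by (auto simp: cc_def)
  have "bounded (u ` K)"
    using K(1) cc_cont[OF assms] by (meson compact_continuous_image compact_imp_bounded continuous_on_subset subset_UNIV)
  then obtain B where "\<And>x. x \<in> K \<Longrightarrow> \<bar>u x\<bar> \<le> B" by (auto simp: bounded_iff)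
  then have "\<bar>u x\<bar> \<le> max 1 B" for x using K(2)[of x] by (cases "x \<in> K") (force simp: max_def)+
  then show ?thesis by (intro that[of "max 1 B"]) auto
qed

lemma rtest_cc: "u \<in> rtest U \<Longrightarrow> u \<in> cc"
  using ccI[of u] smooth_continuous[OF rtest_smooth, of u U UNIV] by (metis rtestE)

lemma rtest_gr_cc:
  assumes "u \<in> rtest U" "continuous_on UNIV g" shows "(\<lambda>x. gr u x \<bullet> g x) \<in> cc"
  using assms(1) by (elim rtestE, intro ccI)
    (auto intro!: continuous_intros continuous_gr rtest_smooth[OF assms(1)] assms(2))

lemma rtest_norm_gr_cc:
  assumes "u \<in> rtest U" shows "(\<lambda>x. (norm (gr u x))\<^sup>2) \<in> cc"
  using rtest_gr_cc[OF assms continuous_gr[OF rtest_smooth[OF assms]]] by (simp add: power2_norm_eq_inner)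

definition ip :: "('a::euclidean_space \<Rightarrow> real) \<Rightarrow> ('a \<Rightarrow> real) \<Rightarrow> real" where
  "ip u v = (\<integral>x. u x * v x \<partial>lborel)"

lemma ip_commute: "ip u v = ip v u"
  by (simp add: ip_def mult.commute)

lemma ip_add_left: "u \<in> cc \<Longrightarrow> v \<in> cc \<Longrightarrow> w \<in> cc \<Longrightarrow> ip (\<lambda>x. u x + v x) w = ip u w + ip v w"
  by (simp add: ip_def distrib_right cc_integrable[OF cc_mult] Bochner_Integration.integral_add)

lemma ip_diff_left: "u \<in> cc \<Longrightarrow> v \<in> cc \<Longrightarrow> w \<in> cc \<Longrightarrow> ip (\<lambda>x. u x - v x) w = ip u w - ip v w"
  by (simp add: ip_def left_diff_distrib cc_integrable[OF cc_mult] Bochner_Integration.integral_diff)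

lemma ip_cmult_left: "ip (\<lambda>x. c * u x) w = c * ip u w"
  by (simp add: ip_def mult.assoc)

lemma ip_add_right: "u \<in> cc \<Longrightarrow> v \<in> cc \<Longrightarrow> w \<in> cc \<Longrightarrow> ip w (\<lambda>x. u x + v x) = ip w u + ip w v"
  and ip_diff_right: "u \<in> cc \<Longrightarrow> v \<in> cc \<Longrightarrow> w \<in> cc \<Longrightarrow> ip w (\<lambda>x. u x - v x) = ip w u - ip w v"
  and ip_cmult_right: "ip w (\<lambda>x. c * u x) = c * ip w u"
  using ip_add_left[of u v w] ip_diff_left[of u v w] ip_cmult_left[of c u w] by (simp_all add: ip_commute)

lemma ip_nonneg: "0 \<le> ip u u"
  by (simp add: ip_def)

lemmas ip_simps = ip_add_left ip_add_right ip_diff_left ip_diff_right ip_cmult_left ip_cmult_right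
lemmas cc_intros = cc_add cc_diff cc_cmult cc_mult

text \<open>A form that is only nonnegative may degenerate: \<open>b = 0\<close> forces \<open>c = 0\<close>, and \<open>b < 0\<close> is excluded by
  large \<open>s\<close>. So this yields the Cauchy-Schwarz inequality for such forms, too.\<close>

lemma discriminant_nonneg:
  fixes a b c :: real
  assumes q: "\<And>s. 0 \<le> a + 2 * s * c + s\<^sup>2 * b" shows "c\<^sup>2 \<le> a * b"
proof (cases "b = 0")
  case True
  have "c = 0"
  proof (rule ccontr)
    assume "c \<noteq> 0"
    then show False using q[of "- (a + 1) / (2 * c)"] True by (simp add: field_simps)
  qed
  then show ?thesis using True by simp
next
  case False
  have "0 \<le> b"
  proof (rule ccontr)
    assume nb: "\<not> 0 \<le> b"
    have a: "0 \<le> a" using q[of 0] by simp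
    define s where "s = a / (- b) + 1"
    have s: "1 \<le> s" "s * (- b) = a - b" using nb a by (auto simp: s_def field_simps)
    have "0 \<le> a + s\<^sup>2 * b" using q[of s] q[of "- s"] by simp
    moreover have "s * (s * (- b)) \<ge> 1 * (s * (- b))" using s nb a by (intro mult_right_mono) auto
    moreover have "s\<^sup>2 * b = - (s * (s * (- b)))" by (simp add: power2_eq_square)
    ultimately show False using s(2) nb by linarith
  qed
  then show ?thesis using q[of "- c / b"] False by (simp add: field_simps power2_eq_square)
qed

lemma ip_Cauchy_Schwarz:
  assumes "u \<in> cc" "v \<in> cc" shows "(ip u v)\<^sup>2 \<le> ip u u * ip v v"
proof (rule discriminant_nonneg)
  fix s
  show "0 \<le> ip u u + 2 * s * ip u v + s\<^sup>2 * ip v v"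
    using ip_nonneg[of "\<lambda>x. u x + s * v x"] assms
    by (simp add: ip_simps cc_intros ip_commute[of v u] power2_eq_square algebra_simps)
qed

abbreviation dirichlet :: "(real ^ 'n \<Rightarrow> real) \<Rightarrow> real" where
  "dirichlet u \<equiv> (\<integral>x. (norm (gr u x))\<^sup>2 \<partial>lborel)"

lemma dirichlet_nonneg: "0 \<le> dirichlet u"
  by simp

lemma LINT_lebesgue_on:
  fixes g :: "'a::euclidean_space \<Rightarrow> 'b::euclidean_space"
  assumes "S \<in> sets borel" "g \<in> borel_measurable borel" "\<And>x. x \<notin> S \<Longrightarrow> g x = 0"
  shows "(LINT x|lebesgue_on S. g x) = (\<integral>x. g x \<partial>lborel)"
proof -
  have "(LINT x|lebesgue_on S. g x) = (LINT x|lebesgue. indicator S x *\<^sub>R g x)"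
    using assms(1) by (subst integral_restrict_space) auto
  also have "(\<lambda>x. indicator S x *\<^sub>R g x) = g"
    using assms(3) by (auto simp: indicator_def)
  also have "(LINT x|lebesgue. g x) = (\<integral>x. g x \<partial>lborel)"
    using assms(2) by (intro integral_completion) simp
  finally show ?thesis .
qed

section \<open>Complex test functions and the lowest eigenvalue\<close>

lemma test_functions_iff:
  "\<phi> \<in> test_functions U \<longleftrightarrow> smooth \<phi> \<and> (\<exists>K. compact K \<and> K \<subseteq> U \<and> (\<forall>x. x \<notin> K \<longrightarrow> \<phi> x = 0))"
proof
  show "\<phi> \<in> test_functions U \<Longrightarrow> smooth \<phi> \<and> (\<exists>K. compact K \<and> K \<subseteq> U \<and> (\<forall>x. x \<notin> K \<longrightarrow> \<phi> x = 0))"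
    unfolding test_functions_def smooth_def
    by (intro conjI exI[of _ "closure {x. \<phi> x \<noteq> 0}"]) (auto intro: closure_subset[THEN subsetD])
next
  assume "smooth \<phi> \<and> (\<exists>K. compact K \<and> K \<subseteq> U \<and> (\<forall>x. x \<notin> K \<longrightarrow> \<phi> x = 0))"
  then obtain K where K: "smooth \<phi>" "compact K" "K \<subseteq> U" "\<And>x. x \<notin> K \<Longrightarrow> \<phi> x = 0" by blast
  have "closure {x. \<phi> x \<noteq> 0} \<subseteq> K"
    using K by (intro closure_minimal) (auto simp: compact_imp_closed)
  moreover have "compact (closure {x. \<phi> x \<noteq> 0})"
    using calculation K(2) closed_closure compact_Int_closed[of K] by (metis Int_absorb1)
  ultimately show "\<phi> \<in> test_functions U" using K by (auto simp: test_functions_def smooth_def)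
qed

lemma test_Re_Im:
  assumes "\<phi> \<in> test_functions U"
  shows "(\<lambda>x. Re (\<phi> x)) \<in> rtest U" "(\<lambda>x. Im (\<phi> x)) \<in> rtest U"
    and grad_components: "grad \<phi> x $ i = Complex (gr (\<lambda>x. Re (\<phi> x)) x $ i) (gr (\<lambda>x. Im (\<phi> x)) x $ i)"
proof -
  obtain K where K: "smooth \<phi>" "compact K" "K \<subseteq> U" "\<And>x. x \<notin> K \<Longrightarrow> \<phi> x = 0"
    using assms by (auto simp: test_functions_iff)
  show "(\<lambda>x. Re (\<phi> x)) \<in> rtest U" "(\<lambda>x. Im (\<phi> x)) \<in> rtest U"
    using K(2-4) smooth_linear_comp[OF bounded_linear_Re K(1)] smooth_linear_comp[OF bounded_linear_Im K(1)]
    by (auto intro!: rtestI[of _ K])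
  have d: "(\<phi> has_derivative frechet_derivative \<phi> (at x)) (at x)" for x
    by (rule smooth_has_derivative[OF K(1)])
  show "grad \<phi> x $ i = Complex (gr (\<lambda>x. Re (\<phi> x)) x $ i) (gr (\<lambda>x. Im (\<phi> x)) x $ i)"
    using frechet_derivative_at[OF bounded_linear.has_derivative[OF bounded_linear_Re d[of x]], symmetric]
      frechet_derivative_at[OF bounded_linear.has_derivative[OF bounded_linear_Im d[of x]], symmetric]
    by (simp add: grad_def gr_def complex_eq_iff)
qed

lemma norm_grad:
  assumes "\<phi> \<in> test_functions U"
  shows "(norm (grad \<phi> x))\<^sup>2 = (norm (gr (\<lambda>x. Re (\<phi> x)) x))\<^sup>2 + (norm (gr (\<lambda>x. Im (\<phi> x)) x))\<^sup>2"
  unfolding power2_norm_eq_inner inner_vec_def grad_components[OF assms]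
  by (simp add: inner_complex_def sum.distrib)

lemma test_of_real:
  assumes "u \<in> rtest U" shows "(\<lambda>x. complex_of_real (u x)) \<in> test_functions U"
  using assms smooth_linear_comp[OF bounded_linear_of_real rtest_smooth[OF assms]]
  by (auto simp: test_functions_iff rtest_def)

definition rot_field :: "real ^ 2 \<Rightarrow> real ^ 2" where
  "rot_field x = vector [x $ 2, - x $ 1]"

text \<open>The transverse angular derivative, as the derivative along the vector field that generates the
  rotations.\<close>

definition tau :: "(real ^ 2 \<Rightarrow> real) \<Rightarrow> real ^ 2 \<Rightarrow> real" where
  "tau u x = gr u x \<bullet> rot_field x"

lemma continuous_rot_field: "continuous_on S rot_field"
proof -
  have "continuous_on S (\<lambda>x. rot_field x $ 1)" "continuous_on S (\<lambda>x. rot_field x $ 2)"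
    unfolding rot_field_def vector_2 by (intro continuous_intros)+
  then have "continuous_on S (\<lambda>x. rot_field x $ i)" for i
    using exhaust_2[of i] by auto
  then have "continuous_on S (\<lambda>x. \<chi> i. rot_field x $ i)" by (intro continuous_on_vec_lambda)
  then show ?thesis by simp
qed

lemma norm_rot_field: "norm (rot_field x) = norm x"
  by (simp add: rot_field_def norm_eq_sqrt_inner inner_vec_def sum_2)

lemma tau_alt: "tau u x = x $ 2 * gr u x $ 1 - x $ 1 * gr u x $ 2"
  by (simp add: tau_def rot_field_def inner_vec_def sum_2)

lemma tau_cc: "u \<in> rtest U \<Longrightarrow> tau u \<in> cc"
  unfolding tau_def[abs_def] by (rule rtest_gr_cc[OF _ continuous_rot_field])

lemma norm_angular_deriv:
  assumes "\<phi> \<in> test_functions U"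
  shows "(norm (angular_deriv \<phi> x))\<^sup>2 = (tau (\<lambda>x. Re (\<phi> x)) x)\<^sup>2 + (tau (\<lambda>x. Im (\<phi> x)) x)\<^sup>2"
  unfolding angular_deriv_def grad_components[OF assms] tau_alt cmod_power2 by simp

text \<open>All quadratic quantities split over real and imaginary parts. This reduces both the variational
  problem for the lowest eigenvalue and the final inequality to real functions.\<close>

lemma rayleigh_split:
  assumes U: "open U" and \<phi>: "\<phi> \<in> test_functions U"
  defines "v \<equiv> (\<lambda>x. Re (\<phi> x))" and "w \<equiv> (\<lambda>x. Im (\<phi> x))"
  shows "(LINT x|lebesgue_on U. (norm (\<phi> x))\<^sup>2) = ip v v + ip w w"
    "(LINT x|lebesgue_on U. (norm (grad \<phi> x))\<^sup>2) = dirichlet v + dirichlet w"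
proof -
  have vw: "v \<in> rtest U" "w \<in> rtest U" using test_Re_Im[OF \<phi>] by (auto simp: v_def w_def)
  have e: "(norm (\<phi> x))\<^sup>2 = v x * v x + w x * w x" for x
    by (simp add: cmod_power2 v_def w_def flip: power2_eq_square)
  have c: "(\<lambda>x. v x * v x + w x * w x) \<in> cc"
    using vw by (intro cc_intros rtest_cc)
  have "(LINT x|lebesgue_on U. (norm (\<phi> x))\<^sup>2) = (\<integral>x. v x * v x + w x * w x \<partial>lborel)"
    using rtest_zero_out[OF vw(1)] rtest_zero_out[OF vw(2)] U cc_borel[OF c] unfolding e
    by (subst LINT_lebesgue_on) auto
  then show "(LINT x|lebesgue_on U. (norm (\<phi> x))\<^sup>2) = ip v v + ip w w"
    unfolding ip_def by (simp add: Bochner_Integration.integral_add cc_integrable cc_mult rtest_cc[OF vw(1)] rtest_cc[OF vw(2)])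
  have "(LINT x|lebesgue_on U. (norm (grad \<phi> x))\<^sup>2) = (\<integral>x. (norm (gr v x))\<^sup>2 + (norm (gr w x))\<^sup>2 \<partial>lborel)"
    using rtest_zero_out[OF vw(1)] rtest_zero_out[OF vw(2)] U
    unfolding norm_grad[OF \<phi>] v_def[symmetric] w_def[symmetric]
    by (subst LINT_lebesgue_on)
      (auto intro!: cc_borel cc_add rtest_norm_gr_cc[OF vw(1)] rtest_norm_gr_cc[OF vw(2)])
  then show "(LINT x|lebesgue_on U. (norm (grad \<phi> x))\<^sup>2) = dirichlet v + dirichlet w"
    by (simp add: Bochner_Integration.integral_add cc_integrable rtest_norm_gr_cc[OF vw(1)] rtest_norm_gr_cc[OF vw(2)])
qed

lemma angular_split:
  assumes U: "open U" and \<phi>: "\<phi> \<in> test_functions U"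
  defines "v \<equiv> (\<lambda>x. Re (\<phi> x))" and "w \<equiv> (\<lambda>x. Im (\<phi> x))"
  shows "(LINT x|lebesgue_on U. (norm (angular_deriv \<phi> x))\<^sup>2) = ip (tau v) (tau v) + ip (tau w) (tau w)"
proof -
  have vw: "v \<in> rtest U" "w \<in> rtest U" using test_Re_Im[OF \<phi>] by (auto simp: v_def w_def)
  have "(LINT x|lebesgue_on U. (norm (angular_deriv \<phi> x))\<^sup>2) = (\<integral>x. tau v x * tau v x + tau w x * tau w x \<partial>lborel)"
    using rtest_zero_out[OF vw(1)] rtest_zero_out[OF vw(2)] U
      cc_borel[OF cc_add[OF cc_mult[OF tau_cc[OF vw(1)] tau_cc[OF vw(1)]] cc_mult[OF tau_cc[OF vw(2)] tau_cc[OF vw(2)]]]]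
    unfolding norm_angular_deriv[OF \<phi>] v_def[symmetric] w_def[symmetric] power2_eq_square[of "tau _ _"]
    by (subst LINT_lebesgue_on) (auto simp: tau_def)
  then show ?thesis
    unfolding ip_def by (simp add: Bochner_Integration.integral_add cc_integrable cc_mult tau_cc[OF vw(1)] tau_cc[OF vw(2)])
qed

lemma ip_pos:
  assumes "u \<in> cc" "u \<noteq> (\<lambda>_. 0)" shows "0 < ip u u"
proof (rule ccontr)
  assume "\<not> 0 < ip u u"
  then have "ip u u = 0" using ip_nonneg[of u] by linarith
  then have "AE x in lborel. u x * u x = 0"
    unfolding ip_def using assms(1) by (subst (asm) integral_nonneg_eq_0_iff_AE) (auto simp: cc_integrable cc_mult)
  then have ae: "AE x in lborel. u x = 0" by simp
  have "u x = 0" for x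
  proof -
    have "closed {x. u x = 0}"
      using continuous_closed_preimage_constant[OF cc_cont[OF assms(1)] closed_UNIV] by simp
    from mem_closed_if_AE_lebesgue[OF this] show ?thesis
      using AE_completion[OF ae] by simp
  qed
  then show False using assms(2) by auto
qed

text \<open>The Rayleigh quotient of a complex function is a mediant of those of its real and imaginary parts,
  so one of these parts has a quotient that is at least as small; hence real test functions suffice in the
  variational characterisation.\<close>

lemma lambda1_properties:
  fixes \<omega> :: "(real ^ 2) set"
  assumes "open \<omega>" "\<omega> \<noteq> {}"
  shows lambda1_nonneg: "0 \<le> lambda1 \<omega> \<beta>"
    and lambda1_le: "u \<in> rtest \<omega> \<Longrightarrow> lambda1 \<omega> \<beta> * ip u u \<le> dirichlet u + \<beta>\<^sup>2 * ip (tau u) (tau u)"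
    and lambda1_approx: "\<kappa> > 0 \<Longrightarrow> \<exists>u\<in>rtest \<omega>. ip u u = 1 \<and>
       dirichlet u + \<beta>\<^sup>2 * ip (tau u) (tau u) \<le> lambda1 \<omega> \<beta> + \<kappa>"
proof -
  define a where "a u = dirichlet u + \<beta>\<^sup>2 * ip (tau u) (tau u)" for u
  define R where "R \<phi> = ((LINT y|lebesgue_on \<omega>. (norm (grad \<phi> y))\<^sup>2) +
      \<beta>\<^sup>2 * (LINT y|lebesgue_on \<omega>. (norm (angular_deriv \<phi> y))\<^sup>2)) /
     (LINT y|lebesgue_on \<omega>. (norm (\<phi> y))\<^sup>2)" for \<phi>
  let ?T = "test_functions \<omega> - {\<lambda>_. 0}"
  have lam: "lambda1 \<omega> \<beta> = (INF \<phi>\<in>?T. R \<phi>)" by (simp add: lambda1_def R_def)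
  have a0: "0 \<le> a u" for u by (simp add: a_def ip_nonneg)
  have Rsplit: "R \<phi> = (a (\<lambda>x. Re (\<phi> x)) + a (\<lambda>x. Im (\<phi> x))) /
      (ip (\<lambda>x. Re (\<phi> x)) (\<lambda>x. Re (\<phi> x)) + ip (\<lambda>x. Im (\<phi> x)) (\<lambda>x. Im (\<phi> x)))"
    if "\<phi> \<in> test_functions \<omega>" for \<phi>
    unfolding R_def rayleigh_split[OF assms(1) that] angular_split[OF assms(1) that]
    by (simp add: a_def algebra_simps)
  have R0: "0 \<le> R \<phi>" if "\<phi> \<in> ?T" for \<phi>
    unfolding Rsplit[OF DiffD1[OF that]] by (intro divide_nonneg_nonneg add_nonneg_nonneg a0 ip_nonneg)
  have bdd: "bdd_below (R ` ?T)" by (rule bdd_belowI2[OF R0])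
  obtain p where p: "p \<in> \<omega>" using assms(2) by blast
  obtain l h where ab: "cbox l h \<subseteq> \<omega>" "p \<in> box l h"
    by (rule open_contains_cbox[OF assms(1) p]) blast
  have bt: "bump l h \<in> rtest \<omega>" using ab by (intro rtest_bump)
  have "bump l h p \<noteq> 0" using ab bump_nonzero_iff by blast
  then have "(\<lambda>x. complex_of_real (bump l h x)) \<noteq> (\<lambda>_. 0)"
    by (metis of_real_eq_0_iff)
  then have "(\<lambda>x. complex_of_real (bump l h x)) \<in> ?T"
    using test_of_real[OF bt] by blast
  then have ne: "?T \<noteq> {}" by blast
  show "0 \<le> lambda1 \<omega> \<beta>" unfolding lam by (rule cINF_greatest[OF ne R0])
  show "lambda1 \<omega> \<beta> * ip u u \<le> dirichlet u + \<beta>\<^sup>2 * ip (tau u) (tau u)" if u: "u \<in> rtest \<omega>"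
  proof (cases "u = (\<lambda>_. 0)")
    case True
    then show ?thesis using a0[of u] by (simp add: a_def ip_def)
  next
    case False
    then have "(\<lambda>x. complex_of_real (u x)) \<noteq> (\<lambda>_. 0)"
      by (metis (no_types, lifting) ext of_real_eq_0_iff)
    then have T: "(\<lambda>x. complex_of_real (u x)) \<in> ?T" using test_of_real[OF u] by blast
    have gz: "gr (\<lambda>x. 0 :: real) y = 0" for y :: "real^2" by (rule gr_zero_open[OF open_UNIV]) auto
    have "lambda1 \<omega> \<beta> \<le> R (\<lambda>x. complex_of_real (u x))"
      unfolding lam by (rule cINF_lower[OF bdd T])
    also have "\<dots> = a u / ip u u"
      using Rsplit[OF test_of_real[OF u]] by (simp add: a_def tau_def gz ip_def)
    finally show ?thesis using ip_pos[OF rtest_cc[OF u] False] by (simp add: a_def field_simps)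
  qed
  show "\<exists>u\<in>rtest \<omega>. ip u u = 1 \<and> dirichlet u + \<beta>\<^sup>2 * ip (tau u) (tau u) \<le> lambda1 \<omega> \<beta> + \<kappa>" if "\<kappa> > 0"
  proof -
    let ?l = "lambda1 \<omega> \<beta> + \<kappa>"
    have "\<exists>\<phi>\<in>?T. R \<phi> < ?l"
      using that by (subst cINF_less_iff[OF ne bdd, symmetric]) (simp add: lam)
    then obtain \<phi> where \<phi>: "\<phi> \<in> test_functions \<omega>" "\<phi> \<noteq> (\<lambda>_. 0)" "R \<phi> < ?l" by auto
    define v where "v = (\<lambda>x. Re (\<phi> x))"
    define w where "w = (\<lambda>x. Im (\<phi> x))"
    have vw: "v \<in> rtest \<omega>" "w \<in> rtest \<omega>" using test_Re_Im[OF \<phi>(1)] by (auto simp: v_def w_def)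
    have nz: "v \<noteq> (\<lambda>_. 0) \<or> w \<noteq> (\<lambda>_. 0)"
      using \<phi>(2) by (auto simp: v_def w_def fun_eq_iff complex_eq_iff)
    then have pos: "0 < ip v v + ip w w"
      using ip_pos rtest_cc vw ip_nonneg by (metis add_nonneg_pos add_pos_nonneg)
    have "(a v + a w) / (ip v v + ip w w) < ?l"
      using \<phi>(3) Rsplit[OF \<phi>(1)] by (simp add: v_def w_def)
    then have "a v + a w < ?l * ip v v + ?l * ip w w"
      using pos by (simp add: field_simps)
    then have "a v < ?l * ip v v \<or> a w < ?l * ip w w" by linarith
    then obtain z where z: "z \<in> rtest \<omega>" "a z < ?l * ip z z" using vw by blast
    have "0 < ?l" using \<open>0 \<le> lambda1 \<omega> \<beta>\<close> that by linarith
    have ipz: "0 < ip z z" using z(2) a0[of z] ip_nonneg[of z]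
      by (metis less_le mult_zero_right not_le order.strict_trans1)
    define c where "c = 1 / sqrt (ip z z)"
    have c2: "c * c * ip z z = 1" "c\<^sup>2 = 1 / ip z z" using ipz by (auto simp: c_def field_simps power2_eq_square)
    have gc: "gr (\<lambda>x. c * z x) x = c *\<^sub>R gr z x" for x
      by (rule gr_cmult[OF rtest_smooth[OF z(1)]])
    have tc: "tau (\<lambda>x. c * z x) = (\<lambda>x. c * tau z x)"
      by (auto simp: tau_def gc)
    have "a (\<lambda>x. c * z x) = c\<^sup>2 * a z"
      by (simp add: a_def gc tc ip_cmult_left ip_cmult_right power_mult_distrib algebra_simps power2_eq_square)
    also have "\<dots> \<le> ?l" using z(2) ipz by (simp add: c2(2) field_simps)
    finally show ?thesis
      using rtest_cmult[OF z(1), of c] c2(1) by (intro bexI[of _ "\<lambda>x. c * z x"]) (auto simp: a_def ip_cmult_left ip_cmult_right)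
  qed
qed

section \<open>Poincare inequality on convex sets\<close>

text \<open>The Cauchy-Schwarz inequality for the integral of \<open>f\<close>, from expanding the integral of the square of
  \<open>(b - a) f - (F b - F a)\<close>. Nonnegative integrals make Tonelli's theorem available to its applications.\<close>

lemma FTC_square:
  fixes F f :: "real \<Rightarrow> real"
  assumes "a \<le> b" and F: "\<And>t. (F has_real_derivative f t) (at t)" and f: "continuous_on UNIV f"
  shows "ennreal ((F b - F a)\<^sup>2) \<le> ennreal (b - a) * (\<integral>\<^sup>+t. indicator {a..b} t * ennreal ((f t)\<^sup>2) \<partial>lborel)"
proof (cases "a = b")
  case False
  then have ab: "a < b" using assms(1) by simp
  have I: "(\<integral>t. indicator {a..b} t *\<^sub>R f t \<partial>lborel) = F b - F a"
    using assms(1) continuous_on_subset[OF f] F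
    by (intro integral_FTC_atLeastAtMost)
      (auto simp: has_real_derivative_iff_has_vector_derivative[symmetric] intro: has_field_derivative_at_within)
  have int: "integrable lborel (\<lambda>t. indicator {a..b} t *\<^sub>R h t)" if "continuous_on UNIV h" for h :: "real \<Rightarrow> real"
    using that by (intro borel_integrable_compact) (auto intro: continuous_on_subset)
  let ?I = "F b - F a" and ?J = "(\<integral>t. indicator {a..b} t *\<^sub>R (f t)\<^sup>2 \<partial>lborel)"
  have "0 \<le> (\<integral>t. indicator {a..b} t *\<^sub>R ((b - a) * f t - ?I)\<^sup>2 \<partial>lborel)"
    by (intro integral_nonneg_AE) auto
  also have "(\<lambda>t. indicator {a..b} t *\<^sub>R ((b - a) * f t - ?I)\<^sup>2) =
      (\<lambda>t. (b - a)\<^sup>2 * (indicator {a..b} t *\<^sub>R (f t)\<^sup>2) - (2 * (b - a) * ?I) * (indicator {a..b} t *\<^sub>R f t)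
          + ?I\<^sup>2 * (indicator {a..b} t *\<^sub>R 1))"
    by (auto simp: power2_eq_square algebra_simps split: split_indicator)
  also have "integral\<^sup>L lborel \<dots> = (b - a)\<^sup>2 * ?J - (2 * (b - a) * ?I) * ?I + ?I\<^sup>2 * (b - a)"
    using int[of "\<lambda>t. (f t)\<^sup>2"] int[of f] int[of "\<lambda>_. 1"] f assms(1)
    by (simp add: Bochner_Integration.integral_add Bochner_Integration.integral_diff I[simplified] continuous_on_power)
  also have "\<dots> = (b - a) * ((b - a) * ?J - ?I\<^sup>2)"
    by (simp add: power2_eq_square algebra_simps)
  finally have le: "?I\<^sup>2 \<le> (b - a) * ?J"
    using ab by (simp add: zero_le_mult_iff)
  have "(\<integral>\<^sup>+t. indicator {a..b} t * ennreal ((f t)\<^sup>2) \<partial>lborel) = (\<integral>\<^sup>+t. ennreal (indicator {a..b} t *\<^sub>R (f t)\<^sup>2) \<partial>lborel)"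
    by (intro nn_integral_cong) (auto split: split_indicator)
  also have "\<dots> = ennreal ?J"
    using int[of "\<lambda>t. (f t)\<^sup>2"] f by (intro nn_integral_eq_integral) (auto intro: continuous_intros)
  finally show ?thesis using le ab by (simp add: ennreal_mult'[symmetric])
qed simp

lemma nn_integral_affine:
  fixes f :: "'a::euclidean_space \<Rightarrow> ennreal"
  assumes [measurable]: "f \<in> borel_measurable borel" and t: "t > 0"
  shows "(\<integral>\<^sup>+x. f x \<partial>lborel) = ennreal (t ^ DIM('a)) * (\<integral>\<^sup>+x. f (c + t *\<^sub>R x) \<partial>lborel)"
  using t by (subst lborel_affine[of t c])
    (simp_all add: nn_integral_density nn_integral_distr nn_integral_cmult)

text \<open>For fixed \<open>x\<close> the map from \<open>y\<close> to \<open>(1 - t) x + t y\<close> sends \<open>Q\<close> into itself and contracts volumes by the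
  factor \<open>t ^ DIM('a)\<close>, which is at least \<open>1 / 2 ^ DIM('a)\<close>.\<close>

lemma convex_average_bound_half:
  fixes Q :: "'a::euclidean_space set"
  assumes Q: "convex Q" "Q \<in> sets borel" and [measurable]: "G \<in> borel_measurable borel"
    and t: "1/2 \<le> t" "t \<le> 1"
  shows "(\<integral>\<^sup>+x. \<integral>\<^sup>+y. indicator Q x * indicator Q y * G ((1 - t) *\<^sub>R x + t *\<^sub>R y) \<partial>lborel \<partial>lborel)
    \<le> 2 ^ DIM('a) * emeasure lborel Q * (\<integral>\<^sup>+x. indicator Q x * G x \<partial>lborel)"
proof -
  note [measurable] = Q(2)
  let ?I = "\<integral>\<^sup>+x. indicator Q x * G x \<partial>lborel"
  have inner: "(\<integral>\<^sup>+y. indicator Q x * indicator Q y * G ((1 - t) *\<^sub>R x + t *\<^sub>R y) \<partial>lborel)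
      \<le> indicator Q x * (2 ^ DIM('a) * ?I)" for x
  proof -
    have K: "(\<integral>\<^sup>+y. indicator Q ((1 - t) *\<^sub>R x + t *\<^sub>R y) * G ((1 - t) *\<^sub>R x + t *\<^sub>R y) \<partial>lborel) \<le> 2 ^ DIM('a) * ?I"
    proof -
      let ?K = "\<integral>\<^sup>+y. indicator Q ((1 - t) *\<^sub>R x + t *\<^sub>R y) * G ((1 - t) *\<^sub>R x + t *\<^sub>R y) \<partial>lborel"
      have I: "?I = ennreal (t ^ DIM('a)) * ?K"
        using t by (intro nn_integral_affine) auto
      have "1 \<le> (2 * t) ^ DIM('a)" using t by (intro one_le_power) auto
      then have "1 * ?K \<le> ennreal ((2 * t) ^ DIM('a)) * ?K"
        by (intro mult_right_mono) (auto simp flip: ennreal_1 intro!: ennreal_leI)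
      also have "ennreal ((2 * t) ^ DIM('a)) = 2 ^ DIM('a) * ennreal (t ^ DIM('a))"
        using t by (simp add: power_mult_distrib ennreal_mult' ennreal_power flip: ennreal_numeral)
      finally show ?thesis by (simp add: I mult.assoc)
    qed
    have "(\<integral>\<^sup>+y. indicator Q x * indicator Q y * G ((1 - t) *\<^sub>R x + t *\<^sub>R y) \<partial>lborel)
      \<le> (\<integral>\<^sup>+y. indicator Q x * (indicator Q ((1 - t) *\<^sub>R x + t *\<^sub>R y) * G ((1 - t) *\<^sub>R x + t *\<^sub>R y)) \<partial>lborel)"
      using convexD_alt[OF Q(1), of x _ t] t by (intro nn_integral_mono) (auto split: split_indicator)
    also have "\<dots> = indicator Q x * (\<integral>\<^sup>+y. indicator Q ((1 - t) *\<^sub>R x + t *\<^sub>R y) * G ((1 - t) *\<^sub>R x + t *\<^sub>R y) \<partial>lborel)"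
      by (intro nn_integral_cmult) measurable
    also have "\<dots> \<le> indicator Q x * (2 ^ DIM('a) * ?I)"
      by (intro mult_left_mono K) auto
    finally show ?thesis .
  qed
  have "(\<integral>\<^sup>+x. \<integral>\<^sup>+y. indicator Q x * indicator Q y * G ((1 - t) *\<^sub>R x + t *\<^sub>R y) \<partial>lborel \<partial>lborel)
     \<le> (\<integral>\<^sup>+x. indicator Q x * (2 ^ DIM('a) * ?I) \<partial>lborel)"
    by (intro nn_integral_mono inner)
  also have "\<dots> = 2 ^ DIM('a) * emeasure lborel Q * ?I"
    by (subst nn_integral_multc) (auto simp: ac_simps)
  finally show ?thesis .
qed

text \<open>For \<open>t < 1/2\<close> the points \<open>x\<close> and \<open>y\<close> exchange their roles.\<close>

lemma convex_average_bound:
  fixes Q :: "'a::euclidean_space set"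
  assumes Q: "convex Q" "Q \<in> sets borel" and [measurable]: "G \<in> borel_measurable borel"
    and t: "0 \<le> t" "t \<le> 1"
  shows "(\<integral>\<^sup>+x. \<integral>\<^sup>+y. indicator Q x * indicator Q y * G ((1 - t) *\<^sub>R x + t *\<^sub>R y) \<partial>lborel \<partial>lborel)
    \<le> 2 ^ DIM('a) * emeasure lborel Q * (\<integral>\<^sup>+x. indicator Q x * G x \<partial>lborel)"
proof (cases "1/2 \<le> t")
  case True
  show ?thesis by (rule convex_average_bound_half[OF assms(1-3) True t(2)])
next
  case False
  note [measurable] = Q(2)
  have "(\<integral>\<^sup>+x. \<integral>\<^sup>+y. indicator Q x * indicator Q y * G ((1 - t) *\<^sub>R x + t *\<^sub>R y) \<partial>lborel \<partial>lborel)
     = (\<integral>\<^sup>+y. \<integral>\<^sup>+x. indicator Q x * indicator Q y * G ((1 - t) *\<^sub>R x + t *\<^sub>R y) \<partial>lborel \<partial>lborel)"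
    by (intro lborel_pair.Fubini'[symmetric]) measurable
  also have "\<dots> = (\<integral>\<^sup>+y. \<integral>\<^sup>+x. indicator Q y * indicator Q x * G ((1 - (1 - t)) *\<^sub>R y + (1 - t) *\<^sub>R x) \<partial>lborel \<partial>lborel)"
    by (simp add: ac_simps)
  also have "\<dots> \<le> 2 ^ DIM('a) * emeasure lborel Q * (\<integral>\<^sup>+x. indicator Q x * G x \<partial>lborel)"
    using False t by (intro convex_average_bound_half Q) auto
  finally show ?thesis .
qed

text \<open>The difference \<open>u x - u y\<close> is the integral of the gradient along a segment inside \<open>Q\<close>; integrate its
  square over \<open>x\<close> and \<open>y\<close> first, at a fixed position \<open>t\<close> on the segment. In this double integral form
  the inequality survives Fatou's lemma, which is how it is used for logarithms.\<close>

lemma poincare_convex: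
  fixes u :: "real ^ 'n \<Rightarrow> real"
  assumes Q: "convex Q" "Q \<in> sets borel" "\<And>x y. x \<in> Q \<Longrightarrow> y \<in> Q \<Longrightarrow> norm (x - y) \<le> d"
    and u: "\<And>x. (u has_derivative (\<lambda>v. g x \<bullet> v)) (at x)" and g: "continuous_on UNIV g"
  shows "(\<integral>\<^sup>+x. \<integral>\<^sup>+y. indicator Q x * indicator Q y * ennreal ((u x - u y)\<^sup>2) \<partial>lborel \<partial>lborel)
     \<le> ennreal (d\<^sup>2) * 2 ^ DIM(real ^ 'n) * emeasure lborel Q * (\<integral>\<^sup>+x. indicator Q x * ennreal ((norm (g x))\<^sup>2) \<partial>lborel)"
proof -
  note [measurable] = Q(2)
  have gb: "g \<in> borel_measurable borel" using g by (rule borel_measurable_continuous_onI)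
  have [measurable]: "g \<in> borel \<rightarrow>\<^sub>M borel" by (rule gb)
  define G where "G x = ennreal ((norm (g x))\<^sup>2)" for x
  have [measurable]: "G \<in> borel_measurable borel" unfolding G_def by measurable
  let ?B = "2 ^ DIM(real ^ 'n) * emeasure lborel Q * (\<integral>\<^sup>+x. indicator Q x * G x \<partial>lborel)"
  let ?T = "\<lambda>x y t. indicator {0..1::real} t * (indicator Q x * indicator Q y * G ((1 - t) *\<^sub>R x + t *\<^sub>R y))"
  have pt: "indicator Q x * indicator Q y * ennreal ((u x - u y)\<^sup>2)
      \<le> ennreal (d\<^sup>2) * (\<integral>\<^sup>+t. ?T x y t \<partial>lborel)" for x y
  proof (cases "x \<in> Q \<and> y \<in> Q")
    case True
    have "((\<lambda>t. u ((1 - t) *\<^sub>R x + t *\<^sub>R y)) has_real_derivative g ((1 - t) *\<^sub>R x + t *\<^sub>R y) \<bullet> (y - x)) (at t)" for t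
    proof -
      have "((\<lambda>t. (1 - t) *\<^sub>R x + t *\<^sub>R y) has_derivative (\<lambda>h. h *\<^sub>R (y - x))) (at t)"
        by (auto intro!: derivative_eq_intros simp: algebra_simps)
      from has_derivative_compose[OF this u]
      show ?thesis by (simp add: has_field_derivative_def mult_commute_abs)
    qed
    moreover have "continuous_on UNIV (\<lambda>t. g ((1 - t) *\<^sub>R x + t *\<^sub>R y) \<bullet> (y - x))"
      by (intro continuous_intros continuous_on_compose2[OF g]) auto
    ultimately
    have "ennreal ((u x - u y)\<^sup>2) \<le> (\<integral>\<^sup>+t. indicator {0..1} t * ennreal ((g ((1 - t) *\<^sub>R x + t *\<^sub>R y) \<bullet> (y - x))\<^sup>2) \<partial>lborel)"
      using FTC_square[of 0 1 "\<lambda>t. u ((1 - t) *\<^sub>R x + t *\<^sub>R y)"] by (simp add: power2_commute[of "u x"])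
    also have "\<dots> \<le> (\<integral>\<^sup>+t. ennreal (d\<^sup>2) * ?T x y t \<partial>lborel)"
    proof (intro nn_integral_mono)
      fix t :: real
      let ?z = "(1 - t) *\<^sub>R x + t *\<^sub>R y"
      have "\<bar>g ?z \<bullet> (y - x)\<bar> \<le> norm (g ?z) * d"
        using Cauchy_Schwarz_ineq2[of "g ?z" "y - x"] Q(3)[of y x] True
        by (meson mult_left_mono norm_ge_zero order_trans)
      then have "(g ?z \<bullet> (y - x))\<^sup>2 \<le> (norm (g ?z) * d)\<^sup>2"
        by (metis abs_ge_zero power2_abs power_mono)
      then have "ennreal ((g ?z \<bullet> (y - x))\<^sup>2) \<le> ennreal (d\<^sup>2) * G ?z"
        unfolding G_def by (simp add: ennreal_mult'[symmetric] power_mult_distrib mult.commute ennreal_leI)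
      then show "indicator {0..1} t * ennreal ((g ?z \<bullet> (y - x))\<^sup>2) \<le> ennreal (d\<^sup>2) * ?T x y t"
        using True by (auto split: split_indicator)
    qed
    also have "\<dots> = ennreal (d\<^sup>2) * (\<integral>\<^sup>+t. ?T x y t \<partial>lborel)"
      by (intro nn_integral_cmult) measurable
    finally show ?thesis using True by simp
  qed (auto split: split_indicator)
  have "(\<integral>\<^sup>+x. \<integral>\<^sup>+y. indicator Q x * indicator Q y * ennreal ((u x - u y)\<^sup>2) \<partial>lborel \<partial>lborel)
     \<le> (\<integral>\<^sup>+x. \<integral>\<^sup>+y. ennreal (d\<^sup>2) * (\<integral>\<^sup>+t. ?T x y t \<partial>lborel) \<partial>lborel \<partial>lborel)"
    by (intro nn_integral_mono pt)
  also have "\<dots> = ennreal (d\<^sup>2) * (\<integral>\<^sup>+x. \<integral>\<^sup>+y. \<integral>\<^sup>+t. ?T x y t \<partial>lborel \<partial>lborel \<partial>lborel)"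
    by (simp add: nn_integral_cmult)
  also have "(\<integral>\<^sup>+x. \<integral>\<^sup>+y. \<integral>\<^sup>+t. ?T x y t \<partial>lborel \<partial>lborel \<partial>lborel)
      = (\<integral>\<^sup>+x. \<integral>\<^sup>+t. \<integral>\<^sup>+y. ?T x y t \<partial>lborel \<partial>lborel \<partial>lborel)"
    by (intro nn_integral_cong lborel_pair.Fubini') measurable
  also have "\<dots> = (\<integral>\<^sup>+t. \<integral>\<^sup>+x. \<integral>\<^sup>+y. ?T x y t \<partial>lborel \<partial>lborel \<partial>lborel)"
    by (intro lborel_pair.Fubini'[symmetric]) measurable
  also have "\<dots> \<le> (\<integral>\<^sup>+t. indicator {0..1::real} t * ?B \<partial>lborel)"
  proof (intro nn_integral_mono)
    fix t :: real
    show "(\<integral>\<^sup>+x. \<integral>\<^sup>+y. ?T x y t \<partial>lborel \<partial>lborel) \<le> indicator {0..1} t * ?B"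
    proof (cases "t \<in> {0..1}")
      case True
      then show ?thesis using convex_average_bound[OF Q(1,2), of G t] by simp
    qed simp
  qed
  also have "\<dots> = ?B" by (simp add: nn_integral_multc)
  finally show ?thesis by (simp add: G_def mult.assoc mult_left_mono)
qed

section \<open>Rotations, differentiation of integrals, and Fubini\<close>

text \<open>The Lipschitz bound dominates the difference quotients.\<close>

lemma deriv_integral:
  fixes k :: "real \<Rightarrow> 'a \<Rightarrow> real"
  assumes k: "\<And>r. integrable M (k r)" and k'[measurable]: "k' \<in> borel_measurable M"
    and d: "\<And>y. ((\<lambda>r. k r y) has_real_derivative k' y) (at s)"
    and L: "\<And>r y. \<bar>k r y - k s y\<bar> \<le> \<bar>r - s\<bar> * B y" and B: "integrable M B"
  shows "((\<lambda>r. \<integral>y. k r y \<partial>M) has_real_derivative (\<integral>y. k' y \<partial>M)) (at s)"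
  unfolding has_field_derivative_iff tendsto_at_iff_sequentially
proof (intro allI impI)
  fix X :: "nat \<Rightarrow> real" assume X: "\<forall>i. X i \<in> UNIV - {s}" "X \<longlonglongrightarrow> s"
  have "(\<lambda>i. \<integral>y. (k (X i) y - k s y) / (X i - s) \<partial>M) \<longlonglongrightarrow> (\<integral>y. k' y \<partial>M)"
  proof (rule integral_dominated_convergence[OF k' _ B])
    show "(\<lambda>y. (k (X i) y - k s y) / (X i - s)) \<in> borel_measurable M" for i
      using k by (intro borel_measurable_divide borel_measurable_diff borel_measurable_integrable) auto
    show "AE y in M. (\<lambda>i. (k (X i) y - k s y) / (X i - s)) \<longlonglongrightarrow> k' y"
      using d X unfolding has_field_derivative_iff tendsto_at_iff_sequentially by (auto simp: o_def)
    show "AE y in M. norm ((k (X i) y - k s y) / (X i - s)) \<le> B y" for i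
      using X(1) L[of "X i"] by (auto simp: abs_divide divide_le_eq mult.commute)
  qed
  then show "((\<lambda>y. (integral\<^sup>L M (k y) - integral\<^sup>L M (k s)) / (y - s)) \<circ> X) \<longlonglongrightarrow> (\<integral>y. k' y \<partial>M)"
    using k by (simp add: o_def Bochner_Integration.integral_diff)
qed

definition Rot :: "real \<Rightarrow> real ^ 2 \<Rightarrow> real ^ 2" where
  "Rot a y = vector [cos a * y $ 1 + sin a * y $ 2, - sin a * y $ 1 + cos a * y $ 2]"

lemma Rot_nth [simp]: "Rot a y $ 1 = cos a * y $ 1 + sin a * y $ 2"
  "Rot a y $ 2 = - sin a * y $ 1 + cos a * y $ 2"
  by (simp_all add: Rot_def)

lemma vec2_eq_iff: "x = y \<longleftrightarrow> x $ 1 = y $ 1 \<and> x $ 2 = y $ 2" for x y :: "'a ^ 2"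
  by (simp add: vec_eq_iff forall_2)

lemma Rot_Rot: "Rot a (Rot b y) = Rot (a + b) y"
  by (simp add: vec2_eq_iff cos_add sin_add algebra_simps)

lemma Rot_0 [simp]: "Rot 0 y = y" by (simp add: vec2_eq_iff)

lemma inner_vec2: "x \<bullet> y = x $ 1 * y $ 1 + x $ 2 * y $ 2" for x y :: "real ^ 2"
  by (simp add: inner_vec_def sum_2)

lemma linear_Rot: "linear (Rot a)"
  by (intro linearI) (auto simp: vec2_eq_iff algebra_simps)

lemma Rot_inner: "Rot a x \<bullet> Rot a y = x \<bullet> y"
proof -
  have "Rot a x \<bullet> Rot a y = ((sin a)\<^sup>2 + (cos a)\<^sup>2) * (x \<bullet> y)"
    unfolding inner_vec2 Rot_nth power2_eq_square by algebra
  then show ?thesis by simp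
qed

lemma orthogonal_Rot: "orthogonal_transformation (Rot a)"
  by (simp add: orthogonal_transformation_def linear_Rot Rot_inner)

lemma norm_Rot [simp]: "norm (Rot a x) = norm x"
  by (simp add: norm_eq_sqrt_inner Rot_inner)

lemma continuous_Rot: "continuous_on S (Rot a)"
  using linear_Rot linear_continuous_on linear_conv_bounded_linear by blast

lemma continuous_on_vec2:
  fixes f :: "'a::topological_space \<Rightarrow> real ^ 2"
  assumes "continuous_on S (\<lambda>x. f x $ 1)" "continuous_on S (\<lambda>x. f x $ 2)"
  shows "continuous_on S f"
proof -
  have "continuous_on S (\<lambda>x. f x $ i)" for i using exhaust_2[of i] assms by auto
  then have "continuous_on S (\<lambda>x. \<chi> i. f x $ i)" by (intro continuous_on_vec_lambda)
  then show ?thesis by simp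
qed

lemma continuous_Rot2: "continuous_on S (a :: 'a::t2_space \<Rightarrow> real) \<Longrightarrow> continuous_on S y \<Longrightarrow> continuous_on S (\<lambda>x. Rot (a x) (y x))"
  by (rule continuous_on_vec2) (auto intro!: continuous_intros)

lemma lborel_Rot: "distr lborel borel (Rot a) = lborel"
proof (rule lborel_eqI[symmetric])
  have [measurable]: "Rot a \<in> borel \<rightarrow>\<^sub>M borel"
    by (intro borel_measurable_continuous_onI continuous_Rot)
  fix l u :: "real ^ 2" assume lu: "\<And>b. b \<in> Basis \<Longrightarrow> l \<bullet> b \<le> u \<bullet> b"
  have eq: "Rot a -` box l u = Rot (- a) ` box l u"
    by (auto simp: Rot_Rot image_iff) (metis Rot_Rot Rot_0 add.left_inverse)
  have lm: "box l u \<in> lmeasurable" by simp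
  have im: "Rot a -` box l u \<in> sets borel" using measurable_sets[of "Rot a" borel borel "box l u"] by simp
  have "emeasure (distr lborel borel (Rot a)) (box l u) = emeasure lborel (Rot a -` box l u)"
    by (subst emeasure_distr) auto
  also have "\<dots> = emeasure lebesgue (Rot (- a) ` box l u)"
    using im by (simp add: eq)
  also have "\<dots> = emeasure lebesgue (box l u)"
    using measure_orthogonal_image[OF orthogonal_Rot lm, of "- a"]
      measurable_linear_image[OF linear_Rot lm, of "- a"] lm
    by (simp add: emeasure_eq_measure2 fmeasurableD)
  also have "\<dots> = (\<Prod>b\<in>Basis. (u - l) \<bullet> b)"
    using lu by (simp add: emeasure_lborel_box_eq)
  finally show "emeasure (distr lborel borel (Rot a)) (box l u) = ennreal (\<Prod>b\<in>Basis. (u - l) \<bullet> b)" .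
qed simp

lemma Rot_measurable [measurable]: "Rot a \<in> borel \<rightarrow>\<^sub>M borel"
  by (intro borel_measurable_continuous_onI continuous_Rot)

lemma integral_Rot:
  fixes f :: "real ^ 2 \<Rightarrow> real"
  assumes "f \<in> borel_measurable borel" shows "(\<integral>y. f (Rot a y) \<partial>lborel) = (\<integral>y. f y \<partial>lborel)"
  using assms integral_distr[of "Rot a" lborel borel f] by (simp add: lborel_Rot)

lemma nn_integral_Rot:
  assumes "f \<in> borel_measurable borel" shows "(\<integral>\<^sup>+y. f (Rot a y) \<partial>lborel) = (\<integral>\<^sup>+y. f y \<partial>lborel)"
  using assms nn_integral_distr[of "Rot a" lborel borel f] by (simp add: lborel_Rot)

lemma Rot_has_derivative: "((\<lambda>a. Rot a y) has_derivative (\<lambda>h. h *\<^sub>R rot_field (Rot a y))) (at a)"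
proof -
  have v: "Rot a y = cos a *\<^sub>R y + sin a *\<^sub>R rot_field y" for a
    by (simp add: vec2_eq_iff rot_field_def)
  have "((\<lambda>a. cos a *\<^sub>R y + sin a *\<^sub>R rot_field y) has_derivative
     (\<lambda>h. (- sin a * h) *\<^sub>R y + (cos a * h) *\<^sub>R rot_field y)) (at a)"
    by (auto intro!: derivative_eq_intros simp: mult.commute)
  moreover have "(- sin a * h) *\<^sub>R y + (cos a * h) *\<^sub>R rot_field y = h *\<^sub>R rot_field (Rot a y)" for h
    by (simp add: vec2_eq_iff rot_field_def algebra_simps)
  ultimately show ?thesis by (simp add: v[abs_def])
qed

lemma tau_Rot:
  assumes "smooth u"
  shows "((\<lambda>a. u (Rot a y)) has_real_derivative tau u (Rot a y)) (at a)"
  using has_derivative_compose[OF Rot_has_derivative smooth_gr[OF assms]]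
  by (simp add: has_field_derivative_def tau_def mult_commute_abs)

lemma continuous_tau: "smooth u \<Longrightarrow> continuous_on S (tau u)"
  unfolding tau_def[abs_def] by (intro continuous_intros continuous_gr continuous_rot_field)

text \<open>Along an orbit of the rotations \<open>u\<close> has derivative \<open>tau u\<close>, and rotations preserve the measure. So a
  function with small angular derivative is almost invariant under each rotation.\<close>

lemma rotation_difference_bound:
  assumes u: "u \<in> rtest U" and a: "0 \<le> a"
  shows "(\<integral>\<^sup>+x. ennreal ((u (Rot a x) - u x)\<^sup>2) \<partial>lborel) \<le> ennreal (a\<^sup>2 * ip (tau u) (tau u))"
proof -
  note su = rtest_smooth[OF u]
  have tb[measurable]: "tau u \<in> borel_measurable borel"
    by (intro borel_measurable_continuous_onI continuous_tau su)
  have m2: "(\<lambda>(x, s). Rot s x) \<in> borel_measurable (borel :: ((real ^ 2) \<times> real) measure)"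
    by (intro borel_measurable_continuous_onI) (auto simp: case_prod_unfold intro!: continuous_Rot2 continuous_intros)
  then have [measurable]: "(\<lambda>(x, s). Rot s x) \<in> borel_measurable ((borel :: (real ^ 2) measure) \<Otimes>\<^sub>M (borel :: real measure))"
    by (simp add: borel_prod)
  have "(\<integral>\<^sup>+x. ennreal ((u (Rot a x) - u x)\<^sup>2) \<partial>lborel)
     \<le> (\<integral>\<^sup>+x. ennreal a * (\<integral>\<^sup>+s. indicator {0..a} s * ennreal ((tau u (Rot s x))\<^sup>2) \<partial>lborel) \<partial>lborel)"
  proof (intro nn_integral_mono)
    fix x
    show "ennreal ((u (Rot a x) - u x)\<^sup>2) \<le> ennreal a * (\<integral>\<^sup>+s. indicator {0..a} s * ennreal ((tau u (Rot s x))\<^sup>2) \<partial>lborel)"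
      using FTC_square[OF a tau_Rot[OF su, of x]] 
      by (simp add: continuous_on_compose2[OF continuous_tau[OF su, of UNIV]] continuous_Rot2)
  qed
  also have "\<dots> = ennreal a * (\<integral>\<^sup>+x. \<integral>\<^sup>+s. indicator {0..a} s * ennreal ((tau u (Rot s x))\<^sup>2) \<partial>lborel \<partial>lborel)"
    by (intro nn_integral_cmult) measurable
  also have "(\<integral>\<^sup>+x. \<integral>\<^sup>+s. indicator {0..a} s * ennreal ((tau u (Rot s x))\<^sup>2) \<partial>lborel \<partial>lborel)
     = (\<integral>\<^sup>+s. \<integral>\<^sup>+x. indicator {0..a} s * ennreal ((tau u (Rot s x))\<^sup>2) \<partial>lborel \<partial>lborel)"
    by (intro lborel_pair.Fubini'[symmetric]) measurable
  also have "\<dots> = (\<integral>\<^sup>+s. indicator {0..a} s * ennreal (ip (tau u) (tau u)) \<partial>lborel)"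
  proof (intro nn_integral_cong)
    fix s :: real
    have "(\<integral>\<^sup>+x. indicator {0..a} s * ennreal ((tau u (Rot s x))\<^sup>2) \<partial>lborel)
       = indicator {0..a} s * (\<integral>\<^sup>+x. ennreal ((tau u (Rot s x))\<^sup>2) \<partial>lborel)"
      by (intro nn_integral_cmult) measurable
    also have "(\<integral>\<^sup>+x. ennreal ((tau u (Rot s x))\<^sup>2) \<partial>lborel) = (\<integral>\<^sup>+x. ennreal ((tau u x)\<^sup>2) \<partial>lborel)"
      by (intro nn_integral_Rot) measurable
    also have "\<dots> = ennreal (ip (tau u) (tau u))"
      unfolding ip_def power2_eq_square
      by (intro nn_integral_eq_integral cc_integrable cc_mult tau_cc[OF u]) auto
    finally show "(\<integral>\<^sup>+x. indicator {0..a} s * ennreal ((tau u (Rot s x))\<^sup>2) \<partial>lborel) = indicator {0..a} s * ennreal (ip (tau u) (tau u))" .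
  qed
  also have "\<dots> = ennreal a * ennreal (ip (tau u) (tau u))"
    using a by (subst nn_integral_multc) auto
  also have "ennreal a * \<dots> = ennreal (a\<^sup>2 * ip (tau u) (tau u))"
    using a by (simp add: power2_eq_square ennreal_mult' mult.assoc)
  finally show ?thesis .
qed

text \<open>The integral of \<open>u (Rot r y)\<close> over \<open>y\<close> does not depend on \<open>r\<close>; differentiate it at \<open>r = 0\<close>.\<close>

lemma integral_tau:
  assumes u: "u \<in> rtest U" shows "(\<integral>x. tau u x \<partial>lborel) = 0"
proof -
  note su = rtest_smooth[OF u]
  obtain B where B: "B > 0" "\<And>x. \<bar>tau u x\<bar> \<le> B" using cc_bounded[OF tau_cc[OF u]] by blast
  obtain K where K: "compact K" "\<And>x. x \<notin> K \<Longrightarrow> u x = 0" by (rule rtestE[OF u]) blast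
  then obtain R where R: "\<And>x. x \<in> K \<Longrightarrow> norm x \<le> R" using compact_imp_bounded bounded_iff by metis
  have uR: "u x = 0" if "x \<notin> cball 0 R" for x using that R K(2) by force
  have cr: "(\<lambda>y. u (Rot r y)) \<in> cc" for r
    by (rule ccI[of _ "cball 0 R"])
      (auto intro!: continuous_on_compose2[OF smooth_continuous[OF su, of UNIV]] continuous_Rot uR)
  have L: "\<bar>u (Rot r y) - u (Rot 0 y)\<bar> \<le> \<bar>r - 0\<bar> * (B * indicator (cball 0 R) y)" for r y
  proof (cases "y \<in> cball 0 R")
    case True
    have "norm (u (Rot r y) - u (Rot 0 y)) \<le> B * norm (r - 0)"
      by (rule field_differentiable_bound[of UNIV _ "\<lambda>a. tau u (Rot a y)"])
        (auto intro: tau_Rot[OF su] B)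
    then show ?thesis using True by (simp add: mult.commute)
  next
    case False
    then show ?thesis using uR[of "Rot r y"] uR[of y] by simp
  qed
  have "((\<lambda>r. \<integral>y. u (Rot r y) \<partial>lborel) has_real_derivative (\<integral>y. tau u y \<partial>lborel)) (at 0)"
    by (rule deriv_integral[OF _ _ _ L])
      (use cc_integrable[OF cr] tau_Rot[OF su, of _ 0] cc_borel[OF tau_cc[OF u]] in \<open>auto simp: integrable_indicator_iff emeasure_lborel_cball_finite[unfolded infinity_ennreal_def]\<close>)
  moreover have "(\<lambda>r. \<integral>y. u (Rot r y) \<partial>lborel) = (\<lambda>r. \<integral>y. u y \<partial>lborel)"
    using integral_Rot[of u] cc_borel[OF rtest_cc[OF u]] by auto
  ultimately show ?thesis using DERIV_unique DERIV_const by metis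
qed

lemma tau_mult: "smooth u \<Longrightarrow> smooth v \<Longrightarrow> tau (\<lambda>x. u x * v x) x = u x * tau v x + v x * tau u x"
  by (simp add: tau_def gr_mult inner_add_left)

lemma tau_antisymmetric:
  assumes "u \<in> rtest U" "v \<in> rtest U"
  shows "ip u (tau v) = - ip (tau u) v"
proof -
  have "(\<lambda>x. u x * v x) \<in> rtest U" using assms rtest_smult rtest_smooth by blast
  from integral_tau[OF this] have "(\<integral>x. u x * tau v x + v x * tau u x \<partial>lborel) = 0"
    using assms by (simp add: tau_mult rtest_smooth)
  then have "ip u (tau v) + ip v (tau u) = 0"
    unfolding ip_def using assms
    by (subst (asm) Bochner_Integration.integral_add) (auto intro!: cc_integrable cc_mult intro: rtest_cc tau_cc)
  then show ?thesis by (simp add: ip_commute)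
qed

definition emb :: "real \<Rightarrow> real ^ 2 \<Rightarrow> real ^ 3" where
  "emb s y = vector [s, y $ 1, y $ 2]"

lemma emb_nth [simp]: "emb s y $ 1 = s" "emb s y $ 2 = y $ 1" "emb s y $ 3 = y $ 2"
  by (simp_all add: emb_def)

lemma continuous_on_vec3:
  fixes f :: "'a::topological_space \<Rightarrow> real ^ 3"
  assumes "continuous_on S (\<lambda>x. f x $ 1)" "continuous_on S (\<lambda>x. f x $ 2)" "continuous_on S (\<lambda>x. f x $ 3)"
  shows "continuous_on S f"
proof -
  have "continuous_on S (\<lambda>x. f x $ i)" for i using exhaust_3[of i] assms by auto
  then have "continuous_on S (\<lambda>x. \<chi> i. f x $ i)" by (intro continuous_on_vec_lambda)
  then show ?thesis by simp
qed

lemma continuous_emb: "continuous_on S a \<Longrightarrow> continuous_on S y \<Longrightarrow> continuous_on S (\<lambda>x. emb (a x) (y x))"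
  by (rule continuous_on_vec3) (auto intro!: continuous_intros)

lemma prod_Basis_vec: "(\<Prod>b\<in>(Basis :: (real ^ 'n) set). z \<bullet> b) = (\<Prod>i\<in>UNIV. z $ i)"
proof -
  have "(Basis :: (real ^ 'n) set) = (\<lambda>i. axis i 1) ` UNIV" by (auto simp: Basis_vec_def)
  moreover have "inj (\<lambda>i :: 'n. axis i (1 :: real))" by (auto simp: inj_def axis_eq_axis)
  ultimately show ?thesis
    using prod.reindex[of "\<lambda>i :: 'n. axis i (1 :: real)" UNIV "\<lambda>b. z \<bullet> b"] by (simp add: inner_axis)
qed

lemma mem_box_vec: "x \<in> box l u \<longleftrightarrow> (\<forall>i. l $ i < x $ i \<and> x $ i < u $ i)" for x :: "real ^ 'n"
  by (auto simp: mem_box_cart)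

lemma lborel_emb: "distr (lborel \<Otimes>\<^sub>M lborel) borel (\<lambda>(s, y). emb s y) = lborel"
proof (rule lborel_eqI[symmetric])
  have "(\<lambda>(s, y). emb s y) \<in> borel_measurable (borel :: (real \<times> (real ^ 2)) measure)"
    by (intro borel_measurable_continuous_onI) (auto simp: case_prod_unfold intro!: continuous_emb continuous_intros)
  then have [measurable]: "(\<lambda>(s, y). emb s y) \<in> borel_measurable (lborel \<Otimes>\<^sub>M lborel)"
    by (simp add: borel_prod lborel_prod)
  fix l u :: "real ^ 3" assume lu: "\<And>b. b \<in> Basis \<Longrightarrow> l \<bullet> b \<le> u \<bullet> b"
  have lu': "l $ i \<le> u $ i" for i using lu[of "axis i 1"] by (simp add: inner_axis)
  define l' :: "real ^ 2" where "l' = vector [l $ 2, l $ 3]"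
  define u' :: "real ^ 2" where "u' = vector [u $ 2, u $ 3]"
  have eq: "(\<lambda>(s, y). emb s y) -` box l u \<inter> space (lborel \<Otimes>\<^sub>M lborel) = {l $ 1 <..< u $ 1} \<times> box l' u'"
    by (auto simp: mem_box_vec forall_2 forall_3 l'_def u'_def space_pair_measure)
  have "emeasure (distr (lborel \<Otimes>\<^sub>M lborel) borel (\<lambda>(s, y). emb s y)) (box l u)
     = emeasure (lborel \<Otimes>\<^sub>M lborel) ({l $ 1 <..< u $ 1} \<times> box l' u')"
    by (subst emeasure_distr) (auto simp: eq)
  also have "\<dots> = emeasure lborel {l $ 1 <..< u $ 1} * emeasure lborel (box l' u')"
    by (intro lborel.emeasure_pair_measure_Times) auto
  also have "emeasure lborel (box l' u') = ennreal (\<Prod>b\<in>Basis. (u' - l') \<bullet> b)"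
  proof (rule emeasure_lborel_box)
    fix b :: "real ^ 2" assume "b \<in> Basis"
    then obtain i where "b = axis i 1" by (auto simp: Basis_vec_def)
    then show "l' \<bullet> b \<le> u' \<bullet> b" using lu' exhaust_2[of i] by (auto simp: inner_axis l'_def u'_def)
  qed
  also have "(\<Prod>b\<in>Basis. (u' - l') \<bullet> b) = (u $ 2 - l $ 2) * (u $ 3 - l $ 3)"
    unfolding prod_Basis_vec UNIV_2 by (simp add: l'_def u'_def)
  also have "emeasure lborel {l $ 1 <..< u $ 1} = ennreal (u $ 1 - l $ 1)"
    using lu'[of 1] by simp
  also have "ennreal (u $ 1 - l $ 1) * ennreal ((u $ 2 - l $ 2) * (u $ 3 - l $ 3)) =
      ennreal ((u $ 1 - l $ 1) * ((u $ 2 - l $ 2) * (u $ 3 - l $ 3)))"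
    using lu'[of 1] by (intro ennreal_mult'[symmetric]) simp
  also have "(u $ 1 - l $ 1) * ((u $ 2 - l $ 2) * (u $ 3 - l $ 3)) = (\<Prod>b\<in>Basis. (u - l) \<bullet> b)"
    unfolding prod_Basis_vec UNIV_3 by simp
  finally show "emeasure (distr (lborel \<Otimes>\<^sub>M lborel) borel (\<lambda>(s, y). emb s y)) (box l u) = ennreal (\<Prod>b\<in>Basis. (u - l) \<bullet> b)" .
qed simp

text \<open>Integration in the straightened coordinates of the tube: each slice is only rotated, so no
  Jacobian appears.\<close>

lemma tube_Fubini:
  fixes g :: "real ^ 3 \<Rightarrow> real"
  assumes g: "integrable lborel g"
  shows "integrable lborel (\<lambda>s. \<integral>y. g (emb s (Rot (\<theta> s) y)) \<partial>lborel)"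
    and "(\<integral>s. \<integral>y. g (emb s (Rot (\<theta> s) y)) \<partial>lborel \<partial>lborel) = integral\<^sup>L lborel g"
proof -
  have gb[measurable]: "g \<in> borel_measurable borel" using g by auto
  have "(\<lambda>(s, y). emb s y) \<in> borel_measurable (borel :: (real \<times> (real ^ 2)) measure)"
    by (intro borel_measurable_continuous_onI) (auto simp: case_prod_unfold intro!: continuous_emb continuous_intros)
  then have m[measurable]: "(\<lambda>(s, y). emb s y) \<in> borel_measurable (lborel \<Otimes>\<^sub>M lborel)"
    by (simp add: borel_prod lborel_prod)
  have "emb s \<in> borel_measurable borel" for s
    by (intro borel_measurable_continuous_onI continuous_emb continuous_intros)
  then have ms: "(\<lambda>y. g (emb s y)) \<in> borel_measurable borel" for s by measurable
  have rot: "(\<integral>y. g (emb s (Rot (\<theta> s) y)) \<partial>lborel) = (\<integral>y. g (emb s y) \<partial>lborel)" for s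
    using integral_Rot[OF ms[of s], of "\<theta> s"] by simp
  have i: "integrable (lborel \<Otimes>\<^sub>M lborel) (\<lambda>(s, y). g (emb s y))"
    using g integrable_distr_eq[OF m gb] by (simp add: lborel_emb[unfolded case_prod_unfold] case_prod_unfold)
  show "integrable lborel (\<lambda>s. \<integral>y. g (emb s (Rot (\<theta> s) y)) \<partial>lborel)"
    using lborel_pair.integrable_fst'[OF i] by (simp add: rot)
  have "(\<integral>s. \<integral>y. g (emb s y) \<partial>lborel \<partial>lborel) = (\<integral>z. (case z of (s, y) \<Rightarrow> g (emb s y)) \<partial>(lborel \<Otimes>\<^sub>M lborel))"
    using lborel_pair.integral_fst'[OF i] by simp
  also have "\<dots> = integral\<^sup>L lborel g"
    using integral_distr[OF m gb] by (simp add: lborel_emb[unfolded case_prod_unfold] case_prod_unfold)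
  finally show "(\<integral>s. \<integral>y. g (emb s (Rot (\<theta> s) y)) \<partial>lborel \<partial>lborel) = integral\<^sup>L lborel g"
    by (simp add: rot)
qed

section \<open>Convergence in the mean square\<close>

text \<open>Small \<open>t\<close> makes the second term small, then large \<open>n\<close> the first.\<close>

lemma LIMSEQ_by_weighted_bound:
  fixes a d :: "nat \<Rightarrow> real"
  assumes le: "\<And>n t. t > 0 \<Longrightarrow> \<bar>a n - l\<bar> \<le> (1 + 1 / t) * d n + t * B" and d: "d \<longlonglongrightarrow> 0"
  shows "a \<longlonglongrightarrow> l"
proof (rule LIMSEQ_I)
  fix e :: real assume e: "e > 0"
  define t where "t = e / (2 * (\<bar>B\<bar> + 1))"
  have t: "t > 0" using e by (simp add: t_def)
  have tB: "t * B \<le> e / 2"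
  proof -
    have "t * B \<le> t * (\<bar>B\<bar> + 1)" using t by (intro mult_left_mono) auto
    also have "\<dots> = e / 2" by (simp add: t_def field_simps add_pos_nonneg)
    finally show ?thesis .
  qed
  have "(\<lambda>n. (1 + 1 / t) * d n) \<longlonglongrightarrow> 0" using tendsto_mult_right_zero[OF d] by blast
  then have "\<forall>\<^sub>F n in sequentially. (1 + 1 / t) * d n < e / 2"
    using e by (intro order_tendstoD(2)[of _ 0]) auto
  then obtain N where N: "\<And>n. n \<ge> N \<Longrightarrow> (1 + 1 / t) * d n < e / 2"
    by (auto simp: eventually_sequentially)
  then have "\<bar>a n - l\<bar> < e" if "n \<ge> N" for n using le[OF t, of n] tB N[OF that] by linarith
  then show "\<exists>N. \<forall>n\<ge>N. norm (a n - l) < e" by auto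
qed

lemma norm_sq_add_le: "(norm (x + y))\<^sup>2 \<le> 2 * (norm x)\<^sup>2 + 2 * (norm y)\<^sup>2" for x y :: "'a::real_inner"
proof -
  have "2 * (x \<bullet> y) \<le> x \<bullet> x + y \<bullet> y"
    using inner_ge_zero[of "x - y"] by (simp add: inner_diff inner_commute)
  then show ?thesis by (simp add: power2_norm_eq_inner inner_add inner_commute)
qed

lemma integrable_norm_diff_sq:
  fixes f g :: "'a \<Rightarrow> 'b::euclidean_space"
  assumes [measurable]: "f \<in> borel_measurable M" "g \<in> borel_measurable M"
    and "integrable M (\<lambda>x. (norm (f x))\<^sup>2)" "integrable M (\<lambda>x. (norm (g x))\<^sup>2)"
  shows "integrable M (\<lambda>x. (norm (f x - g x))\<^sup>2)"
proof (rule Bochner_Integration.integrable_bound)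
  show "integrable M (\<lambda>x. 2 * (norm (f x))\<^sup>2 + 2 * (norm (g x))\<^sup>2)" using assms by simp
  show "AE x in M. norm ((norm (f x - g x))\<^sup>2) \<le> norm (2 * (norm (f x))\<^sup>2 + 2 * (norm (g x))\<^sup>2)"
    using norm_sq_add_le[of "f x" "- g x" for x] by (intro AE_I2) simp
qed measurable

text \<open>Since the squares of the norms of \<open>a\<close> and \<open>b\<close> differ by at most
  \<open>(1 + 1 / t) \<bar>a - b\<bar>\<^sup>2 + t \<bar>b\<bar>\<^sup>2\<close>, mean-square convergence carries over to weighted square integrals.\<close>

lemma weighted_norm_sq_tendsto:
  fixes f :: "nat \<Rightarrow> 'a \<Rightarrow> 'b::euclidean_space"
  assumes f[measurable]: "\<And>n. f n \<in> borel_measurable M" and g[measurable]: "g \<in> borel_measurable M"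
    and fi: "\<And>n. integrable M (\<lambda>x. (norm (f n x))\<^sup>2)" and gi: "integrable M (\<lambda>x. (norm (g x))\<^sup>2)"
    and \<rho>[measurable]: "\<rho> \<in> borel_measurable M" and \<rho>01: "\<And>x. 0 \<le> \<rho> x \<and> \<rho> x \<le> 1"
    and lim: "(\<lambda>n. \<integral>x. (norm (f n x - g x))\<^sup>2 \<partial>M) \<longlonglongrightarrow> 0"
  shows "(\<lambda>n. \<integral>x. \<rho> x * (norm (f n x))\<^sup>2 \<partial>M) \<longlonglongrightarrow> (\<integral>x. \<rho> x * (norm (g x))\<^sup>2 \<partial>M)"
proof (rule LIMSEQ_by_weighted_bound[OF _ lim, of _ _ "\<integral>x. (norm (g x))\<^sup>2 \<partial>M"])
  fix n and t :: real assume t: "t > 0"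
  have wi: "integrable M (\<lambda>x. \<rho> x * (norm (h x))\<^sup>2)"
    if [measurable]: "h \<in> borel_measurable M" and "integrable M (\<lambda>x. (norm (h x))\<^sup>2)" for h :: "'a \<Rightarrow> 'b"
    by (rule Bochner_Integration.integrable_bound[OF that(2)])
      (use \<rho>01 in \<open>auto simp: abs_mult mult_le_cancel_right1 intro!: mult_left_le_one_le\<close>)
  have di: "integrable M (\<lambda>x. (norm (f n x - g x))\<^sup>2)"
    by (rule integrable_norm_diff_sq) (auto simp: fi gi)
  have "\<bar>(\<integral>x. \<rho> x * (norm (f n x))\<^sup>2 \<partial>M) - (\<integral>x. \<rho> x * (norm (g x))\<^sup>2 \<partial>M)\<bar>
     = \<bar>\<integral>x. \<rho> x * (norm (f n x))\<^sup>2 - \<rho> x * (norm (g x))\<^sup>2 \<partial>M\<bar>"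
    by (subst Bochner_Integration.integral_diff) (auto intro!: wi fi gi)
  also have "\<dots> \<le> (\<integral>x. \<bar>\<rho> x * (norm (f n x))\<^sup>2 - \<rho> x * (norm (g x))\<^sup>2\<bar> \<partial>M)"
    by (rule integral_abs_bound)
  also have "\<dots> \<le> (\<integral>x. (1 + 1 / t) * (norm (f n x - g x))\<^sup>2 + t * (norm (g x))\<^sup>2 \<partial>M)"
  proof (rule integral_mono)
    show "integrable M (\<lambda>x. \<bar>\<rho> x * (norm (f n x))\<^sup>2 - \<rho> x * (norm (g x))\<^sup>2\<bar>)"
      by (intro integrable_abs Bochner_Integration.integrable_diff wi fi gi) auto
    show "integrable M (\<lambda>x. (1 + 1 / t) * (norm (f n x - g x))\<^sup>2 + t * (norm (g x))\<^sup>2)"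
      using di gi by simp
    fix x
    let ?a = "f n x" and ?b = "g x" and ?D = "norm (f n x - g x)"
    have D: "\<bar>norm ?a - norm ?b\<bar> \<le> ?D" by (rule norm_triangle_ineq3)
    have "\<bar>(norm ?a)\<^sup>2 - (norm ?b)\<^sup>2\<bar> = \<bar>norm ?a - norm ?b\<bar> * (norm ?a + norm ?b)"
      by (simp add: power2_eq_square square_diff_square_factored abs_mult)
    also have "\<dots> \<le> ?D * (?D + 2 * norm ?b)"
      using D by (intro mult_mono) (auto simp: norm_triangle_sub)
    also have "\<dots> \<le> (1 + 1 / t) * ?D\<^sup>2 + t * (norm ?b)\<^sup>2"
    proof -
      have "0 \<le> (?D - t * norm ?b)\<^sup>2" by simp
      then have "2 * t * (?D * norm ?b) \<le> ?D\<^sup>2 + t\<^sup>2 * (norm ?b)\<^sup>2"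
        by (simp add: power2_eq_square algebra_simps)
      then have "2 * (?D * norm ?b) \<le> (?D\<^sup>2 + t\<^sup>2 * (norm ?b)\<^sup>2) / t"
        using t by (simp add: field_simps)
      also have "\<dots> = (1 / t) * ?D\<^sup>2 + t * (norm ?b)\<^sup>2"
        using t by (simp add: field_simps power2_eq_square)
      finally show ?thesis by (simp add: power2_eq_square algebra_simps)
    qed
    finally have *: "\<bar>(norm ?a)\<^sup>2 - (norm ?b)\<^sup>2\<bar> \<le> (1 + 1 / t) * ?D\<^sup>2 + t * (norm ?b)\<^sup>2" .
    have "\<bar>\<rho> x * (norm ?a)\<^sup>2 - \<rho> x * (norm ?b)\<^sup>2\<bar> = \<rho> x * \<bar>(norm ?a)\<^sup>2 - (norm ?b)\<^sup>2\<bar>"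
      using \<rho>01[of x] by (simp add: abs_mult flip: right_diff_distrib)
    also have "\<dots> \<le> \<bar>(norm ?a)\<^sup>2 - (norm ?b)\<^sup>2\<bar>"
      using \<rho>01[of x] by (intro mult_left_le_one_le) auto
    finally show "\<bar>\<rho> x * (norm ?a)\<^sup>2 - \<rho> x * (norm ?b)\<^sup>2\<bar> \<le> (1 + 1 / t) * ?D\<^sup>2 + t * (norm ?b)\<^sup>2"
      using * by linarith
  qed
  also have "\<dots> = (1 + 1 / t) * (\<integral>x. (norm (f n x - g x))\<^sup>2 \<partial>M) + t * (\<integral>x. (norm (g x))\<^sup>2 \<partial>M)"
    using di gi by (simp add: Bochner_Integration.integral_add)
  finally show "\<bar>(\<integral>x. \<rho> x * (norm (f n x))\<^sup>2 \<partial>M) - (\<integral>x. \<rho> x * (norm (g x))\<^sup>2 \<partial>M)\<bar>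
     \<le> (1 + 1 / t) * (\<integral>x. (norm (f n x - g x))\<^sup>2 \<partial>M) + t * (\<integral>x. (norm (g x))\<^sup>2 \<partial>M)" .
qed

text \<open>Convergence in the mean square and, at the same time, almost everywhere: norms and inner products
  pass to the limit by the former, signs and invariance under rotations by the latter.\<close>

definition L2_limit :: "(nat \<Rightarrow> 'a::euclidean_space \<Rightarrow> real) \<Rightarrow> ('a \<Rightarrow> real) \<Rightarrow> bool" where
  "L2_limit u w \<longleftrightarrow> w \<in> borel_measurable borel \<and> integrable lborel (\<lambda>x. (w x)\<^sup>2) \<and>
     (\<lambda>n. \<integral>x. (u n x - w x)\<^sup>2 \<partial>lborel) \<longlonglongrightarrow> 0 \<and> (AE x in lborel. (\<lambda>n. u n x) \<longlonglongrightarrow> w x)"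

lemma cc_sq_integrable: "u \<in> cc \<Longrightarrow> integrable lborel (\<lambda>x. (u x)\<^sup>2)"
  using cc_integrable[OF cc_mult, of u u] by (simp add: power2_eq_square)

lemma L2_limit_norm:
  assumes "\<And>n. u n \<in> cc" "L2_limit u w"
  shows "(\<lambda>n. ip (u n) (u n)) \<longlonglongrightarrow> (\<integral>x. (w x)\<^sup>2 \<partial>lborel)"
  using weighted_norm_sq_tendsto[of u lborel w "\<lambda>_. 1"] assms
  by (simp add: L2_limit_def cc_borel cc_sq_integrable ip_def flip: power2_eq_square)

lemma L2_limit_lincomb:
  assumes uv: "\<And>n. u n \<in> cc" "\<And>n. v n \<in> cc" and "L2_limit u w" "L2_limit v z"
  shows "L2_limit (\<lambda>n x. u n x + c * v n x) (\<lambda>x. w x + c * z x)"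
proof -
  note w = assms(3)[unfolded L2_limit_def] and z = assms(4)[unfolded L2_limit_def]
  have [measurable]: "w \<in> borel_measurable borel" "z \<in> borel_measurable borel" using w z by auto
  have [measurable]: "u n \<in> borel_measurable borel" "v n \<in> borel_measurable borel" for n
    using uv by (auto intro: cc_borel)
  have sq: "(a + b)\<^sup>2 \<le> 2 * a\<^sup>2 + 2 * b\<^sup>2" for a b :: real
    using norm_sq_add_le[of a b] by simp
  have i: "integrable lborel (\<lambda>x. (w x + c * z x)\<^sup>2)"
    using integrable_norm_diff_sq[of w lborel "\<lambda>x. - c * z x"] w z by (simp add: power_mult_distrib)
  have d: "integrable lborel (\<lambda>x. (u n x - w x)\<^sup>2)" "integrable lborel (\<lambda>x. (v n x - z x)\<^sup>2)" for n
    using integrable_norm_diff_sq[of "u n" lborel w] integrable_norm_diff_sq[of "v n" lborel z] w z uv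
    by (auto simp: cc_sq_integrable)
  have "(\<lambda>n. \<integral>x. (u n x + c * v n x - (w x + c * z x))\<^sup>2 \<partial>lborel) \<longlonglongrightarrow> 0"
  proof (rule tendsto_sandwich[OF _ _ tendsto_const])
    show "\<forall>\<^sub>F n in sequentially. (\<integral>x. (u n x + c * v n x - (w x + c * z x))\<^sup>2 \<partial>lborel)
       \<le> 2 * (\<integral>x. (u n x - w x)\<^sup>2 \<partial>lborel) + 2 * c\<^sup>2 * (\<integral>x. (v n x - z x)\<^sup>2 \<partial>lborel)"
    proof (intro always_eventually allI)
      fix n
      have le: "(u n x + c * v n x - (w x + c * z x))\<^sup>2 \<le> 2 * (u n x - w x)\<^sup>2 + 2 * c\<^sup>2 * (v n x - z x)\<^sup>2" for x
      proof -
        have eq: "u n x + c * v n x - (w x + c * z x) = (u n x - w x) + c * (v n x - z x)" by (simp add: algebra_simps)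
        show ?thesis unfolding eq using sq[of "u n x - w x" "c * (v n x - z x)"] by (simp add: power_mult_distrib)
      qed
      have "(\<integral>x. (u n x + c * v n x - (w x + c * z x))\<^sup>2 \<partial>lborel)
        \<le> (\<integral>x. 2 * (u n x - w x)\<^sup>2 + 2 * c\<^sup>2 * (v n x - z x)\<^sup>2 \<partial>lborel)"
      proof (rule integral_mono)
        show i2: "integrable lborel (\<lambda>x. 2 * (u n x - w x)\<^sup>2 + 2 * c\<^sup>2 * (v n x - z x)\<^sup>2)" using d[of n] by simp
        show "integrable lborel (\<lambda>x. (u n x + c * v n x - (w x + c * z x))\<^sup>2)"
          by (rule Bochner_Integration.integrable_bound[OF i2]) (use le in \<open>auto intro!: order_trans[OF le]\<close>)
      qed (rule le)
      also have "\<dots> = 2 * (\<integral>x. (u n x - w x)\<^sup>2 \<partial>lborel) + 2 * c\<^sup>2 * (\<integral>x. (v n x - z x)\<^sup>2 \<partial>lborel)"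
        using d[of n] by (simp add: Bochner_Integration.integral_add)
      finally show "(\<integral>x. (u n x + c * v n x - (w x + c * z x))\<^sup>2 \<partial>lborel)
       \<le> 2 * (\<integral>x. (u n x - w x)\<^sup>2 \<partial>lborel) + 2 * c\<^sup>2 * (\<integral>x. (v n x - z x)\<^sup>2 \<partial>lborel)" .
    qed
    have "(\<lambda>n. 2 * (\<integral>x. (u n x - w x)\<^sup>2 \<partial>lborel) + 2 * c\<^sup>2 * (\<integral>x. (v n x - z x)\<^sup>2 \<partial>lborel)) \<longlonglongrightarrow> 2 * 0 + 2 * c\<^sup>2 * 0"
      using w z by (intro tendsto_intros) auto
    then show "(\<lambda>n. 2 * (\<integral>x. (u n x - w x)\<^sup>2 \<partial>lborel) + 2 * c\<^sup>2 * (\<integral>x. (v n x - z x)\<^sup>2 \<partial>lborel)) \<longlonglongrightarrow> 0" by simp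
  qed simp
  moreover have "AE x in lborel. (\<lambda>n. u n x + c * v n x) \<longlonglongrightarrow> w x + c * z x"
  proof -
    have "AE x in lborel. (\<lambda>n. u n x) \<longlonglongrightarrow> w x" "AE x in lborel. (\<lambda>n. v n x) \<longlonglongrightarrow> z x" using w z by auto
    then show ?thesis by eventually_elim (intro tendsto_intros)
  qed
  ultimately show ?thesis using i by (simp add: L2_limit_def)
qed

lemma L2_limit_subseq: "L2_limit u w \<Longrightarrow> strict_mono r \<Longrightarrow> L2_limit (\<lambda>n. u (r n)) w"
proof -
  assume w: "L2_limit u w" and r: "strict_mono r"
  have sub: "X \<longlonglongrightarrow> l \<Longrightarrow> (\<lambda>n. X (r n)) \<longlonglongrightarrow> l" for X :: "nat \<Rightarrow> real" and l
    using LIMSEQ_subseq_LIMSEQ[OF _ r, of X l] by (simp add: o_def)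
  have "AE x in lborel. (\<lambda>n. u n x) \<longlonglongrightarrow> w x" using w by (simp add: L2_limit_def)
  then have "AE x in lborel. (\<lambda>n. u (r n) x) \<longlonglongrightarrow> w x" by (rule AE_mp) (intro AE_I2 impI sub)
  then show ?thesis using w sub[of "\<lambda>n. \<integral>x. (u n x - w x)\<^sup>2 \<partial>lborel" 0] by (simp add: L2_limit_def)
qed

text \<open>Polarization reduces this to convergence of the norms.\<close>

lemma L2_limit_inner:
  assumes uv: "\<And>n. u n \<in> cc" "\<And>n. v n \<in> cc" and wz: "L2_limit u w" "L2_limit v z"
  shows "(\<lambda>n. ip (u n) (v n)) \<longlonglongrightarrow> (\<integral>x. w x * z x \<partial>lborel)" and "integrable lborel (\<lambda>x. w x * z x)"
proof -
  have c: "(\<lambda>x. u n x + c * v n x) \<in> cc" for n c using uv by (intro cc_intros)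
  note l = L2_limit_norm[OF c L2_limit_lincomb[OF uv wz]]
  have e: "ip (\<lambda>x. u n x + c * v n x) (\<lambda>x. u n x + c * v n x) = ip (u n) (u n) + 2 * c * ip (u n) (v n) + c\<^sup>2 * ip (v n) (v n)" for n c
    using uv by (simp add: ip_simps cc_intros ip_commute[of "v n" "u n"] power2_eq_square algebra_simps)
  have i: "integrable lborel (\<lambda>x. (w x + c * z x)\<^sup>2)" for c
    using L2_limit_lincomb[OF uv wz, of c] by (simp add: L2_limit_def)
  have "integrable lborel (\<lambda>x. ((w x + 1 * z x)\<^sup>2 - (w x + (-1) * z x)\<^sup>2) / 4)"
    by (intro Bochner_Integration.integrable_divide Bochner_Integration.integrable_diff i)
  also have eq: "(\<lambda>x. ((w x + 1 * z x)\<^sup>2 - (w x + (-1) * z x)\<^sup>2) / 4) = (\<lambda>x. w x * z x)"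
    by (auto simp: power2_eq_square algebra_simps)
  finally show "integrable lborel (\<lambda>x. w x * z x)" .
  have "(\<lambda>n. (ip (\<lambda>x. u n x + 1 * v n x) (\<lambda>x. u n x + 1 * v n x) - ip (\<lambda>x. u n x + (-1) * v n x) (\<lambda>x. u n x + (-1) * v n x)) / 4)
     \<longlonglongrightarrow> ((\<integral>x. (w x + 1 * z x)\<^sup>2 \<partial>lborel) - (\<integral>x. (w x + (-1) * z x)\<^sup>2 \<partial>lborel)) / 4"
    by (intro tendsto_intros l) simp
  also have "(\<lambda>n. (ip (\<lambda>x. u n x + 1 * v n x) (\<lambda>x. u n x + 1 * v n x) - ip (\<lambda>x. u n x + (-1) * v n x) (\<lambda>x. u n x + (-1) * v n x)) / 4)
      = (\<lambda>n. ip (u n) (v n))" unfolding e by simp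
  also have "((\<integral>x. (w x + 1 * z x)\<^sup>2 \<partial>lborel) - (\<integral>x. (w x + (-1) * z x)\<^sup>2 \<partial>lborel)) / 4 = (\<integral>x. w x * z x \<partial>lborel)"
    by (subst Bochner_Integration.integral_diff[OF i i, symmetric], subst eq[symmetric]) simp
  finally show "(\<lambda>n. ip (u n) (v n)) \<longlonglongrightarrow> (\<integral>x. w x * z x \<partial>lborel)" .
qed

text \<open>On a bounded set a mean-square Cauchy sequence is Cauchy in the mean, so a subsequence converges
  almost everywhere, and Fatou's lemma identifies its limit as the mean-square limit.\<close>

lemma L2_complete:
  fixes u :: "nat \<Rightarrow> 'a::euclidean_space \<Rightarrow> real"
  assumes \<omega>: "bounded \<omega>" "open \<omega>" and u: "\<And>n. u n \<in> cc" and out: "\<And>n x. x \<notin> \<omega> \<Longrightarrow> u n x = 0"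
    and cauchy: "\<And>e. e > 0 \<Longrightarrow> \<exists>N. \<forall>m\<ge>N. \<forall>n\<ge>N. (\<integral>x. (u m x - u n x)\<^sup>2 \<partial>lborel) < e"
  obtains r w where "strict_mono r" "\<And>x. x \<notin> \<omega> \<Longrightarrow> w x = 0" "L2_limit (\<lambda>n. u (r n)) w"
proof -
  have [measurable]: "u n \<in> borel_measurable borel" for n using u by (auto intro: cc_borel)
  have fin: "emeasure lborel \<omega> < \<infinity>" by (rule emeasure_bounded_finite[OF \<omega>(1)])
  have \<omega>b[measurable]: "\<omega> \<in> sets borel" using \<omega> by auto
  have ii: "integrable lborel (indicator \<omega> :: 'a \<Rightarrow> real)" using fin by (simp add: integrable_indicator_iff)
  have sqi: "integrable lborel (\<lambda>x. (u m x - u n x)\<^sup>2)" for m n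
    by (intro cc_sq_integrable cc_diff u)
  have "\<exists>N. \<forall>i\<ge>N. \<forall>j\<ge>N. (LINT x|lborel. norm (u i x - u j x)) < e" if e: "e > 0" for e
  proof -
    define t where "t = e / (measure lborel \<omega> + 1)"
    have t: "t > 0" using e by (simp add: t_def add_nonneg_pos)
    have "t * measure lborel \<omega> \<le> t * (measure lborel \<omega> + 1)" using t by (intro mult_left_mono) auto
    also have "\<dots> = e"
      using measure_nonneg[of lborel \<omega>] by (simp add: t_def field_simps add_nonneg_eq_0_iff)
    finally have tm: "t * measure lborel \<omega> \<le> e" .
    obtain N where N: "\<And>m n. m \<ge> N \<Longrightarrow> n \<ge> N \<Longrightarrow> (\<integral>x. (u m x - u n x)\<^sup>2 \<partial>lborel) < t * e"
      using cauchy[of "t * e"] t e by auto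
    show ?thesis
    proof (intro exI allI impI)
      fix i j assume ij: "N \<le> i" "N \<le> j"
      have "(LINT x|lborel. norm (u i x - u j x)) \<le> (LINT x|lborel. ((u i x - u j x)\<^sup>2 / t + t * indicator \<omega> x) / 2)"
      proof (rule integral_mono)
        show "integrable lborel (\<lambda>x. norm (u i x - u j x))"
          by (intro integrable_norm Bochner_Integration.integrable_diff cc_integrable u)
        show "integrable lborel (\<lambda>x. ((u i x - u j x)\<^sup>2 / t + t * indicator \<omega> x) / 2)"
          using sqi ii by simp
        fix x
        let ?v = "\<bar>u i x - u j x\<bar>"
        have "2 * t * ?v \<le> ?v\<^sup>2 + t\<^sup>2"
          using zero_le_power2[of "?v - t"] by (simp add: power2_diff algebra_simps)
        then have "?v \<le> ((u i x - u j x)\<^sup>2 / t + t) / 2"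
          using t by (simp add: field_simps power2_eq_square)
        then show "norm (u i x - u j x) \<le> ((u i x - u j x)\<^sup>2 / t + t * indicator \<omega> x) / 2"
          using out[of x i] out[of x j] by (cases "x \<in> \<omega>") auto
      qed
      also have "\<dots> = ((LINT x|lborel. (u i x - u j x)\<^sup>2) / t + t * measure lborel \<omega>) / 2"
        using sqi ii by (simp add: Bochner_Integration.integral_add)
      also have "\<dots> < e"
      proof -
        have "(LINT x|lborel. (u i x - u j x)\<^sup>2) / t < e"
          using N[OF ij] t by (simp add: divide_less_eq mult.commute)
        moreover have "(a + b) / 2 < e" if "a < e" "b \<le> e" for a b :: real using that by simp
        ultimately show ?thesis using tm by blast
      qed
      finally show "(LINT x|lborel. norm (u i x - u j x)) < e" .
    qed
  qed
  from cauchy_L1_AE_cauchy_subseq[OF cc_integrable[OF u] this]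
  obtain r where r: "strict_mono r" "AE x in lborel. Cauchy (\<lambda>i. u (r i) x)" by blast
  define w where "w x = lim (\<lambda>i. u (r i) x)" for x
  have wm[measurable]: "w \<in> borel_measurable borel"
    unfolding w_def[abs_def] by (rule borel_measurable_lim_metric) simp
  have out_w: "w x = 0" if "x \<notin> \<omega>" for x using out[OF that] by (simp add: w_def)
  have ae: "AE x in lborel. (\<lambda>n. u (r n) x) \<longlonglongrightarrow> w x"
    using r(2) by (rule AE_mp) (auto intro!: AE_I2 simp: w_def convergent_LIMSEQ_iff Cauchy_convergent_iff)
  have fatou: "(\<integral>\<^sup>+x. ennreal ((u k x - w x)\<^sup>2) \<partial>lborel) \<le> ennreal e"
    if N: "\<And>m. m \<ge> N \<Longrightarrow> (\<integral>x. (u k x - u m x)\<^sup>2 \<partial>lborel) \<le> e" and e: "e \<ge> 0" for k N e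
  proof -
    have "(\<integral>\<^sup>+x. ennreal ((u k x - w x)\<^sup>2) \<partial>lborel)
       = (\<integral>\<^sup>+x. liminf (\<lambda>m. ennreal ((u k x - u (r m) x)\<^sup>2)) \<partial>lborel)"
    proof (rule nn_integral_cong_AE, rule AE_mp[OF ae], intro AE_I2 impI)
      fix x assume "(\<lambda>n. u (r n) x) \<longlonglongrightarrow> w x"
      then have "(\<lambda>m. ennreal ((u k x - u (r m) x)\<^sup>2)) \<longlonglongrightarrow> ennreal ((u k x - w x)\<^sup>2)"
        by (intro tendsto_ennrealI tendsto_intros)
      then show "ennreal ((u k x - w x)\<^sup>2) = liminf (\<lambda>m. ennreal ((u k x - u (r m) x)\<^sup>2))"
        by (rule lim_imp_Liminf[OF trivial_limit_sequentially, symmetric])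
    qed
    also have "\<dots> \<le> liminf (\<lambda>m. \<integral>\<^sup>+x. ennreal ((u k x - u (r m) x)\<^sup>2) \<partial>lborel)"
      by (intro nn_integral_liminf) measurable
    also have "\<dots> \<le> ennreal e"
    proof (rule order_trans[OF Liminf_le_Limsup[OF trivial_limit_sequentially] Limsup_bounded],
        rule eventually_sequentiallyI[of N])
      fix m assume "m \<ge> N"
      then have "r m \<ge> N" using seq_suble[OF r(1), of m] by linarith
      then show "(\<integral>\<^sup>+x. ennreal ((u k x - u (r m) x)\<^sup>2) \<partial>lborel) \<le> ennreal e"
        using N[of "r m"] sqi[of k "r m"] by (subst nn_integral_eq_integral) (auto intro: ennreal_leI)
    qed
    finally show ?thesis .
  qed
  have fatou2: "integrable lborel (\<lambda>x. (u k x - w x)\<^sup>2) \<and> (\<integral>x. (u k x - w x)\<^sup>2 \<partial>lborel) \<le> e"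
    if "\<And>m. m \<ge> N \<Longrightarrow> (\<integral>x. (u k x - u m x)\<^sup>2 \<partial>lborel) \<le> e" "e \<ge> 0" for k N e
  proof -
    have f: "(\<integral>\<^sup>+x. ennreal ((u k x - w x)\<^sup>2) \<partial>lborel) \<le> ennreal e"
      by (rule fatou[of N]) (use that in auto)
    have i: "integrable lborel (\<lambda>x. (u k x - w x)\<^sup>2)"
      using f by (intro integrableI_bounded) (auto simp: le_less_trans[OF _ ennreal_less_top])
    show ?thesis using i f that(2) by (simp add: nn_integral_eq_integral)
  qed
  obtain N1 where "\<forall>m\<ge>N1. \<forall>n\<ge>N1. (\<integral>x. (u m x - u n x)\<^sup>2 \<partial>lborel) < 1" using cauchy[of 1] by auto
  then have i1: "integrable lborel (\<lambda>x. (u N1 x - w x)\<^sup>2)"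
    using fatou2[of N1 N1 1] by (simp add: less_imp_le)
  have wi: "integrable lborel (\<lambda>x. (w x)\<^sup>2)"
    using integrable_norm_diff_sq[of "u N1" lborel "\<lambda>x. u N1 x - w x"] i1 u[of N1] by (simp add: cc_sq_integrable)
  have "(\<lambda>n. \<integral>x. (u n x - w x)\<^sup>2 \<partial>lborel) \<longlonglongrightarrow> 0"
  proof (rule LIMSEQ_I)
    fix e :: real assume e: "e > 0"
    obtain N where N: "\<forall>m\<ge>N. \<forall>n\<ge>N. (\<integral>x. (u m x - u n x)\<^sup>2 \<partial>lborel) < e/2" using cauchy[of "e/2"] e by auto
    have "(\<integral>x. (u n x - w x)\<^sup>2 \<partial>lborel) \<le> e/2" if "n \<ge> N" for n
      using fatou2[of N n "e/2"] N that e by (simp add: less_imp_le)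
    then show "\<exists>N. \<forall>n\<ge>N. norm ((\<integral>x. (u n x - w x)\<^sup>2 \<partial>lborel) - 0) < e"
      using e by (intro exI[of _ N]) fastforce
  qed
  then have "(\<lambda>n. \<integral>x. (u (r n) x - w x)\<^sup>2 \<partial>lborel) \<longlonglongrightarrow> 0"
    using LIMSEQ_subseq_LIMSEQ[OF _ r(1)] by (fastforce simp: o_def)
  then show ?thesis using r(1) out_w wi ae by (intro that[of r w]) (auto simp: L2_limit_def)
qed

section \<open>Compactness\<close>

text \<open>The double integral of \<open>(v x - v y)\<^sup>2\<close> over \<open>Q \<times> Q\<close> is twice \<open>|Q| \<integral> v\<^sup>2 - (\<integral> v)\<^sup>2\<close>, which turns
  \<open>poincare_convex\<close> into a bound by the mean value and the gradient. When \<open>Q\<close> is a null set the quotient is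
  \<open>0\<close> by convention, and so are all integrals.\<close>

lemma mean_oscillation:
  fixes v :: "real ^ 'n \<Rightarrow> real"
  assumes Q: "convex Q" "Q \<in> sets borel" "\<And>x y. x \<in> Q \<Longrightarrow> y \<in> Q \<Longrightarrow> norm (x - y) \<le> d" "emeasure lborel Q < \<infinity>"
    and v: "v \<in> rtest U"
  shows "(\<integral>x. indicator Q x * (v x)\<^sup>2 \<partial>lborel) \<le> (\<integral>x. indicator Q x * v x \<partial>lborel)\<^sup>2 / measure lborel Q
     + d\<^sup>2 * 2 ^ CARD('n) * (\<integral>x. indicator Q x * (norm (gr v x))\<^sup>2 \<partial>lborel)"
proof -
  note [measurable] = Q(2)
  let ?m = "measure lborel Q" and ?I = "\<integral>x. indicator Q x * v x \<partial>lborel"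
  let ?J = "\<integral>x. indicator Q x * (v x)\<^sup>2 \<partial>lborel" and ?E = "\<integral>x. indicator Q x * (norm (gr v x))\<^sup>2 \<partial>lborel"
  have ind: "integrable lborel (\<lambda>x. indicator Q x * h x)" if "integrable lborel h" for h :: "_ \<Rightarrow> real"
    using integrable_mult_indicator[of Q lborel h] Q(2) that by simp
  have vi: "integrable lborel (\<lambda>x. indicator Q x * v x)" "integrable lborel (\<lambda>x. indicator Q x * (v x)\<^sup>2)"
    "integrable lborel (\<lambda>x. indicator Q x * (norm (gr v x))\<^sup>2)"
    using ind[OF cc_integrable[OF rtest_cc[OF v]]] ind[OF cc_sq_integrable[OF rtest_cc[OF v]]]
      ind[OF cc_integrable[OF rtest_norm_gr_cc[OF v]]] by auto
  have Qi: "integrable lborel (indicator Q :: _ \<Rightarrow> real)" using Q(4) by (simp add: integrable_indicator_iff)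
  have inner: "(\<integral>\<^sup>+y. indicator Q x * indicator Q y * ennreal ((v x - v y)\<^sup>2) \<partial>lborel)
      = ennreal (indicator Q x * (v x)\<^sup>2 * ?m - 2 * (indicator Q x * v x) * ?I + indicator Q x * ?J)" for x
  proof -
    have "(\<integral>\<^sup>+y. indicator Q x * indicator Q y * ennreal ((v x - v y)\<^sup>2) \<partial>lborel)
       = (\<integral>\<^sup>+y. ennreal (indicator Q x * (v x)\<^sup>2 * indicator Q y - 2 * (indicator Q x * v x) * (indicator Q y * v y)
           + indicator Q x * (indicator Q y * (v y)\<^sup>2)) \<partial>lborel)"
      by (intro nn_integral_cong) (auto simp: power2_eq_square algebra_simps split: split_indicator)
    also have "\<dots> = ennreal (\<integral>y. indicator Q x * (v x)\<^sup>2 * indicator Q y - 2 * (indicator Q x * v x) * (indicator Q y * v y)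
           + indicator Q x * (indicator Q y * (v y)\<^sup>2) \<partial>lborel)"
    proof (rule nn_integral_eq_integral)
      show "integrable lborel (\<lambda>y. indicator Q x * (v x)\<^sup>2 * indicator Q y - 2 * (indicator Q x * v x) * (indicator Q y * v y)
           + indicator Q x * (indicator Q y * (v y)\<^sup>2))"
        using vi Qi by (intro Bochner_Integration.integrable_add Bochner_Integration.integrable_diff integrable_mult_right) auto
      have e: "indicator Q x * (v x)\<^sup>2 * indicator Q y - 2 * (indicator Q x * v x) * (indicator Q y * v y)
           + indicator Q x * (indicator Q y * (v y)\<^sup>2) = indicator Q x * indicator Q y * (v x - v y)\<^sup>2" for y
        by (auto simp: power2_eq_square algebra_simps split: split_indicator)
      show "AE y in lborel. 0 \<le> indicator Q x * (v x)\<^sup>2 * indicator Q y - 2 * (indicator Q x * v x) * (indicator Q y * v y)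
           + indicator Q x * (indicator Q y * (v y)\<^sup>2)"
        unfolding e by auto
    qed
    also have "(\<integral>y. indicator Q x * (v x)\<^sup>2 * indicator Q y - 2 * (indicator Q x * v x) * (indicator Q y * v y)
           + indicator Q x * (indicator Q y * (v y)\<^sup>2) \<partial>lborel)
       = indicator Q x * (v x)\<^sup>2 * ?m - 2 * (indicator Q x * v x) * ?I + indicator Q x * ?J"
      using vi Qi
      by (subst Bochner_Integration.integral_add Bochner_Integration.integral_diff,
          (intro Bochner_Integration.integrable_diff integrable_mult_right; simp)+)+ simp
    finally show ?thesis .
  qed
  have nn: "0 \<le> indicator Q x * (v x)\<^sup>2 * ?m - 2 * (indicator Q x * v x) * ?I + indicator Q x * ?J" for x
  proof -
    have "0 \<le> (\<integral>y. indicator Q y * (v x - v y)\<^sup>2 \<partial>lborel)" by (intro integral_nonneg_AE) auto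
    also have "(\<lambda>y. indicator Q y * (v x - v y)\<^sup>2) = (\<lambda>y. (v x)\<^sup>2 * indicator Q y - 2 * v x * (indicator Q y * v y) + indicator Q y * (v y)\<^sup>2)"
      by (auto simp: power2_eq_square algebra_simps split: split_indicator)
    also have "integral\<^sup>L lborel \<dots> = (v x)\<^sup>2 * ?m - 2 * v x * ?I + ?J"
      using vi Qi by (simp add: Bochner_Integration.integral_add Bochner_Integration.integral_diff)
    finally show ?thesis by (auto split: split_indicator)
  qed
  have lhs1: "(\<integral>\<^sup>+x. \<integral>\<^sup>+y. indicator Q x * indicator Q y * ennreal ((v x - v y)\<^sup>2) \<partial>lborel \<partial>lborel)
     = ennreal (\<integral>x. indicator Q x * (v x)\<^sup>2 * ?m - 2 * (indicator Q x * v x) * ?I + indicator Q x * ?J \<partial>lborel)"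
    unfolding inner using vi Qi nn
    by (intro nn_integral_eq_integral) auto
  have lhs2: "(\<integral>x. indicator Q x * (v x)\<^sup>2 * ?m - 2 * (indicator Q x * v x) * ?I + indicator Q x * ?J \<partial>lborel)
      = 2 * (?m * ?J - ?I\<^sup>2)"
  proof -
    have eq: "(\<lambda>x. indicator Q x * (v x)\<^sup>2 * ?m - 2 * (indicator Q x * v x) * ?I + indicator Q x * ?J)
      = (\<lambda>x. ?m * (indicator Q x * (v x)\<^sup>2) - (2 * ?I) * (indicator Q x * v x) + ?J * indicator Q x)"
      by (auto simp: algebra_simps)
    have "integral\<^sup>L lborel (\<lambda>x. ?m * (indicator Q x * (v x)\<^sup>2) - (2 * ?I) * (indicator Q x * v x) + ?J * indicator Q x)
        = ?m * ?J - (2 * ?I) * ?I + ?J * ?m"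
      using vi Qi by (simp add: Bochner_Integration.integral_add Bochner_Integration.integral_diff)
    then show ?thesis unfolding eq by (simp add: power2_eq_square)
  qed
  have lhs: "(\<integral>\<^sup>+x. \<integral>\<^sup>+y. indicator Q x * indicator Q y * ennreal ((v x - v y)\<^sup>2) \<partial>lborel \<partial>lborel)
     = ennreal (2 * (?m * ?J - ?I\<^sup>2))"
    by (simp only: lhs1 lhs2)
  have rhs: "(\<integral>\<^sup>+x. indicator Q x * ennreal ((norm (gr v x))\<^sup>2) \<partial>lborel) = ennreal ?E"
    using vi(3) by (subst nn_integral_eq_integral[symmetric]) (auto intro!: nn_integral_cong split: split_indicator)
  have em: "emeasure lborel Q = ennreal ?m" using Q(4) by (simp add: emeasure_eq_ennreal_measure less_top)
  have E0: "0 \<le> ?E" by simp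
  have "ennreal (2 * (?m * ?J - ?I\<^sup>2)) \<le> ennreal (d\<^sup>2) * 2 ^ DIM(real ^ 'n) * ennreal ?m * ennreal ?E"
    using poincare_convex[OF Q(1-3) smooth_gr[OF rtest_smooth[OF v]] continuous_gr[OF rtest_smooth[OF v]]]
    unfolding lhs rhs em .
  also have "\<dots> = ennreal (d\<^sup>2 * 2 ^ CARD('n) * ?m * ?E)"
    using E0 by (simp add: ennreal_mult' ennreal_power flip: ennreal_numeral)
  finally have "2 * (?m * ?J - ?I\<^sup>2) \<le> d\<^sup>2 * 2 ^ CARD('n) * ?m * ?E"
    using E0 by (subst (asm) ennreal_le_iff) auto
  then have *: "?m * ?J \<le> ?I\<^sup>2 + d\<^sup>2 * 2 ^ CARD('n) * ?m * ?E"
    using E0 by (smt (verit) mult_nonneg_nonneg zero_le_power2 zero_le_power measure_nonneg)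
  show ?thesis
  proof (cases "?m = 0")
    case True
    then have "AE x in lborel. x \<notin> Q"
      using Q em by (intro AE_not_in) (auto simp: null_sets_def)
    then have "AE x in lborel. indicator Q x * (v x)\<^sup>2 = 0" by (auto simp: indicator_def)
    then have "?J = 0" by (simp cong: integral_cong_AE add: integral_eq_zero_AE)
    then show ?thesis using E0 True by simp
  next
    case False
    then have "?m > 0" using measure_nonneg[of lborel Q] by linarith
    then have "?J \<le> (?I\<^sup>2 + d\<^sup>2 * 2 ^ CARD('n) * ?m * ?E) / ?m"
      using * by (subst pos_le_divide_eq) (auto simp: mult.commute)
    also have "\<dots> = ?I\<^sup>2 / ?m + d\<^sup>2 * 2 ^ CARD('n) * ?E" using \<open>?m > 0\<close> by (simp add: field_simps)
    finally show ?thesis .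
  qed
qed

definition cell :: "nat \<Rightarrow> int \<times> int \<Rightarrow> (real ^ 2) set" where
  "cell N k = {x. \<lfloor>real N * x $ 1\<rfloor> = fst k \<and> \<lfloor>real N * x $ 2\<rfloor> = snd k}"

lemma cell_alt: "cell N k = {x. of_int (fst k) \<le> real N * x $ 1 \<and> real N * x $ 1 < of_int (fst k) + 1 \<and>
   of_int (snd k) \<le> real N * x $ 2 \<and> real N * x $ 2 < of_int (snd k) + 1}"
  by (auto simp: cell_def floor_eq_iff)

lemma cell_properties:
  assumes N: "N > 0"
  shows "convex (cell N k)" "cell N k \<in> sets borel"
    and cell_diam: "x \<in> cell N k \<Longrightarrow> y \<in> cell N k \<Longrightarrow> norm (x - y) \<le> 2 / real N"
    and "emeasure lborel (cell N k) < \<infinity>"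
proof -
  have nn: "0 \<le> real N" by simp
  show "convex (cell N k)"
  proof (rule convexI)
    fix x y :: "real ^ 2" and u v :: real
    assume x: "x \<in> cell N k" and y: "y \<in> cell N k" and uv: "0 \<le> u" "0 \<le> v" "u + v = 1"
    have *: "m \<le> u * a + v * b \<and> u * a + v * b < m + 1" if "m \<le> a" "a < m + 1" "m \<le> b" "b < m + 1" for m a b :: real
      using convex_bound_le[of "-a" "-m" "-b" u v] convex_bound_lt[of a "m + 1" b u v] that uv by auto
    show "u *\<^sub>R x + v *\<^sub>R y \<in> cell N k"
      using *[of "of_int (fst k)" "real N * x $ 1" "real N * y $ 1"] *[of "of_int (snd k)" "real N * x $ 2" "real N * y $ 2"] x y
      by (auto simp: cell_alt algebra_simps)
  qed
  show b: "cell N k \<in> sets borel" unfolding cell_alt by measurable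
  show diam: "norm (x - y) \<le> 2 / real N" if "x \<in> cell N k" "y \<in> cell N k" for x y
  proof -
    have "\<bar>real N * x $ 1 - real N * y $ 1\<bar> \<le> 1" "\<bar>real N * x $ 2 - real N * y $ 2\<bar> \<le> 1"
      using that by (auto simp: cell_alt)
    then have "\<bar>x $ 1 - y $ 1\<bar> \<le> 1 / real N" "\<bar>x $ 2 - y $ 2\<bar> \<le> 1 / real N"
      using N by (auto simp: field_simps abs_le_iff)
    moreover have "norm (x - y) \<le> \<bar>x $ 1 - y $ 1\<bar> + \<bar>x $ 2 - y $ 2\<bar>"
      using norm_le_l1_cart[of "x - y"] by (simp add: sum_2)
    ultimately show ?thesis by linarith
  qed
  have "bounded (cell N k)"
  proof (cases "cell N k = {}")
    case False
    then obtain x where "x \<in> cell N k" by blast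
    then show ?thesis using diam[of _ x]
      by (intro boundedI[of _ "norm x + 2 / real N"]) (smt (verit) norm_triangle_sub)
  qed auto
  then show "emeasure lborel (cell N k) < \<infinity>" using b emeasure_bounded_finite by blast
qed

text \<open>The indices of the cells of a grid of mesh \<open>1 / N\<close> that meet the ball of radius \<open>R\<close>, with a margin for
  the rounding.\<close>

definition cells :: "nat \<Rightarrow> real \<Rightarrow> (int \<times> int) set" where
  "cells N R = {- \<lceil>real N * R + 1\<rceil> .. \<lceil>real N * R + 1\<rceil>} \<times> {- \<lceil>real N * R + 1\<rceil> .. \<lceil>real N * R + 1\<rceil>}"

lemma sum_cells:
  assumes "norm x \<le> R" shows "(\<Sum>k\<in>cells N R. indicator (cell N k) x) = (1 :: real)"
proof -
  have b: "- \<lceil>real N * R + 1\<rceil> \<le> \<lfloor>real N * x $ i\<rfloor> \<and> \<lfloor>real N * x $ i\<rfloor> \<le> \<lceil>real N * R + 1\<rceil>" for i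
  proof -
    have "\<bar>x $ i\<bar> \<le> R" using assms component_le_norm_cart[of x i] by linarith
    then have "real N * \<bar>x $ i\<bar> \<le> real N * R" by (intro mult_left_mono) auto
    then have "- (real N * R) \<le> real N * x $ i" "real N * x $ i \<le> real N * R"
      using abs_mult[of "real N" "x $ i"] by (auto simp: abs_le_iff)
    then show ?thesis by linarith
  qed
  let ?k = "(\<lfloor>real N * x $ 1\<rfloor>, \<lfloor>real N * x $ 2\<rfloor>)"
  have "(\<Sum>k\<in>cells N R. indicator (cell N k) x) = (\<Sum>k\<in>cells N R. if k = ?k then 1 else 0 :: real)"
    by (intro sum.cong) (auto simp: cell_def indicator_def prod_eq_iff)
  also have "\<dots> = 1" using b by (subst sum.delta) (auto simp: cells_def)
  finally show ?thesis .
qed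

text \<open>Up to an error of order \<open>1 / N\<^sup>2\<close> in the Dirichlet energy, the norm is controlled by finitely many linear
  functionals, the integrals over the cells of a grid. The factor \<open>16\<close> is the squared diameter bound
  \<open>(2 / N)\<^sup>2\<close> of a cell times the constant \<open>2\<^sup>2\<close> of the planar Poincare inequality.\<close>

lemma cell_inequality:
  assumes N: "N > 0" and R: "\<And>x. x \<in> \<omega> \<Longrightarrow> norm x \<le> R" and v: "v \<in> rtest \<omega>"
  shows "ip v v \<le> (\<Sum>k\<in>cells N R. (\<integral>x. indicator (cell N k) x * v x \<partial>lborel)\<^sup>2 / measure lborel (cell N k))
     + 16 / (real N)\<^sup>2 * dirichlet v"
proof -
  have split: "(\<integral>x. h x \<partial>lborel) = (\<Sum>k\<in>cells N R. \<integral>x. indicator (cell N k) x * h x \<partial>lborel)"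
    if h: "h \<in> cc" "\<And>x. x \<notin> \<omega> \<Longrightarrow> h x = 0" for h
  proof -
    have "h x = (\<Sum>k\<in>cells N R. indicator (cell N k) x * h x)" for x
      using sum_cells[OF R, of x N] h(2)[of x] by (cases "x \<in> \<omega>") (auto simp flip: sum_distrib_right)
    then have "(\<integral>x. h x \<partial>lborel) = (\<integral>x. (\<Sum>k\<in>cells N R. indicator (cell N k) x * h x) \<partial>lborel)" by metis
    also have "\<dots> = (\<Sum>k\<in>cells N R. \<integral>x. indicator (cell N k) x * h x \<partial>lborel)"
      using integrable_mult_indicator[OF _ cc_integrable[OF h(1)]] cell_properties(2)[OF N]
      by (intro Bochner_Integration.integral_sum) simp
    finally show ?thesis .
  qed
  have "ip v v = (\<Sum>k\<in>cells N R. \<integral>x. indicator (cell N k) x * (v x)\<^sup>2 \<partial>lborel)"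
    unfolding ip_def power2_eq_square
    using rtest_zero_out[OF v] by (intro split cc_mult rtest_cc[OF v]) auto
  also have "\<dots> \<le> (\<Sum>k\<in>cells N R. (\<integral>x. indicator (cell N k) x * v x \<partial>lborel)\<^sup>2 / measure lborel (cell N k)
     + 16 / (real N)\<^sup>2 * (\<integral>x. indicator (cell N k) x * (norm (gr v x))\<^sup>2 \<partial>lborel))"
  proof (rule sum_mono)
    fix k
    show "(\<integral>x. indicator (cell N k) x * (v x)\<^sup>2 \<partial>lborel) \<le>
      (\<integral>x. indicator (cell N k) x * v x \<partial>lborel)\<^sup>2 / measure lborel (cell N k)
     + 16 / (real N)\<^sup>2 * (\<integral>x. indicator (cell N k) x * (norm (gr v x))\<^sup>2 \<partial>lborel)"
      using mean_oscillation[OF cell_properties(1,2)[OF N] cell_diam[OF N] cell_properties(4)[OF N] v]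
      by (simp add: power_divide)
  qed
  also have "\<dots> = (\<Sum>k\<in>cells N R. (\<integral>x. indicator (cell N k) x * v x \<partial>lborel)\<^sup>2 / measure lborel (cell N k))
     + 16 / (real N)\<^sup>2 * (\<Sum>k\<in>cells N R. \<integral>x. indicator (cell N k) x * (norm (gr v x))\<^sup>2 \<partial>lborel)"
    by (simp add: sum.distrib sum_distrib_left)
  also have "(\<Sum>k\<in>cells N R. \<integral>x. indicator (cell N k) x * (norm (gr v x))\<^sup>2 \<partial>lborel) = dirichlet v"
    using rtest_zero_out[OF v] by (intro split[symmetric] rtest_norm_gr_cc[OF v]) auto
  finally show ?thesis .
qed

lemma dirichlet_diff_le:
  assumes "u \<in> rtest U" "v \<in> rtest U"
  shows "dirichlet (\<lambda>x. u x - v x) \<le> 2 * dirichlet u + 2 * dirichlet v"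
proof -
  have "dirichlet (\<lambda>x. u x - v x) \<le> (\<integral>x. 2 * (norm (gr u x))\<^sup>2 + 2 * (norm (gr v x))\<^sup>2 \<partial>lborel)"
  proof (rule integral_mono)
    show "integrable lborel (\<lambda>x. (norm (gr (\<lambda>x. u x - v x) x))\<^sup>2)"
      by (intro cc_integrable rtest_norm_gr_cc[OF rtest_diff[OF assms]])
    show "integrable lborel (\<lambda>x. 2 * (norm (gr u x))\<^sup>2 + 2 * (norm (gr v x))\<^sup>2)"
      by (intro cc_integrable cc_add cc_cmult rtest_norm_gr_cc[OF assms(1)] rtest_norm_gr_cc[OF assms(2)])
    show "(norm (gr (\<lambda>x. u x - v x) x))\<^sup>2 \<le> 2 * (norm (gr u x))\<^sup>2 + 2 * (norm (gr v x))\<^sup>2" for x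
      using norm_sq_add_le[of "gr u x" "- gr v x"] by (simp add: gr_diff rtest_smooth[OF assms(1)] rtest_smooth[OF assms(2)])
  qed
  also have "\<dots> = 2 * dirichlet u + 2 * dirichlet v"
    using assms by (simp add: Bochner_Integration.integral_add cc_integrable rtest_norm_gr_cc[OF assms(1)] rtest_norm_gr_cc[OF assms(2)])
  finally show ?thesis .
qed

lemma L1_le_L2:
  assumes "open \<omega>" "bounded \<omega>" "u \<in> rtest \<omega>"
  shows "(\<integral>x. \<bar>u x\<bar> \<partial>lborel) \<le> ip u u + measure lborel \<omega>"
proof -
  have ii: "integrable lborel (indicator \<omega> :: _ \<Rightarrow> real)"
    using emeasure_bounded_finite[OF assms(2)] assms(1) by (simp add: integrable_indicator_iff)
  have "(\<integral>x. \<bar>u x\<bar> \<partial>lborel) \<le> (\<integral>x. u x * u x + indicator \<omega> x \<partial>lborel)"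
  proof (rule integral_mono)
    show "integrable lborel (\<lambda>x. \<bar>u x\<bar>)" by (intro integrable_abs cc_integrable rtest_cc[OF assms(3)])
    show "integrable lborel (\<lambda>x. u x * u x + indicator \<omega> x)"
      by (intro Bochner_Integration.integrable_add ii cc_integrable cc_mult rtest_cc[OF assms(3)])
    fix x
    have "\<bar>u x\<bar> \<le> u x * u x + 1"
      using zero_le_power2[of "\<bar>u x\<bar> - 1"] by (simp add: power2_eq_square algebra_simps)
    then show "\<bar>u x\<bar> \<le> u x * u x + indicator \<omega> x"
      using rtest_zero_out[OF assms(3), of x] by (cases "x \<in> \<omega>") auto
  qed
  also have "\<dots> = ip u u + measure lborel \<omega>"
    using ii rtest_cc[OF assms(3)] by (simp add: ip_def Bochner_Integration.integral_add cc_integrable cc_mult)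
  finally show ?thesis .
qed

text \<open>A diagonal subsequence makes the integrals over all cells of all grids converge; by
  \<open>cell_inequality\<close> it is a Cauchy sequence.\<close>

lemma rellich:
  fixes u :: "nat \<Rightarrow> real ^ 2 \<Rightarrow> real"
  assumes \<omega>: "bounded \<omega>" "open \<omega>" and u: "\<And>n. u n \<in> rtest \<omega>"
    and K: "\<And>n. ip (u n) (u n) \<le> K" "\<And>n. dirichlet (u n) \<le> K"
  obtains r w where "strict_mono r" "\<And>x. x \<notin> \<omega> \<Longrightarrow> w x = 0" "L2_limit (\<lambda>n. u (r n)) w"
proof -
  obtain R where R: "\<And>x. x \<in> \<omega> \<Longrightarrow> norm x \<le> R" using \<omega>(1) bounded_iff by metis
  define f where "f n = (\<lambda>(N, k). if N = 0 then 0 else \<integral>x. indicator (cell N k) x * u n x \<partial>lborel)" for n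
  have cu: "u n \<in> cc" for n using rtest_cc[OF u] .
  have ci: "integrable lborel (\<lambda>x. indicator (cell N k) x * u n x)" if "N > 0" for N k n
    using integrable_mult_indicator[OF _ cc_integrable[OF cu[of n]], of "cell N k"] cell_properties(2)[OF that] by simp
  have "norm (f n z) \<le> \<bar>K\<bar> + measure lborel \<omega>" for n z
  proof -
    obtain N k where z: "z = (N, k)" by (cases z)
    show ?thesis
    proof (cases "N = 0")
      case False
      have "norm (f n z) \<le> (\<integral>x. \<bar>indicator (cell N k) x * u n x\<bar> \<partial>lborel)"
        using False integral_abs_bound[of lborel "\<lambda>x. indicator (cell N k) x * u n x"]
        by (simp add: f_def z)
      also have "\<dots> \<le> (\<integral>x. \<bar>u n x\<bar> \<partial>lborel)"
        using False ci[of N k n] cc_integrable[OF cu[of n]]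
        by (intro integral_mono integrable_abs) (auto simp: abs_mult split: split_indicator)
      also have "\<dots> \<le> \<bar>K\<bar> + measure lborel \<omega>"
        using L1_le_L2[OF \<omega>(2,1) u[of n]] K(1)[of n] by linarith
      finally show ?thesis .
    qed (simp add: f_def z)
  qed
  then obtain s where s: "strict_mono s" and "\<And>z. \<exists>l. (\<lambda>n. f (s n) z) \<longlonglongrightarrow> l"
    using function_convergent_subsequence[of "UNIV :: (nat \<times> int \<times> int) set" f] by (metis UNIV_I countableI_type)
  then obtain l where l: "\<And>z. (\<lambda>n. f (s n) z) \<longlonglongrightarrow> l z" by metis
  have "\<exists>M. \<forall>m\<ge>M. \<forall>n\<ge>M. (\<integral>x. (u (s m) x - u (s n) x)\<^sup>2 \<partial>lborel) < e" if e: "e > 0" for e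
  proof -
    \<comment> \<open>A mesh so fine that the energy term of \<open>cell_inequality\<close>, with energy at most \<open>4 \<bar>K\<bar>\<close>, is below
      \<open>e / 2\<close>.\<close>
    obtain N where N: "N > 0" "128 * (\<bar>K\<bar> + 1) / e < real N"
      using reals_Archimedean2[of "max 1 (128 * (\<bar>K\<bar> + 1) / e)"] by (auto simp: max_def split: if_splits)
    have "real N \<le> (real N)\<^sup>2" using N(1) by (simp add: power2_eq_square)
    then have "128 * (\<bar>K\<bar> + 1) / e < (real N)\<^sup>2" using N(2) by linarith
    then have N2: "16 / (real N)\<^sup>2 * (4 * \<bar>K\<bar>) < e / 2" using e N(1) by (simp add: field_simps)
    define D where "D n = (\<Sum>k\<in>cells N R. 2 * (f (s n) (N, k) - l (N, k))\<^sup>2 / measure lborel (cell N k))" for n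
    have "D \<longlonglongrightarrow> (\<Sum>k\<in>cells N R. 2 * (l (N, k) - l (N, k))\<^sup>2 / measure lborel (cell N k))"
      unfolding D_def divide_inverse by (intro tendsto_sum tendsto_intros l)
    then have "D \<longlonglongrightarrow> 0" by simp
    then have "\<forall>\<^sub>F n in sequentially. D n < e / 4" using e by (intro order_tendstoD) auto
    then obtain M where M: "\<And>n. n \<ge> M \<Longrightarrow> D n < e / 4" by (auto simp: eventually_sequentially)
    show ?thesis
    proof (intro exI allI impI)
      fix m n assume mn: "M \<le> m" "M \<le> n"
      let ?v = "\<lambda>x. u (s m) x - u (s n) x"
      have v: "?v \<in> rtest \<omega>" by (intro rtest_diff u)
      have "dirichlet ?v \<le> 4 * \<bar>K\<bar>" using dirichlet_diff_le[OF u[of "s m"] u[of "s n"]] K(2)[of "s m"] K(2)[of "s n"] by linarith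
      then have E: "16 / (real N)\<^sup>2 * dirichlet ?v < e / 2"
        using N2 by (smt (verit) divide_nonneg_nonneg mult_left_mono zero_le_power2)
      have "(\<Sum>k\<in>cells N R. (\<integral>x. indicator (cell N k) x * ?v x \<partial>lborel)\<^sup>2 / measure lborel (cell N k)) \<le> D m + D n"
        unfolding D_def sum.distrib[symmetric]
      proof (rule sum_mono)
        fix k
        have "(\<integral>x. indicator (cell N k) x * ?v x \<partial>lborel) = f (s m) (N, k) - f (s n) (N, k)"
          using N(1) ci by (simp add: f_def right_diff_distrib Bochner_Integration.integral_diff)
        also have "\<dots> = (f (s m) (N, k) - l (N, k)) + - (f (s n) (N, k) - l (N, k))" by simp
        finally have "(\<integral>x. indicator (cell N k) x * ?v x \<partial>lborel)\<^sup>2 \<le> 2 * (f (s m) (N, k) - l (N, k))\<^sup>2 + 2 * (f (s n) (N, k) - l (N, k))\<^sup>2"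
          using norm_sq_add_le[of "f (s m) (N, k) - l (N, k)" "- (f (s n) (N, k) - l (N, k))"]
          by (simp add: power2_commute)
        then show "(\<integral>x. indicator (cell N k) x * ?v x \<partial>lborel)\<^sup>2 / measure lborel (cell N k)
           \<le> 2 * (f (s m) (N, k) - l (N, k))\<^sup>2 / measure lborel (cell N k) + 2 * (f (s n) (N, k) - l (N, k))\<^sup>2 / measure lborel (cell N k)"
          unfolding add_divide_distrib[symmetric] by (intro divide_right_mono) auto
      qed
      then have "ip ?v ?v < e" using cell_inequality[OF N(1) R v] M[OF mn(1)] M[OF mn(2)] E by linarith
      then show "(\<integral>x. (u (s m) x - u (s n) x)\<^sup>2 \<partial>lborel) < e" by (simp add: ip_def power2_eq_square)
    qed
  qed
  from L2_complete[OF \<omega> cu _ this]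
  obtain r w where "strict_mono r" "\<And>x. x \<notin> \<omega> \<Longrightarrow> w x = 0" "L2_limit (\<lambda>n. u (s (r n))) w"
    using rtest_zero_out[OF u] by blast
  then show ?thesis using s by (intro that[of "s \<circ> r" w]) (auto simp: strict_mono_o[unfolded o_def] o_def)
qed

section \<open>Positivity of minimizers\<close>

text \<open>The form of \<open>- \<Delta> - \<lambda>\<^sub>1\<close> at \<open>\<beta> = 0\<close>; along normalized minimizing sequences it tends to zero.\<close>

definition excess :: "(real ^ 2) set \<Rightarrow> (real ^ 2 \<Rightarrow> real) \<Rightarrow> real" where
  "excess \<omega> u = dirichlet u - lambda1 \<omega> 0 * ip u u"

lemma excess_nonneg:
  assumes "open \<omega>" "u \<in> rtest \<omega>" shows "0 \<le> excess \<omega> u"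
proof (cases "\<omega> = {}")
  case True
  then have "u = (\<lambda>_. 0)" using rtest_zero_out[OF assms(2)] by auto
  then show ?thesis by (simp add: excess_def ip_def)
next
  case False
  then show ?thesis using lambda1_le[OF assms(1) False assms(2), of 0] by (simp add: excess_def)
qed

definition excess_form :: "(real ^ 2) set \<Rightarrow> (real ^ 2 \<Rightarrow> real) \<Rightarrow> (real ^ 2 \<Rightarrow> real) \<Rightarrow> real" where
  "excess_form \<omega> u v = (\<integral>x. gr u x \<bullet> gr v x \<partial>lborel) - lambda1 \<omega> 0 * ip u v"

lemma gr_gr_cc: "u \<in> rtest U \<Longrightarrow> v \<in> rtest U \<Longrightarrow> (\<lambda>x. gr u x \<bullet> gr v x) \<in> cc"
  by (rule rtest_gr_cc) (auto intro: continuous_gr rtest_smooth)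

lemma excess_lincomb:
  assumes u: "u \<in> rtest \<omega>" and v: "v \<in> rtest \<omega>"
  shows "excess \<omega> (\<lambda>x. u x + s * v x) = excess \<omega> u + 2 * s * excess_form \<omega> u v + s\<^sup>2 * excess \<omega> v"
proof -
  have g: "(norm (gr (\<lambda>x. u x + s * v x) x))\<^sup>2 = (norm (gr u x))\<^sup>2 + 2 * s * (gr u x \<bullet> gr v x) + s\<^sup>2 * (norm (gr v x))\<^sup>2" for x
    unfolding gr_add[OF rtest_smooth[OF u] rtest_smooth[OF rtest_cmult[OF v]]] gr_cmult[OF rtest_smooth[OF v]]
    unfolding power2_norm_eq_inner by (simp add: inner_add inner_commute power2_eq_square)
  have "dirichlet (\<lambda>x. u x + s * v x) = dirichlet u + 2 * s * (\<integral>x. gr u x \<bullet> gr v x \<partial>lborel) + s\<^sup>2 * dirichlet v"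
    unfolding g
    using cc_integrable[OF rtest_norm_gr_cc[OF u]] cc_integrable[OF rtest_norm_gr_cc[OF v]] cc_integrable[OF gr_gr_cc[OF u v]]
    by (simp add: Bochner_Integration.integral_add)
  moreover have "ip (\<lambda>x. u x + s * v x) (\<lambda>x. u x + s * v x) = ip u u + 2 * s * ip u v + s\<^sup>2 * ip v v"
    using rtest_cc[OF u] rtest_cc[OF v] by (simp add: ip_simps cc_intros ip_commute[of v u] power2_eq_square algebra_simps)
  ultimately show ?thesis by (simp add: excess_def excess_form_def algebra_simps)
qed

text \<open>Near-minimizers nearly solve the eigenvalue equation: when the excess of \<open>u\<close> is small, so is the weak
  form of the equation tested with any \<open>v\<close>.\<close>

lemma excess_Cauchy_Schwarz:
  assumes "open \<omega>" "u \<in> rtest \<omega>" "v \<in> rtest \<omega>"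
  shows "(excess_form \<omega> u v)\<^sup>2 \<le> excess \<omega> u * excess \<omega> v"
proof (rule discriminant_nonneg)
  fix s
  show "0 \<le> excess \<omega> u + 2 * s * excess_form \<omega> u v + s\<^sup>2 * excess \<omega> v"
    unfolding excess_lincomb[OF assms(2,3), symmetric]
    by (intro excess_nonneg assms(1) rtest_add rtest_cmult assms(2,3))
qed

definition log_test :: "real \<Rightarrow> (real ^ 'n \<Rightarrow> real) \<Rightarrow> (real ^ 'n \<Rightarrow> real) \<Rightarrow> real ^ 'n \<Rightarrow> real" where
  "log_test \<delta> p \<phi> x = inverse (p x + \<delta>) * \<phi> x * \<phi> x"

lemma log_test_rtest:
  assumes "\<And>x. p x + \<delta> \<noteq> 0" "p \<in> rtest U" "\<phi> \<in> rtest U"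
  shows "log_test \<delta> p \<phi> \<in> rtest U"
  unfolding log_test_def[abs_def]
  by (intro rtest_smult smooth_mult smooth_inverse smooth_add smooth_const assms rtest_smooth[OF assms(2)] rtest_smooth[OF assms(3)])

lemma gr_log_test:
  assumes nz: "\<And>x. p x + \<delta> \<noteq> 0" and p: "smooth p" and \<phi>: "smooth \<phi>"
  shows "gr (log_test \<delta> p \<phi>) x = (2 * \<phi> x / (p x + \<delta>)) *\<^sub>R gr \<phi> x - ((\<phi> x)\<^sup>2 / (p x + \<delta>)\<^sup>2) *\<^sub>R gr p x"
proof -
  have s: "smooth (\<lambda>x. p x + \<delta>)" by (intro smooth_add smooth_const p)
  have si: "smooth (\<lambda>x. inverse (p x + \<delta>))" by (intro smooth_inverse s nz)
  have "gr (\<lambda>x. p x + \<delta>) x = gr p x" by (rule gr_eq) (use has_derivative_add_const[OF smooth_gr[OF p]] in simp)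
  moreover have "gr (\<lambda>x. inverse (p x + \<delta>)) x = (- (inverse (p x + \<delta>))\<^sup>2) *\<^sub>R gr (\<lambda>x. p x + \<delta>) x"
    using DERIV_inverse[OF nz[of x]] by (intro gr_chain s) (simp add: power2_eq_square numeral_2_eq_2)
  ultimately have gi: "gr (\<lambda>x. inverse (p x + \<delta>)) x = (- (inverse (p x + \<delta>))\<^sup>2) *\<^sub>R gr p x" by simp
  have "gr (log_test \<delta> p \<phi>) x = (inverse (p x + \<delta>) * \<phi> x) *\<^sub>R gr \<phi> x
      + \<phi> x *\<^sub>R (inverse (p x + \<delta>) *\<^sub>R gr \<phi> x + \<phi> x *\<^sub>R gr (\<lambda>x. inverse (p x + \<delta>)) x)"
    unfolding log_test_def[abs_def] gr_mult[OF smooth_mult[OF si \<phi>] \<phi>] gr_mult[OF si \<phi>] ..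
  also have "\<dots> = (2 * (inverse (p x + \<delta>) * \<phi> x)) *\<^sub>R gr \<phi> x - ((\<phi> x)\<^sup>2 * (inverse (p x + \<delta>))\<^sup>2) *\<^sub>R gr p x"
    unfolding gi by (simp add: vec_eq_iff power2_eq_square algebra_simps)
  finally show ?thesis by (simp add: divide_inverse power_inverse mult_ac)
qed

text \<open>The test function \<open>\<phi>\<^sup>2 / (p + \<delta>)\<close> turns the approximate eigenvalue equation of \<open>p\<close> into a bound on
  \<open>\<phi>\<^sup>2\<close> times the squared gradient of \<open>ln (p + \<delta>)\<close>. Negative powers of \<open>\<delta>\<close> occur only together with the
  excess of \<open>p\<close>, so they disappear in the limit of a minimizing sequence.\<close>

lemma log_gradient_bound:
  assumes \<omega>: "open \<omega>" "\<omega> \<noteq> {}" and p: "p \<in> rtest \<omega>" and \<phi>: "\<phi> \<in> rtest \<omega>" and \<delta>: "\<delta> > 0"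
    and low: "\<And>x. - \<delta> / 2 \<le> p x" and B: "\<And>x. \<bar>\<phi> x\<bar> \<le> B"
  shows "(\<integral>x. (\<phi> x)\<^sup>2 * (norm (gr p x))\<^sup>2 / (p x + \<delta>)\<^sup>2 \<partial>lborel) \<le>
     4 * dirichlet \<phi> + 2 * lambda1 \<omega> 0 * ip \<phi> \<phi> +
     2 * sqrt (excess \<omega> p * (32 * B\<^sup>2 / \<delta>\<^sup>2 * dirichlet \<phi> + 32 * B ^ 4 / \<delta> ^ 4 * dirichlet p))"
    and "(\<lambda>x. (\<phi> x)\<^sup>2 * (norm (gr p x))\<^sup>2 / (p x + \<delta>)\<^sup>2) \<in> cc"
proof -
  let ?L = "lambda1 \<omega> 0" and ?\<psi> = "log_test \<delta> p \<phi>"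
  have L0: "0 \<le> ?L" by (rule lambda1_nonneg[OF \<omega>])
  have q: "\<delta> / 2 \<le> p x + \<delta>" for x using low[of x] by linarith
  then have qp: "0 < p x + \<delta>" for x using \<delta> by (smt (verit) half_gt_zero)
  then have nz: "p x + \<delta> \<noteq> 0" for x using less_irrefl by metis
  have \<psi>: "?\<psi> \<in> rtest \<omega>" by (rule log_test_rtest[OF nz p \<phi>])
  note g\<psi> = gr_log_test[OF nz rtest_smooth[OF p] rtest_smooth[OF \<phi>]]
  define A where "A x = (\<phi> x)\<^sup>2 * (norm (gr p x))\<^sup>2 / (p x + \<delta>)\<^sup>2" for x
  have "(\<lambda>x. ((\<phi> x)\<^sup>2 / (p x + \<delta>)\<^sup>2) * (norm (gr p x))\<^sup>2) \<in> cc"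
    using nz smooth_continuous[OF rtest_smooth[OF p]] smooth_continuous[OF rtest_smooth[OF \<phi>]]
    by (intro cc_multc rtest_norm_gr_cc[OF p]) (auto intro!: continuous_intros)
  then show Acc: "(\<lambda>x. (\<phi> x)\<^sup>2 * (norm (gr p x))\<^sup>2 / (p x + \<delta>)\<^sup>2) \<in> cc" by simp
  \<comment> \<open>The gradient of the test function contributes \<open>2 X - A\<close>, and \<open>X\<close> is absorbed by half of \<open>A\<close>.
    The mass term has a sign up to \<open>(\<phi> x)\<^sup>2\<close>, because \<open>p / (p + \<delta>) \<ge> - 1\<close>.\<close>
  have point: "A x \<le> 4 * (norm (gr \<phi> x))\<^sup>2 + 2 * ?L * (\<phi> x * \<phi> x) - 2 * (gr p x \<bullet> gr ?\<psi> x) + 2 * ?L * (p x * ?\<psi> x)" for x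
  proof -
    let ?q = "p x + \<delta>"
    define X where "X = ((\<phi> x / ?q) *\<^sub>R gr p x) \<bullet> gr \<phi> x"
    have A: "A x = (norm ((\<phi> x / ?q) *\<^sub>R gr p x))\<^sup>2"
      by (simp add: A_def power_divide power_mult_distrib)
    have e: "gr p x \<bullet> gr ?\<psi> x = 2 * X - A x"
      unfolding g\<psi> A_def X_def by (simp add: inner_diff_right power2_norm_eq_inner)
    have "0 \<le> (norm ((\<phi> x / ?q) *\<^sub>R gr p x - 2 *\<^sub>R gr \<phi> x))\<^sup>2" by simp
    also have "\<dots> = A x - 4 * X + 4 * (norm (gr \<phi> x))\<^sup>2"
      unfolding A X_def power2_norm_eq_inner by (simp add: inner_diff inner_commute)
    finally have 1: "4 * X \<le> A x + 4 * (norm (gr \<phi> x))\<^sup>2" by linarith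
    have "- 1 \<le> p x / ?q" using low[of x] qp[of x] \<delta> by (simp add: pos_le_divide_eq)
    then have "- 1 * (\<phi> x * \<phi> x) \<le> p x / ?q * (\<phi> x * \<phi> x)" by (rule mult_right_mono) simp
    also have "\<dots> = p x * ?\<psi> x" by (simp add: log_test_def divide_inverse)
    finally have "0 \<le> \<phi> x * \<phi> x + p x * ?\<psi> x" by simp
    then have 2: "0 \<le> 2 * ?L * (\<phi> x * \<phi> x) + 2 * ?L * (p x * ?\<psi> x)"
      using L0 by (metis distrib_left mult_nonneg_nonneg zero_le_numeral)
    show ?thesis unfolding e using 1 2 by (simp add: algebra_simps)
  qed
  have c: "(\<lambda>x. (norm (gr \<phi> x))\<^sup>2) \<in> cc" "(\<lambda>x. \<phi> x * \<phi> x) \<in> cc" "(\<lambda>x. gr p x \<bullet> gr ?\<psi> x) \<in> cc" "(\<lambda>x. p x * ?\<psi> x) \<in> cc"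
    using rtest_norm_gr_cc[OF \<phi>] cc_mult[OF rtest_cc[OF \<phi>] rtest_cc[OF \<phi>]] gr_gr_cc[OF p \<psi>] cc_mult[OF rtest_cc[OF p] rtest_cc[OF \<psi>]] .
  have "integral\<^sup>L lborel A \<le> (\<integral>x. 4 * (norm (gr \<phi> x))\<^sup>2 + 2 * ?L * (\<phi> x * \<phi> x) - 2 * (gr p x \<bullet> gr ?\<psi> x) + 2 * ?L * (p x * ?\<psi> x) \<partial>lborel)"
  proof (rule integral_mono[OF _ _ point])
    show "integrable lborel A" using cc_integrable[OF Acc] unfolding A_def[abs_def] .
    show "integrable lborel (\<lambda>x. 4 * (norm (gr \<phi> x))\<^sup>2 + 2 * ?L * (\<phi> x * \<phi> x) - 2 * (gr p x \<bullet> gr ?\<psi> x) + 2 * ?L * (p x * ?\<psi> x))"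
      by (intro cc_integrable cc_add cc_diff cc_cmult c)
  qed
  also have "\<dots> = 4 * dirichlet \<phi> + 2 * ?L * ip \<phi> \<phi> - 2 * excess_form \<omega> p ?\<psi>"
    using c[THEN cc_integrable]
    by (simp add: Bochner_Integration.integral_add Bochner_Integration.integral_diff excess_form_def ip_def)
  finally have main: "integral\<^sup>L lborel A \<le> 4 * dirichlet \<phi> + 2 * ?L * ip \<phi> \<phi> - 2 * excess_form \<omega> p ?\<psi>" .
  have pointE: "(norm (gr ?\<psi> x))\<^sup>2 \<le> 32 * B\<^sup>2 / \<delta>\<^sup>2 * (norm (gr \<phi> x))\<^sup>2 + 32 * B ^ 4 / \<delta> ^ 4 * (norm (gr p x))\<^sup>2" for x
  proof -
    let ?q = "p x + \<delta>"
    have b1: "\<bar>\<phi> x / ?q\<bar> \<le> 2 * B / \<delta>"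
    proof -
      have "\<bar>\<phi> x\<bar> * \<delta> \<le> B * (2 * ?q)" using B[of x] q[of x] \<delta> by (intro mult_mono) auto
      then show ?thesis using qp[of x] \<delta> by (simp add: field_simps)
    qed
    then have b2: "(\<phi> x / ?q)\<^sup>2 \<le> (2 * B / \<delta>)\<^sup>2" by (metis abs_ge_zero power2_abs power_mono)
    then have b4: "((\<phi> x / ?q)\<^sup>2)\<^sup>2 \<le> ((2 * B / \<delta>)\<^sup>2)\<^sup>2" by (rule power_mono) simp
    have "(norm (gr ?\<psi> x))\<^sup>2 \<le> 2 * (norm ((2 * \<phi> x / ?q) *\<^sub>R gr \<phi> x))\<^sup>2 + 2 * (norm (((\<phi> x)\<^sup>2 / ?q\<^sup>2) *\<^sub>R gr p x))\<^sup>2"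
      unfolding g\<psi> using norm_sq_add_le[of "(2 * \<phi> x / ?q) *\<^sub>R gr \<phi> x" "- (((\<phi> x)\<^sup>2 / ?q\<^sup>2) *\<^sub>R gr p x)"]
      by simp
    also have "\<dots> = 8 * ((\<phi> x / ?q)\<^sup>2 * (norm (gr \<phi> x))\<^sup>2) + 2 * (((\<phi> x / ?q)\<^sup>2)\<^sup>2 * (norm (gr p x))\<^sup>2)"
      by (simp add: power_mult_distrib power_divide)
    also have "\<dots> \<le> 8 * ((2 * B / \<delta>)\<^sup>2 * (norm (gr \<phi> x))\<^sup>2) + 2 * (((2 * B / \<delta>)\<^sup>2)\<^sup>2 * (norm (gr p x))\<^sup>2)"
      using b2 b4 by (intro add_mono mult_left_mono mult_right_mono) auto
    also have "\<dots> = 32 * B\<^sup>2 / \<delta>\<^sup>2 * (norm (gr \<phi> x))\<^sup>2 + 32 * B ^ 4 / \<delta> ^ 4 * (norm (gr p x))\<^sup>2"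
      by (simp add: power_divide power_mult_distrib)
    finally show ?thesis .
  qed
  let ?M = "32 * B\<^sup>2 / \<delta>\<^sup>2 * dirichlet \<phi> + 32 * B ^ 4 / \<delta> ^ 4 * dirichlet p"
  have "dirichlet ?\<psi> \<le> (\<integral>x. 32 * B\<^sup>2 / \<delta>\<^sup>2 * (norm (gr \<phi> x))\<^sup>2 + 32 * B ^ 4 / \<delta> ^ 4 * (norm (gr p x))\<^sup>2 \<partial>lborel)"
    by (intro integral_mono pointE cc_integrable cc_add cc_cmult rtest_norm_gr_cc[OF \<psi>] rtest_norm_gr_cc[OF \<phi>] rtest_norm_gr_cc[OF p])
  also have "\<dots> = ?M"
    using cc_integrable[OF rtest_norm_gr_cc[OF \<phi>]] cc_integrable[OF rtest_norm_gr_cc[OF p]]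
    by (simp add: Bochner_Integration.integral_add)
  finally have "excess \<omega> ?\<psi> \<le> ?M"
    using L0 ip_nonneg[of ?\<psi>] by (simp add: excess_def) (smt (verit) mult_nonneg_nonneg)
  then have "(excess_form \<omega> p ?\<psi>)\<^sup>2 \<le> excess \<omega> p * ?M"
    using excess_Cauchy_Schwarz[OF \<omega>(1) p \<psi>] excess_nonneg[OF \<omega>(1) p] by (meson mult_left_mono order_trans)
  then have "\<bar>excess_form \<omega> p ?\<psi>\<bar> \<le> sqrt (excess \<omega> p * ?M)" by (metis real_sqrt_abs real_sqrt_le_iff)
  then show "(\<integral>x. (\<phi> x)\<^sup>2 * (norm (gr p x))\<^sup>2 / (p x + \<delta>)\<^sup>2 \<partial>lborel) \<le> 4 * dirichlet \<phi> + 2 * ?L * ip \<phi> \<phi> + 2 * sqrt (excess \<omega> p * ?M)"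
    using main unfolding A_def by linarith
qed

lemma ln_shift_derivative:
  assumes "smooth p" "p x + \<delta> > 0"
  shows "((\<lambda>x. ln (p x + \<delta>)) has_derivative (\<lambda>v. (inverse (p x + \<delta>) *\<^sub>R gr p x) \<bullet> v)) (at x)"
proof -
  have "((\<lambda>x. p x + \<delta>) has_derivative (\<lambda>v. gr p x \<bullet> v)) (at x)"
    using has_derivative_add_const[OF smooth_gr[OF assms(1)]] by simp
  from has_derivative_compose[OF this DERIV_ln[OF assms(2), unfolded has_field_derivative_def]]
  show ?thesis by simp
qed

text \<open>The Poincare inequality for \<open>ln (p n + \<delta>)\<close>, followed by Fatou's lemma as the minimizing sequence
  \<open>p n\<close> tends to \<open>w\<close>. The point is that \<open>C\<close> does not depend on \<open>\<delta>\<close>.\<close>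

lemma log_oscillation:
  fixes p :: "nat \<Rightarrow> real ^ 2 \<Rightarrow> real"
  assumes \<omega>: "open \<omega>" "\<omega> \<noteq> {}" and p: "\<And>n. p n \<in> rtest \<omega>"
    and \<sigma>: "\<sigma> \<longlonglongrightarrow> 0" "\<And>n x. - \<sigma> n \<le> p n x" and ex: "(\<lambda>n. excess \<omega> (p n)) \<longlonglongrightarrow> 0"
    and D: "\<And>n. dirichlet (p n) \<le> K"
    and w: "AE x in lborel. (\<lambda>n. p n x) \<longlonglongrightarrow> w x" "w \<in> borel_measurable borel" "\<And>x. 0 \<le> w x"
    and Q: "convex Q" "Q \<in> sets borel" "\<And>x y. x \<in> Q \<Longrightarrow> y \<in> Q \<Longrightarrow> norm (x - y) \<le> d" "emeasure lborel Q < \<infinity>"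
    and \<phi>: "\<phi> \<in> rtest \<omega>" "c > 0" "\<And>x. x \<in> Q \<Longrightarrow> c \<le> \<phi> x"
  obtains C where "\<And>\<delta>. \<delta> > 0 \<Longrightarrow> (\<integral>\<^sup>+x. \<integral>\<^sup>+y. indicator Q x * indicator Q y * ennreal ((ln (w x + \<delta>) - ln (w y + \<delta>))\<^sup>2) \<partial>lborel \<partial>lborel) \<le> ennreal C"
proof -
  note [measurable] = Q(2) w(2)
  let ?L = "lambda1 \<omega> 0"
  have L0: "0 \<le> ?L" by (rule lambda1_nonneg[OF \<omega>])
  obtain B where B: "B > 0" "\<And>x. \<bar>\<phi> x\<bar> \<le> B" using cc_bounded[OF rtest_cc[OF \<phi>(1)]] by blast
  define C0 where "C0 = (4 * dirichlet \<phi> + 2 * ?L * ip \<phi> \<phi> + 1) / c\<^sup>2"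
  have C0: "0 \<le> C0" using L0 by (simp add: C0_def ip_nonneg)
  define C where "C = d\<^sup>2 * 4 * measure lborel Q * C0"
  show ?thesis
  proof (rule that[of C])
    fix \<delta> :: real assume \<delta>: "\<delta> > 0"
    define M where "M = 32 * B\<^sup>2 / \<delta>\<^sup>2 * dirichlet \<phi> + 32 * B ^ 4 / \<delta> ^ 4 * K"
    have "(\<lambda>n. 2 * sqrt (excess \<omega> (p n) * M)) \<longlonglongrightarrow> 2 * sqrt (0 * M)"
      by (intro tendsto_intros ex)
    then have ev: "\<forall>\<^sub>F n in sequentially. 2 * sqrt (excess \<omega> (p n) * M) < 1" by (intro order_tendstoD(2)[of _ 0]) auto
    have ev2: "\<forall>\<^sub>F n in sequentially. \<sigma> n < \<delta> / 2" using \<sigma>(1) \<delta> by (intro order_tendstoD(2)[of _ 0]) auto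
    let ?F = "\<lambda>n x y. indicator Q x * indicator Q y * ennreal ((ln (p n x + \<delta>) - ln (p n y + \<delta>))\<^sup>2)"
    have bound: "\<forall>\<^sub>F n in sequentially. (\<integral>\<^sup>+x. \<integral>\<^sup>+y. ?F n x y \<partial>lborel \<partial>lborel) \<le> ennreal C"
      using ev ev2
    proof eventually_elim
      fix n assume n1: "2 * sqrt (excess \<omega> (p n) * M) < 1" and n2: "\<sigma> n < \<delta> / 2"
      have low: "- \<delta> / 2 \<le> p n x" for x using \<sigma>(2)[of n x] n2 by linarith
      have pos: "0 < p n x + \<delta>" for x using low[of x] \<delta> by linarith
      let ?g = "\<lambda>x. inverse (p n x + \<delta>) *\<^sub>R gr (p n) x"
      let ?A = "\<lambda>x. (\<phi> x)\<^sup>2 * (norm (gr (p n) x))\<^sup>2 / (p n x + \<delta>)\<^sup>2"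
      note lg = log_gradient_bound[OF \<omega> p[of n] \<phi>(1) \<delta> low B(2)]
      have "32 * B\<^sup>2 / \<delta>\<^sup>2 * dirichlet \<phi> + 32 * B ^ 4 / \<delta> ^ 4 * dirichlet (p n) \<le> M"
        unfolding M_def using D[of n] by (intro add_left_mono mult_left_mono) auto
      then have "sqrt (excess \<omega> (p n) * (32 * B\<^sup>2 / \<delta>\<^sup>2 * dirichlet \<phi> + 32 * B ^ 4 / \<delta> ^ 4 * dirichlet (p n))) \<le> sqrt (excess \<omega> (p n) * M)"
        using excess_nonneg[OF \<omega>(1) p[of n]] by (simp add: mult_left_mono)
      then have "(\<integral>x. ?A x \<partial>lborel) \<le> 4 * dirichlet \<phi> + 2 * ?L * ip \<phi> \<phi> + 1"
        using lg(1) n1 by linarith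
      then have A: "(\<integral>x. ?A x \<partial>lborel) \<le> C0 * c\<^sup>2" using \<phi>(2) by (simp add: C0_def)
      have gc: "continuous_on UNIV ?g"
        using pos by (intro continuous_intros smooth_continuous continuous_gr rtest_smooth[OF p]) (auto simp: less_imp_neq[OF pos, symmetric])
      have "(\<integral>\<^sup>+x. indicator Q x * ennreal ((norm (?g x))\<^sup>2) \<partial>lborel) \<le> (\<integral>\<^sup>+x. ennreal (?A x / c\<^sup>2) \<partial>lborel)"
      proof (intro nn_integral_mono)
        fix x
        show "indicator Q x * ennreal ((norm (?g x))\<^sup>2) \<le> ennreal (?A x / c\<^sup>2)"
        proof (cases "x \<in> Q")
          case True
          have "c\<^sup>2 \<le> (\<phi> x)\<^sup>2" using \<phi>(2,3) True by (intro power_mono) auto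
          then have "c\<^sup>2 * (norm (?g x))\<^sup>2 \<le> (\<phi> x)\<^sup>2 * (norm (?g x))\<^sup>2" by (intro mult_right_mono) auto
          also have "\<dots> = ?A x" using pos[of x] by (simp add: power_mult_distrib divide_inverse power_inverse)
          finally have "(norm (?g x))\<^sup>2 \<le> ?A x / c\<^sup>2" using \<phi>(2) by (subst pos_le_divide_eq) (auto simp only: mult.commute zero_less_power)
          then show ?thesis using True by (simp add: ennreal_leI)
        qed simp
      qed
      also have "\<dots> = ennreal ((\<integral>x. ?A x \<partial>lborel) / c\<^sup>2)"
        by (subst nn_integral_eq_integral[OF Bochner_Integration.integrable_divide[OF cc_integrable[OF lg(2)]]])
          (simp_all only: integral_divide_zero, simp)
      also have "\<dots> \<le> ennreal C0" using A \<phi>(2) by (intro ennreal_leI) (simp add: pos_divide_le_eq)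
      finally have gb: "(\<integral>\<^sup>+x. indicator Q x * ennreal ((norm (?g x))\<^sup>2) \<partial>lborel) \<le> ennreal C0" .
      have "(\<integral>\<^sup>+x. \<integral>\<^sup>+y. ?F n x y \<partial>lborel \<partial>lborel) \<le> ennreal (d\<^sup>2) * 2 ^ DIM(real ^ 2) * emeasure lborel Q * (\<integral>\<^sup>+x. indicator Q x * ennreal ((norm (?g x))\<^sup>2) \<partial>lborel)"
        by (rule poincare_convex[OF Q(1-3) ln_shift_derivative[OF rtest_smooth[OF p] pos] gc])
      also have "\<dots> \<le> ennreal (d\<^sup>2) * 2 ^ DIM(real ^ 2) * emeasure lborel Q * ennreal C0"
        by (intro mult_left_mono gb) auto
      also have "\<dots> = ennreal C"
      proof -
        have four: "2 ^ DIM(real ^ 2) = ennreal 4" by simp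
        have em: "emeasure lborel Q = ennreal (measure lborel Q)"
          using Q(4) by (intro emeasure_eq_ennreal_measure) auto
        show ?thesis unfolding four em using C0 by (simp add: C_def ennreal_mult')
      qed
      finally show "(\<integral>\<^sup>+x. \<integral>\<^sup>+y. ?F n x y \<partial>lborel \<partial>lborel) \<le> ennreal C" .
    qed
    have [measurable]: "p n \<in> borel_measurable borel" for n by (rule cc_borel[OF rtest_cc[OF p]])
    let ?G = "\<lambda>x y. indicator Q x * indicator Q y * ennreal ((ln (w x + \<delta>) - ln (w y + \<delta>))\<^sup>2)"
    have lim: "AE x in lborel. AE y in lborel. ?G x y = liminf (\<lambda>n. ?F n x y)"
      using w(1)
    proof eventually_elim
      fix x assume x: "(\<lambda>n. p n x) \<longlonglongrightarrow> w x"
      show "AE y in lborel. ?G x y = liminf (\<lambda>n. ?F n x y)"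
        using w(1)
      proof eventually_elim
        fix y assume y: "(\<lambda>n. p n y) \<longlonglongrightarrow> w y"
        have nz: "w x + \<delta> \<noteq> 0" "w y + \<delta> \<noteq> 0" using w(3)[of x] w(3)[of y] \<delta> by auto
        have "(\<lambda>n. (ln (p n x + \<delta>) - ln (p n y + \<delta>))\<^sup>2) \<longlonglongrightarrow> (ln (w x + \<delta>) - ln (w y + \<delta>))\<^sup>2"
          by (intro tendsto_intros x y nz)
        then have "(\<lambda>n. ennreal (indicator Q x * indicator Q y * (ln (p n x + \<delta>) - ln (p n y + \<delta>))\<^sup>2))
           \<longlonglongrightarrow> ennreal (indicator Q x * indicator Q y * (ln (w x + \<delta>) - ln (w y + \<delta>))\<^sup>2)"
          by (intro tendsto_ennrealI tendsto_mult tendsto_const)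
        then have "(\<lambda>n. ?F n x y) \<longlonglongrightarrow> ?G x y"
          by (simp add: ennreal_mult' ennreal_indicator)
        then show "?G x y = liminf (\<lambda>n. ?F n x y)"
          by (rule lim_imp_Liminf[OF trivial_limit_sequentially, symmetric])
      qed
    qed
    have "(\<integral>\<^sup>+x. \<integral>\<^sup>+y. ?G x y \<partial>lborel \<partial>lborel) = (\<integral>\<^sup>+x. \<integral>\<^sup>+y. liminf (\<lambda>n. ?F n x y) \<partial>lborel \<partial>lborel)"
      by (rule nn_integral_cong_AE, rule AE_mp[OF lim], intro AE_I2 impI, rule nn_integral_cong_AE)
    also have "\<dots> \<le> (\<integral>\<^sup>+x. liminf (\<lambda>n. \<integral>\<^sup>+y. ?F n x y \<partial>lborel) \<partial>lborel)"
      by (intro nn_integral_mono nn_integral_liminf) measurable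
    also have "\<dots> \<le> liminf (\<lambda>n. \<integral>\<^sup>+x. \<integral>\<^sup>+y. ?F n x y \<partial>lborel \<partial>lborel)"
      by (intro nn_integral_liminf) measurable
    also have "\<dots> \<le> ennreal C" by (rule Liminf_le[OF trivial_limit_sequentially bound])
    finally show "(\<integral>\<^sup>+x. \<integral>\<^sup>+y. ?G x y \<partial>lborel \<partial>lborel) \<le> ennreal C" .
  qed
qed

text \<open>If \<open>w\<close> vanished on a set of positive measure and were at least \<open>1 / (m + 1)\<close> on another one, then
  \<open>ln (w + \<delta>)\<close> would differ between them by an arbitrarily large amount as \<open>\<delta>\<close> tends to \<open>0\<close>.\<close>

lemma log_oscillation_dichotomy:
  fixes w :: "real ^ 2 \<Rightarrow> real"
  assumes w[measurable]: "w \<in> borel_measurable borel" "\<And>x. 0 \<le> w x" and Q[measurable]: "Q \<in> sets borel"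
    and C: "\<And>\<delta>. \<delta> > 0 \<Longrightarrow> (\<integral>\<^sup>+x. \<integral>\<^sup>+y. indicator Q x * indicator Q y * ennreal ((ln (w x + \<delta>) - ln (w y + \<delta>))\<^sup>2) \<partial>lborel \<partial>lborel) \<le> ennreal C"
  shows "(AE x in lborel. x \<in> Q \<longrightarrow> w x = 0) \<or> (AE x in lborel. x \<in> Q \<longrightarrow> 0 < w x)"
proof (rule disjCI)
  define Z where "Z = {x \<in> Q. w x = 0}"
  have [measurable]: "Z \<in> sets borel" unfolding Z_def by measurable
  assume "\<not> (AE x in lborel. x \<in> Q \<longrightarrow> 0 < w x)"
  then have Z: "emeasure lborel Z \<noteq> 0"
    using w(2) by (subst (asm) AE_iff_measurable[of Z]) (auto simp: Z_def less_le)
  have "AE x in lborel. x \<in> Q \<longrightarrow> w x < 1 / real (Suc m)" for m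
  proof -
    define P where "P = {x \<in> Q. 1 / real (Suc m) \<le> w x}"
    have [measurable]: "P \<in> sets borel" unfolding P_def by measurable
    let ?z = "emeasure lborel Z * emeasure lborel P"
    have le: "of_nat k * ?z \<le> ennreal C" for k :: nat
    proof -
      \<comment> \<open>This \<open>\<delta>\<close> makes \<open>ln (w + \<delta>)\<close> differ by at least \<open>k + 1\<close> between \<open>Z\<close> and \<open>P\<close>.\<close>
      define \<delta> where "\<delta> = 1 / (real (Suc m) * exp (real k + 1))"
      have \<delta>: "\<delta> > 0" by (simp add: \<delta>_def)
      have ln: "of_nat k \<le> ennreal ((ln (w x + \<delta>) - ln (w y + \<delta>))\<^sup>2)" if "x \<in> Z" "y \<in> P" for x y
      proof -
        have "real k + 1 = ln (exp (real k + 1) * \<delta>) - ln \<delta>" using \<delta> by (simp add: ln_mult)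
        also have "exp (real k + 1) * \<delta> = 1 / real (Suc m)" by (simp add: \<delta>_def)
        also have "ln (1 / real (Suc m)) \<le> ln (w y + \<delta>)"
        proof -
          have "1 / real (Suc m) \<le> w y + \<delta>" using that \<delta> by (simp add: P_def)
          then show ?thesis by (subst ln_le_cancel_iff) (auto intro: less_le_trans[of 0 "1 / real (Suc m)"])
        qed
        finally have "real k + 1 \<le> ln (w y + \<delta>) - ln (w x + \<delta>)" using that by (simp add: Z_def)
        then have "(real k + 1)\<^sup>2 \<le> (ln (w y + \<delta>) - ln (w x + \<delta>))\<^sup>2" by (intro power_mono) auto
        moreover have "real k \<le> (real k + 1)\<^sup>2" by (simp add: power2_eq_square algebra_simps)
        ultimately have "real k \<le> (ln (w x + \<delta>) - ln (w y + \<delta>))\<^sup>2" by (simp add: power2_commute)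
        then show ?thesis by (simp add: ennreal_of_nat_eq_real_of_nat ennreal_leI)
      qed
      have "of_nat k * ?z = (\<integral>\<^sup>+x. \<integral>\<^sup>+y. of_nat k * (indicator Z x * indicator P y) \<partial>lborel \<partial>lborel)"
        by (simp add: nn_integral_cmult nn_integral_multc mult.assoc)
      also have "\<dots> \<le> (\<integral>\<^sup>+x. \<integral>\<^sup>+y. indicator Q x * indicator Q y * ennreal ((ln (w x + \<delta>) - ln (w y + \<delta>))\<^sup>2) \<partial>lborel \<partial>lborel)"
        using ln by (intro nn_integral_mono) (auto simp: Z_def P_def split: split_indicator)
      also have "\<dots> \<le> ennreal C" by (rule C[OF \<delta>])
      finally show ?thesis .
    qed
    have "?z = 0"
    proof (rule ccontr)
      assume z: "?z \<noteq> 0"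
      have "?z < \<infinity>" using le[of 1] by (simp add: le_less_trans)
      then obtain r where r: "?z = ennreal r" "r > 0"
        using z by (cases ?z) (auto simp: less_le)
      obtain k where "\<bar>C\<bar> / r < real k" using reals_Archimedean2 by blast
      then have "C < real k * r" using r by (simp add: divide_less_eq)
      moreover have "ennreal (real k * r) \<le> ennreal C"
        using le[of k] r by (simp add: ennreal_of_nat_eq_real_of_nat ennreal_mult')
      ultimately show False using r \<open>\<bar>C\<bar> / r < real k\<close>
        by (smt (verit) divide_nonneg_pos ennreal_le_iff2 mult_pos_pos)
    qed
    then have "emeasure lborel P = 0" using Z by simp
    then show ?thesis by (subst AE_iff_measurable[of P]) (auto simp: P_def not_less)
  qed
  then have "AE x in lborel. \<forall>m. x \<in> Q \<longrightarrow> w x < 1 / real (Suc m)" by (subst AE_all_countable) blast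
  then show "AE x in lborel. x \<in> Q \<longrightarrow> w x = 0"
  proof eventually_elim
    fix x assume x: "\<forall>m. x \<in> Q \<longrightarrow> w x < 1 / real (Suc m)"
    show "x \<in> Q \<longrightarrow> w x = 0"
    proof (rule impI, rule ccontr)
      assume "x \<in> Q" "w x \<noteq> 0"
      then have "0 < w x" using w(2)[of x] by simp
      then obtain m where "1 / real (Suc m) < w x" using nat_approx_posE by metis
      then show False using x \<open>x \<in> Q\<close> by (smt (verit))
    qed
  qed
qed

text \<open>The union of all open sets on which \<open>P\<close> holds almost everywhere and the corresponding union for \<open>R\<close>
  are disjoint, because a nonempty open set is not a null set, and together they cover the connected
  set.\<close>

lemma connected_dichotomy:
  fixes \<omega> :: "'a::euclidean_space set"
  assumes "connected \<omega>" and excl: "\<And>x. \<not> (P x \<and> R x)"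
    and loc: "\<And>p. p \<in> \<omega> \<Longrightarrow> \<exists>Q. open Q \<and> p \<in> Q \<and> ((AE x in lborel. x \<in> Q \<longrightarrow> P x) \<or> (AE x in lborel. x \<in> Q \<longrightarrow> R x))"
  shows "(AE x in lborel. x \<in> \<omega> \<longrightarrow> P x) \<or> (AE x in lborel. x \<in> \<omega> \<longrightarrow> R x)"
proof -
  define \<F> where "\<F> S = {Q. open Q \<and> (AE x in lborel. x \<in> Q \<longrightarrow> S x)}" for S :: "'a \<Rightarrow> bool"
  have un: "AE x in lborel. x \<in> \<Union>(\<F> S) \<longrightarrow> S x" for S
  proof -
    obtain \<G> where G: "\<G> \<subseteq> \<F> S" "countable \<G>" "\<Union>\<G> = \<Union>(\<F> S)"
      using Lindelof[of "\<F> S"] by (auto simp: \<F>_def)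
    have "AE x in lborel. \<forall>Q\<in>\<G>. x \<in> Q \<longrightarrow> S x"
      using G by (subst AE_ball_countable) (auto simp: \<F>_def)
    then show ?thesis unfolding G(3)[symmetric] by eventually_elim blast
  qed
  have op: "open (\<Union>(\<F> S))" for S by (auto simp: \<F>_def)
  have "\<Union>(\<F> P) \<inter> \<Union>(\<F> R) = {}"
  proof (rule ccontr)
    let ?O = "\<Union>(\<F> P) \<inter> \<Union>(\<F> R)"
    assume ne: "?O \<noteq> {}"
    have "AE x in lborel. x \<notin> ?O" using un[of P] un[of R] by eventually_elim (use excl in blast)
    then have "AE x in lebesgue. x \<in> - ?O" by (intro AE_completion) simp
    moreover have "closed (- ?O)" using op by (intro closed_Compl open_Int)
    ultimately show False using mem_closed_if_AE_lebesgue ne by blast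
  qed
  moreover have "\<omega> \<subseteq> \<Union>(\<F> P) \<union> \<Union>(\<F> R)" using loc by (fastforce simp: \<F>_def)
  ultimately have "\<Union>(\<F> P) \<inter> \<omega> = {} \<or> \<Union>(\<F> R) \<inter> \<omega> = {}"
    using connectedD[OF assms(1) op op] by blast
  then have "\<omega> \<subseteq> \<Union>(\<F> P) \<or> \<omega> \<subseteq> \<Union>(\<F> R)" using \<open>\<omega> \<subseteq> \<Union>(\<F> P) \<union> \<Union>(\<F> R)\<close> by blast
  then show ?thesis
  proof
    assume "\<omega> \<subseteq> \<Union>(\<F> P)"
    then show ?thesis using un[of P] by (intro disjI1) (auto elim!: eventually_mono)
  next
    assume "\<omega> \<subseteq> \<Union>(\<F> R)"
    then show ?thesis using un[of R] by (intro disjI2) (auto elim!: eventually_mono)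
  qed
qed

text \<open>A smooth approximation from below of the positive part. It vanishes at \<open>0\<close>, so that composition with
  it preserves compact supports.\<close>

definition spos :: "real \<Rightarrow> real \<Rightarrow> real" where
  "spos s x = (sqrt (x\<^sup>2 + s\<^sup>2) + x - s) / 2"

lemma spos_approx:
  assumes "s > 0" shows "max x 0 - s / 2 \<le> spos s x" "spos s x \<le> max x 0"
proof -
  have "\<bar>x\<bar> \<le> sqrt (x\<^sup>2 + s\<^sup>2)" by (simp add: real_le_rsqrt)
  moreover have "sqrt (x\<^sup>2 + s\<^sup>2) \<le> \<bar>x\<bar> + s" using sqrt_sum_squares_le_sum_abs[of x s] assms by simp
  ultimately show "max x 0 - s / 2 \<le> spos s x" "spos s x \<le> max x 0"
    by (auto simp: spos_def max_def abs_if split: if_splits)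
qed

lemma spos_rtest:
  assumes "s > 0" "u \<in> rtest U"
  shows "(\<lambda>x. spos s (u x)) \<in> rtest U"
    and "gr (\<lambda>x. spos s (u x)) x = ((1 + u x / sqrt ((u x)\<^sup>2 + s\<^sup>2)) / 2) *\<^sub>R gr u x"
proof -
  have pos: "0 < y\<^sup>2 + s\<^sup>2" for y using assms(1) by (simp add: add_nonneg_pos)
  have "smooth (\<lambda>x. (1/2) * (sqrt (u x * u x + s\<^sup>2) + u x + (- s)))"
    using pos by (intro smooth_cmult smooth_add smooth_sqrt smooth_mult smooth_const rtest_smooth[OF assms(2)])
      (simp add: power2_eq_square)
  then have sm: "smooth (\<lambda>x. spos s (u x))" by (simp add: spos_def power2_eq_square)
  obtain K where K: "compact K" "K \<subseteq> U" "\<And>x. x \<notin> K \<Longrightarrow> u x = 0" by (rule rtestE[OF assms(2)]) blast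
  show "(\<lambda>x. spos s (u x)) \<in> rtest U"
    by (rule rtestI[OF sm K(1,2)]) (use K(3) assms(1) in \<open>simp add: spos_def\<close>)
  have "(spos s has_real_derivative (1 + y / sqrt (y\<^sup>2 + s\<^sup>2)) / 2) (at y)" for y
    unfolding spos_def[abs_def] using pos[of y]
    by (auto intro!: derivative_eq_intros simp: field_simps)
  from gr_chain[OF rtest_smooth[OF assms(2)] this]
  show "gr (\<lambda>x. spos s (u x)) x = ((1 + u x / sqrt ((u x)\<^sup>2 + s\<^sup>2)) / 2) *\<^sub>R gr u x" .
qed

text \<open>Energy and mass of \<open>u\<close> split over its positive and negative parts, and the negative part has
  nonnegative excess; so passing to the positive part does not increase the excess, up to an error of
  order \<open>s\<close> from the smoothing.\<close>

lemma spos_excess: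
  assumes \<omega>: "open \<omega>" "bounded \<omega>" "\<omega> \<noteq> {}" and s: "s > 0" and u: "u \<in> rtest \<omega>"
  shows "excess \<omega> (\<lambda>x. spos s (u x)) \<le> excess \<omega> u + lambda1 \<omega> 0 * (s * (ip u u + measure lborel \<omega>))"
    and "dirichlet (\<lambda>x. spos s (u x)) \<le> dirichlet u"
proof -
  let ?p = "\<lambda>x. spos s (u x)" and ?q = "\<lambda>x. spos s (u x) - u x" and ?L = "lambda1 \<omega> 0"
  have L0: "0 \<le> ?L" by (rule lambda1_nonneg[OF \<omega>(1,3)])
  have p: "?p \<in> rtest \<omega>" by (rule spos_rtest[OF s u])
  have q: "?q \<in> rtest \<omega>" by (rule rtest_diff[OF p u])
  define \<rho> where "\<rho> x = (1 + u x / sqrt ((u x)\<^sup>2 + s\<^sup>2)) / 2" for x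
  have r: "0 \<le> \<rho> x" "\<rho> x \<le> 1" for x
  proof -
    have pos: "0 < sqrt ((u x)\<^sup>2 + s\<^sup>2)" using s by (simp add: add_nonneg_pos)
    have "\<bar>u x\<bar> \<le> sqrt ((u x)\<^sup>2 + s\<^sup>2)" by (simp add: real_le_rsqrt)
    then have "\<bar>u x / sqrt ((u x)\<^sup>2 + s\<^sup>2)\<bar> \<le> 1" using pos by (simp add: abs_divide divide_le_eq)
    then have "- 1 \<le> u x / sqrt ((u x)\<^sup>2 + s\<^sup>2)" "u x / sqrt ((u x)\<^sup>2 + s\<^sup>2) \<le> 1" by linarith+
    then show "0 \<le> \<rho> x" "\<rho> x \<le> 1" unfolding \<rho>_def by auto
  qed
  have gp: "gr ?p x = \<rho> x *\<^sub>R gr u x" for x unfolding \<rho>_def by (rule spos_rtest(2)[OF s u])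
  have gq: "gr ?q x = (\<rho> x - 1) *\<^sub>R gr u x" for x
    using gr_diff[OF rtest_smooth[OF p] rtest_smooth[OF u]] by (simp add: gp algebra_simps)
  have pt: "(norm (gr ?p x))\<^sup>2 + (norm (gr ?q x))\<^sup>2 \<le> (norm (gr u x))\<^sup>2" for x
  proof -
    have "(\<rho> x)\<^sup>2 + (\<rho> x - 1)\<^sup>2 \<le> 1"
      using mult_nonneg_nonneg[OF r(1)[of x], of "1 - \<rho> x"] r(2)[of x] by (simp add: power2_eq_square algebra_simps)
    then have "((\<rho> x)\<^sup>2 + (\<rho> x - 1)\<^sup>2) * (norm (gr u x))\<^sup>2 \<le> 1 * (norm (gr u x))\<^sup>2" by (intro mult_right_mono) auto
    then show ?thesis by (simp add: gp gq power_mult_distrib distrib_right)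
  qed
  note ci = cc_integrable[OF rtest_norm_gr_cc[OF p]] cc_integrable[OF rtest_norm_gr_cc[OF q]] cc_integrable[OF rtest_norm_gr_cc[OF u]]
  have D: "dirichlet ?p + dirichlet ?q \<le> dirichlet u"
    using integral_mono[OF Bochner_Integration.integrable_add[OF ci(1,2)] ci(3) pt]
    by (simp add: Bochner_Integration.integral_add ci)
  then show "dirichlet ?p \<le> dirichlet u" using dirichlet_nonneg[of ?q] by linarith
  have "ip u u - ip ?p ?p - ip ?q ?q \<le> s * (\<integral>x. \<bar>u x\<bar> \<partial>lborel)"
  proof -
    have cs: "(\<lambda>x. u x * u x) \<in> cc" "(\<lambda>x. ?p x * ?p x) \<in> cc" "(\<lambda>x. ?q x * ?q x) \<in> cc"
      by (intro cc_mult rtest_cc[OF u] rtest_cc[OF p] rtest_cc[OF q])+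
    have "ip u u - ip ?p ?p - ip ?q ?q = (\<integral>x. u x * u x - ?p x * ?p x - ?q x * ?q x \<partial>lborel)"
      unfolding ip_def using cs[THEN cc_integrable] by (simp add: Bochner_Integration.integral_diff)
    also have "\<dots> \<le> (\<integral>x. s * \<bar>u x\<bar> \<partial>lborel)"
    proof (rule integral_mono)
      show "integrable lborel (\<lambda>x. u x * u x - ?p x * ?p x - ?q x * ?q x)"
        by (intro cc_integrable cc_diff cs)
      show "integrable lborel (\<lambda>x. s * \<bar>u x\<bar>)" by (intro integrable_mult_right integrable_abs cc_integrable rtest_cc[OF u])
      fix x
      define e where "e = ?p x - max (u x) 0"
      have e: "- s / 2 \<le> e" "e \<le> 0" using spos_approx[OF s, of "u x"] by (auto simp: e_def)
      have "u x * u x - ?p x * ?p x - ?q x * ?q x = - 2 * e * \<bar>u x\<bar> - 2 * e * e"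
        by (auto simp: e_def max_def abs_if algebra_simps)
      also have "\<dots> \<le> - 2 * e * \<bar>u x\<bar>" by simp
      also have "\<dots> \<le> s * \<bar>u x\<bar>" using e by (intro mult_right_mono) auto
      finally show "u x * u x - ?p x * ?p x - ?q x * ?q x \<le> s * \<bar>u x\<bar>" .
    qed
    finally show ?thesis by simp
  qed
  also have "\<dots> \<le> s * (ip u u + measure lborel \<omega>)"
    using L1_le_L2[OF \<omega>(1,2) u] s by (intro mult_left_mono) auto
  finally have "?L * (ip u u - ip ?p ?p - ip ?q ?q) \<le> ?L * (s * (ip u u + measure lborel \<omega>))"
    using L0 by (rule mult_left_mono)
  moreover have "0 \<le> excess \<omega> ?q" by (rule excess_nonneg[OF \<omega>(1) q])
  ultimately show "excess \<omega> ?p \<le> excess \<omega> u + ?L * (s * (ip u u + measure lborel \<omega>))"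
    using D by (simp add: excess_def algebra_simps)
qed

text \<open>The smoothed positive parts of a minimizing sequence form a minimizing sequence for the positive
  part of the limit. The logarithmic estimate gives the alternative on small balls, and connectedness
  spreads it over \<open>\<omega>\<close>.\<close>

lemma minimizing_half_sign:
  assumes \<omega>: "open \<omega>" "bounded \<omega>" "connected \<omega>" "\<omega> \<noteq> {}" and u: "\<And>n. u n \<in> rtest \<omega>"
    and K: "\<And>n. ip (u n) (u n) \<le> K" and ex: "(\<lambda>n. excess \<omega> (u n)) \<longlonglongrightarrow> 0"
    and w: "w \<in> borel_measurable borel" "AE x in lborel. (\<lambda>n. u n x) \<longlonglongrightarrow> w x"
  shows "(AE x in lborel. x \<in> \<omega> \<longrightarrow> w x \<le> 0) \<or> (AE x in lborel. x \<in> \<omega> \<longrightarrow> 0 < w x)"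
proof -
  let ?L = "lambda1 \<omega> 0"
  have L0: "0 \<le> ?L" by (rule lambda1_nonneg[OF \<omega>(1,4)])
  define s where "s n = 1 / real (Suc n)" for n
  have s: "s n > 0" for n by (simp add: s_def)
  have s0: "s \<longlonglongrightarrow> 0" unfolding s_def by (rule LIMSEQ_Suc[OF lim_1_over_n])
  define p where "p n = (\<lambda>x. spos (s n) (u n x))" for n
  have p: "p n \<in> rtest \<omega>" for n unfolding p_def by (rule spos_rtest(1)[OF s u])
  have K0: "0 \<le> K" using K[of 0] ip_nonneg[of "u 0"] by linarith
  have exp: "(\<lambda>n. excess \<omega> (p n)) \<longlonglongrightarrow> 0"
  proof (rule tendsto_sandwich[OF _ _ tendsto_const])
    show "\<forall>\<^sub>F n in sequentially. 0 \<le> excess \<omega> (p n)" using excess_nonneg[OF \<omega>(1) p] by simp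
    show "\<forall>\<^sub>F n in sequentially. excess \<omega> (p n) \<le> excess \<omega> (u n) + ?L * (s n * (K + measure lborel \<omega>))"
    proof (intro always_eventually allI)
      fix n
      have "?L * (s n * (ip (u n) (u n) + measure lborel \<omega>)) \<le> ?L * (s n * (K + measure lborel \<omega>))"
        using L0 s[of n] K[of n] by (intro mult_left_mono) auto
      then show "excess \<omega> (p n) \<le> excess \<omega> (u n) + ?L * (s n * (K + measure lborel \<omega>))"
        using spos_excess(1)[OF \<omega>(1,2,4) s[of n] u[of n]] unfolding p_def by linarith
    qed
    have "(\<lambda>n. excess \<omega> (u n) + ?L * (s n * (K + measure lborel \<omega>))) \<longlonglongrightarrow> 0 + ?L * (0 * (K + measure lborel \<omega>))"
      by (intro tendsto_intros ex s0)
    then show "(\<lambda>n. excess \<omega> (u n) + ?L * (s n * (K + measure lborel \<omega>))) \<longlonglongrightarrow> 0" by simp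
  qed
  obtain B where B: "\<And>n. excess \<omega> (u n) \<le> B"
    using convergent_imp_Bseq[OF convergentI[OF ex]] by (auto simp: Bseq_def) (metis abs_le_D1)
  have D: "dirichlet (p n) \<le> B + ?L * K" for n
  proof -
    have "dirichlet (p n) \<le> dirichlet (u n)" unfolding p_def by (rule spos_excess(2)[OF \<omega>(1,2,4) s u])
    also have "\<dots> = excess \<omega> (u n) + ?L * ip (u n) (u n)" by (simp add: excess_def)
    also have "\<dots> \<le> B + ?L * K" using B K L0 by (intro add_mono mult_left_mono) auto
    finally show ?thesis .
  qed
  have low: "- s n \<le> p n x" for n x using spos_approx(1)[OF s[of n], of "u n x"] s[of n] by (simp add: p_def)
  \<comment> \<open>The limit of the smoothed positive parts.\<close>
  define w' where "w' x = max (w x) 0" for x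
  have w'm: "w' \<in> borel_measurable borel" unfolding w'_def using w(1) by measurable
  have w'0: "0 \<le> w' x" for x by (simp add: w'_def)
  have w'lim: "AE x in lborel. (\<lambda>n. p n x) \<longlonglongrightarrow> w' x"
    using w(2)
  proof eventually_elim
    fix x assume x: "(\<lambda>n. u n x) \<longlonglongrightarrow> w x"
    show "(\<lambda>n. p n x) \<longlonglongrightarrow> w' x"
    proof (rule tendsto_sandwich)
      show "\<forall>\<^sub>F n in sequentially. max (u n x) 0 - s n / 2 \<le> p n x" "\<forall>\<^sub>F n in sequentially. p n x \<le> max (u n x) 0"
        using spos_approx[OF s] by (auto simp: p_def)
      have "(\<lambda>n. max (u n x) 0 - s n / 2) \<longlonglongrightarrow> max (w x) 0 - 0 / 2" by (intro tendsto_intros x s0) simp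
      then show "(\<lambda>n. max (u n x) 0 - s n / 2) \<longlonglongrightarrow> w' x" by (simp add: w'_def)
      show "(\<lambda>n. max (u n x) 0) \<longlonglongrightarrow> w' x" unfolding w'_def by (intro tendsto_intros x)
    qed
  qed
  have "(AE x in lborel. x \<in> \<omega> \<longrightarrow> w' x = 0) \<or> (AE x in lborel. x \<in> \<omega> \<longrightarrow> 0 < w' x)"
  proof (rule connected_dichotomy[OF \<omega>(3)])
    fix q assume "q \<in> \<omega>"
    then obtain l h where lh: "cbox l h \<subseteq> \<omega>" "q \<in> box l h"
      by (rule open_contains_cbox[OF \<omega>(1)]) blast
    obtain r where r: "r > 0" "cball q r \<subseteq> box l h"
      using open_contains_cball[of "box l h"] lh(2) by auto
    have b: "bump l h \<in> rtest \<omega>" by (rule rtest_bump[OF lh(1)])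
    have "continuous_on (cball q r) (bump l h)" by (rule smooth_continuous[OF smooth_bump])
    then obtain z where z: "z \<in> cball q r" "\<And>y. y \<in> cball q r \<Longrightarrow> bump l h z \<le> bump l h y"
      using continuous_attains_inf[of "cball q r" "bump l h"] r(1) by auto
    have c: "0 < bump l h z" using z(1) r(2) bump_pos_iff by blast
    have dist: "norm (x - y) \<le> 2 * r" if "x \<in> ball q r" "y \<in> ball q r" for x y
      using that dist_triangle2[of x y q] by (simp add: dist_norm[symmetric] dist_commute)
    obtain C where "\<And>\<delta>. \<delta> > 0 \<Longrightarrow> (\<integral>\<^sup>+x. \<integral>\<^sup>+y. indicator (ball q r) x * indicator (ball q r) y * ennreal ((ln (w' x + \<delta>) - ln (w' y + \<delta>))\<^sup>2) \<partial>lborel \<partial>lborel) \<le> ennreal C"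
      by (rule log_oscillation[OF \<omega>(1,4) p s0 low exp D w'lim w'm w'0 convex_ball _ dist emeasure_lborel_ball_finite b c])
        (use z(2) in auto)
    from log_oscillation_dichotomy[OF w'm w'0 _ this]
    show "\<exists>Q. open Q \<and> q \<in> Q \<and> ((AE x in lborel. x \<in> Q \<longrightarrow> w' x = 0) \<or> (AE x in lborel. x \<in> Q \<longrightarrow> 0 < w' x))"
      using r(1) by (intro exI[of _ "ball q r"]) auto
  qed auto
  then show ?thesis
    by (rule disj_forward) (auto elim!: eventually_mono simp: w'_def max_def split: if_splits)
qed

text \<open>The two one-sided statements, for \<open>u\<close> and for \<open>- u\<close>, leave only these possibilities.\<close>

lemma minimizing_limit_sign:
  assumes \<omega>: "open \<omega>" "bounded \<omega>" "connected \<omega>" "\<omega> \<noteq> {}" and u: "\<And>n. u n \<in> rtest \<omega>"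
    and K: "\<And>n. ip (u n) (u n) \<le> K" and ex: "(\<lambda>n. excess \<omega> (u n)) \<longlonglongrightarrow> 0"
    and w: "w \<in> borel_measurable borel" "AE x in lborel. (\<lambda>n. u n x) \<longlonglongrightarrow> w x"
  shows "(AE x in lborel. x \<in> \<omega> \<longrightarrow> w x = 0) \<or> (AE x in lborel. x \<in> \<omega> \<longrightarrow> 0 < w x) \<or> (AE x in lborel. x \<in> \<omega> \<longrightarrow> w x < 0)"
proof -
  let ?v = "\<lambda>n x. - 1 * u n x"
  have v: "?v n \<in> rtest \<omega>" for n by (rule rtest_cmult[OF u])
  have ipv: "ip (?v n) (?v n) = ip (u n) (u n)" for n by (simp add: ip_def)
  have grv: "gr (?v n) x = - gr (u n) x" for n x using gr_cmult[OF rtest_smooth[OF u], of "-1" n x] by simp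
  have exv: "excess \<omega> (?v n) = excess \<omega> (u n)" for n unfolding excess_def ipv grv by simp
  have neg: "(AE x in lborel. x \<in> \<omega> \<longrightarrow> - w x \<le> 0) \<or> (AE x in lborel. x \<in> \<omega> \<longrightarrow> 0 < - w x)"
  proof (rule minimizing_half_sign[OF \<omega> v])
    show "ip (?v n) (?v n) \<le> K" for n unfolding ipv by (rule K)
    show "(\<lambda>n. excess \<omega> (?v n)) \<longlonglongrightarrow> 0" unfolding exv by (rule ex)
    show "(\<lambda>x. - w x) \<in> borel_measurable borel" using w(1) by measurable
    show "AE x in lborel. (\<lambda>n. - 1 * u n x) \<longlonglongrightarrow> - w x" using w(2) by eventually_elim (auto intro: tendsto_minus)
  qed
  have zero: "AE x in lborel. x \<in> \<omega> \<longrightarrow> w x = 0"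
    if "AE x in lborel. x \<in> \<omega> \<longrightarrow> - w x \<le> 0" "AE x in lborel. x \<in> \<omega> \<longrightarrow> w x \<le> 0"
    using that by eventually_elim auto
  show ?thesis
    using neg minimizing_half_sign[OF \<omega> u K ex w] zero by (elim disjE) simp_all
qed

section \<open>The spectral gap of the cross-section\<close>

lemma L2_limit_nonzero:
  fixes w :: "'a::euclidean_space \<Rightarrow> real"
  assumes "\<And>x. x \<notin> \<omega> \<Longrightarrow> w x = 0" "(\<integral>x. (w x)\<^sup>2 \<partial>lborel) = 1"
  shows "\<not> (AE x in lborel. x \<in> \<omega> \<longrightarrow> w x = 0)"
proof
  assume "AE x in lborel. x \<in> \<omega> \<longrightarrow> w x = 0"
  then have "AE x in lborel. (w x)\<^sup>2 = 0" by eventually_elim (use assms(1) in auto)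
  then have "(\<integral>x. (w x)\<^sup>2 \<partial>lborel) = 0" by (rule integral_eq_zero_AE)
  then show False using assms(2) by simp
qed

text \<open>Otherwise two orthonormal minimizing sequences converge, by compactness, to orthogonal limits that
  both have a constant sign on \<open>\<omega>\<close>. Formulated for pairs of orthonormal functions, the gap does not refer
  to eigenfunctions.\<close>

lemma spectral_gap:
  assumes \<omega>: "open \<omega>" "bounded \<omega>" "connected \<omega>" "\<omega> \<noteq> {}"
  obtains \<delta> where "\<delta> > 0" "\<And>u v. u \<in> rtest \<omega> \<Longrightarrow> v \<in> rtest \<omega> \<Longrightarrow> ip u u = 1 \<Longrightarrow> ip v v = 1 \<Longrightarrow> ip u v = 0
     \<Longrightarrow> 2 * lambda1 \<omega> 0 + \<delta> \<le> dirichlet u + dirichlet v"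
proof (rule ccontr)
  let ?L = "lambda1 \<omega> 0"
  assume no: "\<not> thesis"
  have "\<exists>u v. u \<in> rtest \<omega> \<and> v \<in> rtest \<omega> \<and> ip u u = 1 \<and> ip v v = 1 \<and> ip u v = 0 \<and>
      dirichlet u + dirichlet v < 2 * ?L + 1 / real (Suc n)" for n
  proof (rule ccontr)
    assume "\<not> ?thesis"
    then show False using no that[of "1 / real (Suc n)"] by (smt (verit) divide_pos_pos of_nat_0_less_iff zero_less_Suc)
  qed
  then obtain u v where uv: "\<And>n. u n \<in> rtest \<omega>" "\<And>n. v n \<in> rtest \<omega>" "\<And>n. ip (u n) (u n) = 1" "\<And>n. ip (v n) (v n) = 1"
    "\<And>n. ip (u n) (v n) = 0" and less: "\<And>n. dirichlet (u n) + dirichlet (v n) < 2 * ?L + 1 / real (Suc n)" by metis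
  have ex: "0 \<le> excess \<omega> (u n)" "0 \<le> excess \<omega> (v n)" "excess \<omega> (u n) \<le> 1 / real (Suc n)" "excess \<omega> (v n) \<le> 1 / real (Suc n)" for n
    using excess_nonneg[OF \<omega>(1) uv(1)[of n]] excess_nonneg[OF \<omega>(1) uv(2)[of n]] less[of n]
    by (simp_all add: excess_def uv)
  have l0: "(\<lambda>n. 1 / real (Suc n)) \<longlonglongrightarrow> 0" by (rule LIMSEQ_Suc[OF lim_1_over_n])
  have exu: "(\<lambda>n. excess \<omega> (u n)) \<longlonglongrightarrow> 0" "(\<lambda>n. excess \<omega> (v n)) \<longlonglongrightarrow> 0"
    using ex by (auto intro!: tendsto_sandwich[OF _ _ tendsto_const l0] always_eventually)
  define K where "K = \<bar>?L\<bar> + 1"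
  have le1: "1 / real (Suc n) \<le> 1" for n by simp
  have KD: "dirichlet (u n) \<le> K" "dirichlet (v n) \<le> K" "ip (u n) (u n) \<le> K" "ip (v n) (v n) \<le> K" for n
    using ex(3,4)[of n] le1[of n] unfolding excess_def uv K_def by linarith+
  obtain r w where r: "strict_mono r" "\<And>x. x \<notin> \<omega> \<Longrightarrow> w x = 0" "L2_limit (\<lambda>n. u (r n)) w"
    by (rule rellich[of \<omega> u K, OF \<omega>(2,1) uv(1) KD(3,1)]) blast
  obtain s z where s: "strict_mono s" "\<And>x. x \<notin> \<omega> \<Longrightarrow> z x = 0" "L2_limit (\<lambda>n. v (r (s n))) z"
    by (rule rellich[of \<omega> "\<lambda>n. v (r n)" K, OF \<omega>(2,1) uv(2) KD(4,2)]) blast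
  have w: "L2_limit (\<lambda>n. u (r (s n))) w" using L2_limit_subseq[OF r(3) s(1)] .
  have rs: "strict_mono (\<lambda>n. r (s n))" using r(1) s(1) by (simp add: strict_mono_def)
  have sub: "X \<longlonglongrightarrow> 0 \<Longrightarrow> (\<lambda>n. X (r (s n))) \<longlonglongrightarrow> 0" for X :: "nat \<Rightarrow> real"
    using LIMSEQ_subseq_LIMSEQ[OF _ rs, of X] by (simp add: o_def)
  have cc: "u n \<in> cc" "v n \<in> cc" for n using uv by (auto intro: rtest_cc)
  have w1: "(\<integral>x. (w x)\<^sup>2 \<partial>lborel) = 1" and z1: "(\<integral>x. (z x)\<^sup>2 \<partial>lborel) = 1" and wz0: "(\<integral>x. w x * z x \<partial>lborel) = 0"
    using L2_limit_norm[OF cc(1) w] L2_limit_norm[OF cc(2) s(3)] L2_limit_inner(1)[OF cc w s(3)]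
    by (simp_all add: uv LIMSEQ_const_iff)
  have wzi: "integrable lborel (\<lambda>x. w x * z x)" by (rule L2_limit_inner(2)[OF cc w s(3)])
  have signs: "(AE x in lborel. x \<in> \<omega> \<longrightarrow> 0 < y x) \<or> (AE x in lborel. x \<in> \<omega> \<longrightarrow> y x < 0)"
    if q: "\<And>n. q n \<in> rtest \<omega>" "\<And>n. ip (q n) (q n) = 1" "(\<lambda>n. excess \<omega> (q n)) \<longlonglongrightarrow> 0" "L2_limit q y"
      "\<And>x. x \<notin> \<omega> \<Longrightarrow> y x = 0" "(\<integral>x. (y x)\<^sup>2 \<partial>lborel) = 1" for q y
    using minimizing_limit_sign[of \<omega> q 1 y, OF \<omega> q(1)] L2_limit_nonzero[of \<omega> y] q by (auto simp: L2_limit_def)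
  have sw: "(AE x in lborel. x \<in> \<omega> \<longrightarrow> 0 < w x) \<or> (AE x in lborel. x \<in> \<omega> \<longrightarrow> w x < 0)"
    by (rule signs[of "\<lambda>n. u (r (s n))" w]) (use uv sub[OF exu(1)] w r(2) w1 in auto)
  have sz: "(AE x in lborel. x \<in> \<omega> \<longrightarrow> 0 < z x) \<or> (AE x in lborel. x \<in> \<omega> \<longrightarrow> z x < 0)"
    by (rule signs[of "\<lambda>n. v (r (s n))" z]) (use uv sub[OF exu(2)] s z1 in auto)
  have "\<exists>c. AE x in lborel. x \<in> \<omega> \<longrightarrow> 0 < c * (w x * z x)"
    using sw sz
  proof (elim disjE)
    assume "AE x in lborel. x \<in> \<omega> \<longrightarrow> 0 < w x" "AE x in lborel. x \<in> \<omega> \<longrightarrow> 0 < z x"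
    then have "AE x in lborel. x \<in> \<omega> \<longrightarrow> 0 < 1 * (w x * z x)" by eventually_elim auto
    then show ?thesis by blast
  next
    assume "AE x in lborel. x \<in> \<omega> \<longrightarrow> 0 < w x" "AE x in lborel. x \<in> \<omega> \<longrightarrow> z x < 0"
    then have "AE x in lborel. x \<in> \<omega> \<longrightarrow> 0 < - 1 * (w x * z x)" by eventually_elim (auto simp: mult_less_0_iff)
    then show ?thesis by blast
  next
    assume "AE x in lborel. x \<in> \<omega> \<longrightarrow> w x < 0" "AE x in lborel. x \<in> \<omega> \<longrightarrow> 0 < z x"
    then have "AE x in lborel. x \<in> \<omega> \<longrightarrow> 0 < - 1 * (w x * z x)" by eventually_elim (auto simp: mult_less_0_iff)
    then show ?thesis by blast
  next
    assume "AE x in lborel. x \<in> \<omega> \<longrightarrow> w x < 0" "AE x in lborel. x \<in> \<omega> \<longrightarrow> z x < 0"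
    then have "AE x in lborel. x \<in> \<omega> \<longrightarrow> 0 < 1 * (w x * z x)" by eventually_elim (auto simp: zero_less_mult_iff)
    then show ?thesis by blast
  qed
  then obtain c where c: "AE x in lborel. x \<in> \<omega> \<longrightarrow> 0 < c * (w x * z x)" by blast
  have nn: "AE x in lborel. 0 \<le> c * (w x * z x)" using c
  proof eventually_elim
    fix x assume "x \<in> \<omega> \<longrightarrow> 0 < c * (w x * z x)"
    then show "0 \<le> c * (w x * z x)" using r(2)[of x] by (cases "x \<in> \<omega>") auto
  qed
  have "(\<integral>x. c * (w x * z x) \<partial>lborel) = 0" using wz0 by simp
  then have "AE x in lborel. c * (w x * z x) = 0"
    using integral_nonneg_eq_0_iff_AE[OF integrable_mult_right[OF wzi] nn] by simp
  with c have "AE x in lborel. x \<in> \<omega> \<longrightarrow> w x = 0" by eventually_elim auto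
  then show False using L2_limit_nonzero[of \<omega> w] r(2) w1 by blast
qed

section \<open>The ground state is not rotationally symmetric\<close>

lemma Ck_continuous: "Ck_on k UNIV f \<Longrightarrow> continuous_on UNIV f"
proof (induction k)
  case (Suc k)
  then show ?case using Ck_Suc_D by blast
qed simp

text \<open>Near a boundary point the set lies on one side of a graph, so the exterior comes arbitrarily close to
  that point, which is therefore not interior to the closure. This makes \<open>\<omega>\<close> recoverable from the
  same set up to null sets.\<close>

lemma Ck_boundary_regular:
  assumes b: "Ck_boundary k \<omega>" and o: "open \<omega>"
  shows "interior (closure \<omega>) \<subseteq> \<omega>"
proof
  fix p assume p: "p \<in> interior (closure \<omega>)"
  show "p \<in> \<omega>"
  proof (rule ccontr)
    assume pn: "p \<notin> \<omega>"
    then have fr: "p \<in> frontier \<omega>" using p o interior_subset by (auto simp: frontier_def interior_open)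
    from b[unfolded Ck_boundary_def, rule_format, OF fr] obtain r u v \<gamma> where r: "r > 0" "norm u = 1" "norm v = 1" "u \<bullet> v = 0" "Ck_on k UNIV \<gamma>"
      "\<omega> \<inter> ball p r = {x \<in> ball p r. \<gamma> (u \<bullet> x) < v \<bullet> x}"
      by blast
    define A where "A = ball p r \<inter> {x. v \<bullet> x < \<gamma> (u \<bullet> x)}"
    have "continuous_on UNIV (\<lambda>x. \<gamma> (u \<bullet> x))"
      by (intro continuous_on_compose2[OF Ck_continuous[OF r(5)]] continuous_intros) auto
    then have "open {x. v \<bullet> x < \<gamma> (u \<bullet> x)}" by (intro open_Collect_less continuous_intros)
    then have oA: "open A" by (simp add: A_def open_Int)
    have "\<gamma> (u \<bullet> x) < v \<bullet> x" if "x \<in> \<omega>" "x \<in> ball p r" for x using r(6) that by blast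
    then have "A \<inter> \<omega> = {}" unfolding A_def by fastforce
    then have dis: "A \<inter> closure \<omega> = {}" using oA open_Int_closure_eq_empty by blast
    obtain e where e: "e > 0" "ball p e \<subseteq> interior (closure \<omega>)" using p open_interior openE by blast
    define s where "s = min e r / 2"
    have s: "0 < s" "s < e" "s < r" using e(1) r(1) by (auto simp: s_def)
    let ?x = "p - s *\<^sub>R v"
    have "\<not> \<gamma> (u \<bullet> p) < v \<bullet> p"
    proof
      assume "\<gamma> (u \<bullet> p) < v \<bullet> p"
      then have "p \<in> \<omega> \<inter> ball p r" unfolding r(6) using r(1) by simp
      then show False using pn by simp
    qed
    moreover have "u \<bullet> ?x = u \<bullet> p" "v \<bullet> ?x = v \<bullet> p - s"
      using r by (auto simp: inner_diff_right dot_square_norm)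
    moreover have "?x \<in> ball p r" "?x \<in> ball p e" using r(3) s by (auto simp: dist_norm)
    moreover have "?x \<in> closure \<omega>" using \<open>?x \<in> ball p e\<close> e(2) interior_subset by blast
    ultimately have "?x \<in> A" "?x \<in> closure \<omega>" using s by (auto simp: A_def)
    then show False using dis by blast
  qed
qed

lemma AE_Rot:
  assumes "AE x in lborel. P x" shows "AE x in lborel. P (Rot a x)"
proof (rule AE_distrD[where f="Rot a" and P=P and M'=borel])
  show "Rot a \<in> lborel \<rightarrow>\<^sub>M borel" by simp
  show "AE x in distr lborel borel (Rot a). P x" unfolding lborel_Rot by (rule assms)
qed

lemma AE_open_closure:
  fixes W \<omega> :: "'a::euclidean_space set"
  assumes "open W" "AE x in lborel. x \<in> W \<longrightarrow> x \<in> \<omega>" shows "W \<subseteq> closure \<omega>"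
proof -
  have "AE x in lborel. x \<in> - (W - closure \<omega>)" using assms(2) by eventually_elim (use closure_subset in auto)
  then have "AE x in lebesgue. x \<in> - (W - closure \<omega>)" by (rule AE_completion)
  moreover have "closed (- (W - closure \<omega>))" using assms(1) by (intro closed_Compl open_Diff) auto
  ultimately show ?thesis using mem_closed_if_AE_lebesgue by blast
qed

text \<open>Otherwise a minimizing sequence with angular derivatives tending to zero has a limit that is
  invariant under all rotations and nonzero exactly on \<open>\<omega>\<close>, up to null sets. Then each rotated copy of \<open>\<omega>\<close>
  is contained in \<open>\<omega>\<close> up to a null set, hence in the interior of its closure, hence in \<open>\<omega>\<close>.\<close>

lemma angular_derivative_lower_bound:
  assumes \<omega>: "open \<omega>" "bounded \<omega>" "connected \<omega>" "\<omega> \<noteq> {}"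
    and reg: "interior (closure \<omega>) \<subseteq> \<omega>" and nr: "\<not> rotationally_invariant \<omega>"
  obtains d where "d > 0" "\<And>u. u \<in> rtest \<omega> \<Longrightarrow> ip u u = 1 \<Longrightarrow> dirichlet u \<le> lambda1 \<omega> 0 + d \<Longrightarrow> d \<le> ip (tau u) (tau u)"
proof (rule ccontr)
  let ?L = "lambda1 \<omega> 0"
  assume no: "\<not> thesis"
  have "\<exists>u. u \<in> rtest \<omega> \<and> ip u u = 1 \<and> dirichlet u \<le> ?L + 1 / real (Suc n) \<and> ip (tau u) (tau u) < 1 / real (Suc n)" for n
  proof (rule ccontr)
    assume "\<not> ?thesis"
    then show False using no that[of "1 / real (Suc n)"] by (smt (verit) divide_pos_pos of_nat_0_less_iff zero_less_Suc)
  qed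
  then obtain u where u: "\<And>n. u n \<in> rtest \<omega>" "\<And>n. ip (u n) (u n) = 1" "\<And>n. dirichlet (u n) \<le> ?L + 1 / real (Suc n)"
    "\<And>n. ip (tau (u n)) (tau (u n)) < 1 / real (Suc n)" by metis
  have l0: "(\<lambda>n. 1 / real (Suc n)) \<longlonglongrightarrow> 0" by (rule LIMSEQ_Suc[OF lim_1_over_n])
  have ex: "0 \<le> excess \<omega> (u n)" "excess \<omega> (u n) \<le> 1 / real (Suc n)" for n
    using excess_nonneg[OF \<omega>(1) u(1)[of n]] u(3)[of n] by (simp_all add: excess_def u(2))
  have exu: "(\<lambda>n. excess \<omega> (u n)) \<longlonglongrightarrow> 0"
    using ex by (auto intro!: tendsto_sandwich[OF _ _ tendsto_const l0] always_eventually)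
  define K where "K = \<bar>?L\<bar> + 1"
  have le1: "1 / real (Suc n) \<le> 1" for n by simp
  have KD: "dirichlet (u n) \<le> K" "ip (u n) (u n) \<le> K" for n
    using u(3)[of n] le1[of n] unfolding u(2) K_def by linarith+
  obtain r w where r: "strict_mono r" "\<And>x. x \<notin> \<omega> \<Longrightarrow> w x = 0" "L2_limit (\<lambda>n. u (r n)) w"
    by (rule rellich[of \<omega> u K, OF \<omega>(2,1) u(1) KD(2,1)]) blast
  have sub: "X \<longlonglongrightarrow> 0 \<Longrightarrow> (\<lambda>n. X (r n)) \<longlonglongrightarrow> 0" for X :: "nat \<Rightarrow> real"
    using LIMSEQ_subseq_LIMSEQ[OF _ r(1), of X] by (simp add: o_def)
  have cc: "u n \<in> cc" for n using u by (auto intro: rtest_cc)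
  have [measurable]: "u n \<in> borel_measurable borel" for n by (rule cc_borel[OF cc])
  have w1: "(\<integral>x. (w x)\<^sup>2 \<partial>lborel) = 1"
    using L2_limit_norm[OF cc r(3)] by (simp add: u(2) LIMSEQ_const_iff)
  have wae: "AE x in lborel. (\<lambda>n. u (r n) x) \<longlonglongrightarrow> w x" and wm[measurable]: "w \<in> borel_measurable borel"
    using r(3) by (auto simp: L2_limit_def)
  have nz: "AE x in lborel. x \<in> \<omega> \<longrightarrow> w x \<noteq> 0"
  proof -
    have "\<not> (AE x in lborel. x \<in> \<omega> \<longrightarrow> w x = 0)" by (rule L2_limit_nonzero[OF r(2) w1])
    moreover have "(AE x in lborel. x \<in> \<omega> \<longrightarrow> w x = 0) \<or> (AE x in lborel. x \<in> \<omega> \<longrightarrow> 0 < w x) \<or> (AE x in lborel. x \<in> \<omega> \<longrightarrow> w x < 0)"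
      by (rule minimizing_limit_sign[of \<omega> "\<lambda>n. u (r n)" 1 w, OF \<omega> u(1) _ sub[OF exu] wm wae]) (simp add: u(2))
    ultimately consider "AE x in lborel. x \<in> \<omega> \<longrightarrow> 0 < w x" | "AE x in lborel. x \<in> \<omega> \<longrightarrow> w x < 0" by blast
    then show ?thesis by cases (rule eventually_mono, assumption, force)+
  qed
  have inv: "AE x in lborel. w (Rot a x) = w x" if a: "a \<ge> 0" for a
  proof -
    have "AE x in lborel. ennreal ((w (Rot a x) - w x)\<^sup>2) = liminf (\<lambda>n. ennreal ((u (r n) (Rot a x) - u (r n) x)\<^sup>2))"
      using wae AE_Rot[OF wae, of a]
    proof eventually_elim
      fix x assume "(\<lambda>n. u (r n) x) \<longlonglongrightarrow> w x" "(\<lambda>n. u (r n) (Rot a x)) \<longlonglongrightarrow> w (Rot a x)"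
      then have "(\<lambda>n. ennreal ((u (r n) (Rot a x) - u (r n) x)\<^sup>2)) \<longlonglongrightarrow> ennreal ((w (Rot a x) - w x)\<^sup>2)"
        by (intro tendsto_ennrealI tendsto_intros)
      then show "ennreal ((w (Rot a x) - w x)\<^sup>2) = liminf (\<lambda>n. ennreal ((u (r n) (Rot a x) - u (r n) x)\<^sup>2))"
        by (rule lim_imp_Liminf[OF trivial_limit_sequentially, symmetric])
    qed
    then have "(\<integral>\<^sup>+x. ennreal ((w (Rot a x) - w x)\<^sup>2) \<partial>lborel) = (\<integral>\<^sup>+x. liminf (\<lambda>n. ennreal ((u (r n) (Rot a x) - u (r n) x)\<^sup>2)) \<partial>lborel)"
      by (rule nn_integral_cong_AE)
    also have "\<dots> \<le> liminf (\<lambda>n. \<integral>\<^sup>+x. ennreal ((u (r n) (Rot a x) - u (r n) x)\<^sup>2) \<partial>lborel)"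
      by (rule nn_integral_liminf) measurable
    also have "\<dots> \<le> liminf (\<lambda>n. ennreal (a\<^sup>2 * (1 / real (Suc (r n)))))"
    proof (rule Liminf_mono, intro always_eventually allI)
      fix n
      have "(\<integral>\<^sup>+x. ennreal ((u (r n) (Rot a x) - u (r n) x)\<^sup>2) \<partial>lborel) \<le> ennreal (a\<^sup>2 * ip (tau (u (r n))) (tau (u (r n))))"
        by (rule rotation_difference_bound[OF u(1) a])
      also have "\<dots> \<le> ennreal (a\<^sup>2 * (1 / real (Suc (r n))))"
        by (intro ennreal_leI mult_left_mono less_imp_le[OF u(4)]) simp
      finally show "(\<integral>\<^sup>+x. ennreal ((u (r n) (Rot a x) - u (r n) x)\<^sup>2) \<partial>lborel) \<le> ennreal (a\<^sup>2 * (1 / real (Suc (r n))))" .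
    qed
    also have "\<dots> = 0"
    proof (rule lim_imp_Liminf[OF trivial_limit_sequentially])
      have "(\<lambda>n. ennreal (a\<^sup>2 * (1 / real (Suc (r n))))) \<longlonglongrightarrow> ennreal (a\<^sup>2 * 0)"
        by (intro tendsto_ennrealI tendsto_mult tendsto_const sub[OF l0])
      then show "(\<lambda>n. ennreal (a\<^sup>2 * (1 / real (Suc (r n))))) \<longlonglongrightarrow> 0" by simp
    qed
    finally have "(\<integral>\<^sup>+x. ennreal ((w (Rot a x) - w x)\<^sup>2) \<partial>lborel) = 0" by simp
    then have "AE x in lborel. ennreal ((w (Rot a x) - w x)\<^sup>2) = 0"
      by (subst (asm) nn_integral_0_iff_AE) auto
    then show ?thesis by eventually_elim (simp add: ennreal_eq_0_iff)
  qed
  have pull_nonneg: "x \<in> \<omega>" if a: "a \<ge> 0" and x: "Rot a x \<in> \<omega>" for a x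
  proof -
    define W where "W = Rot a -` \<omega>"
    have oW: "open W" unfolding W_def using \<omega>(1) continuous_Rot[of UNIV a] by (rule open_vimage)
    have "AE x in lborel. x \<in> W \<longrightarrow> x \<in> \<omega>"
      using inv[OF a] AE_Rot[OF nz, of a]
    proof eventually_elim
      fix x assume "w (Rot a x) = w x" "Rot a x \<in> \<omega> \<longrightarrow> w (Rot a x) \<noteq> 0"
      then show "x \<in> W \<longrightarrow> x \<in> \<omega>" using r(2)[of x] by (auto simp: W_def)
    qed
    then have "W \<subseteq> closure \<omega>" by (rule AE_open_closure[OF oW])
    then have "W \<subseteq> interior (closure \<omega>)" using oW by (simp add: interior_maximal)
    then show ?thesis using x reg by (auto simp: W_def)
  qed
  \<comment> \<open>Every rotation has a nonnegative angle.\<close>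
  have periodic: "Rot (a + 2 * pi * of_int k) x = Rot a x" for a k x
  proof -
    have "cos (a + 2 * pi * of_int k) = cos a" "sin (a + 2 * pi * of_int k) = sin a"
      using cos_int_2pin[of k] sin_int_2pin[of k] by (simp_all add: cos_add sin_add)
    then show ?thesis by (simp add: vec2_eq_iff)
  qed
  have pull: "x \<in> \<omega>" if x: "Rot a x \<in> \<omega>" for a x
  proof -
    obtain n :: nat where n: "\<bar>a\<bar> < real n" using reals_Archimedean2 by blast
    have "real n * 1 \<le> real n * (2 * pi)" using pi_gt3 by (intro mult_left_mono) auto
    then have "0 \<le> a + 2 * pi * of_int (int n)" using n by (simp add: mult_ac)
    then show ?thesis using pull_nonneg[of "a + 2 * pi * of_int (int n)" x] x periodic[of a "int n" x] by simp
  qed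
  have "rotationally_invariant \<omega>"
    unfolding rotationally_invariant_def
  proof
    fix a :: real
    have mat: "vector [vector [cos a, sin a], vector [- sin a, cos a]] *v y = Rot a y" for y :: "real ^ 2"
      by (simp add: vec2_eq_iff matrix_vector_mult_def sum_2)
    have "Rot a y \<in> \<omega>" if "y \<in> \<omega>" for y
      using pull[of "- a" "Rot a y"] that by (simp add: Rot_Rot)
    moreover have "y \<in> Rot a ` \<omega>" if "y \<in> \<omega>" for y
      using pull[of a "Rot (- a) y"] that by (intro image_eqI[of _ _ "Rot (- a) y"]) (auto simp: Rot_Rot)
    ultimately show "(\<lambda>y. vector [vector [cos a, sin a], vector [- sin a, cos a]] *v y) ` \<omega> = \<omega>"
      unfolding mat by auto
  qed
  then show False using nr by blast
qed

section \<open>The twisted transverse form\<close>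

text \<open>The form of \<open>- \<Delta> - \<beta>\<^sup>2 \<partial>\<^sub>\<tau>\<^sup>2 - \<lambda>\<^sub>1\<close> on the cross-section.\<close>

definition transverse_form :: "(real ^ 2) set \<Rightarrow> real \<Rightarrow> (real ^ 2 \<Rightarrow> real) \<Rightarrow> real" where
  "transverse_form \<omega> \<beta> u = dirichlet u + \<beta>\<^sup>2 * ip (tau u) (tau u) - lambda1 \<omega> \<beta> * ip u u"

lemma transverse_form_nonneg:
  assumes "open \<omega>" "\<omega> \<noteq> {}" "u \<in> rtest \<omega>" shows "0 \<le> transverse_form \<omega> \<beta> u"
  using lambda1_le[OF assms, of \<beta>] by (simp add: transverse_form_def)

lemma gr_lincomb:
  "u \<in> rtest U \<Longrightarrow> v \<in> rtest U \<Longrightarrow> gr (\<lambda>x. s * u x + v x) x = s *\<^sub>R gr u x + gr v x"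
  by (subst gr_add[OF rtest_smooth[OF rtest_cmult] rtest_smooth]) (simp_all add: gr_cmult[OF rtest_smooth])

lemma tau_lincomb:
  "u \<in> rtest U \<Longrightarrow> v \<in> rtest U \<Longrightarrow> tau (\<lambda>x. s * u x + v x) = (\<lambda>x. s * tau u x + tau v x)"
  by (auto simp: tau_def gr_lincomb inner_add_left)

lemma transverse_form_lincomb:
  assumes u: "u \<in> rtest \<omega>" and v: "v \<in> rtest \<omega>"
  obtains b where "\<And>s. transverse_form \<omega> \<beta> (\<lambda>x. s * u x + v x) = s\<^sup>2 * transverse_form \<omega> \<beta> u + s * b + transverse_form \<omega> \<beta> v"
proof (rule that)
  fix s
  have g: "(norm (gr (\<lambda>x. s * u x + v x) x))\<^sup>2 = s\<^sup>2 * (norm (gr u x))\<^sup>2 + (2 * s * (gr u x \<bullet> gr v x) + (norm (gr v x))\<^sup>2)" for x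
    unfolding gr_lincomb[OF u v] power2_norm_eq_inner by (simp add: inner_add inner_commute power2_eq_square)
  have d: "dirichlet (\<lambda>x. s * u x + v x) = s\<^sup>2 * dirichlet u + (2 * s * (\<integral>x. gr u x \<bullet> gr v x \<partial>lborel) + dirichlet v)"
    unfolding g
    using cc_integrable[OF rtest_norm_gr_cc[OF u]] cc_integrable[OF rtest_norm_gr_cc[OF v]] cc_integrable[OF gr_gr_cc[OF u v]]
    by (simp add: Bochner_Integration.integral_add)
  have i: "ip (\<lambda>x. s * p x + q x) (\<lambda>x. s * p x + q x) = s\<^sup>2 * ip p p + (2 * s * ip p q + ip q q)"
    if "p \<in> cc" "q \<in> cc" for p q :: "real ^ 2 \<Rightarrow> real"
    using that by (simp add: ip_simps cc_intros ip_commute[of q p] power2_eq_square algebra_simps)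
  show "transverse_form \<omega> \<beta> (\<lambda>x. s * u x + v x) = s\<^sup>2 * transverse_form \<omega> \<beta> u
      + s * (2 * (\<integral>x. gr u x \<bullet> gr v x \<partial>lborel) + 2 * \<beta>\<^sup>2 * ip (tau u) (tau v) - 2 * lambda1 \<omega> \<beta> * ip u v) + transverse_form \<omega> \<beta> v"
    unfolding transverse_form_def tau_lincomb[OF u v] d i[OF rtest_cc[OF u] rtest_cc[OF v]] i[OF tau_cc[OF u] tau_cc[OF v]]
    by (simp add: algebra_simps)
qed

text \<open>The mixed term is bounded below by nonnegativity of the form at \<open>2 s u + v\<close>.\<close>

lemma transverse_form_sum_lower:
  assumes \<omega>: "open \<omega>" "\<omega> \<noteq> {}" and u: "u \<in> rtest \<omega>" and v: "v \<in> rtest \<omega>"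
  shows "transverse_form \<omega> \<beta> v / 2 - s\<^sup>2 * transverse_form \<omega> \<beta> u \<le> transverse_form \<omega> \<beta> (\<lambda>x. s * u x + v x)"
proof -
  obtain b where b: "\<And>s. transverse_form \<omega> \<beta> (\<lambda>x. s * u x + v x) = s\<^sup>2 * transverse_form \<omega> \<beta> u + s * b + transverse_form \<omega> \<beta> v"
    by (rule transverse_form_lincomb[OF u v]) blast
  have "0 \<le> transverse_form \<omega> \<beta> (\<lambda>x. (2 * s) * u x + v x)"
    by (intro transverse_form_nonneg \<omega> rtest_add rtest_cmult u v)
  then have "0 \<le> 4 * (s\<^sup>2 * transverse_form \<omega> \<beta> u) + 2 * (s * b) + transverse_form \<omega> \<beta> v" unfolding b by (simp add: power_mult_distrib mult_ac)
  then show ?thesis unfolding b by linarith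
qed

lemma tau_le_dirichlet:
  assumes R: "\<And>x. x \<in> \<omega> \<Longrightarrow> norm x \<le> R" and u: "u \<in> rtest \<omega>"
  shows "ip (tau u) (tau u) \<le> R\<^sup>2 * dirichlet u"
proof -
  have "ip (tau u) (tau u) \<le> (\<integral>x. R\<^sup>2 * (norm (gr u x))\<^sup>2 \<partial>lborel)"
    unfolding ip_def
  proof (rule integral_mono)
    show "integrable lborel (\<lambda>x. tau u x * tau u x)" by (intro cc_integrable cc_mult tau_cc[OF u])
    show "integrable lborel (\<lambda>x. R\<^sup>2 * (norm (gr u x))\<^sup>2)" by (intro cc_integrable cc_cmult rtest_norm_gr_cc[OF u])
    fix x
    show "tau u x * tau u x \<le> R\<^sup>2 * (norm (gr u x))\<^sup>2"
    proof (cases "x \<in> \<omega>")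
      case True
      have "\<bar>tau u x\<bar> \<le> norm (gr u x) * norm (rot_field x)" unfolding tau_def by (rule Cauchy_Schwarz_ineq2)
      also have "\<dots> \<le> norm (gr u x) * R" unfolding norm_rot_field using R[OF True] by (intro mult_left_mono) auto
      finally have "\<bar>tau u x\<bar>\<^sup>2 \<le> (norm (gr u x) * R)\<^sup>2" by (intro power_mono) auto
      then show ?thesis by (simp add: power2_eq_square mult_ac)
    next
      case False
      then show ?thesis using rtest_zero_out[OF u False] by (simp add: tau_def)
    qed
  qed
  then show ?thesis by simp
qed

text \<open>A near-minimizer for \<open>\<beta> = 0\<close> is a test function for every \<open>\<beta>\<close>.\<close>

lemma lambda1_growth:
  assumes \<omega>: "open \<omega>" "\<omega> \<noteq> {}" and R: "\<And>x. x \<in> \<omega> \<Longrightarrow> norm x \<le> R"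
  shows "lambda1 \<omega> \<beta> \<le> lambda1 \<omega> 0 + \<beta>\<^sup>2 * R\<^sup>2 * lambda1 \<omega> 0"
proof (rule field_le_epsilon)
  fix e :: real assume e: "e > 0"
  define M where "M = 1 + \<beta>\<^sup>2 * R\<^sup>2"
  have M: "M > 0" by (simp add: M_def add_pos_nonneg)
  obtain u where u: "u \<in> rtest \<omega>" "ip u u = 1" "dirichlet u \<le> lambda1 \<omega> 0 + e / M"
    using lambda1_approx[OF \<omega>, of "e / M" 0] e M by auto
  have "lambda1 \<omega> \<beta> \<le> dirichlet u + \<beta>\<^sup>2 * ip (tau u) (tau u)"
    using lambda1_le[OF \<omega> u(1), of \<beta>] u(2) by simp
  also have "\<dots> \<le> dirichlet u + \<beta>\<^sup>2 * (R\<^sup>2 * dirichlet u)"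
    by (intro add_left_mono mult_left_mono tau_le_dirichlet[OF R u(1)]) auto
  also have "\<dots> = M * dirichlet u" by (simp add: M_def algebra_simps)
  also have "\<dots> \<le> M * (lambda1 \<omega> 0 + e / M)" using u(3) M by (intro mult_left_mono) auto
  also have "\<dots> = M * lambda1 \<omega> 0 + e" using M by (simp add: distrib_left)
  also have "\<dots> = lambda1 \<omega> 0 + \<beta>\<^sup>2 * R\<^sup>2 * lambda1 \<omega> 0 + e" by (simp add: M_def algebra_simps)
  finally show "lambda1 \<omega> \<beta> \<le> lambda1 \<omega> 0 + \<beta>\<^sup>2 * R\<^sup>2 * lambda1 \<omega> 0 + e" .
qed

text \<open>For small \<open>\<beta>\<close> the form is a small perturbation of the one at \<open>\<beta> = 0\<close>: by \<open>lambda1_growth\<close> the eigenvalue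
  moves by \<open>O(\<beta>\<^sup>2)\<close>, so near-minimizers for \<open>\<beta>\<close> are near-minimizers for \<open>0\<close> and both the spectral gap and the
  lower bound on the angular derivative persist. The norm and the Dirichlet energy of the orthogonal
  part are both controlled; the error \<open>\<kappa> z\<^sup>2\<close> accounts for \<open>\<xi>\<close> being no exact minimizer. The condition with
  the factor \<open>36\<close> is the one under which \<open>slice_quadratic_estimate\<close> absorbs the mixed terms.\<close>

lemma transverse_gap:
  assumes \<omega>: "open \<omega>" "bounded \<omega>" "connected \<omega>" "\<omega> \<noteq> {}"
    and reg: "interior (closure \<omega>) \<subseteq> \<omega>" and nr: "\<not> rotationally_invariant \<omega>"
  obtains \<beta>s \<delta> D0 D1 R where "\<beta>s > 0" "\<delta> > 0" "D0 > 0" "D1 > 0" "R > 0" "\<And>x. x \<in> \<omega> \<Longrightarrow> norm x \<le> R"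
    "36 * \<beta>s\<^sup>2 * (D1 + R\<^sup>2) \<le> \<delta>"
    "\<And>\<beta> \<kappa>. \<bar>\<beta>\<bar> \<le> \<beta>s \<Longrightarrow> \<kappa> > 0 \<Longrightarrow> \<exists>\<xi>\<in>rtest \<omega>. ip \<xi> \<xi> = 1 \<and> D0 \<le> ip (tau \<xi>) (tau \<xi>) \<and> ip (tau \<xi>) (tau \<xi>) \<le> D1 \<and>
       (\<forall>u\<in>rtest \<omega>. \<forall>z. ip \<xi> u = 0 \<longrightarrow> \<delta> * (ip u u + dirichlet u) - \<kappa> * z\<^sup>2 \<le> transverse_form \<omega> \<beta> (\<lambda>x. z * \<xi> x + u x))"
proof -
  let ?L = "lambda1 \<omega> 0"
  have L0: "0 \<le> ?L" by (rule lambda1_nonneg[OF \<omega>(1,4)])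
  obtain R0 where R0: "\<And>x. x \<in> \<omega> \<Longrightarrow> norm x \<le> R0" using \<omega>(2) bounded_iff by metis
  define R where "R = max 1 R0"
  have R: "R > 0" "\<And>x. x \<in> \<omega> \<Longrightarrow> norm x \<le> R" using R0 by (auto simp: R_def le_max_iff_disj)
  obtain g where g: "g > 0" "\<And>u v. u \<in> rtest \<omega> \<Longrightarrow> v \<in> rtest \<omega> \<Longrightarrow> ip u u = 1 \<Longrightarrow> ip v v = 1 \<Longrightarrow> ip u v = 0
     \<Longrightarrow> 2 * ?L + g \<le> dirichlet u + dirichlet v" by (rule spectral_gap[OF \<omega>]) blast
  obtain d where d: "d > 0" "\<And>u. u \<in> rtest \<omega> \<Longrightarrow> ip u u = 1 \<Longrightarrow> dirichlet u \<le> ?L + d \<Longrightarrow> d \<le> ip (tau u) (tau u)"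
    by (rule angular_derivative_lower_bound[OF \<omega> reg nr]) blast
  define D1 where "D1 = R\<^sup>2 * (?L + d)"
  have D1: "D1 > 0" using R(1) L0 d(1) by (simp add: D1_def)
  define \<Lambda> where "\<Lambda> = ?L + R\<^sup>2 * ?L"
  have \<Lambda>: "0 \<le> \<Lambda>" using L0 by (simp add: \<Lambda>_def)
  \<comment> \<open>With this weight, the convex combination of the bound by \<open>g / 2\<close> times the squared norm and of
    the bound by \<open>dirichlet u\<close> minus \<open>\<Lambda>\<close> times the squared norm retains \<open>g / 4\<close> of the latter and
    \<open>s\<close> of the energy.\<close>
  define s where "s = g / (4 * (g / 2 + \<Lambda>))"
  have s: "0 < s" "s \<le> 1 / 2" "s * (g / 2 + \<Lambda>) = g / 4" using g(1) \<Lambda> by (auto simp: s_def field_simps)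
  define \<delta> where "\<delta> = min (g / 4) s / 2"
  have \<delta>: "\<delta> > 0" "2 * \<delta> \<le> g / 4" "2 * \<delta> \<le> s" using g(1) s(1) by (auto simp: \<delta>_def)
  define \<beta>s where "\<beta>s = Min {1, g / (8 * R\<^sup>2 * (?L + 1)), d / (2 * R\<^sup>2 * (?L + 1)), \<delta> / (36 * (D1 + R\<^sup>2))}"
  have R2: "R\<^sup>2 > 0" using R(1) by simp
  have \<beta>s: "\<beta>s > 0" "\<beta>s \<le> 1" "\<beta>s \<le> g / (8 * R\<^sup>2 * (?L + 1))" "\<beta>s \<le> d / (2 * R\<^sup>2 * (?L + 1))" "\<beta>s \<le> \<delta> / (36 * (D1 + R\<^sup>2))"
    using R2 L0 g(1) d(1) \<delta>(1) D1 by (auto simp: \<beta>s_def add_pos_pos)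
  have sq: "b\<^sup>2 \<le> \<beta>s" if "\<bar>b\<bar> \<le> \<beta>s" for b
  proof -
    have "b\<^sup>2 = \<bar>b\<bar> * \<bar>b\<bar>" by (simp add: power2_eq_square)
    also have "\<dots> \<le> \<beta>s * 1" using that \<beta>s(1,2) by (intro mult_mono) auto
    finally show ?thesis by simp
  qed
  have "\<beta>s\<^sup>2 \<le> \<delta> / (36 * (D1 + R\<^sup>2))" using sq[of \<beta>s] \<beta>s(1,5) by linarith
  then have last: "36 * \<beta>s\<^sup>2 * (D1 + R\<^sup>2) \<le> \<delta>" using D1 R2 by (simp add: pos_le_divide_eq add_pos_pos mult_ac)
  show ?thesis
  proof (rule that[OF \<beta>s(1) \<delta>(1) d(1) D1 R last])
    fix \<beta> \<kappa> :: real assume \<beta>: "\<bar>\<beta>\<bar> \<le> \<beta>s" and \<kappa>: "\<kappa> > 0"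
    let ?l = "lambda1 \<omega> \<beta>"
    have b1: "\<beta>\<^sup>2 * (8 * R\<^sup>2 * (?L + 1)) \<le> g" "\<beta>\<^sup>2 * (2 * R\<^sup>2 * (?L + 1)) \<le> d" "\<beta>\<^sup>2 \<le> 1"
      using order_trans[OF sq[OF \<beta>] \<beta>s(3)] order_trans[OF sq[OF \<beta>] \<beta>s(4)] order_trans[OF sq[OF \<beta>] \<beta>s(2)] R2 L0
      by (simp_all add: pos_le_divide_eq)
    have "\<beta>\<^sup>2 * R\<^sup>2 * ?L \<le> \<beta>\<^sup>2 * R\<^sup>2 * (?L + 1)" by (intro mult_left_mono) auto
    then have b2: "\<beta>\<^sup>2 * R\<^sup>2 * ?L \<le> g / 8" "\<beta>\<^sup>2 * R\<^sup>2 * ?L \<le> d / 2"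
      using b1 by (simp_all add: mult_ac)
    have lu: "?l \<le> ?L + \<beta>\<^sup>2 * R\<^sup>2 * ?L" by (rule lambda1_growth[OF \<omega>(1,4) R(2)])
    have "\<beta>\<^sup>2 * R\<^sup>2 * ?L \<le> 1 * R\<^sup>2 * ?L" using b1(3) L0 by (intro mult_right_mono) auto
    then have l\<Lambda>: "?l \<le> \<Lambda>" using lu by (simp add: \<Lambda>_def)
    define k where "k = Min {\<kappa>, g / 4, d / 2}"
    have k: "k > 0" "k \<le> \<kappa>" "k \<le> g / 4" "k \<le> d / 2" using \<kappa> g(1) d(1) by (auto simp: k_def)
    obtain \<xi> where \<xi>: "\<xi> \<in> rtest \<omega>" "ip \<xi> \<xi> = 1" "dirichlet \<xi> + \<beta>\<^sup>2 * ip (tau \<xi>) (tau \<xi>) \<le> ?l + k"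
      using lambda1_approx[OF \<omega>(1,4) k(1)] by blast
    have t0: "0 \<le> \<beta>\<^sup>2 * ip (tau v) (tau v)" for v by (simp add: ip_nonneg)
    have D\<xi>: "dirichlet \<xi> \<le> ?L + d" using \<xi>(3) t0[of \<xi>] lu b2(2) k(4) by linarith
    have q\<xi>: "transverse_form \<omega> \<beta> \<xi> \<le> k" using \<xi> by (simp add: transverse_form_def)
    have unit: "g / 2 \<le> transverse_form \<omega> \<beta> v" if v: "v \<in> rtest \<omega>" "ip v v = 1" "ip \<xi> v = 0" for v
    proof -
      have "2 * ?L + g \<le> dirichlet v + dirichlet \<xi>"
        using g(2)[OF v(1) \<xi>(1) v(2) \<xi>(2)] v(3) by (simp add: ip_commute)
      then show ?thesis using \<xi>(3) t0[of \<xi>] t0[of v] lu b2(1) k(3) unfolding transverse_form_def v(2) by linarith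
    qed
    have gap: "g / 2 * ip u u \<le> transverse_form \<omega> \<beta> u" if u: "u \<in> rtest \<omega>" "ip \<xi> u = 0" for u
    proof (cases "ip u u = 0")
      case True
      then show ?thesis using transverse_form_nonneg[OF \<omega>(1,4) u(1)] by simp
    next
      case False
      then have pos: "ip u u > 0" using ip_nonneg[of u] by linarith
      define c where "c = 1 / sqrt (ip u u)"
      have c2: "c\<^sup>2 * ip u u = 1" using pos by (simp add: c_def power_divide)
      have gc: "gr (\<lambda>x. c * u x) x = c *\<^sub>R gr u x" for x by (rule gr_cmult[OF rtest_smooth[OF u(1)]])
      have tc: "tau (\<lambda>x. c * u x) = (\<lambda>x. c * tau u x)" by (auto simp: tau_def gc)
      have "g / 2 \<le> transverse_form \<omega> \<beta> (\<lambda>x. c * u x)"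
        using u c2 by (intro unit rtest_cmult) (auto simp: ip_cmult_left ip_cmult_right power2_eq_square mult_ac)
      also have "\<dots> = c\<^sup>2 * transverse_form \<omega> \<beta> u"
        by (simp add: transverse_form_def gc tc ip_cmult_left ip_cmult_right power_mult_distrib power2_eq_square algebra_simps)
      finally have "g / 2 * ip u u \<le> c\<^sup>2 * transverse_form \<omega> \<beta> u * ip u u" using pos by (intro mult_right_mono) auto
      also have "\<dots> = (c\<^sup>2 * ip u u) * transverse_form \<omega> \<beta> u" by simp
      finally show ?thesis unfolding c2 by simp
    qed
    have strong: "2 * \<delta> * (ip u u + dirichlet u) \<le> transverse_form \<omega> \<beta> u" if u: "u \<in> rtest \<omega>" "ip \<xi> u = 0" for u
    proof -
      have N0: "0 \<le> ip u u" by (rule ip_nonneg)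
      have E0: "0 \<le> dirichlet u" by (rule dirichlet_nonneg)
      have "dirichlet u - \<Lambda> * ip u u \<le> transverse_form \<omega> \<beta> u"
        using t0[of u] mult_right_mono[OF l\<Lambda> N0] by (simp add: transverse_form_def)
      then have 1: "s * (dirichlet u - \<Lambda> * ip u u) \<le> s * transverse_form \<omega> \<beta> u" using s(1) by (intro mult_left_mono) auto
      have 2: "(1 - s) * (g / 2 * ip u u) \<le> (1 - s) * transverse_form \<omega> \<beta> u"
        using gap[OF u] s(2) by (intro mult_left_mono) auto
      have "2 * \<delta> * (ip u u + dirichlet u) \<le> g / 4 * ip u u + s * dirichlet u"
        using mult_right_mono[OF \<delta>(2) N0] mult_right_mono[OF \<delta>(3) E0] by (simp add: distrib_left)
      also have "\<dots> = (g / 2 - s * (g / 2 + \<Lambda>)) * ip u u + s * dirichlet u" unfolding s(3) by simp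
      also have "\<dots> = (1 - s) * (g / 2 * ip u u) + s * (dirichlet u - \<Lambda> * ip u u)"
        by (simp add: field_simps)
      also have "\<dots> \<le> (1 - s) * transverse_form \<omega> \<beta> u + s * transverse_form \<omega> \<beta> u" by (rule add_mono[OF 2 1])
      also have "\<dots> = transverse_form \<omega> \<beta> u" by (simp add: algebra_simps)
      finally show ?thesis .
    qed
    show "\<exists>\<xi>\<in>rtest \<omega>. ip \<xi> \<xi> = 1 \<and> d \<le> ip (tau \<xi>) (tau \<xi>) \<and> ip (tau \<xi>) (tau \<xi>) \<le> D1 \<and>
       (\<forall>u\<in>rtest \<omega>. \<forall>z. ip \<xi> u = 0 \<longrightarrow> \<delta> * (ip u u + dirichlet u) - \<kappa> * z\<^sup>2 \<le> transverse_form \<omega> \<beta> (\<lambda>x. z * \<xi> x + u x))"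
    proof (intro bexI[OF _ \<xi>(1)] conjI \<xi>(2) d(2)[OF \<xi>(1,2) D\<xi>] ballI allI impI)
      show "ip (tau \<xi>) (tau \<xi>) \<le> D1"
        using tau_le_dirichlet[OF R(2) \<xi>(1)] mult_left_mono[OF D\<xi>, of "R\<^sup>2"] by (simp add: D1_def)
      fix u z assume u: "u \<in> rtest \<omega>" "ip \<xi> u = 0"
      have "z\<^sup>2 * transverse_form \<omega> \<beta> \<xi> \<le> z\<^sup>2 * \<kappa>" using q\<xi> k(2) by (intro mult_left_mono) auto
      then show "\<delta> * (ip u u + dirichlet u) - \<kappa> * z\<^sup>2 \<le> transverse_form \<omega> \<beta> (\<lambda>x. z * \<xi> x + u x)"
        using transverse_form_sum_lower[OF \<omega>(1,4) \<xi>(1) u(1), of \<beta> z] strong[OF u] by (simp add: mult.commute)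
    qed
  qed
qed

section \<open>The estimate on a single cross-section\<close>

lemma weighted_AM_GM:
  fixes a b p k t :: real
  assumes "p\<^sup>2 \<le> a * b" "0 \<le> a" "0 \<le> b" "t > 0"
  shows "2 * k * p \<le> t * a + k\<^sup>2 * b / t"
proof -
  let ?x = "t * a" and ?y = "k\<^sup>2 * b / t"
  have xy: "4 * (k\<^sup>2 * (a * b)) = 4 * ?x * ?y" using assms(4) by (simp add: mult_ac)
  have four: "4 * x * y \<le> (x + y)\<^sup>2" for x y :: real
    using zero_le_power2[of "x - y"] by (simp add: power2_sum power2_diff)
  have "(2 * k * p)\<^sup>2 = 4 * (k\<^sup>2 * p\<^sup>2)" by (simp add: power_mult_distrib)
  also have "\<dots> \<le> 4 * (k\<^sup>2 * (a * b))" using assms(1) by (intro mult_left_mono) auto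
  also have "\<dots> = 4 * ?x * ?y" by (rule xy)
  also have "\<dots> \<le> (?x + ?y)\<^sup>2" by (rule four)
  finally have sq: "(2 * k * p)\<^sup>2 \<le> (?x + ?y)\<^sup>2" .
  have "0 \<le> ?x + ?y" using assms(2-4) by (intro add_nonneg_nonneg mult_nonneg_nonneg divide_nonneg_nonneg) auto
  with sq show ?thesis by (rule power2_le_imp_le)
qed

text \<open>The algebra behind \<open>slice_inequality\<close>, where \<open>A\<close>, \<open>n\<close> and \<open>YY\<close> are the squared norms of \<open>X\<close>, \<open>\<eta>\<close> and
  \<open>tau \<eta>\<close>, \<open>G\<close> is the Dirichlet energy of \<open>\<eta>\<close>, \<open>D\<close> and \<open>T\<close> are the squared norms of \<open>tau \<xi>\<close> and \<open>tau \<phi>\<close>, and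
  \<open>m\<close>, \<open>q\<close>, \<open>p\<close> are inner products. The term with \<open>m\<close> is absorbed by \<open>f'\<^sup>2\<close> and \<open>n\<close>, the terms with \<open>q\<close> and
  \<open>p\<close> by a quarter of \<open>A\<close> each, at the expense of a quarter of the potential term and of \<open>G\<close>. Because
  \<open>\<epsilon>\<close> is small compared with \<open>\<beta>\<close>, terms in \<open>\<epsilon>\<^sup>2\<close> are small compared with \<open>\<beta> \<epsilon>\<close>.\<close>

lemma slice_quadratic_estimate:
  fixes \<beta> \<epsilon> :: real
  assumes \<epsilon>: "\<bar>\<epsilon>\<bar> \<le> \<bar>\<beta>\<bar> / 16" "0 \<le> \<beta> * \<epsilon>" and \<delta>: "36 * \<beta>\<^sup>2 * (D1 + R\<^sup>2) \<le> \<delta>"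
    and D: "0 < D0" "D0 \<le> D" "D \<le> D1" and nn: "0 \<le> A" "0 \<le> n" "0 \<le> G" "0 \<le> YY"
    and m: "m\<^sup>2 \<le> D * n" and q: "q\<^sup>2 \<le> A * D" and p: "p\<^sup>2 \<le> A * YY" and YY: "YY \<le> R\<^sup>2 * G"
    and T: "f\<^sup>2 * D \<le> 2 * T + 2 * YY"
  shows "f'\<^sup>2 / 2 + 3 / 4 * D0 * (\<beta> * \<epsilon>) * f\<^sup>2 + \<delta> / 2 * n
     \<le> f'\<^sup>2 + A + 2 * (2 * \<beta> + \<epsilon>) * f' * m - 2 * \<epsilon> * f * q - 2 * (\<beta> + \<epsilon>) * p + (2 * \<beta> * \<epsilon> + \<epsilon>\<^sup>2) * T + \<delta> * (n + G)"
proof -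
  have D1p: "0 < D1" "0 < D" using D by auto
  have be: "\<beta> * \<epsilon> \<le> \<beta>\<^sup>2 / 16"
  proof -
    have "\<beta> * \<epsilon> \<le> \<bar>\<beta>\<bar> * \<bar>\<epsilon>\<bar>" by (metis abs_ge_self abs_mult)
    also have "\<dots> \<le> \<bar>\<beta>\<bar> * (\<bar>\<beta>\<bar> / 16)" using \<epsilon>(1) by (intro mult_left_mono) auto
    finally show ?thesis by (simp add: power2_eq_square)
  qed
  have e2: "\<epsilon>\<^sup>2 \<le> \<beta> * \<epsilon> / 16"
  proof -
    have "\<epsilon>\<^sup>2 = \<bar>\<epsilon>\<bar> * \<bar>\<epsilon>\<bar>" by (simp add: power2_eq_square)
    also have "\<dots> \<le> \<bar>\<epsilon>\<bar> * (\<bar>\<beta>\<bar> / 16)" using \<epsilon>(1) by (intro mult_left_mono) auto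
    also have "\<bar>\<epsilon>\<bar> * (\<bar>\<beta>\<bar> / 16) = \<bar>\<beta> * \<epsilon>\<bar> / 16" by (simp add: abs_mult)
    finally show ?thesis using \<epsilon>(2) by simp
  qed
  have sq: "x\<^sup>2 \<le> y\<^sup>2 * \<beta>\<^sup>2" if "\<bar>x\<bar> \<le> y * \<bar>\<beta>\<bar>" for x y
    using power_mono[OF that, of 2] by (simp add: power_mult_distrib)
  have "\<bar>2 * \<beta> + \<epsilon>\<bar> \<le> 3 * \<bar>\<beta>\<bar>" using \<epsilon>(1) by linarith
  from sq[OF this] have t1: "(2 * \<beta> + \<epsilon>)\<^sup>2 \<le> 9 * \<beta>\<^sup>2" by simp
  have "\<bar>\<beta> + \<epsilon>\<bar> \<le> 2 * \<bar>\<beta>\<bar>" using \<epsilon>(1) by linarith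
  from sq[OF this] have t2: "(\<beta> + \<epsilon>)\<^sup>2 \<le> 4 * \<beta>\<^sup>2" by simp
  have a: "- (2 * (2 * \<beta> + \<epsilon>) * f' * m) \<le> f'\<^sup>2 / 2 + 18 * \<beta>\<^sup>2 * D1 * n"
  proof -
    have "2 * (- (2 * \<beta> + \<epsilon>)) * (f' * m) \<le> (1/2) * f'\<^sup>2 + (- (2 * \<beta> + \<epsilon>))\<^sup>2 * m\<^sup>2 / (1/2)"
      by (rule weighted_AM_GM) (auto simp: power_mult_distrib)
    also have "\<dots> = f'\<^sup>2 / 2 + 2 * ((2 * \<beta> + \<epsilon>)\<^sup>2 * m\<^sup>2)" by (simp add: power2_eq_square algebra_simps)
    also have "(2 * \<beta> + \<epsilon>)\<^sup>2 * m\<^sup>2 \<le> (9 * \<beta>\<^sup>2) * (D1 * n)"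
      using t1 m mult_right_mono[OF D(3) nn(2)] by (intro mult_mono) auto
    finally show ?thesis by (simp add: algebra_simps)
  qed
  have b: "2 * \<epsilon> * f * q \<le> A / 4 + \<beta> * \<epsilon> / 4 * f\<^sup>2 * D"
  proof -
    have "2 * (\<epsilon> * f) * q \<le> (1/4) * A + (\<epsilon> * f)\<^sup>2 * D / (1/4)"
      using q nn(1) D1p by (intro weighted_AM_GM) auto
    also have "\<dots> = A / 4 + 4 * (\<epsilon>\<^sup>2 * (f\<^sup>2 * D))" by (simp add: power_mult_distrib)
    also have "\<epsilon>\<^sup>2 * (f\<^sup>2 * D) \<le> (\<beta> * \<epsilon> / 16) * (f\<^sup>2 * D)" using e2 D1p by (intro mult_right_mono) auto
    finally show ?thesis by (simp add: mult_ac)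
  qed
  have c: "2 * (\<beta> + \<epsilon>) * p \<le> A / 4 + 16 * \<beta>\<^sup>2 * R\<^sup>2 * G"
  proof -
    have "2 * (\<beta> + \<epsilon>) * p \<le> (1/4) * A + (\<beta> + \<epsilon>)\<^sup>2 * YY / (1/4)"
      using p nn by (intro weighted_AM_GM) auto
    also have "\<dots> = A / 4 + 4 * ((\<beta> + \<epsilon>)\<^sup>2 * YY)" by simp
    also have "(\<beta> + \<epsilon>)\<^sup>2 * YY \<le> (4 * \<beta>\<^sup>2) * (R\<^sup>2 * G)" using t2 YY nn by (intro mult_mono) auto
    finally show ?thesis by simp
  qed
  have T0: "0 \<le> 2 * T + 2 * YY - f\<^sup>2 * D" using T by simp
  have "\<beta> * \<epsilon> * (f\<^sup>2 * D - 2 * YY) \<le> \<beta> * \<epsilon> * (2 * T)" using T0 \<epsilon>(2) by (intro mult_left_mono) auto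
  moreover have "\<beta> * \<epsilon> * (2 * YY) \<le> \<beta>\<^sup>2 / 16 * (2 * (R\<^sup>2 * G))" using be YY nn \<epsilon>(2) by (intro mult_mono) auto
  ultimately have d: "\<beta> * \<epsilon> * f\<^sup>2 * D - \<beta>\<^sup>2 * R\<^sup>2 * G / 8 \<le> 2 * \<beta> * \<epsilon> * T" by (simp add: algebra_simps)
  have T1: "- YY \<le> T" using T D1p by (smt (verit) mult_nonneg_nonneg zero_le_power2)
  have "\<epsilon>\<^sup>2 * (- YY) \<le> \<epsilon>\<^sup>2 * T" using T1 by (intro mult_left_mono) auto
  moreover have "\<epsilon>\<^sup>2 * YY \<le> (\<beta>\<^sup>2 / 256) * (R\<^sup>2 * G)" using e2 be YY nn by (intro mult_mono) auto
  ultimately have d2: "- (\<beta>\<^sup>2 * R\<^sup>2 * G / 256) \<le> \<epsilon>\<^sup>2 * T" by (simp add: algebra_simps)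
  have "36 * \<beta>\<^sup>2 * D1 \<le> \<delta>" "36 * \<beta>\<^sup>2 * R\<^sup>2 \<le> \<delta>"
    using \<delta> D1p(1) by (auto simp: distrib_left intro: order_trans[rotated])
  from mult_right_mono[OF this(1) nn(2)] mult_right_mono[OF this(2) nn(3)]
  have e: "36 * \<beta>\<^sup>2 * D1 * n \<le> \<delta> * n" "36 * \<beta>\<^sup>2 * R\<^sup>2 * G \<le> \<delta> * G" .
  have f: "3 / 4 * D0 * (\<beta> * \<epsilon>) * f\<^sup>2 \<le> 3 / 4 * (\<beta> * \<epsilon> * f\<^sup>2 * D)"
    using mult_left_mono[OF D(2) mult_nonneg_nonneg[OF \<epsilon>(2) zero_le_power2[of f]]] by (simp add: mult_ac)
  have g: "0 \<le> \<beta>\<^sup>2 * R\<^sup>2 * G" using nn by simp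
  have b': "2 * \<epsilon> * f * q \<le> A / 4 + (\<beta> * \<epsilon> * f\<^sup>2 * D) / 4" using b by simp
  have "(2 * \<beta> * \<epsilon> + \<epsilon>\<^sup>2) * T = 2 * \<beta> * \<epsilon> * T + \<epsilon>\<^sup>2 * T" "\<delta> * (n + G) = \<delta> * n + \<delta> * G" "\<delta> / 2 * n = (\<delta> * n) / 2"
    by (simp_all add: algebra_simps)
  then show ?thesis using a b' c d d2 e f g nn(1) by linarith
qed

text \<open>Here \<open>\<phi>\<close> is a slice, \<open>P\<close> the longitudinal derivative of the function on the tube and \<open>d\<close> the derivative of
  the slice in \<open>s\<close>. Decompose \<open>\<phi> = f \<xi> + \<eta>\<close> and \<open>d = f' \<xi> + X\<close> along \<open>\<xi>\<close>. The mixed terms of first order in \<open>\<beta>\<close>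
  in the squared norm of \<open>P\<close> are multiples of \<open>f' m\<close>, \<open>f q\<close> and \<open>p\<close>; adding \<open>2 \<beta>\<close> times the \<open>s\<close>-derivative \<open>f' m + f q\<close> of \<open>f m\<close>
  removes the one with \<open>f q\<close>, for which the energy offers no counterpart of order \<open>\<beta> f\<^sup>2\<close>, and leaves only
  small multiples of the other products.\<close>

lemma slice_inequality:
  fixes \<beta> \<epsilon> :: real
  assumes R: "\<And>x. x \<in> \<omega> \<Longrightarrow> norm x \<le> R" and D: "0 < D0" "D0 \<le> ip (tau \<xi>) (tau \<xi>)" "ip (tau \<xi>) (tau \<xi>) \<le> D1"
    and \<xi>: "\<xi> \<in> rtest \<omega>" "ip \<xi> \<xi> = 1"
    and gap: "\<And>u z. u \<in> rtest \<omega> \<Longrightarrow> ip \<xi> u = 0 \<Longrightarrow> \<delta> * (ip u u + dirichlet u) - \<kappa> * z\<^sup>2 \<le> transverse_form \<omega> \<beta> (\<lambda>x. z * \<xi> x + u x)"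
    and \<epsilon>: "\<bar>\<epsilon>\<bar> \<le> \<bar>\<beta>\<bar> / 16" "0 \<le> \<beta> * \<epsilon>" and \<delta>: "36 * \<beta>\<^sup>2 * (D1 + R\<^sup>2) \<le> \<delta>"
    and \<phi>: "\<phi> \<in> rtest \<omega>" and P: "P \<in> cc"
  defines "d \<equiv> \<lambda>y. P y + (\<beta> + \<epsilon>) * tau \<phi> y"
  shows "(ip \<xi> d)\<^sup>2 / 2 + 3 / 4 * D0 * (\<beta> * \<epsilon>) * (ip \<xi> \<phi>)\<^sup>2 + \<delta> / 2 * (ip \<phi> \<phi> - (ip \<xi> \<phi>)\<^sup>2) - \<kappa> * (ip \<xi> \<phi>)\<^sup>2
     \<le> ip P P + dirichlet \<phi> - lambda1 \<omega> \<beta> * ip \<phi> \<phi>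
       + 2 * \<beta> * (ip \<xi> d * ip (tau \<xi>) \<phi> + ip \<xi> \<phi> * ip (tau \<xi>) d)"
proof -
  define f where "f = ip \<xi> \<phi>"
  define f' where "f' = ip \<xi> d"
  define \<eta> where "\<eta> = (\<lambda>x. \<phi> x - f * \<xi> x)"
  define X where "X = (\<lambda>x. d x - f' * \<xi> x)"
  have \<eta>: "\<eta> \<in> rtest \<omega>" unfolding \<eta>_def by (intro rtest_diff rtest_cmult \<phi> \<xi>)
  have \<phi>eq: "\<phi> = (\<lambda>x. f * \<xi> x + \<eta> x)" by (simp add: \<eta>_def)
  note c = rtest_cc[OF \<xi>(1)] rtest_cc[OF \<phi>] rtest_cc[OF \<eta>] tau_cc[OF \<xi>(1)] tau_cc[OF \<phi>] tau_cc[OF \<eta>] P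
  have dc: "d \<in> cc" unfolding d_def by (intro cc_add cc_cmult c)
  have Xc: "X \<in> cc" unfolding X_def by (intro cc_diff cc_cmult c dc)
  have deq: "d = (\<lambda>x. f' * \<xi> x + X x)" by (simp add: X_def)
  have \<xi>\<eta>: "ip \<xi> \<eta> = 0" using \<xi>(2) by (simp add: \<eta>_def ip_diff_right ip_cmult_right cc_cmult c f_def)
  have \<xi>X: "ip \<xi> X = 0" using \<xi>(2) by (simp add: X_def ip_diff_right ip_cmult_right cc_cmult c dc f'_def)
  let ?S = "tau \<xi>" and ?Y = "tau \<eta>" and ?T = "tau \<phi>"
  have \<xi>S: "ip \<xi> ?S = 0" using tau_antisymmetric[OF \<xi>(1) \<xi>(1)] by (simp add: ip_commute)
  have T: "?T = (\<lambda>x. f * ?S x + ?Y x)" by (subst \<phi>eq) (rule tau_lincomb[OF \<xi>(1) \<eta>])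
  define m where "m = ip ?S \<phi>"
  have m\<eta>: "m = ip ?S \<eta>" unfolding m_def
    by (subst \<phi>eq) (simp add: ip_add_right ip_cmult_right cc_cmult c ip_commute[of ?S \<xi>] \<xi>S)
  have \<xi>Y: "ip \<xi> ?Y = - m" unfolding m\<eta> by (rule tau_antisymmetric[OF \<xi>(1) \<eta>])
  define q where "q = ip X ?S"
  define p where "p = ip X ?Y"
  have m': "ip ?S d = q" unfolding deq ip_commute[of ?S]
    by (simp add: ip_add_left ip_cmult_left cc_cmult c Xc \<xi>S q_def)
  have dd: "ip d d = f'\<^sup>2 + ip X X" unfolding deq
    by (simp add: ip_simps cc_intros c Xc \<xi>(2) \<xi>X ip_commute[of X \<xi>] power2_eq_square)
  have dT: "ip d ?T = - f' * m + f * q + p" unfolding deq T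
    by (simp add: ip_simps cc_intros c Xc \<xi>S \<xi>Y q_def p_def algebra_simps)
  have "P = (\<lambda>x. d x - (\<beta> + \<epsilon>) * ?T x)" by (simp add: d_def)
  then have PP: "ip P P = ip d d - 2 * (\<beta> + \<epsilon>) * ip d ?T + (\<beta> + \<epsilon>)\<^sup>2 * ip ?T ?T"
    using dc c by (simp add: ip_simps cc_intros ip_commute[of ?T d] power2_eq_square algebra_simps)
  have n: "ip \<eta> \<eta> = ip \<phi> \<phi> - f\<^sup>2" unfolding \<phi>eq
    by (simp add: ip_simps cc_intros c \<xi>\<eta> ip_commute[of \<eta> \<xi>] \<xi>(2) power2_eq_square)
  have TT: "f\<^sup>2 * ip ?S ?S \<le> 2 * ip ?T ?T + 2 * ip ?Y ?Y"
  proof -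
    have "0 \<le> ip (\<lambda>x. f * ?S x + 2 * ?Y x) (\<lambda>x. f * ?S x + 2 * ?Y x)" by (rule ip_nonneg)
    then show ?thesis unfolding T
      by (simp add: ip_simps cc_intros c ip_commute[of ?Y ?S] power2_eq_square algebra_simps)
  qed
  have num: "f'\<^sup>2 / 2 + 3 / 4 * D0 * (\<beta> * \<epsilon>) * f\<^sup>2 + \<delta> / 2 * ip \<eta> \<eta>
     \<le> f'\<^sup>2 + ip X X + 2 * (2 * \<beta> + \<epsilon>) * f' * m - 2 * \<epsilon> * f * q - 2 * (\<beta> + \<epsilon>) * p
       + (2 * \<beta> * \<epsilon> + \<epsilon>\<^sup>2) * ip ?T ?T + \<delta> * (ip \<eta> \<eta> + dirichlet \<eta>)"
  proof (rule slice_quadratic_estimate[OF \<epsilon> \<delta> D])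
    show "m\<^sup>2 \<le> ip ?S ?S * ip \<eta> \<eta>" unfolding m\<eta> by (rule ip_Cauchy_Schwarz) (rule c)+
    show "q\<^sup>2 \<le> ip X X * ip ?S ?S" unfolding q_def by (intro ip_Cauchy_Schwarz c Xc)
    show "p\<^sup>2 \<le> ip X X * ip ?Y ?Y" unfolding p_def by (intro ip_Cauchy_Schwarz c Xc)
    show "ip ?Y ?Y \<le> R\<^sup>2 * dirichlet \<eta>" by (rule tau_le_dirichlet[OF R \<eta>])
  qed (use TT in \<open>auto intro: ip_nonneg\<close>)
  have "\<delta> * (ip \<eta> \<eta> + dirichlet \<eta>) - \<kappa> * f\<^sup>2 \<le> transverse_form \<omega> \<beta> \<phi>"
    using gap[OF \<eta> \<xi>\<eta>, of f] unfolding \<phi>eq[symmetric] .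
  then have g: "\<delta> * (ip \<eta> \<eta> + dirichlet \<eta>) - \<kappa> * f\<^sup>2 \<le> dirichlet \<phi> + \<beta>\<^sup>2 * ip ?T ?T - lambda1 \<omega> \<beta> * ip \<phi> \<phi>"
    by (simp add: transverse_form_def)
  have id: "ip P P + 2 * \<beta> * (f' * m + f * q) = f'\<^sup>2 + ip X X + 2 * (2 * \<beta> + \<epsilon>) * f' * m - 2 * \<epsilon> * f * q - 2 * (\<beta> + \<epsilon>) * p
       + (2 * \<beta> * \<epsilon> + \<epsilon>\<^sup>2) * ip ?T ?T + \<beta>\<^sup>2 * ip ?T ?T"
    unfolding PP dd dT by (simp add: power2_eq_square algebra_simps)
  have "f'\<^sup>2 / 2 + 3 / 4 * D0 * (\<beta> * \<epsilon>) * f\<^sup>2 + \<delta> / 2 * ip \<eta> \<eta> - \<kappa> * f\<^sup>2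
     \<le> ip P P + dirichlet \<phi> - lambda1 \<omega> \<beta> * ip \<phi> \<phi> + 2 * \<beta> * (f' * m + f * q)"
    using num g id by linarith
  then show ?thesis unfolding n m' f_def[symmetric] f'_def[symmetric] m_def[symmetric] .
qed

section \<open>One-dimensional Hardy inequality\<close>

text \<open>This is how \<open>\<epsilon>\<close>, as a derivative up to a constant, becomes measurable.\<close>

lemma borel_measurable_derivative:
  fixes F F' :: "real \<Rightarrow> real"
  assumes F: "\<And>s. (F has_real_derivative F' s) (at s)"
  shows "F' \<in> borel_measurable borel"
proof (rule borel_measurable_LIMSEQ_real)
  fix s
  have h: "filterlim (\<lambda>n. 1 / real (Suc n)) (at 0) sequentially"
    by (rule filterlim_atI[OF LIMSEQ_Suc[OF lim_1_over_n]]) simp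
  show "(\<lambda>n. (F (s + 1 / real (Suc n)) - F s) / (1 / real (Suc n))) \<longlonglongrightarrow> F' s"
    using filterlim_compose[OF F[of s, unfolded DERIV_def] h] .
next
  fix n
  have "continuous_on UNIV F" using DERIV_isCont[OF F] by (simp add: continuous_on_eq_continuous_at)
  then have [measurable]: "F \<in> borel_measurable borel" by (rule borel_measurable_continuous_onI)
  show "(\<lambda>s. (F (s + 1 / real (Suc n)) - F s) / (1 / real (Suc n))) \<in> borel_measurable borel" by measurable
qed

lemma integrable_bounded_on_interval:
  fixes h :: "real \<Rightarrow> real"
  assumes [measurable]: "h \<in> borel_measurable borel" and B: "\<And>s. s \<in> {a..b} \<Longrightarrow> \<bar>h s\<bar> \<le> B"
  shows "integrable lborel (\<lambda>s. indicator {a..b} s * h s)"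
proof (rule Bochner_Integration.integrable_bound)
  show "integrable lborel (\<lambda>s. \<bar>B\<bar> * indicator {a..b} s)"
    by (auto simp: integrable_indicator_iff emeasure_lborel_Icc_eq)
  show "AE s in lborel. norm (indicator {a..b} s * h s) \<le> norm (\<bar>B\<bar> * indicator {a..b} s)"
    using B by (intro AE_I2) (force split: split_indicator)
qed measurable

text \<open>The Henstock-Kurzweil integral integrates every derivative, and for a bounded one it agrees with
  the Lebesgue integral.\<close>

lemma FTC_bounded:
  fixes F F' :: "real \<Rightarrow> real"
  assumes "a \<le> b" and F: "\<And>s. s \<in> {a..b} \<Longrightarrow> (F has_real_derivative F' s) (at s)"
    and [measurable]: "F' \<in> borel_measurable borel" and B: "\<And>s. s \<in> {a..b} \<Longrightarrow> \<bar>F' s\<bar> \<le> B"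
  shows "(\<integral>s. indicator {a..b} s * F' s \<partial>lborel) = F b - F a"
proof -
  have "(F' has_integral (F b - F a)) {a..b}"
    using assms(1) F
    by (intro fundamental_theorem_of_calculus)
      (auto simp: has_real_derivative_iff_has_vector_derivative[symmetric] intro: has_field_derivative_at_within)
  then have "integral {a..b} F' = F b - F a" by (rule integral_unique)
  moreover have "set_integrable lborel {a..b} F'"
    unfolding set_integrable_def using integrable_bounded_on_interval[OF assms(3) B] by simp
  ultimately show ?thesis
    using set_borel_integral_eq_integral(2)[of "{a..b}" F'] by (simp add: set_lebesgue_integral_def)
qed

lemma continuous_bounded_Icc:
  fixes f :: "real \<Rightarrow> real"
  assumes "continuous_on UNIV f" obtains C where "\<And>s. s \<in> {l..r} \<Longrightarrow> \<bar>f s\<bar> \<le> C"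
proof -
  have "bounded (f ` {l..r})"
    using assms by (meson compact_Icc compact_continuous_image compact_imp_bounded continuous_on_subset subset_UNIV)
  then obtain C where "\<forall>s\<in>{l..r}. \<bar>f s\<bar> \<le> C" by (auto simp: bounded_iff)
  then show ?thesis by (intro that) blast
qed

text \<open>With \<open>w = 1 + \<sigma> (s - a)\<close>, integrate the derivative of \<open>f\<^sup>2 / w\<close> and use that the square of
  \<open>f / w - 2 \<sigma> f'\<close> is nonnegative. The sign \<open>\<sigma>\<close> distinguishes the two sides of \<open>a\<close>.\<close>

lemma hardy_interval:
  fixes f f' :: "real \<Rightarrow> real"
  assumes lr: "l \<le> r" and f: "\<And>s. (f has_real_derivative f' s) (at s)" and B: "\<And>s. \<bar>f' s\<bar> \<le> B"
    and \<sigma>: "\<sigma> = 1 \<or> \<sigma> = - 1" and w: "\<And>s. s \<in> {l..r} \<Longrightarrow> 1 \<le> 1 + \<sigma> * (s - a)"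
  shows "(\<integral>s. indicator {l..r} s * (f s)\<^sup>2 / (1 + \<sigma> * (s - a))\<^sup>2 \<partial>lborel)
    \<le> 2 * \<sigma> * ((f l)\<^sup>2 / (1 + \<sigma> * (l - a)) - (f r)\<^sup>2 / (1 + \<sigma> * (r - a))) + 4 * (\<integral>s. indicator {l..r} s * (f' s)\<^sup>2 \<partial>lborel)"
proof -
  let ?w = "\<lambda>s. 1 + \<sigma> * (s - a)"
  have f'm[measurable]: "f' \<in> borel_measurable borel" by (rule borel_measurable_derivative[OF f])
  have fc: "continuous_on UNIV f" using DERIV_isCont[OF f] by (simp add: continuous_on_eq_continuous_at)
  have fm[measurable]: "f \<in> borel_measurable borel" by (rule borel_measurable_continuous_onI[OF fc])
  obtain C where C: "\<And>s. s \<in> {l..r} \<Longrightarrow> \<bar>f s\<bar> \<le> C" by (rule continuous_bounded_Icc[OF fc]) blast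
  have wp: "1 \<le> ?w s" "0 < ?w s" "?w s \<noteq> 0" if "s \<in> {l..r}" for s using w[OF that] by auto
  have ss: "\<sigma> * \<sigma> = 1" using \<sigma> by auto
  define u where "u s = f s / ?w s" for s
  have [measurable]: "u \<in> borel_measurable borel" unfolding u_def[abs_def] by measurable
  have u: "\<bar>u s\<bar> \<le> C" if "s \<in> {l..r}" for s
  proof -
    have "\<bar>u s\<bar> = \<bar>f s\<bar> / ?w s" using wp[OF that] by (simp add: u_def abs_divide)
    also have "\<dots> \<le> \<bar>f s\<bar> / 1" using wp[OF that] by (intro divide_left_mono) auto
    finally show ?thesis using C[OF that] by simp
  qed
  define F' where "F' s = 2 * u s * f' s - \<sigma> * (u s)\<^sup>2" for s
  have F: "((\<lambda>s. (f s)\<^sup>2 / ?w s) has_real_derivative F' s) (at s)" if "s \<in> {l..r}" for s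
  proof -
    have w: "(?w has_real_derivative \<sigma>) (at s)" by (auto intro!: derivative_eq_intros)
    have "((\<lambda>s. (f s)\<^sup>2) has_real_derivative 2 * f s * f' s) (at s)"
      using f[of s] by (auto intro!: derivative_eq_intros)
    from DERIV_divide[OF this w wp(3)[OF that]]
    have "((\<lambda>s. (f s)\<^sup>2 / ?w s) has_real_derivative ((2 * f s * f' s) * ?w s - (f s)\<^sup>2 * \<sigma>) / (?w s * ?w s)) (at s)" .
    moreover have "((2 * f s * f' s) * c - (f s)\<^sup>2 * \<sigma>) / (c * c) = 2 * (f s / c) * f' s - \<sigma> * (f s / c)\<^sup>2" if "c \<noteq> 0" for c
      using that by (simp add: field_simps power2_eq_square)
    ultimately show ?thesis unfolding F'_def u_def using wp(3)[OF that] by simp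
  qed
  have F'B: "\<bar>F' s\<bar> \<le> 2 * \<bar>C\<bar> * \<bar>B\<bar> + \<bar>C\<bar>\<^sup>2" if "s \<in> {l..r}" for s
  proof -
    have "\<bar>2 * u s * f' s\<bar> \<le> 2 * \<bar>C\<bar> * \<bar>B\<bar>"
      using u[OF that] B[of s] by (auto simp: abs_mult intro!: mult_mono)
    moreover have "\<bar>\<sigma> * (u s)\<^sup>2\<bar> \<le> \<bar>C\<bar>\<^sup>2"
      using \<sigma> u[OF that] power_mono[of "\<bar>u s\<bar>" "\<bar>C\<bar>" 2] by (auto simp: abs_mult)
    ultimately show ?thesis unfolding F'_def by linarith
  qed
  have [measurable]: "F' \<in> borel_measurable borel" unfolding F'_def[abs_def] by measurable
  have I: "(\<integral>s. indicator {l..r} s * F' s \<partial>lborel) = (f r)\<^sup>2 / ?w r - (f l)\<^sup>2 / ?w l"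
    by (rule FTC_bounded[OF lr F _ F'B]) measurable
  have iu: "integrable lborel (\<lambda>s. indicator {l..r} s * (u s)\<^sup>2)"
    using u power_mono[of "\<bar>u _\<bar>" C 2] by (intro integrable_bounded_on_interval[of _ _ _ "C\<^sup>2"]) auto
  have if': "integrable lborel (\<lambda>s. indicator {l..r} s * (f' s)\<^sup>2)"
    using B power_mono[of "\<bar>f' _\<bar>" B 2] by (intro integrable_bounded_on_interval[of _ _ _ "B\<^sup>2"]) auto
  have iF: "integrable lborel (\<lambda>s. indicator {l..r} s * F' s)"
    by (rule integrable_bounded_on_interval[OF _ F'B]) measurable
  have "(\<integral>s. indicator {l..r} s * (u s)\<^sup>2 \<partial>lborel) \<le> (\<integral>s. - 2 * \<sigma> * (indicator {l..r} s * F' s) + 4 * (indicator {l..r} s * (f' s)\<^sup>2) \<partial>lborel)"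
  proof (rule integral_mono[OF iu])
    show "integrable lborel (\<lambda>s. - 2 * \<sigma> * (indicator {l..r} s * F' s) + 4 * (indicator {l..r} s * (f' s)\<^sup>2))"
      using iF if' by simp
    fix s
    have "0 \<le> (u s - 2 * \<sigma> * f' s)\<^sup>2" by simp
    also have "\<dots> = (u s)\<^sup>2 - 4 * \<sigma> * (u s * f' s) + 4 * (\<sigma> * \<sigma>) * (f' s)\<^sup>2"
      by (simp add: power2_eq_square algebra_simps)
    finally have "4 * \<sigma> * (u s * f' s) \<le> (u s)\<^sup>2 + 4 * (f' s)\<^sup>2" unfolding ss by simp
    moreover have "- 2 * \<sigma> * F' s = - (4 * \<sigma> * (u s * f' s)) + 2 * (\<sigma> * \<sigma>) * (u s)\<^sup>2"
      by (simp add: F'_def algebra_simps)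
    ultimately have "(u s)\<^sup>2 \<le> - 2 * \<sigma> * F' s + 4 * (f' s)\<^sup>2" unfolding ss by linarith
    then show "indicator {l..r} s * (u s)\<^sup>2 \<le> - 2 * \<sigma> * (indicator {l..r} s * F' s) + 4 * (indicator {l..r} s * (f' s)\<^sup>2)"
      by (auto split: split_indicator)
  qed
  also have "\<dots> = - 2 * \<sigma> * ((f r)\<^sup>2 / ?w r - (f l)\<^sup>2 / ?w l) + 4 * (\<integral>s. indicator {l..r} s * (f' s)\<^sup>2 \<partial>lborel)"
    using iF if' I by (simp add: Bochner_Integration.integral_add)
  finally show ?thesis by (simp add: u_def power_divide algebra_simps)
qed

text \<open>The inequalities on both sides of \<open>a\<close> leave only the boundary value \<open>f a\<close>, and \<open>1 + \<bar>s - a\<bar>\<close> is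
  comparable to the square root of \<open>1 + s\<^sup>2\<close>, with a constant depending on \<open>N\<close>.\<close>

lemma hardy_line:
  fixes f f' :: "real \<Rightarrow> real"
  assumes f: "\<And>s. (f has_real_derivative f' s) (at s)" and B: "\<And>s. \<bar>f' s\<bar> \<le> B"
    and M: "\<And>s. M \<le> \<bar>s\<bar> \<Longrightarrow> f s = 0"  "\<And>s. M \<le> \<bar>s\<bar> \<Longrightarrow> f' s = 0" and N: "0 \<le> N" "\<bar>a\<bar> \<le> N"
  shows "(\<integral>s. (f s)\<^sup>2 / (1 + s\<^sup>2) \<partial>lborel) \<le> 2 * (1 + N)\<^sup>2 * (4 * (f a)\<^sup>2 + 4 * (\<integral>s. (f' s)\<^sup>2 \<partial>lborel))"
proof -
  define L where "L = \<bar>M\<bar> + \<bar>a\<bar>"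
  have L: "- L \<le> a" "a \<le> L" "M \<le> L" "M \<le> \<bar>- L\<bar>" "M \<le> \<bar>L\<bar>" by (auto simp: L_def)
  have z: "f (- L) = 0" "f L = 0" using M(1)[of L] M(1)[of "- L"] L by auto
  have f'm[measurable]: "f' \<in> borel_measurable borel" by (rule borel_measurable_derivative[OF f])
  have fc: "continuous_on UNIV f" using DERIV_isCont[OF f] by (simp add: continuous_on_eq_continuous_at)
  have fm[measurable]: "f \<in> borel_measurable borel" by (rule borel_measurable_continuous_onI[OF fc])
  have out: "f s = 0 \<and> f' s = 0" if "s \<notin> {- L..L}" for s using M[of s] that L(3) by (auto simp: not_le abs_if)
  let ?K = "2 * (1 + N)\<^sup>2"
  obtain C where C: "\<And>s. s \<in> {-L..L} \<Longrightarrow> \<bar>f s\<bar> \<le> C" by (rule continuous_bounded_Icc[OF fc]) blast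
  have sb: "integrable lborel (\<lambda>s. indicator {l..r} s * (f s)\<^sup>2 / (h s))"
    if [measurable]: "h \<in> borel_measurable borel" and "\<And>s. s \<in> {l..r} \<Longrightarrow> 1 \<le> h s" "{l..r} \<subseteq> {-L..L}" for h l r
  proof -
    have "\<bar>(f s)\<^sup>2 / h s\<bar> \<le> C\<^sup>2" if s: "s \<in> {l..r}" for s
    proof -
      have "\<bar>(f s)\<^sup>2 / h s\<bar> = (f s)\<^sup>2 / h s" using that \<open>\<And>s. s \<in> {l..r} \<Longrightarrow> 1 \<le> h s\<close>[OF s] by simp
      also have "\<dots> \<le> (f s)\<^sup>2 / 1" using \<open>\<And>s. s \<in> {l..r} \<Longrightarrow> 1 \<le> h s\<close>[OF s] by (intro divide_left_mono) auto
      also have "\<dots> \<le> C\<^sup>2" using C[of s] s \<open>{l..r} \<subseteq> {-L..L}\<close> power_mono[of "\<bar>f s\<bar>" C 2] by auto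
      finally show ?thesis .
    qed
    from integrable_bounded_on_interval[OF _ this] show ?thesis by simp
  qed
  have if': "integrable lborel (\<lambda>s. indicator {l..r} s * (f' s)\<^sup>2)" for l r
    using B power_mono[of "\<bar>f' _\<bar>" B 2] by (intro integrable_bounded_on_interval[of _ _ _ "B\<^sup>2"]) auto
  have f'tot: "(\<lambda>s. indicator {-L..L} s * (f' s)\<^sup>2) = (\<lambda>s. (f' s)\<^sup>2)"
    using out by (auto simp: indicator_def fun_eq_iff)
  have F': "(\<integral>s. indicator {l..r} s * (f' s)\<^sup>2 \<partial>lborel) \<le> (\<integral>s. indicator {-L..L} s * (f' s)\<^sup>2 \<partial>lborel)" if "{l..r} \<subseteq> {-L..L}" for l r
    using that by (intro integral_mono if') (auto split: split_indicator)
  let ?R = "\<lambda>s. indicator {a..L} s * (f s)\<^sup>2 / (1 + 1 * (s - a))\<^sup>2"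
  let ?L = "\<lambda>s. indicator {-L..a} s * (f s)\<^sup>2 / (1 + (-1) * (s - a))\<^sup>2"
  have one: "1 \<le> t\<^sup>2" if "1 \<le> t" for t :: real using that by (simp add: one_le_power)
  have iR: "integrable lborel ?R" and iL: "integrable lborel ?L"
    using L by (auto intro!: sb one)
  have split': "(\<integral>s. indicator {a..L} s * (f' s)\<^sup>2 \<partial>lborel) + (\<integral>s. indicator {-L..a} s * (f' s)\<^sup>2 \<partial>lborel) = (\<integral>s. (f' s)\<^sup>2 \<partial>lborel)"
  proof -
    have "(\<integral>s. indicator {a..L} s * (f' s)\<^sup>2 \<partial>lborel) + (\<integral>s. indicator {-L..a} s * (f' s)\<^sup>2 \<partial>lborel)
       = (\<integral>s. indicator {a..L} s * (f' s)\<^sup>2 + indicator {-L..a} s * (f' s)\<^sup>2 \<partial>lborel)"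
      by (intro Bochner_Integration.integral_add[symmetric] if')
    also have "\<dots> = (\<integral>s. indicator {-L..L} s * (f' s)\<^sup>2 \<partial>lborel)"
    proof (rule integral_cong_AE)
      show "AE s in lborel. indicator {a..L} s * (f' s)\<^sup>2 + indicator {-L..a} s * (f' s)\<^sup>2 = indicator {-L..L} s * (f' s)\<^sup>2"
        using AE_lborel_singleton[of a] by eventually_elim (use L in \<open>auto split: split_indicator\<close>)
    qed measurable
    finally show ?thesis unfolding f'tot .
  qed
  have hR: "integral\<^sup>L lborel ?R \<le> 2 * 1 * ((f a)\<^sup>2 / (1 + 1 * (a - a)) - (f L)\<^sup>2 / (1 + 1 * (L - a))) + 4 * (\<integral>s. indicator {a..L} s * (f' s)\<^sup>2 \<partial>lborel)"
    by (rule hardy_interval[OF L(2) f B]) auto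
  have hL: "integral\<^sup>L lborel ?L \<le> 2 * (-1) * ((f (-L))\<^sup>2 / (1 + (-1) * (-L - a)) - (f a)\<^sup>2 / (1 + (-1) * (a - a))) + 4 * (\<integral>s. indicator {-L..a} s * (f' s)\<^sup>2 \<partial>lborel)"
    by (rule hardy_interval[OF L(1) f B]) auto
  have pt: "(f s)\<^sup>2 / (1 + s\<^sup>2) \<le> ?K * (?R s + ?L s)" for s
  proof (cases "s \<in> {-L..L}")
    case True
    let ?w = "1 + \<bar>s - a\<bar>"
    have "0 \<le> N * \<bar>s\<bar>" using N by simp
    moreover have "(1 + N) * (1 + \<bar>s\<bar>) = 1 + N + \<bar>s\<bar> + N * \<bar>s\<bar>" by (simp add: algebra_simps)
    ultimately have "?w \<le> (1 + N) * (1 + \<bar>s\<bar>)" using N by linarith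
    then have "?w\<^sup>2 \<le> ((1 + N) * (1 + \<bar>s\<bar>))\<^sup>2" by (intro power_mono) auto
    also have "\<dots> = (1 + N)\<^sup>2 * (1 + \<bar>s\<bar>)\<^sup>2" by (simp add: power_mult_distrib)
    also have "\<dots> \<le> (1 + N)\<^sup>2 * (2 * (1 + s\<^sup>2))"
    proof (rule mult_left_mono)
      show "(1 + \<bar>s\<bar>)\<^sup>2 \<le> 2 * (1 + s\<^sup>2)" using zero_le_power2[of "1 - \<bar>s\<bar>"] by (simp add: power2_sum power2_diff)
    qed simp
    finally have w: "?w\<^sup>2 \<le> ?K * (1 + s\<^sup>2)" by (simp add: algebra_simps)
    have p: "0 < 1 + s\<^sup>2" "0 < ?w\<^sup>2" by (auto simp: add_pos_nonneg)
    have "(f s)\<^sup>2 / (1 + s\<^sup>2) \<le> ?K * ((f s)\<^sup>2 / ?w\<^sup>2)"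
    proof -
      have "(f s)\<^sup>2 * ?w\<^sup>2 \<le> (f s)\<^sup>2 * (?K * (1 + s\<^sup>2))" using w by (intro mult_left_mono) auto
      then show ?thesis using p by (simp add: divide_simps mult_ac)
    qed
    also have "(f s)\<^sup>2 / ?w\<^sup>2 \<le> ?R s + ?L s"
      using True by (cases "a \<le> s") (auto split: split_indicator simp: abs_if)
    finally show ?thesis by (simp add: mult_left_mono)
  qed (use out[of s] in simp)
  have "(\<integral>s. (f s)\<^sup>2 / (1 + s\<^sup>2) \<partial>lborel) \<le> (\<integral>s. ?K * (?R s + ?L s) \<partial>lborel)"
  proof (rule integral_mono[OF _ _ pt])
    show "integrable lborel (\<lambda>s. ?K * (?R s + ?L s))" using iR iL by (intro integrable_mult_right Bochner_Integration.integrable_add)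
    have "integrable lborel (\<lambda>s. indicator {-L..L} s * (f s)\<^sup>2 / (1 + s\<^sup>2))" by (rule sb) auto
    also have "(\<lambda>s. indicator {-L..L} s * (f s)\<^sup>2 / (1 + s\<^sup>2)) = (\<lambda>s. (f s)\<^sup>2 / (1 + s\<^sup>2))"
      using out by (auto simp: indicator_def fun_eq_iff)
    finally show "integrable lborel (\<lambda>s. (f s)\<^sup>2 / (1 + s\<^sup>2))" .
  qed
  also have "\<dots> = ?K * (integral\<^sup>L lborel ?R + integral\<^sup>L lborel ?L)"
    by (simp only: integral_mult_right_zero Bochner_Integration.integral_add[OF iR iL])
  also have "\<dots> \<le> ?K * (4 * (f a)\<^sup>2 + 4 * (\<integral>s. (f' s)\<^sup>2 \<partial>lborel))"
    using hR hL split' by (intro mult_left_mono) (auto simp: z)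
  finally show ?thesis .
qed

text \<open>Averaging \<open>hardy_line\<close> over the base point \<open>a\<close> with weight \<open>V\<close> turns \<open>(f a)\<^sup>2\<close> into the potential energy.\<close>

lemma hardy_with_potential:
  fixes f f' V :: "real \<Rightarrow> real"
  assumes f: "\<And>s. (f has_real_derivative f' s) (at s)" and B: "\<And>s. \<bar>f' s\<bar> \<le> B"
    and M: "\<And>s. M \<le> \<bar>s\<bar> \<Longrightarrow> f s = 0"  "\<And>s. M \<le> \<bar>s\<bar> \<Longrightarrow> f' s = 0" and N: "0 \<le> N"
    and V[measurable]: "V \<in> borel_measurable borel" and V0: "\<And>s. 0 \<le> V s" "\<And>s. V s \<le> C"
    and W: "(\<integral>s. indicator {-N..N} s * V s \<partial>lborel) = W"
    and c: "0 \<le> c" "c * (8 * (1 + N)\<^sup>2) \<le> k * W" "c * (8 * (1 + N)\<^sup>2) \<le> 1 / 2" "0 < W" "0 \<le> k"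
  shows "c * (\<integral>s. (f s)\<^sup>2 / (1 + s\<^sup>2) \<partial>lborel) \<le> (\<integral>s. (f' s)\<^sup>2 \<partial>lborel) / 2 + k * (\<integral>s. V s * (f s)\<^sup>2 \<partial>lborel)"
proof -
  let ?H = "\<integral>s. (f s)\<^sup>2 / (1 + s\<^sup>2) \<partial>lborel" and ?E = "\<integral>s. (f' s)\<^sup>2 \<partial>lborel" and ?K = "2 * (1 + N)\<^sup>2"
  let ?V = "\<integral>s. V s * (f s)\<^sup>2 \<partial>lborel"
  have fc: "continuous_on UNIV f" using DERIV_isCont[OF f] by (simp add: continuous_on_eq_continuous_at)
  have fm[measurable]: "f \<in> borel_measurable borel" by (rule borel_measurable_continuous_onI[OF fc])
  obtain G where G: "\<And>s. s \<in> {- \<bar>M\<bar> .. \<bar>M\<bar>} \<Longrightarrow> \<bar>f s\<bar> \<le> G"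
    by (rule continuous_bounded_Icc[OF fc]) blast
  have G': "\<bar>f s\<bar> \<le> \<bar>G\<bar>" for s
    using G[of s] M(1)[of s] by (cases "s \<in> {- \<bar>M\<bar> .. \<bar>M\<bar>}") (auto simp: not_le abs_if split: if_splits)
  have VB: "\<bar>V s * (f s)\<^sup>2\<bar> \<le> C * \<bar>G\<bar>\<^sup>2" for s
    using V0[of s] G'[of s] power_mono[OF G'[of s], of 2] by (simp add: abs_mult mult_mono)
  have iV: "integrable lborel (\<lambda>s. indicator {-N..N} s * V s)" using V0 by (intro integrable_bounded_on_interval[OF V, of _ _ C]) auto
  have iVf: "integrable lborel (\<lambda>s. indicator {l..r} s * (V s * (f s)\<^sup>2))" for l r
    by (rule integrable_bounded_on_interval[OF _ VB]) measurable
  have tot: "(\<lambda>s. indicator {- \<bar>M\<bar> .. \<bar>M\<bar>} s * (V s * (f s)\<^sup>2)) = (\<lambda>s. V s * (f s)\<^sup>2)"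
  proof
    fix s show "indicator {- \<bar>M\<bar> .. \<bar>M\<bar>} s * (V s * (f s)\<^sup>2) = V s * (f s)\<^sup>2"
      using M(1)[of s] by (cases "s \<in> {- \<bar>M\<bar> .. \<bar>M\<bar>}") (auto simp: not_le abs_if split: if_splits)
  qed
  have E0: "0 \<le> ?E" by simp
  have "W * ?H = (\<integral>s. indicator {-N..N} s * V s * ?H \<partial>lborel)" using W by simp
  also have "\<dots> \<le> (\<integral>s. (4 * ?K) * (indicator {-N..N} s * (V s * (f s)\<^sup>2)) + (4 * ?K * ?E) * (indicator {-N..N} s * V s) \<partial>lborel)"
  proof (rule integral_mono)
    show "integrable lborel (\<lambda>s. indicator {-N..N} s * V s * ?H)" using iV by simp
    show "integrable lborel (\<lambda>s. (4 * ?K) * (indicator {-N..N} s * (V s * (f s)\<^sup>2)) + (4 * ?K * ?E) * (indicator {-N..N} s * V s))"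
      by (intro Bochner_Integration.integrable_add integrable_mult_right iV iVf)
    fix s
    show "indicator {-N..N} s * V s * ?H \<le> (4 * ?K) * (indicator {-N..N} s * (V s * (f s)\<^sup>2)) + (4 * ?K * ?E) * (indicator {-N..N} s * V s)"
    proof (cases "s \<in> {-N..N}")
      case True
      have "?H \<le> ?K * (4 * (f s)\<^sup>2 + 4 * ?E)" using True by (intro hardy_line[OF f B M N]) auto
      from mult_left_mono[OF this V0(1)[of s]] show ?thesis using True by (simp add: algebra_simps)
    qed simp
  qed
  also have "\<dots> = (4 * ?K) * (\<integral>s. indicator {-N..N} s * (V s * (f s)\<^sup>2) \<partial>lborel) + (4 * ?K * ?E) * W"
    using iV iVf W by (simp add: Bochner_Integration.integral_add)
  also have "(\<integral>s. indicator {-N..N} s * (V s * (f s)\<^sup>2) \<partial>lborel) \<le> ?V"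
  proof (rule integral_mono[OF iVf])
    show "integrable lborel (\<lambda>s. V s * (f s)\<^sup>2)" using iVf[of "- \<bar>M\<bar>" "\<bar>M\<bar>"] unfolding tot .
    show "indicator {-N..N} s * (V s * (f s)\<^sup>2) \<le> V s * (f s)\<^sup>2" for s using V0[of s] by (auto split: split_indicator)
  qed
  finally have WH: "W * ?H \<le> 8 * (1 + N)\<^sup>2 * ?V + 8 * (1 + N)\<^sup>2 * ?E * W" by (simp add: mult_left_mono)
  have V0': "0 \<le> ?V" using V0 by (intro integral_nonneg_AE) auto
  have "c * (W * ?H) \<le> c * (8 * (1 + N)\<^sup>2 * ?V + 8 * (1 + N)\<^sup>2 * ?E * W)" using WH c(1) by (rule mult_left_mono)
  also have "\<dots> = (c * (8 * (1 + N)\<^sup>2)) * ?V + (c * (8 * (1 + N)\<^sup>2)) * (?E * W)" by (simp add: algebra_simps)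
  also have "\<dots> \<le> (k * W) * ?V + (1 / 2) * (?E * W)"
    using c V0' E0 by (intro add_mono mult_right_mono) auto
  finally have "W * (c * ?H) \<le> W * (?E / 2 + k * ?V)" by (simp add: algebra_simps)
  then show ?thesis using c(4) by simp
qed

section \<open>The twisted tube\<close>

text \<open>The point of the tube with straightened coordinates \<open>(s, y)\<close>.\<close>

definition tube_pt :: "(real \<Rightarrow> real) \<Rightarrow> real \<Rightarrow> real ^ 2 \<Rightarrow> real ^ 3" where
  "tube_pt \<theta> s y = emb s (Rot (\<theta> s) y)"

definition transv :: "real ^ 3 \<Rightarrow> real ^ 2" where
  "transv x = vector [x $ 2, x $ 3]"

lemma transv_nth [simp]: "transv x $ 1 = x $ 2" "transv x $ 2 = x $ 3"
  by (simp_all add: transv_def)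

lemma vec3_eq_iff: "x = y \<longleftrightarrow> x $ 1 = y $ 1 \<and> x $ 2 = y $ 2 \<and> x $ 3 = y $ 3" for x y :: "'a ^ 3"
  by (simp add: vec_eq_iff forall_3)

lemma inner_vec3: "x \<bullet> y = x $ 1 * y $ 1 + x $ 2 * y $ 2 + x $ 3 * y $ 3" for x y :: "real ^ 3"
  by (simp add: inner_vec_def sum_3)

lemma transv_emb [simp]: "transv (emb s y) = y"
  by (simp add: vec2_eq_iff)

lemma inner_emb: "g \<bullet> emb h y = g $ 1 * h + transv g \<bullet> y"
  by (simp add: inner_vec3 inner_vec2)

lemma norm_transv: "(norm x)\<^sup>2 = (x $ 1)\<^sup>2 + (norm (transv x))\<^sup>2" for x :: "real ^ 3"
  unfolding power2_norm_eq_inner inner_vec3 inner_vec2 by (simp add: power2_eq_square)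

lemma continuous_transv: "continuous_on S transv"
  by (rule continuous_on_vec2) (auto intro!: continuous_intros)

lemma twisted_tube_alt: "twisted_tube \<omega> \<theta> = {x. Rot (- \<theta> (x $ 1)) (transv x) \<in> \<omega>}"
proof -
  have mat: "vector [vector [1, 0, 0], vector [0, cos a, sin a], vector [0, - sin a, cos a]] *v (vector [x1, x2, x3] :: real ^ 3)
     = emb x1 (Rot a (vector [x2, x3]))" for a x1 x2 x3 :: real
    by (simp add: vec3_eq_iff matrix_vector_mult_def sum_3)
  have "twisted_tube \<omega> \<theta> = {emb s (Rot (\<theta> s) y) | s y. y \<in> \<omega>}" (is "_ = ?B")
  proof
    show "twisted_tube \<omega> \<theta> \<subseteq> ?B" unfolding twisted_tube_def mat by blast
    show "?B \<subseteq> twisted_tube \<omega> \<theta>"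
    proof
      fix x assume "x \<in> ?B"
      then obtain s y where "x = emb s (Rot (\<theta> s) y)" "y \<in> \<omega>" by blast
      moreover have "y = vector [y $ 1, y $ 2]" by (simp add: vec2_eq_iff)
      ultimately show "x \<in> twisted_tube \<omega> \<theta>" unfolding twisted_tube_def mat by (smt (verit) mem_Collect_eq)
    qed
  qed
  also have "\<dots> = {x. Rot (- \<theta> (x $ 1)) (transv x) \<in> \<omega>}"
  proof (intro set_eqI iffI)
    fix x assume "x \<in> ?B"
    then show "x \<in> {x. Rot (- \<theta> (x $ 1)) (transv x) \<in> \<omega>}" by (auto simp: Rot_Rot)
  next
    fix x assume "x \<in> {x. Rot (- \<theta> (x $ 1)) (transv x) \<in> \<omega>}"
    moreover have "x = emb (x $ 1) (Rot (\<theta> (x $ 1)) (Rot (- \<theta> (x $ 1)) (transv x)))"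
      by (simp add: Rot_Rot vec3_eq_iff)
    ultimately show "x \<in> ?B" by blast
  qed
  finally show ?thesis .
qed

lemma tube_pt_in [simp]: "tube_pt \<theta> s y \<in> twisted_tube \<omega> \<theta> \<longleftrightarrow> y \<in> \<omega>"
  by (simp add: twisted_tube_alt tube_pt_def Rot_Rot)

lemma open_twisted_tube:
  assumes "open \<omega>" "continuous_on UNIV \<theta>" shows "open (twisted_tube \<omega> \<theta>)"
proof -
  have "continuous_on UNIV (\<lambda>x :: real ^ 3. - \<theta> (x $ 1))"
    by (intro continuous_intros continuous_on_compose2[OF assms(2)]) auto
  then have "continuous_on UNIV (\<lambda>x :: real ^ 3. Rot (- \<theta> (x $ 1)) (transv x))"
    by (intro continuous_Rot2 continuous_transv)
  then show ?thesis
    unfolding twisted_tube_alt using open_vimage[OF assms(1)] by (simp add: vimage_def)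
qed

lemma bounded_linear_section: "bounded_linear (\<lambda>y. emb 0 (Rot a y))"
proof -
  have "linear (\<lambda>y. emb 0 (Rot a y))"
    by (intro linearI) (auto simp: vec3_eq_iff algebra_simps)
  then show ?thesis by (simp add: linear_conv_bounded_linear)
qed

lemma tube_pt_affine: "tube_pt \<theta> s y = emb s 0 + emb 0 (Rot (\<theta> s) y)"
  by (simp add: tube_pt_def vec3_eq_iff)

lemma norm_tube_pt: "(norm (tube_pt \<theta> s y))\<^sup>2 = s\<^sup>2 + (norm y)\<^sup>2"
  by (simp add: norm_transv tube_pt_def)

lemma continuous_tube_pt: "continuous_on UNIV (tube_pt \<theta> s)"
  unfolding tube_pt_def by (intro continuous_emb continuous_Rot continuous_intros)

lemma section_compact:
  assumes "compact K" shows "compact {y. tube_pt \<theta> s y \<in> K}"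
proof -
  obtain B where B: "\<And>x. x \<in> K \<Longrightarrow> norm x \<le> B" using compact_imp_bounded[OF assms] bounded_iff by metis
  have "closed (tube_pt \<theta> s -` K)" using compact_imp_closed[OF assms] continuous_tube_pt by (rule closed_vimage)
  moreover have "bounded (tube_pt \<theta> s -` K)"
  proof (rule boundedI)
    fix y assume "y \<in> tube_pt \<theta> s -` K"
    then have b: "norm (tube_pt \<theta> s y) \<le> B" using B by simp
    have "(norm y)\<^sup>2 \<le> (norm (tube_pt \<theta> s y))\<^sup>2" unfolding norm_tube_pt by simp
    then have "norm y \<le> norm (tube_pt \<theta> s y)" by (rule power2_le_imp_le) simp
    then show "norm y \<le> B" using b by simp
  qed
  ultimately show ?thesis by (simp add: vimage_def compact_eq_bounded_closed)
qed

lemma section_cc: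
  assumes "g \<in> cc" shows "(\<lambda>y. g (tube_pt \<theta> s y)) \<in> cc"
proof -
  obtain K where K: "compact K" "\<And>x. x \<notin> K \<Longrightarrow> g x = 0" using assms by (auto simp: cc_def)
  show ?thesis
  proof (rule ccI[OF _ section_compact[OF K(1)]])
    show "continuous_on UNIV (\<lambda>y. g (tube_pt \<theta> s y))"
      by (rule continuous_on_compose2[OF cc_cont[OF assms] continuous_tube_pt]) auto
  qed (use K(2) in simp)
qed

lemma section_rtest:
  assumes \<psi>: "\<psi> \<in> rtest (twisted_tube \<omega> \<theta>)"
  shows "(\<lambda>y. \<psi> (tube_pt \<theta> s y)) \<in> rtest \<omega>"
proof -
  obtain K where K: "compact K" "K \<subseteq> twisted_tube \<omega> \<theta>" "\<And>x. x \<notin> K \<Longrightarrow> \<psi> x = 0" by (rule rtestE[OF \<psi>]) blast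
  show ?thesis
  proof (rule rtestI[OF _ section_compact[OF K(1)]])
    show "smooth (\<lambda>y. \<psi> (tube_pt \<theta> s y))"
      unfolding tube_pt_affine by (rule smooth_affine[OF bounded_linear_section rtest_smooth[OF \<psi>]])
    show "{y. tube_pt \<theta> s y \<in> K} \<subseteq> \<omega>" using K(2) tube_pt_in by blast
  qed (use K(3) in simp)
qed

text \<open>So the slice has the same transverse gradient as the function on the tube, up to a rotation that
  does not affect its norm.\<close>

lemma gr_section:
  assumes "smooth \<psi>"
  shows "gr (\<lambda>y. \<psi> (tube_pt \<theta> s y)) y = Rot (- \<theta> s) (transv (gr \<psi> (tube_pt \<theta> s y)))"
proof (rule gr_eq)
  let ?z = "tube_pt \<theta> s y"
  have "((\<lambda>y. emb s 0 + emb 0 (Rot (\<theta> s) y)) has_derivative (\<lambda>v. emb 0 (Rot (\<theta> s) v))) (at y)"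
    using has_derivative_add[OF has_derivative_const bounded_linear_imp_has_derivative[OF bounded_linear_section]] by auto
  then have "(tube_pt \<theta> s has_derivative (\<lambda>v. emb 0 (Rot (\<theta> s) v))) (at y)"
    unfolding tube_pt_affine[abs_def] .
  from has_derivative_compose[OF this smooth_gr[OF assms]]
  have "((\<lambda>y. \<psi> (tube_pt \<theta> s y)) has_derivative (\<lambda>v. gr \<psi> ?z \<bullet> emb 0 (Rot (\<theta> s) v))) (at y)" .
  moreover have "gr \<psi> ?z \<bullet> emb 0 (Rot (\<theta> s) v) = Rot (- \<theta> s) (transv (gr \<psi> ?z)) \<bullet> v" for v
    using Rot_inner[of "\<theta> s" "Rot (- \<theta> s) (transv (gr \<psi> ?z))" v] by (simp add: inner_emb Rot_Rot)
  ultimately show "((\<lambda>y. \<psi> (tube_pt \<theta> s y)) has_derivative (\<lambda>v. Rot (- \<theta> s) (transv (gr \<psi> ?z)) \<bullet> v)) (at y)" by simp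
qed

lemma rot_field_Rot: "rot_field (Rot a y) = Rot a (rot_field y)"
  by (simp add: vec2_eq_iff rot_field_def algebra_simps)

lemma tau_section:
  assumes "smooth \<psi>"
  shows "tau (\<lambda>y. \<psi> (tube_pt \<theta> s y)) y = transv (gr \<psi> (tube_pt \<theta> s y)) \<bullet> rot_field (transv (tube_pt \<theta> s y))"
proof -
  let ?g = "transv (gr \<psi> (tube_pt \<theta> s y))"
  have "Rot (- \<theta> s) ?g \<bullet> rot_field y = Rot (\<theta> s) (Rot (- \<theta> s) ?g) \<bullet> Rot (\<theta> s) (rot_field y)" by (rule Rot_inner[symmetric])
  also have "\<dots> = ?g \<bullet> rot_field (Rot (\<theta> s) y)" by (simp add: Rot_Rot rot_field_Rot)
  finally show ?thesis unfolding tau_def gr_section[OF assms] by (simp add: tube_pt_def)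
qed

text \<open>Moving in \<open>s\<close> with \<open>y\<close> fixed means to move along the tube while rotating with angular velocity \<open>\<theta>'\<close>.\<close>

lemma longitudinal_derivative:
  assumes \<psi>: "smooth \<psi>" and \<theta>: "(\<theta> has_real_derivative \<theta>') (at s)"
  shows "((\<lambda>s. \<psi> (tube_pt \<theta> s y)) has_real_derivative
     gr \<psi> (tube_pt \<theta> s y) $ 1 + \<theta>' * tau (\<lambda>y. \<psi> (tube_pt \<theta> s y)) y) (at s)"
proof -
  let ?z = "tube_pt \<theta> s y"
  have e: "tube_pt \<theta> r y = emb r 0 + emb 0 (Rot (\<theta> r) y)" for r by (rule tube_pt_affine)
  have l1: "bounded_linear (\<lambda>h. emb h 0)"
    unfolding linear_conv_bounded_linear[symmetric] by (intro linearI) (auto simp: vec3_eq_iff)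
  have l2: "bounded_linear (\<lambda>v. emb 0 v)"
    unfolding linear_conv_bounded_linear[symmetric] by (intro linearI) (auto simp: vec3_eq_iff)
  have "((\<lambda>r. Rot (\<theta> r) y) has_derivative (\<lambda>h. (h * \<theta>') *\<^sub>R rot_field (Rot (\<theta> s) y))) (at s)"
    using has_derivative_compose[OF \<theta>[unfolded has_field_derivative_def] Rot_has_derivative]
    by (simp add: mult.commute)
  from has_derivative_add[OF bounded_linear_imp_has_derivative[OF l1] bounded_linear.has_derivative[OF l2 this]]
  have "((\<lambda>r. tube_pt \<theta> r y) has_derivative (\<lambda>h. emb h 0 + emb 0 ((h * \<theta>') *\<^sub>R rot_field (Rot (\<theta> s) y)))) (at s)"
    unfolding e .
  from has_derivative_compose[OF this smooth_gr[OF \<psi>]]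
  have "((\<lambda>r. \<psi> (tube_pt \<theta> r y)) has_derivative (\<lambda>h. gr \<psi> ?z \<bullet> (emb h 0 + emb 0 ((h * \<theta>') *\<^sub>R rot_field (Rot (\<theta> s) y))))) (at s)" .
  moreover have "gr \<psi> ?z \<bullet> (emb h 0 + emb 0 ((h * \<theta>') *\<^sub>R rot_field (Rot (\<theta> s) y)))
      = (gr \<psi> ?z $ 1 + \<theta>' * tau (\<lambda>y. \<psi> (tube_pt \<theta> s y)) y) * h" for h
  proof -
    have "transv ?z = Rot (\<theta> s) y" by (simp add: tube_pt_def)
    then show ?thesis unfolding tau_section[OF \<psi>] by (simp add: inner_add_right inner_emb algebra_simps)
  qed
  ultimately show ?thesis by (simp add: has_field_derivative_def mult_commute_abs)
qed

section \<open>The Hardy inequality for real test functions on the tube\<close>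

text \<open>The integral of \<open>slice_inequality\<close> over \<open>s\<close>, in which the total derivative disappears.
  \<open>hardy_with_potential\<close> bounds the weighted norm of the coefficient \<open>f\<close>, and the gap term bounds the
  rest of the slice, whose weighted norm is at most its norm. As \<open>\<xi>\<close> depends on \<open>\<kappa>\<close> while the conclusion of
  the estimate does not, \<open>\<kappa>\<close> can then tend to zero.\<close>

lemma tube_inequality_test:
  fixes \<beta> :: real and \<epsilon> \<theta> :: "real \<Rightarrow> real"
  assumes R: "\<And>x. x \<in> \<omega> \<Longrightarrow> norm x \<le> R" and D: "0 < D0" and \<delta>0: "0 < \<delta>" and \<delta>: "36 * \<beta>\<^sup>2 * (D1 + R\<^sup>2) \<le> \<delta>"
    and ground: "\<And>\<kappa>. \<kappa> > 0 \<Longrightarrow> \<exists>\<xi>\<in>rtest \<omega>. ip \<xi> \<xi> = 1 \<and> D0 \<le> ip (tau \<xi>) (tau \<xi>) \<and> ip (tau \<xi>) (tau \<xi>) \<le> D1 \<and>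
       (\<forall>u\<in>rtest \<omega>. \<forall>z. ip \<xi> u = 0 \<longrightarrow> \<delta> * (ip u u + dirichlet u) - \<kappa> * z\<^sup>2 \<le> transverse_form \<omega> \<beta> (\<lambda>x. z * \<xi> x + u x))"
    and \<theta>: "\<And>s. (\<theta> has_real_derivative \<beta> + \<epsilon> s) (at s)"
    and \<epsilon>: "\<And>s. \<bar>\<epsilon> s\<bar> \<le> \<bar>\<beta>\<bar> / 16" "\<And>s. 0 \<le> \<beta> * \<epsilon> s"
    and N: "0 \<le> N" and W: "(\<integral>s. indicator {-N..N} s * (\<beta> * \<epsilon> s) \<partial>lborel) = W" "0 < W"
    and c: "0 \<le> c" "c * (8 * (1 + N)\<^sup>2) \<le> 3 / 4 * D0 * W" "c * (8 * (1 + N)\<^sup>2) \<le> 1 / 2" "c \<le> \<delta> / 2"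
    and \<psi>: "\<psi> \<in> rtest (twisted_tube \<omega> \<theta>)"
  shows "c * (\<integral>x. (\<psi> x)\<^sup>2 / (1 + (norm x)\<^sup>2) \<partial>lborel) \<le> dirichlet \<psi> - lambda1 \<omega> \<beta> * ip \<psi> \<psi>"
proof -
  let ?l = "lambda1 \<omega> \<beta>"
  note s\<psi> = rtest_smooth[OF \<psi>]
  define \<phi> where "\<phi> s = (\<lambda>y. \<psi> (tube_pt \<theta> s y))" for s
  define P where "P s = (\<lambda>y. gr \<psi> (tube_pt \<theta> s y) $ 1)" for s
  define d where "d s = (\<lambda>y. P s y + (\<beta> + \<epsilon> s) * tau (\<phi> s) y)" for s
  define n where "n s = ip (\<phi> s) (\<phi> s)" for s
  have \<phi>: "\<phi> s \<in> rtest \<omega>" for s unfolding \<phi>_def by (rule section_rtest[OF \<psi>])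
  have g1: "(\<lambda>x. gr \<psi> x $ 1) \<in> cc"
    using rtest_gr_cc[OF \<psi> continuous_on_const, of "axis 1 1"] by (simp add: inner_axis)
  have P: "P s \<in> cc" for s unfolding P_def by (rule section_cc[OF g1])
  have dc: "d s \<in> cc" for s unfolding d_def by (intro cc_add cc_cmult P tau_cc[OF \<phi>])
  \<comment> \<open>In coordinates of the tube the angular derivative of a slice is a continuous function of
    compact support, so it is bounded uniformly over all slices.\<close>
  have tcc: "(\<lambda>x. transv (gr \<psi> x) \<bullet> rot_field (transv x)) \<in> cc"
  proof -
    have "transv (gr \<psi> x) \<bullet> rot_field (transv x) = gr \<psi> x \<bullet> emb 0 (rot_field (transv x))" for x by (simp add: inner_emb)
    moreover have "continuous_on UNIV (\<lambda>x. emb 0 (rot_field (transv x)))"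
      by (intro continuous_emb continuous_intros continuous_on_compose2[OF continuous_rot_field[of UNIV] continuous_transv]) auto
    ultimately show ?thesis using rtest_gr_cc[OF \<psi>] by simp
  qed
  obtain B1 where B1: "B1 > 0" "\<And>x. \<bar>gr \<psi> x $ 1\<bar> \<le> B1" by (rule cc_bounded[OF g1]) blast
  obtain B2 where B2: "B2 > 0" "\<And>x. \<bar>transv (gr \<psi> x) \<bullet> rot_field (transv x)\<bar> \<le> B2" by (rule cc_bounded[OF tcc]) blast
  define B where "B = B1 + 2 * \<bar>\<beta>\<bar> * B2"
  have dB: "\<bar>d s y\<bar> \<le> B" for s y
  proof -
    have "\<bar>tau (\<phi> s) y\<bar> \<le> B2" unfolding \<phi>_def tau_section[OF s\<psi>] by (rule B2)
    moreover have "\<bar>\<beta> + \<epsilon> s\<bar> \<le> 2 * \<bar>\<beta>\<bar>" using \<epsilon>(1)[of s] by linarith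
    ultimately have "\<bar>(\<beta> + \<epsilon> s) * tau (\<phi> s) y\<bar> \<le> 2 * \<bar>\<beta>\<bar> * B2" unfolding abs_mult by (intro mult_mono) auto
    moreover have "\<bar>P s y\<bar> \<le> B1" unfolding P_def by (rule B1)
    ultimately show ?thesis unfolding d_def B_def by linarith
  qed
  have \<phi>d: "((\<lambda>s. \<phi> s y) has_real_derivative d s y) (at s)" for s y
    using longitudinal_derivative[OF s\<psi> \<theta>[of s], of y] unfolding \<phi>_def d_def P_def .
  have lip: "\<bar>\<phi> r y - \<phi> s y\<bar> \<le> B * \<bar>r - s\<bar>" for r s y
    using field_differentiable_bound[of UNIV "\<lambda>s. \<phi> s y" "\<lambda>s. d s y" B r s] \<phi>d dB by simp
  have deriv: "((\<lambda>s. ip \<zeta> (\<phi> s)) has_real_derivative ip \<zeta> (d s)) (at s)" if \<zeta>: "\<zeta> \<in> cc" for \<zeta> s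
    unfolding ip_def
  proof (rule deriv_integral[where B="\<lambda>y. B * \<bar>\<zeta> y\<bar>"])
    show "integrable lborel (\<lambda>y. \<zeta> y * \<phi> r y)" for r by (intro cc_integrable cc_mult \<zeta> rtest_cc[OF \<phi>])
    show "(\<lambda>y. \<zeta> y * d s y) \<in> borel_measurable lborel" using cc_borel[OF cc_mult[OF \<zeta> dc]] by simp
    show "((\<lambda>r. \<zeta> y * \<phi> r y) has_real_derivative \<zeta> y * d s y) (at s)" for y
      by (rule DERIV_cmult[OF \<phi>d])
    show "\<bar>\<zeta> y * \<phi> r y - \<zeta> y * \<phi> s y\<bar> \<le> \<bar>r - s\<bar> * (B * \<bar>\<zeta> y\<bar>)" for r y
      using mult_left_mono[OF lip[of r y s], of "\<bar>\<zeta> y\<bar>"] by (simp add: abs_mult mult_ac flip: right_diff_distrib)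
    show "integrable lborel (\<lambda>y. B * \<bar>\<zeta> y\<bar>)" using cc_integrable[OF \<zeta>] by simp
  qed
  have dbound: "\<bar>ip \<zeta> (d s)\<bar> \<le> B * (\<integral>y. \<bar>\<zeta> y\<bar> \<partial>lborel)" if \<zeta>: "\<zeta> \<in> cc" for \<zeta> s
  proof -
    have "\<bar>ip \<zeta> (d s)\<bar> \<le> (\<integral>y. \<bar>\<zeta> y * d s y\<bar> \<partial>lborel)" unfolding ip_def by (rule integral_abs_bound)
    also have "\<dots> \<le> (\<integral>y. B * \<bar>\<zeta> y\<bar> \<partial>lborel)"
    proof (rule integral_mono)
      show "integrable lborel (\<lambda>y. \<bar>\<zeta> y * d s y\<bar>)" by (intro integrable_abs cc_integrable cc_mult \<zeta> dc)
      show "integrable lborel (\<lambda>y. B * \<bar>\<zeta> y\<bar>)" by (intro integrable_mult_right integrable_abs cc_integrable \<zeta>)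
      show "\<bar>\<zeta> y * d s y\<bar> \<le> B * \<bar>\<zeta> y\<bar>" for y
        using mult_left_mono[OF dB[of s y], of "\<bar>\<zeta> y\<bar>"] by (simp add: abs_mult mult.commute)
    qed
    finally show ?thesis by simp
  qed
  obtain K where K: "compact K" "\<And>x. x \<notin> K \<Longrightarrow> \<psi> x = 0" "\<And>x. x \<notin> K \<Longrightarrow> gr \<psi> x = 0" by (rule rtestE[OF \<psi>]) blast
  obtain M0 where M0: "\<And>x. x \<in> K \<Longrightarrow> norm x \<le> M0" using compact_imp_bounded[OF K(1)] bounded_iff by metis
  define M where "M = M0 + 1"
  have notK: "tube_pt \<theta> s y \<notin> K" if "M \<le> \<bar>s\<bar>" for s y
  proof
    assume "tube_pt \<theta> s y \<in> K"
    then have "norm (tube_pt \<theta> s y) \<le> M0" by (rule M0)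
    moreover have "\<bar>s\<bar> \<le> norm (tube_pt \<theta> s y)"
      by (rule power2_le_imp_le) (simp_all add: norm_tube_pt)
    ultimately show False using that by (simp add: M_def)
  qed
  have out: "\<phi> s = (\<lambda>_. 0)" "d s = (\<lambda>_. 0)" if "M \<le> \<bar>s\<bar>" for s
  proof -
    show "\<phi> s = (\<lambda>_. 0)" using K(2) notK[OF that] by (auto simp: \<phi>_def)
    have "transv 0 = 0" by (simp add: vec2_eq_iff)
    then have "tau (\<phi> s) y = 0" for y unfolding \<phi>_def tau_section[OF s\<psi>] using K(3) notK[OF that] by simp
    then show "d s = (\<lambda>_. 0)" using K(3) notK[OF that] by (auto simp: d_def P_def)
  qed
  have ip0: "ip \<zeta> (\<lambda>_. 0) = 0" for \<zeta> :: "real ^ 2 \<Rightarrow> real" by (simp add: ip_def)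
  \<comment> \<open>\<open>\<beta> + \<epsilon>\<close> is the derivative of \<open>\<theta>\<close>.\<close>
  have \<epsilon>m[measurable]: "\<epsilon> \<in> borel_measurable borel"
  proof -
    have "(\<lambda>s. (\<beta> + \<epsilon> s) - \<beta>) \<in> borel_measurable borel"
      using borel_measurable_derivative[OF \<theta>] by measurable
    then show ?thesis by simp
  qed
  define L where "L = \<bar>M\<bar>"
  have L: "0 \<le> L" "M \<le> \<bar>L\<bar>" "M \<le> \<bar>- L\<bar>" by (auto simp: L_def)
  have outL: "M \<le> \<bar>s\<bar>" if "s \<notin> {-L..L}" for s using that by (auto simp: L_def abs_if split: if_splits)
  have intL: "integrable lborel h"
    if [measurable]: "h \<in> borel_measurable borel" and "\<And>s. \<bar>h s\<bar> \<le> C" "\<And>s. M \<le> \<bar>s\<bar> \<Longrightarrow> h s = 0" for h :: "real \<Rightarrow> real" and C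
  proof -
    have "integrable lborel (\<lambda>s. indicator {-L..L} s * h s)"
      by (rule integrable_bounded_on_interval[OF that(1) that(2)])
    moreover have "(\<lambda>s. indicator {-L..L} s * h s) = h"
      using that(3) outL by (auto simp: indicator_def fun_eq_iff)
    ultimately show ?thesis by simp
  qed
  have tubeI: "integrable lborel (\<lambda>s. \<integral>y. g (tube_pt \<theta> s y) \<partial>lborel)" "(\<integral>s. \<integral>y. g (tube_pt \<theta> s y) \<partial>lborel \<partial>lborel) = integral\<^sup>L lborel g"
    if "g \<in> cc" for g :: "real ^ 3 \<Rightarrow> real"
    using tube_Fubini[OF cc_integrable[OF that], of \<theta>] by (simp_all add: tube_pt_def)
  have c2: "(\<lambda>x. \<psi> x * \<psi> x) \<in> cc" by (intro cc_mult rtest_cc[OF \<psi>])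
  have c3: "(\<lambda>x. (norm (gr \<psi> x))\<^sup>2) \<in> cc" by (rule rtest_norm_gr_cc[OF \<psi>])
  have c4: "(\<lambda>x. inverse (1 + (x $ 1)\<^sup>2) * (\<psi> x * \<psi> x)) \<in> cc"
  proof (rule cc_multc[OF _ c2])
    have "1 + (x $ 1)\<^sup>2 \<noteq> 0" for x :: "real ^ 3" by (simp add: add_pos_nonneg less_imp_neq[symmetric])
    then show "continuous_on UNIV (\<lambda>x :: real ^ 3. inverse (1 + (x $ 1)\<^sup>2))" by (intro continuous_intros) auto
  qed
  have ni: "integrable lborel n" and nI: "integral\<^sup>L lborel n = ip \<psi> \<psi>"
    using tubeI[OF c2] by (simp_all add: n_def[abs_def] ip_def \<phi>_def)
  have gi: "(\<integral>y. (norm (gr \<psi> (tube_pt \<theta> s y)))\<^sup>2 \<partial>lborel) = ip (P s) (P s) + dirichlet (\<phi> s)" for s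
  proof -
    have e: "(norm (gr \<psi> (tube_pt \<theta> s y)))\<^sup>2 = P s y * P s y + (norm (gr (\<phi> s) y))\<^sup>2" for y
      unfolding \<phi>_def gr_section[OF s\<psi>] by (simp add: norm_transv[of "gr \<psi> _"] P_def power2_eq_square[of "_ $ 1"])
    show ?thesis unfolding e ip_def
      by (intro Bochner_Integration.integral_add cc_integrable cc_mult P rtest_norm_gr_cc[OF \<phi>])
  qed
  define q where "q s = ip (P s) (P s) + dirichlet (\<phi> s) - ?l * n s" for s
  have qi0: "integrable lborel (\<lambda>s. ip (P s) (P s) + dirichlet (\<phi> s))" "(\<integral>s. ip (P s) (P s) + dirichlet (\<phi> s) \<partial>lborel) = dirichlet \<psi>"
    using tubeI[OF c3] by (simp_all add: gi)
  have qi: "integrable lborel q" and qI: "integral\<^sup>L lborel q = dirichlet \<psi> - ?l * ip \<psi> \<psi>"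
    using qi0 ni nI by (simp_all add: q_def[abs_def] Bochner_Integration.integral_diff)
  have n0: "0 \<le> n s" for s by (simp add: n_def ip_nonneg)
  have H: "(\<integral>s. n s / (1 + s\<^sup>2) \<partial>lborel) = (\<integral>x. inverse (1 + (x $ 1)\<^sup>2) * (\<psi> x * \<psi> x) \<partial>lborel)"
    and Hi: "integrable lborel (\<lambda>s. n s / (1 + s\<^sup>2))"
  proof -
    have e: "(\<integral>y. inverse (1 + (tube_pt \<theta> s y $ 1)\<^sup>2) * (\<psi> (tube_pt \<theta> s y) * \<psi> (tube_pt \<theta> s y)) \<partial>lborel) = n s / (1 + s\<^sup>2)" for s
      by (simp add: tube_pt_def n_def ip_def \<phi>_def divide_inverse mult.commute)
    show "(\<integral>s. n s / (1 + s\<^sup>2) \<partial>lborel) = (\<integral>x. inverse (1 + (x $ 1)\<^sup>2) * (\<psi> x * \<psi> x) \<partial>lborel)" "integrable lborel (\<lambda>s. n s / (1 + s\<^sup>2))"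
      using tubeI[OF c4] by (simp_all add: e)
  qed
  have weight: "(\<integral>x. (\<psi> x)\<^sup>2 / (1 + (norm x)\<^sup>2) \<partial>lborel) \<le> (\<integral>s. n s / (1 + s\<^sup>2) \<partial>lborel)"
    unfolding H
  proof (rule integral_mono')
    show "integrable lborel (\<lambda>x. inverse (1 + (x $ 1)\<^sup>2) * (\<psi> x * \<psi> x))" by (rule cc_integrable[OF c4])
    fix x :: "real ^ 3"
    have "(\<psi> x)\<^sup>2 / (1 + (norm x)\<^sup>2) \<le> (\<psi> x)\<^sup>2 / (1 + (x $ 1)\<^sup>2)"
      unfolding norm_transv by (intro divide_left_mono) (auto intro!: mult_pos_pos add_pos_nonneg)
    then show "(\<psi> x)\<^sup>2 / (1 + (norm x)\<^sup>2) \<le> inverse (1 + (x $ 1)\<^sup>2) * (\<psi> x * \<psi> x)"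
      by (simp add: divide_inverse power2_eq_square mult.commute)
  qed auto
  have main: "c * (\<integral>s. n s / (1 + s\<^sup>2) \<partial>lborel) - \<kappa> * ip \<psi> \<psi> \<le> dirichlet \<psi> - ?l * ip \<psi> \<psi>" if \<kappa>: "\<kappa> > 0" for \<kappa>
  proof -
    obtain \<xi> where \<xi>: "\<xi> \<in> rtest \<omega>" "ip \<xi> \<xi> = 1" "D0 \<le> ip (tau \<xi>) (tau \<xi>)" "ip (tau \<xi>) (tau \<xi>) \<le> D1"
      and gap: "\<And>u z. u \<in> rtest \<omega> \<Longrightarrow> ip \<xi> u = 0 \<Longrightarrow> \<delta> * (ip u u + dirichlet u) - \<kappa> * z\<^sup>2 \<le> transverse_form \<omega> \<beta> (\<lambda>x. z * \<xi> x + u x)"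
      using ground[OF \<kappa>] by blast
    define f where "f s = ip \<xi> (\<phi> s)" for s
    define f' where "f' s = ip \<xi> (d s)" for s
    define m where "m s = ip (tau \<xi>) (\<phi> s)" for s
    define m' where "m' s = ip (tau \<xi>) (d s)" for s
    note \<xi>c = rtest_cc[OF \<xi>(1)] tau_cc[OF \<xi>(1)]
    have fd: "(f has_real_derivative f' s) (at s)" for s unfolding f_def[abs_def] f'_def by (rule deriv[OF \<xi>c(1)])
    have md: "(m has_real_derivative m' s) (at s)" for s unfolding m_def[abs_def] m'_def by (rule deriv[OF \<xi>c(2)])
    obtain C1 where f'B: "\<And>s. \<bar>f' s\<bar> \<le> C1" using dbound[OF \<xi>c(1)] unfolding f'_def by blast
    obtain C2 where m'B: "\<And>s. \<bar>m' s\<bar> \<le> C2" using dbound[OF \<xi>c(2)] unfolding m'_def by blast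
    have zero: "f s = 0" "m s = 0" "f' s = 0" "m' s = 0" if "M \<le> \<bar>s\<bar>" for s
      using out[OF that] by (simp_all add: f_def m_def f'_def m'_def ip0)
    have [measurable]: "f' \<in> borel_measurable borel" "m' \<in> borel_measurable borel"
      using borel_measurable_derivative[OF fd] borel_measurable_derivative[OF md] by auto
    have cont: "continuous_on UNIV f" "continuous_on UNIV m"
      using DERIV_isCont[OF fd] DERIV_isCont[OF md] by (simp_all add: continuous_on_eq_continuous_at)
    have [measurable]: "f \<in> borel_measurable borel" "m \<in> borel_measurable borel"
      using cont by (auto intro: borel_measurable_continuous_onI)
    obtain G1 where "\<And>s. s \<in> {-L..L} \<Longrightarrow> \<bar>f s\<bar> \<le> G1" by (rule continuous_bounded_Icc[OF cont(1)]) blast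
    then have fB: "\<bar>f s\<bar> \<le> \<bar>G1\<bar>" for s using zero(1)[of s] outL[of s] by (cases "s \<in> {-L..L}") fastforce+
    obtain G2 where "\<And>s. s \<in> {-L..L} \<Longrightarrow> \<bar>m s\<bar> \<le> G2" by (rule continuous_bounded_Icc[OF cont(2)]) blast
    then have mB: "\<bar>m s\<bar> \<le> \<bar>G2\<bar>" for s using zero(2)[of s] outL[of s] by (cases "s \<in> {-L..L}") fastforce+
    have C0: "0 \<le> C1" "0 \<le> C2" using f'B[of 0] m'B[of 0] by linarith+
    \<comment> \<open>The total derivative of \<open>slice_inequality\<close>.\<close>
    define F' where "F' s = f' s * m s + f s * m' s" for s
    have [measurable]: "F' \<in> borel_measurable borel" unfolding F'_def[abs_def] by measurable
    have Fd: "((\<lambda>s. f s * m s) has_real_derivative F' s) (at s)" for s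
      using DERIV_mult'[OF fd md] by (simp add: F'_def add.commute)
    have F'B: "\<bar>F' s\<bar> \<le> C1 * \<bar>G2\<bar> + \<bar>G1\<bar> * C2" for s
    proof -
      have "\<bar>f' s * m s\<bar> \<le> C1 * \<bar>G2\<bar>" "\<bar>f s * m' s\<bar> \<le> \<bar>G1\<bar> * C2"
        unfolding abs_mult using f'B[of s] mB[of s] fB[of s] m'B[of s] C0 by (auto intro!: mult_mono)
      then show ?thesis unfolding F'_def by linarith
    qed
    have F'i: "integrable lborel F'" by (rule intL[OF _ F'B]) (auto simp: F'_def zero)
    have F'I: "integral\<^sup>L lborel F' = 0"
    proof -
      have "(\<integral>s. indicator {-L..L} s * F' s \<partial>lborel) = f L * m L - f (-L) * m (-L)"
        by (rule FTC_bounded[OF _ Fd _ F'B]) (use L in auto)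
      moreover have "(\<lambda>s. indicator {-L..L} s * F' s) = F'"
      proof
        fix s show "indicator {-L..L} s * F' s = F' s"
          using outL[of s] zero[of s] by (cases "s \<in> {-L..L}") (simp_all add: F'_def)
      qed
      ultimately show ?thesis using zero L by simp
    qed
    let ?V = "\<lambda>s. \<beta> * \<epsilon> s"
    have VB: "?V s \<le> \<bar>\<beta>\<bar> * \<bar>\<beta>\<bar>" for s
    proof -
      have "?V s \<le> \<bar>\<beta>\<bar> * \<bar>\<epsilon> s\<bar>" by (metis abs_ge_self abs_mult)
      also have "\<dots> \<le> \<bar>\<beta>\<bar> * \<bar>\<beta>\<bar>" using \<epsilon>(1)[of s] by (intro mult_left_mono) auto
      finally show ?thesis .
    qed
    have f2B: "(f s)\<^sup>2 \<le> \<bar>G1\<bar>\<^sup>2" for s using power_mono[OF fB[of s], of 2] by simp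
    have f2i: "integrable lborel (\<lambda>s. (f s)\<^sup>2)" using f2B by (intro intL[of _ "\<bar>G1\<bar>\<^sup>2"]) (auto simp: zero)
    have f'2i: "integrable lborel (\<lambda>s. (f' s)\<^sup>2)"
    proof (rule intL[of _ "C1\<^sup>2"])
      show "\<bar>(f' s)\<^sup>2\<bar> \<le> C1\<^sup>2" for s using power_mono[OF f'B[of s], of 2] by simp
    qed (auto simp: zero)
    have Vi: "integrable lborel (\<lambda>s. ?V s * (f s)\<^sup>2)"
    proof (rule intL[of _ "\<bar>\<beta>\<bar> * \<bar>\<beta>\<bar> * \<bar>G1\<bar>\<^sup>2"])
      fix s
      have "0 \<le> ?V s * (f s)\<^sup>2" using \<epsilon>(2)[of s] by (rule mult_nonneg_nonneg) simp
      moreover have "?V s * (f s)\<^sup>2 \<le> \<bar>\<beta>\<bar> * \<bar>\<beta>\<bar> * \<bar>G1\<bar>\<^sup>2" by (rule mult_mono[OF VB f2B]) auto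
      ultimately show "\<bar>?V s * (f s)\<^sup>2\<bar> \<le> \<bar>\<beta>\<bar> * \<bar>\<beta>\<bar> * \<bar>G1\<bar>\<^sup>2" by linarith
    qed (auto simp: zero)
    have fn: "(f s)\<^sup>2 \<le> n s" for s
      using ip_Cauchy_Schwarz[OF \<xi>c(1) rtest_cc[OF \<phi>], of s] \<xi>(2) by (simp add: f_def n_def)
    have slice: "(f' s)\<^sup>2 / 2 + 3 / 4 * D0 * (?V s * (f s)\<^sup>2) + \<delta> / 2 * (n s - (f s)\<^sup>2) - \<kappa> * (f s)\<^sup>2 \<le> q s + 2 * \<beta> * F' s" for s
    proof -
      have e: "3 / 4 * D0 * (?V s * (f s)\<^sup>2) = 3 / 4 * D0 * ?V s * (f s)\<^sup>2" by simp
      show ?thesis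
        unfolding e unfolding q_def F'_def f_def f'_def m_def m'_def n_def d_def
        by (rule slice_inequality[OF R D \<xi>(3,4,1,2) gap \<epsilon>(1)[of s] \<epsilon>(2)[of s] \<delta> \<phi>[of s] P[of s]])
    qed
    have "(\<integral>s. (f' s)\<^sup>2 / 2 + 3 / 4 * D0 * (?V s * (f s)\<^sup>2) + \<delta> / 2 * (n s - (f s)\<^sup>2) - \<kappa> * (f s)\<^sup>2 \<partial>lborel)
       \<le> (\<integral>s. q s + 2 * \<beta> * F' s \<partial>lborel)"
    proof (rule integral_mono[OF _ _ slice])
      show "integrable lborel (\<lambda>s. (f' s)\<^sup>2 / 2 + 3 / 4 * D0 * (?V s * (f s)\<^sup>2) + \<delta> / 2 * (n s - (f s)\<^sup>2) - \<kappa> * (f s)\<^sup>2)"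
        by (intro Bochner_Integration.integrable_add Bochner_Integration.integrable_diff integrable_mult_right
            Bochner_Integration.integrable_divide f'2i Vi f2i ni)
      show "integrable lborel (\<lambda>s. q s + 2 * \<beta> * F' s)"
        by (intro Bochner_Integration.integrable_add integrable_mult_right qi F'i)
    qed
    also have "\<dots> = dirichlet \<psi> - ?l * ip \<psi> \<psi>"
      using qi F'i qI F'I by (simp add: Bochner_Integration.integral_add)
    also have "(\<integral>s. (f' s)\<^sup>2 / 2 + 3 / 4 * D0 * (?V s * (f s)\<^sup>2) + \<delta> / 2 * (n s - (f s)\<^sup>2) - \<kappa> * (f s)\<^sup>2 \<partial>lborel)
      = (\<integral>s. (f' s)\<^sup>2 \<partial>lborel) / 2 + 3 / 4 * D0 * (\<integral>s. ?V s * (f s)\<^sup>2 \<partial>lborel) + \<delta> / 2 * (\<integral>s. n s - (f s)\<^sup>2 \<partial>lborel) - \<kappa> * (\<integral>s. (f s)\<^sup>2 \<partial>lborel)"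
      using f'2i Vi f2i ni by (simp add: Bochner_Integration.integral_add Bochner_Integration.integral_diff)
    finally have tot: "(\<integral>s. (f' s)\<^sup>2 \<partial>lborel) / 2 + 3 / 4 * D0 * (\<integral>s. ?V s * (f s)\<^sup>2 \<partial>lborel) + \<delta> / 2 * (\<integral>s. n s - (f s)\<^sup>2 \<partial>lborel) - \<kappa> * (\<integral>s. (f s)\<^sup>2 \<partial>lborel)
       \<le> dirichlet \<psi> - ?l * ip \<psi> \<psi>" .
    have h1: "c * (\<integral>s. (f s)\<^sup>2 / (1 + s\<^sup>2) \<partial>lborel) \<le> (\<integral>s. (f' s)\<^sup>2 \<partial>lborel) / 2 + 3 / 4 * D0 * (\<integral>s. ?V s * (f s)\<^sup>2 \<partial>lborel)"
      by (rule hardy_with_potential[OF fd f'B zero(1) zero(3) N _ \<epsilon>(2) VB W(1) c(1,2,3) W(2)]) (use D in auto)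
    have fwi: "integrable lborel (\<lambda>s. (f s)\<^sup>2 / (1 + s\<^sup>2))"
    proof (rule Bochner_Integration.integrable_bound[OF f2i])
      show "AE s in lborel. norm ((f s)\<^sup>2 / (1 + s\<^sup>2)) \<le> norm ((f s)\<^sup>2)"
        by (intro AE_I2) (simp add: divide_le_eq add_pos_nonneg mult_le_cancel_left1)
    qed measurable
    have h2: "c * (\<integral>s. n s / (1 + s\<^sup>2) - (f s)\<^sup>2 / (1 + s\<^sup>2) \<partial>lborel) \<le> \<delta> / 2 * (\<integral>s. n s - (f s)\<^sup>2 \<partial>lborel)"
    proof (rule mult_mono[OF c(4)])
      show "(\<integral>s. n s / (1 + s\<^sup>2) - (f s)\<^sup>2 / (1 + s\<^sup>2) \<partial>lborel) \<le> (\<integral>s. n s - (f s)\<^sup>2 \<partial>lborel)"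
      proof (rule integral_mono)
        show "integrable lborel (\<lambda>s. n s / (1 + s\<^sup>2) - (f s)\<^sup>2 / (1 + s\<^sup>2))" using Hi fwi by (rule Bochner_Integration.integrable_diff)
        show "integrable lborel (\<lambda>s. n s - (f s)\<^sup>2)" using ni f2i by (rule Bochner_Integration.integrable_diff)
        fix s
        have "(n s - (f s)\<^sup>2) / (1 + s\<^sup>2) \<le> (n s - (f s)\<^sup>2) / 1"
          using fn[of s] by (intro divide_left_mono) (auto simp: add_pos_nonneg)
        then show "n s / (1 + s\<^sup>2) - (f s)\<^sup>2 / (1 + s\<^sup>2) \<le> n s - (f s)\<^sup>2" by (simp add: diff_divide_distrib)
      qed
      show "0 \<le> (\<integral>s. n s / (1 + s\<^sup>2) - (f s)\<^sup>2 / (1 + s\<^sup>2) \<partial>lborel)"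
      proof (intro integral_nonneg_AE AE_I2)
        fix s
        have "0 \<le> (n s - (f s)\<^sup>2) / (1 + s\<^sup>2)" using fn[of s] by (intro divide_nonneg_nonneg) auto
        then show "0 \<le> n s / (1 + s\<^sup>2) - (f s)\<^sup>2 / (1 + s\<^sup>2)" by (simp add: diff_divide_distrib)
      qed
    qed (use \<delta>0 in simp)
    have h2': "c * (\<integral>s. n s / (1 + s\<^sup>2) - (f s)\<^sup>2 / (1 + s\<^sup>2) \<partial>lborel) = c * (\<integral>s. n s / (1 + s\<^sup>2) \<partial>lborel) - c * (\<integral>s. (f s)\<^sup>2 / (1 + s\<^sup>2) \<partial>lborel)"
      using Hi fwi by (simp add: Bochner_Integration.integral_diff right_diff_distrib)
    have "(\<integral>s. (f s)\<^sup>2 \<partial>lborel) \<le> ip \<psi> \<psi>" unfolding nI[symmetric] by (rule integral_mono[OF f2i ni fn])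
    then have "\<kappa> * (\<integral>s. (f s)\<^sup>2 \<partial>lborel) \<le> \<kappa> * ip \<psi> \<psi>" using \<kappa> by (intro mult_left_mono) auto
    then show ?thesis using tot h1 h2 unfolding h2' by linarith
  qed
  have "c * (\<integral>s. n s / (1 + s\<^sup>2) \<partial>lborel) \<le> dirichlet \<psi> - ?l * ip \<psi> \<psi>"
  proof (rule field_le_epsilon)
    fix e :: real assume e: "e > 0"
    have ip0: "0 \<le> ip \<psi> \<psi>" by (rule ip_nonneg)
    define \<kappa> where "\<kappa> = e / (ip \<psi> \<psi> + 1)"
    have k: "\<kappa> > 0" using e ip0 by (simp add: \<kappa>_def)
    have "\<kappa> * ip \<psi> \<psi> \<le> \<kappa> * (ip \<psi> \<psi> + 1)" using k by (intro mult_left_mono) auto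
    also have "\<dots> = e" using ip0 by (simp add: \<kappa>_def)
    finally show "c * (\<integral>s. n s / (1 + s\<^sup>2) \<partial>lborel) \<le> dirichlet \<psi> - ?l * ip \<psi> \<psi> + e" using main[OF k] by linarith
  qed
  then show ?thesis using mult_left_mono[OF weight c(1)] by linarith
qed

section \<open>Uniqueness of weak gradients\<close>

text \<open>Lebesgue differentiation along cubes.\<close>

lemma ae_zero_of_integrals:
  fixes h :: "'a::euclidean_space \<Rightarrow> complex"
  assumes hint: "integrable lebesgue (\<lambda>x. indicator (cbox a b) x *\<^sub>R h x)"
    and zero: "\<And>c d. cbox c d \<subseteq> cbox a b \<Longrightarrow> integral (cbox c d) h = 0"
  shows "AE x in lebesgue. x \<in> cbox a b \<longrightarrow> h x = 0"
proof -
  define f where "f x = (if x \<in> cbox a b then h x else 0)" for x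
  have hi: "h integrable_on cbox a b"
    by (rule set_lebesgue_integral_eq_integral(1)) (simp add: set_integrable_def hint)
  then have "f integrable_on UNIV" unfolding f_def[abs_def] integrable_restrict_UNIV .
  then have fi: "f integrable_on cbox c d" for c d by (rule integrable_on_subcbox) simp
  from integrable_ccontinuous_explicit[OF fi]
  obtain N where N: "negligible N" and lim: "\<And>x e. x \<notin> N \<Longrightarrow> 0 < e \<Longrightarrow>
      \<exists>d>0. \<forall>k. 0 < k \<and> k < d \<longrightarrow> norm (integral (cbox x (x + k *\<^sub>R One)) f /\<^sub>R k ^ DIM('a) - f x) < e"
    by blast
  have pt: "h x = 0" if x: "x \<in> box a b" "x \<notin> N" for x
  proof (rule ccontr)
    assume nz: "h x \<noteq> 0"
    have xc: "x \<in> cbox a b" using x(1) box_subset_cbox by blast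
    from nz obtain d where d: "d > 0" "\<And>k. 0 < k \<Longrightarrow> k < d \<Longrightarrow> norm (integral (cbox x (x + k *\<^sub>R One)) f /\<^sub>R k ^ DIM('a) - f x) < norm (h x)"
      using lim[OF x(2), of "norm (h x)"] by auto
    obtain r where r: "r > 0" "ball x r \<subseteq> box a b" using x(1) openE[OF open_box] by blast
    \<comment> \<open>The cube with side \<open>k\<close> at \<open>x\<close> has to stay inside the box.\<close>
    define n1 where "n1 = norm (One :: 'a) + 1"
    have n1: "n1 > 0" by (simp add: n1_def add_nonneg_pos)
    define k where "k = min (d / 2) (r / (2 * n1))"
    have k: "0 < k" "k < d" using d(1) r(1) n1 by (auto simp: k_def)
    have "k * norm (One :: 'a) \<le> (r / (2 * n1)) * n1" using k(1) by (intro mult_mono) (auto simp: k_def n1_def)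
    also have "\<dots> < r" using r(1) n1 by simp
    finally have "x + k *\<^sub>R One \<in> ball x r" using k(1) by (simp add: dist_norm)
    then have "x + k *\<^sub>R One \<in> box a b" using r(2) by blast
    then have "x + k *\<^sub>R One \<in> cbox a b" using box_subset_cbox by blast
    then have sub: "cbox x (x + k *\<^sub>R One) \<subseteq> cbox a b" using xc by (auto simp: mem_box) (meson order_trans)+
    have "integral (cbox x (x + k *\<^sub>R One)) f = integral (cbox x (x + k *\<^sub>R One)) h"
      using sub by (intro integral_cong) (auto simp: f_def)
    then have "integral (cbox x (x + k *\<^sub>R One)) f = 0" using zero[OF sub] by simp
    then show False using d(2)[OF k] xc by (simp add: f_def)
  qed
  have "AE x in lebesgue. x \<notin> N" using N by (intro AE_not_in) (simp add: negligible_iff_null_sets)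
  moreover have "AE x in lebesgue. x \<notin> cbox a b - box a b"
    by (intro AE_not_in null_sets_completionI null_sets_cbox_Diff_box)
  ultimately show ?thesis by eventually_elim (use pt in blast)
qed

text \<open>For a bump function \<open>B\<close> of the box, the test functions \<open>k B / (1 + k B)\<close> increase to the indicator of the
  open box.\<close>

lemma box_integral_zero_of_tests:
  fixes h :: "real ^ 'n \<Rightarrow> complex"
  assumes K: "cbox c d \<subseteq> U" and hint: "integrable lebesgue (\<lambda>x. indicator (cbox c d) x *\<^sub>R h x)"
    and test: "\<And>\<phi>. \<phi> \<in> test_functions U \<Longrightarrow> (\<And>x. x \<notin> cbox c d \<Longrightarrow> \<phi> x = 0) \<Longrightarrow>
       (LINT x|lebesgue. indicator (cbox c d) x *\<^sub>R (h x * \<phi> x)) = 0"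
  shows "integral (cbox c d) h = 0"
proof -
  let ?B = "bump c d"
  define \<rho> where "\<rho> k x = inverse (1 + real k * ?B x) * real k * ?B x" for k x
  have pos: "0 < 1 + real k * ?B x" for k x using bump_nonneg[of c d x] by (simp add: add_pos_nonneg)
  have \<rho>test: "(\<lambda>x. complex_of_real (\<rho> k x)) \<in> test_functions U" for k
  proof -
    have "1 + real k * ?B x \<noteq> 0" for x using pos[of k x] by linarith
    then have "smooth (\<lambda>x. inverse (1 + real k * ?B x) * real k)"
      by (intro smooth_mult smooth_inverse smooth_add smooth_const smooth_bump)
    from rtest_smult[OF this rtest_bump[OF K]] show ?thesis
      unfolding \<rho>_def[abs_def] by (rule test_of_real)
  qed
  have \<rho>0: "\<rho> k x = 0" if "x \<notin> box c d" for k x using that bump_nonzero_iff[of c d x] by (auto simp: \<rho>_def)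
  have \<rho>1: "0 \<le> \<rho> k x \<and> \<rho> k x \<le> 1" for k x
    using pos[of k x] bump_nonneg[of c d x] by (simp add: \<rho>_def divide_simps mult.commute)
  have \<rho>lim: "(\<lambda>k. \<rho> k x) \<longlonglongrightarrow> indicator (box c d) x" for x
  proof (cases "x \<in> box c d")
    case True
    then have B: "?B x > 0" using bump_pos_iff by blast
    have "(\<lambda>k. \<rho> k x) \<longlonglongrightarrow> 1"
      using B unfolding \<rho>_def by real_asymp
    then show ?thesis using True by simp
  qed (simp add: \<rho>0)
  have "(\<lambda>k. LINT x|lebesgue. indicator (cbox c d) x *\<^sub>R (h x * complex_of_real (\<rho> k x)))
     \<longlonglongrightarrow> (LINT x|lebesgue. indicator (cbox c d) x *\<^sub>R (h x * complex_of_real (indicator (box c d) x)))"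
  proof (rule integral_dominated_convergence[where w="\<lambda>x. norm (indicator (cbox c d) x *\<^sub>R h x)"])
    have hm: "(\<lambda>x. indicator (cbox c d) x *\<^sub>R h x) \<in> borel_measurable lebesgue" using hint by auto
    have eq: "indicator (cbox c d) x *\<^sub>R (h x * complex_of_real t) = (indicator (cbox c d) x *\<^sub>R h x) * complex_of_real t" for x t
      by simp
    have "(\<lambda>x. complex_of_real (indicator (box c d) x)) \<in> borel_measurable borel" by measurable
    then have "(\<lambda>x. complex_of_real (indicator (box c d) x)) \<in> borel_measurable lebesgue" by (intro measurable_completion) simp
    then show "(\<lambda>x. indicator (cbox c d) x *\<^sub>R (h x * complex_of_real (indicator (box c d) x))) \<in> borel_measurable lebesgue"
      unfolding eq by (intro borel_measurable_times hm)
    have "(\<lambda>x. complex_of_real (\<rho> k x)) \<in> borel_measurable borel" for k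
      using \<rho>test[of k] by (intro borel_measurable_continuous_onI smooth_continuous) (simp add: test_functions_iff)
    then have "(\<lambda>x. complex_of_real (\<rho> k x)) \<in> borel_measurable lebesgue" for k by (intro measurable_completion) simp
    then show "(\<lambda>x. indicator (cbox c d) x *\<^sub>R (h x * complex_of_real (\<rho> k x))) \<in> borel_measurable lebesgue" for k
      unfolding eq by (intro borel_measurable_times hm)
    show "integrable lebesgue (\<lambda>x. norm (indicator (cbox c d) x *\<^sub>R h x))" using hint by (rule integrable_norm)
    show "AE x in lebesgue. (\<lambda>k. indicator (cbox c d) x *\<^sub>R (h x * complex_of_real (\<rho> k x)))
        \<longlonglongrightarrow> indicator (cbox c d) x *\<^sub>R (h x * complex_of_real (indicator (box c d) x))"
      by (intro AE_I2 tendsto_intros \<rho>lim)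
    show "AE x in lebesgue. norm (indicator (cbox c d) x *\<^sub>R (h x * complex_of_real (\<rho> k x))) \<le> norm (indicator (cbox c d) x *\<^sub>R h x)" for k
      using \<rho>1 by (intro AE_I2) (auto simp: norm_mult mult_left_le intro!: mult_left_mono)
  qed
  moreover have "(LINT x|lebesgue. indicator (cbox c d) x *\<^sub>R (h x * complex_of_real (\<rho> k x))) = 0" for k
  proof (rule test[OF \<rho>test])
    fix x assume "x \<notin> cbox c d"
    then have "x \<notin> box c d" using box_subset_cbox by blast
    then show "complex_of_real (\<rho> k x) = 0" by (simp add: \<rho>0)
  qed
  ultimately have z: "(LINT x|lebesgue. indicator (cbox c d) x *\<^sub>R (h x * complex_of_real (indicator (box c d) x))) = 0"
    by (simp add: LIMSEQ_const_iff)
  have "set_integrable lebesgue (cbox c d) h" using hint by (simp add: set_integrable_def)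
  then have si: "set_integrable lebesgue (box c d) h"
    by (rule set_integrable_subset) (auto intro: box_subset_cbox[THEN subsetD])
  have "integral (cbox c d) h = integral (box c d) h" by (rule integral_open_interval[symmetric])
  also have "\<dots> = (LINT x:box c d|lebesgue. h x)" by (rule set_lebesgue_integral_eq_integral(2)[OF si, symmetric])
  also have "\<dots> = (LINT x|lebesgue. indicator (cbox c d) x *\<^sub>R (h x * complex_of_real (indicator (box c d) x)))"
    unfolding set_lebesgue_integral_def using box_subset_cbox[of c d]
    by (intro Bochner_Integration.integral_cong) (auto split: split_indicator)
  finally show ?thesis using z by simp
qed

lemma LINT_on_supported:
  fixes g :: "real ^ 'n \<Rightarrow> complex"
  assumes "open U" "K \<subseteq> U" "\<And>x. x \<notin> K \<Longrightarrow> g x = 0"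
  shows "(LINT x|lebesgue_on U. g x) = (LINT x|lebesgue. indicator K x *\<^sub>R g x)"
proof -
  have "(LINT x|lebesgue_on U. g x) = (LINT x|lebesgue. indicator U x *\<^sub>R g x)"
    using assms(1) by (subst integral_restrict_space) auto
  also have "(\<lambda>x. indicator U x *\<^sub>R g x) = (\<lambda>x. indicator K x *\<^sub>R g x)"
    using assms(2,3) by (auto simp: indicator_def fun_eq_iff)
  finally show ?thesis .
qed

text \<open>Membership in \<open>H1_0\<close> provides one weak gradient, the limit of the gradients of test functions; the
  inequality has to hold for every other one.\<close>

lemma weak_gradient_unique:
  fixes f :: "real ^ 'n \<Rightarrow> complex"
  assumes U: "open U" and G: "has_weak_gradient U f G" and G': "has_weak_gradient U f G'"
  shows "AE x in lebesgue_on U. G x = G' x" and "G \<in> borel_measurable (lebesgue_on U)"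
proof -
  have int: "integrable lebesgue (\<lambda>x. indicator (cbox c d) x *\<^sub>R (H x $ i))"
    if H: "has_weak_gradient U f H" and sub: "cbox c d \<subseteq> U" for H c d i
  proof -
    have "integrable (lebesgue_on (cbox c d)) H"
      using H sub by (auto simp: has_weak_gradient_def locally_integrable_on_def)
    then have "integrable (lebesgue_on (cbox c d)) (\<lambda>x. H x $ i)"
      by (rule integrable_bounded_linear[OF bounded_linear_vec_nth])
    then show ?thesis by (subst (asm) integrable_restrict_space) auto
  qed
  have eqbox: "AE x in lebesgue. x \<in> cbox a b \<longrightarrow> G x $ i - G' x $ i = 0" if sub: "cbox a b \<subseteq> U" for a b i
  proof (rule ae_zero_of_integrals)
    have diff: "integrable lebesgue (\<lambda>x. indicator (cbox c d) x *\<^sub>R (G x $ i - G' x $ i))" if "cbox c d \<subseteq> U" for c d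
      using Bochner_Integration.integrable_diff[OF int[OF G that, of i] int[OF G' that, of i]] by (simp add: scaleR_diff_right)
    show "integrable lebesgue (\<lambda>x. indicator (cbox a b) x *\<^sub>R (G x $ i - G' x $ i))" by (rule diff[OF sub])
    fix c d assume "cbox c d \<subseteq> cbox a b"
    then have cd: "cbox c d \<subseteq> U" using sub by blast
    show "integral (cbox c d) (\<lambda>x. G x $ i - G' x $ i) = 0"
    proof (rule box_integral_zero_of_tests[OF cd diff[OF cd]])
      fix \<phi> :: "real ^ 'n \<Rightarrow> complex" assume \<phi>: "\<phi> \<in> test_functions U" and out: "\<And>x. x \<notin> cbox c d \<Longrightarrow> \<phi> x = 0"
      have c\<phi>: "continuous_on UNIV \<phi>" using \<phi> smooth_continuous by (auto simp: test_functions_iff)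
      have "bounded (\<phi> ` cbox c d)"
        using compact_imp_bounded[OF compact_continuous_image[OF continuous_on_subset[OF c\<phi> subset_UNIV] compact_cbox]] .
      then obtain C where C: "\<forall>x\<in>cbox c d. norm (\<phi> x) \<le> C" by (auto simp: bounded_iff)
      have \<phi>m: "\<phi> \<in> borel_measurable lebesgue"
        using borel_measurable_continuous_onI[OF c\<phi>] by (intro measurable_completion) simp
      have pint: "integrable lebesgue (\<lambda>x. indicator (cbox c d) x *\<^sub>R (H x $ i * \<phi> x))" if "has_weak_gradient U f H" for H
      proof (rule Bochner_Integration.integrable_bound[OF integrable_mult_right[OF integrable_norm[OF int[OF that cd, of i]], of "\<bar>C\<bar>"]])
        have "(\<lambda>x. (indicator (cbox c d) x *\<^sub>R (H x $ i)) * \<phi> x) \<in> borel_measurable lebesgue"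
          using int[OF that cd, of i] by (intro borel_measurable_times \<phi>m) auto
        then show "(\<lambda>x. indicator (cbox c d) x *\<^sub>R (H x $ i * \<phi> x)) \<in> borel_measurable lebesgue" by simp
        show "AE x in lebesgue. norm (indicator (cbox c d) x *\<^sub>R (H x $ i * \<phi> x)) \<le> norm (\<bar>C\<bar> * norm (indicator (cbox c d) x *\<^sub>R H x $ i))"
        proof (rule AE_I2)
          fix x
          show "norm (indicator (cbox c d) x *\<^sub>R (H x $ i * \<phi> x)) \<le> norm (\<bar>C\<bar> * norm (indicator (cbox c d) x *\<^sub>R H x $ i))"
          proof (cases "x \<in> cbox c d")
            case True
            then have "norm (\<phi> x) \<le> \<bar>C\<bar>" using C by force
            then show ?thesis using True by (simp add: norm_mult mult.commute mult_right_mono)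
          qed simp
        qed
      qed
      have "(LINT x|lebesgue_on U. G x $ i * \<phi> x) = (LINT x|lebesgue_on U. G' x $ i * \<phi> x)"
      proof -
        have "(LINT x|lebesgue_on U. f x * grad \<phi> x $ i) = - (LINT x|lebesgue_on U. H x $ i * \<phi> x)"
          if "has_weak_gradient U f H" for H using that \<phi> unfolding has_weak_gradient_def by blast
        from this[OF G] this[OF G'] show ?thesis by simp
      qed
      then have "(LINT x|lebesgue. indicator (cbox c d) x *\<^sub>R (G x $ i * \<phi> x)) = (LINT x|lebesgue. indicator (cbox c d) x *\<^sub>R (G' x $ i * \<phi> x))"
        using out by (subst (asm) (1 2) LINT_on_supported[OF U cd]) auto
      then show "(LINT x|lebesgue. indicator (cbox c d) x *\<^sub>R ((G x $ i - G' x $ i) * \<phi> x)) = 0"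
        using Bochner_Integration.integral_diff[OF pint[OF G] pint[OF G']]
        by (simp add: left_diff_distrib scaleR_diff_right)
    qed
  qed
  obtain D where D: "countable D" "D \<subseteq> Pow U" "\<And>X. X \<in> D \<Longrightarrow> \<exists>a b. X = cbox a b" "\<Union>D = U"
    using open_countable_Union_open_cbox[OF U] by metis
  have "AE x in lebesgue. \<forall>X\<in>D. x \<in> X \<longrightarrow> G x = G' x"
  proof (subst AE_ball_countable[OF D(1)], rule ballI)
    fix X assume X: "X \<in> D"
    then obtain a b where ab: "X = cbox a b" "cbox a b \<subseteq> U" using D(2,3) by blast
    have "AE x in lebesgue. \<forall>i. x \<in> cbox a b \<longrightarrow> G x $ i - G' x $ i = 0"
      using eqbox[OF ab(2)] by (subst AE_all_countable) blast
    then show "AE x in lebesgue. x \<in> X \<longrightarrow> G x = G' x" by eventually_elim (auto simp: ab(1) vec_eq_iff)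
  qed
  then have "AE x in lebesgue. x \<in> U \<longrightarrow> G x = G' x" by eventually_elim (use D(4) in blast)
  then show "AE x in lebesgue_on U. G x = G' x" using U by (simp add: AE_restrict_space_iff)
  show "G \<in> borel_measurable (lebesgue_on U)"
  proof (rule measurable_piecewise_restrict[OF D(1)])
    fix X assume X: "X \<in> D"
    then obtain a b where ab: "X = cbox a b" "cbox a b \<subseteq> U" using D(2,3) by blast
    show "X \<inter> space (lebesgue_on U) \<in> sets (lebesgue_on U)"
      using ab U by (auto simp: sets_restrict_space space_restrict_space image_iff intro!: bexI[of _ "cbox a b"])
    have "integrable (lebesgue_on (cbox a b)) G"
      using G ab(2) by (auto simp: has_weak_gradient_def locally_integrable_on_def)
    then have "G \<in> borel_measurable (lebesgue_on (cbox a b))" by (rule borel_measurable_integrable)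
    moreover have "restrict_space (lebesgue_on U) X = lebesgue_on (cbox a b)"
      using U ab by (subst restrict_restrict_space) (auto simp: Int_absorb1)
    ultimately show "G \<in> borel_measurable (restrict_space (lebesgue_on U) X)" by simp
  qed (use D(4) in \<open>auto simp: space_restrict_space\<close>)
qed

section \<open>Passing to the Sobolev space\<close>

lemma cc_integrable_on:
  assumes "open U" "g \<in> cc" shows "integrable (lebesgue_on U) g"
proof -
  have "integrable lebesgue g" using cc_integrable[OF assms(2)] cc_borel[OF assms(2)] by (simp add: integrable_completion)
  then show ?thesis using assms(1) integrable_mult_indicator[of U lebesgue g] by (subst integrable_restrict_space) auto
qed

lemma continuous_measurable_on:
  fixes g :: "'a::euclidean_space \<Rightarrow> 'b::euclidean_space"
  assumes "continuous_on UNIV g" shows "g \<in> borel_measurable (lebesgue_on U)"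
  using borel_measurable_continuous_onI[OF assms]
  by (intro measurable_restrict_space1 measurable_completion) simp

lemma test_square_integrable:
  assumes U: "open U" and \<phi>: "\<phi> \<in> test_functions U"
  shows "\<phi> \<in> borel_measurable (lebesgue_on U)" "integrable (lebesgue_on U) (\<lambda>x. (norm (\<phi> x))\<^sup>2)"
    "grad \<phi> \<in> borel_measurable (lebesgue_on U)" "integrable (lebesgue_on U) (\<lambda>x. (norm (grad \<phi> x))\<^sup>2)"
proof -
  note vw = test_Re_Im[OF \<phi>]
  have s: "smooth \<phi>" using \<phi> by (simp add: test_functions_iff)
  show "\<phi> \<in> borel_measurable (lebesgue_on U)" by (rule continuous_measurable_on[OF smooth_continuous[OF s]])
  have "continuous_on UNIV (grad \<phi>)"
    unfolding grad_def by (intro continuous_on_vec_lambda smooth_continuous smooth_frechet s)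
  then show "grad \<phi> \<in> borel_measurable (lebesgue_on U)" by (rule continuous_measurable_on)
  have "(\<lambda>x. Re (\<phi> x) * Re (\<phi> x) + Im (\<phi> x) * Im (\<phi> x)) \<in> cc"
    by (intro cc_add cc_mult rtest_cc[OF vw(1)] rtest_cc[OF vw(2)])
  moreover have "(norm (\<phi> x))\<^sup>2 = Re (\<phi> x) * Re (\<phi> x) + Im (\<phi> x) * Im (\<phi> x)" for x
    by (simp add: cmod_power2 flip: power2_eq_square)
  ultimately show "integrable (lebesgue_on U) (\<lambda>x. (norm (\<phi> x))\<^sup>2)"
    using cc_integrable_on[OF U] by simp
  show "integrable (lebesgue_on U) (\<lambda>x. (norm (grad \<phi> x))\<^sup>2)"
    unfolding norm_grad[OF \<phi>] by (intro cc_integrable_on[OF U] cc_add rtest_norm_gr_cc[OF vw(1)] rtest_norm_gr_cc[OF vw(2)])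
qed

lemma weight_cc:
  assumes "v \<in> cc" shows "(\<lambda>x. (v x)\<^sup>2 / (1 + (norm x)\<^sup>2)) \<in> cc"
proof -
  have nz: "1 + (norm x)\<^sup>2 \<noteq> 0" for x :: 'a
    using zero_le_power2[of "norm x"] by linarith
  have "(\<lambda>x. inverse (1 + (norm x)\<^sup>2) * (v x * v x)) \<in> cc"
    using nz by (intro cc_multc cc_mult assms continuous_intros) auto
  then show ?thesis by (simp add: divide_inverse power2_eq_square mult_ac)
qed

lemma complex_test_inequality:
  assumes U: "open U" and \<phi>: "\<phi> \<in> test_functions U"
    and ineq: "\<And>v. v \<in> rtest U \<Longrightarrow> c * (\<integral>x. (v x)\<^sup>2 / (1 + (norm x)\<^sup>2) \<partial>lborel) \<le> dirichlet v - l * ip v v"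
  shows "c * (LINT x|lebesgue_on U. (norm (\<phi> x))\<^sup>2 / (1 + (norm x)\<^sup>2)) \<le>
     (LINT x|lebesgue_on U. (norm (grad \<phi> x))\<^sup>2) - l * (LINT x|lebesgue_on U. (norm (\<phi> x))\<^sup>2)"
proof -
  let ?v = "\<lambda>x. Re (\<phi> x)" and ?w = "\<lambda>x. Im (\<phi> x)"
  note vw = test_Re_Im[OF \<phi>]
  note wc = weight_cc[OF rtest_cc[OF vw(1)]] weight_cc[OF rtest_cc[OF vw(2)]]
  have e: "(norm (\<phi> x))\<^sup>2 / (1 + (norm x)\<^sup>2) = (?v x)\<^sup>2 / (1 + (norm x)\<^sup>2) + (?w x)\<^sup>2 / (1 + (norm x)\<^sup>2)" for x
    by (simp add: cmod_power2 add_divide_distrib)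
  have "(LINT x|lebesgue_on U. (norm (\<phi> x))\<^sup>2 / (1 + (norm x)\<^sup>2)) = (\<integral>x. (?v x)\<^sup>2 / (1 + (norm x)\<^sup>2) + (?w x)\<^sup>2 / (1 + (norm x)\<^sup>2) \<partial>lborel)"
    unfolding e using U cc_borel[OF cc_add[OF wc]] rtest_zero_out[OF vw(1)] rtest_zero_out[OF vw(2)]
    by (intro LINT_lebesgue_on) auto
  also have "\<dots> = (\<integral>x. (?v x)\<^sup>2 / (1 + (norm x)\<^sup>2) \<partial>lborel) + (\<integral>x. (?w x)\<^sup>2 / (1 + (norm x)\<^sup>2) \<partial>lborel)"
    by (intro Bochner_Integration.integral_add cc_integrable wc)
  finally show ?thesis
    using ineq[OF vw(1)] ineq[OF vw(2)] unfolding rayleigh_split[OF U \<phi>] by (simp add: algebra_simps)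
qed

text \<open>All three integrals are continuous under the convergence of functions and gradients in the mean
  square, so the inequality extends from test functions.\<close>

lemma H1_0_inequality:
  assumes U: "open U" and \<psi>: "\<psi> \<in> H1_0 U" and G: "has_weak_gradient U \<psi> G"
    and ineq: "\<And>v. v \<in> rtest U \<Longrightarrow> c * (\<integral>x. (v x)\<^sup>2 / (1 + (norm x)\<^sup>2) \<partial>lborel) \<le> dirichlet v - l * ip v v"
  shows "c * (LINT x|lebesgue_on U. (norm (\<psi> x))\<^sup>2 / (1 + (norm x)\<^sup>2)) \<le>
     (LINT x|lebesgue_on U. (norm (G x))\<^sup>2) - l * (LINT x|lebesgue_on U. (norm (\<psi> x))\<^sup>2)"
proof -
  obtain H \<phi> where \<psi>2: "square_integrable_on U \<psi>" and H2: "square_integrable_on U H" and H: "has_weak_gradient U \<psi> H"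
    and \<phi>: "\<And>n::nat. \<phi> n \<in> test_functions U"
    and lim: "(\<lambda>n. (LINT x|lebesgue_on U. (norm (\<phi> n x - \<psi> x))\<^sup>2) + (LINT x|lebesgue_on U. (norm (grad (\<phi> n) x - H x))\<^sup>2)) \<longlonglongrightarrow> 0"
    using \<psi> unfolding H1_0_def by blast
  have nn: "0 \<le> (LINT x|lebesgue_on U. (norm (g x))\<^sup>2)" for g :: "real ^ 'a \<Rightarrow> 'c::real_normed_vector" by simp
  have l1: "(\<lambda>n. LINT x|lebesgue_on U. (norm (\<phi> n x - \<psi> x))\<^sup>2) \<longlonglongrightarrow> 0"
    by (rule tendsto_sandwich[OF _ _ tendsto_const lim]) (auto intro!: always_eventually)
  have l2: "(\<lambda>n. LINT x|lebesgue_on U. (norm (grad (\<phi> n) x - H x))\<^sup>2) \<longlonglongrightarrow> 0"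
    by (rule tendsto_sandwich[OF _ _ tendsto_const lim]) (auto intro!: always_eventually)
  note ts = test_square_integrable[OF U \<phi>]
  have w: "(\<lambda>x. inverse (1 + (norm x)\<^sup>2)) \<in> borel_measurable (lebesgue_on U)"
  proof (rule continuous_measurable_on)
    have "1 + (norm x)\<^sup>2 \<noteq> 0" for x :: "real ^ 'a" using zero_le_power2[of "norm x"] by linarith
    then show "continuous_on UNIV (\<lambda>x :: real ^ 'a. inverse (1 + (norm x)\<^sup>2))" by (intro continuous_intros) auto
  qed
  have w01: "0 \<le> inverse (1 + (norm x)\<^sup>2) \<and> inverse (1 + (norm x)\<^sup>2) \<le> 1" for x :: "real ^ 'a"
    using zero_le_power2[of "norm x"] by (auto simp: inverse_le_1_iff)
  have a1: "(\<lambda>n. LINT x|lebesgue_on U. 1 * (norm (\<phi> n x))\<^sup>2) \<longlonglongrightarrow> (LINT x|lebesgue_on U. 1 * (norm (\<psi> x))\<^sup>2)"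
    using \<psi>2 by (intro weighted_norm_sq_tendsto[OF ts(1) _ ts(2) _ _ _ l1]) (auto simp: square_integrable_on_def)
  have a2: "(\<lambda>n. LINT x|lebesgue_on U. inverse (1 + (norm x)\<^sup>2) * (norm (\<phi> n x))\<^sup>2) \<longlonglongrightarrow> (LINT x|lebesgue_on U. inverse (1 + (norm x)\<^sup>2) * (norm (\<psi> x))\<^sup>2)"
    using \<psi>2 w w01 by (intro weighted_norm_sq_tendsto[OF ts(1) _ ts(2) _ _ _ l1]) (auto simp: square_integrable_on_def)
  have a3: "(\<lambda>n. LINT x|lebesgue_on U. 1 * (norm (grad (\<phi> n) x))\<^sup>2) \<longlonglongrightarrow> (LINT x|lebesgue_on U. 1 * (norm (H x))\<^sup>2)"
    using H2 by (intro weighted_norm_sq_tendsto[OF ts(3) _ ts(4) _ _ _ l2]) (auto simp: square_integrable_on_def)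
  have "c * (LINT x|lebesgue_on U. inverse (1 + (norm x)\<^sup>2) * (norm (\<psi> x))\<^sup>2) \<le>
     (LINT x|lebesgue_on U. 1 * (norm (H x))\<^sup>2) - l * (LINT x|lebesgue_on U. 1 * (norm (\<psi> x))\<^sup>2)"
  proof (rule LIMSEQ_le)
    show "(\<lambda>n. c * (LINT x|lebesgue_on U. inverse (1 + (norm x)\<^sup>2) * (norm (\<phi> n x))\<^sup>2)) \<longlonglongrightarrow> c * (LINT x|lebesgue_on U. inverse (1 + (norm x)\<^sup>2) * (norm (\<psi> x))\<^sup>2)"
      by (intro tendsto_intros a2)
    show "(\<lambda>n. (LINT x|lebesgue_on U. 1 * (norm (grad (\<phi> n) x))\<^sup>2) - l * (LINT x|lebesgue_on U. 1 * (norm (\<phi> n x))\<^sup>2))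
       \<longlonglongrightarrow> (LINT x|lebesgue_on U. 1 * (norm (H x))\<^sup>2) - l * (LINT x|lebesgue_on U. 1 * (norm (\<psi> x))\<^sup>2)"
      by (intro tendsto_intros a1 a3)
    show "\<exists>N. \<forall>n\<ge>N. c * (LINT x|lebesgue_on U. inverse (1 + (norm x)\<^sup>2) * (norm (\<phi> n x))\<^sup>2)
       \<le> (LINT x|lebesgue_on U. 1 * (norm (grad (\<phi> n) x))\<^sup>2) - l * (LINT x|lebesgue_on U. 1 * (norm (\<phi> n x))\<^sup>2)"
      using complex_test_inequality[OF U \<phi> ineq] by (simp add: divide_inverse mult.commute)
  qed
  moreover have "(LINT x|lebesgue_on U. (norm (G x))\<^sup>2) = (LINT x|lebesgue_on U. (norm (H x))\<^sup>2)"
  proof (rule integral_cong_AE)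
    show "AE x in lebesgue_on U. (norm (G x))\<^sup>2 = (norm (H x))\<^sup>2"
      using weak_gradient_unique(1)[OF U G H] by eventually_elim simp
    show "(\<lambda>x. (norm (G x))\<^sup>2) \<in> borel_measurable (lebesgue_on U)" "(\<lambda>x. (norm (H x))\<^sup>2) \<in> borel_measurable (lebesgue_on U)"
      using weak_gradient_unique(2)[OF U G H] weak_gradient_unique(2)[OF U H G] by measurable
  qed
  ultimately show ?thesis by (simp add: divide_inverse mult.commute)
qed

section \<open>The Hardy inequality on the twisted tube\<close>

text \<open>A nonnegative function that is nonzero at one point need not have a positive integral, but \<open>\<beta> \<epsilon>\<close> is the
  derivative of \<open>\<beta> (\<theta> s - \<beta> s)\<close>: with a vanishing integral this monotone function would be constant near
  the point, and its derivative would vanish there.\<close>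

lemma twist_mass_positive:
  fixes \<beta> :: real and \<epsilon> \<theta> :: "real \<Rightarrow> real"
  assumes \<theta>: "\<And>s. (\<theta> has_real_derivative \<beta> + \<epsilon> s) (at s)" and B: "\<And>s. \<bar>\<epsilon> s\<bar> \<le> B"
    and \<epsilon>: "\<And>s. 0 \<le> \<beta> * \<epsilon> s" "\<beta> * \<epsilon> p \<noteq> 0"
  obtains N where "0 \<le> N" "0 < (\<integral>s. indicator {-N..N} s * (\<beta> * \<epsilon> s) \<partial>lborel)"
proof -
  define g where "g s = \<beta> * (\<theta> s - \<beta> * s)" for s
  have g: "(g has_real_derivative \<beta> * \<epsilon> s) (at s)" for s
    unfolding g_def[abs_def] by (auto intro!: derivative_eq_intros \<theta> simp: algebra_simps)
  define N where "N = \<bar>p\<bar> + 1"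
  have N: "0 \<le> N" "- N < p" "p < N" "- N \<le> N" by (auto simp: N_def)
  have m: "(\<lambda>s. \<beta> * \<epsilon> s) \<in> borel_measurable borel" by (rule borel_measurable_derivative[OF g])
  have I: "(\<integral>s. indicator {-N..N} s * (\<beta> * \<epsilon> s) \<partial>lborel) = g N - g (- N)"
    by (rule FTC_bounded[OF N(4) g m, of "\<bar>\<beta>\<bar> * B"]) (simp add: abs_mult mult_left_mono B)
  have mono: "g a \<le> g b" if "a \<le> b" for a b
    using DERIV_nonneg_imp_nondecreasing[OF that, of g] g \<epsilon>(1) by blast
  have "g (- N) \<noteq> g N"
  proof
    assume eq: "g (- N) = g N"
    have const: "g s = g N" if "s \<in> {-N<..<N}" for s
      using mono[of "- N" s] mono[of s N] that eq by auto
    have "((\<lambda>_. g N) has_real_derivative 0) (at p)" by simp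
    then have "(g has_real_derivative 0) (at p)"
      using N const by (intro has_field_derivative_transform_within_open[of "\<lambda>_. g N" 0 p "{-N<..<N}" g]) auto
    then have "\<beta> * \<epsilon> p = 0" using g[of p] DERIV_unique by blast
    then show False using \<epsilon>(2) by simp
  qed
  then have "0 < g N - g (- N)" using mono[OF N(4)] by simp
  then show ?thesis using I N(1) by (intro that[of N]) auto
qed

theorem theorem1:
  fixes \<omega> :: "(real ^ 2) set"
  assumes "bounded \<omega>" and "open \<omega>" and "connected \<omega>"
    and "\<not> rotationally_invariant \<omega>"
    and "Ck_boundary 4 \<omega>"
  shows "\<exists>\<beta>s > 0. \<exists>\<epsilon>s c :: real \<Rightarrow> (real \<Rightarrow> real) \<Rightarrow> real.
    (\<forall>\<beta> \<epsilon>. 0 < \<epsilon>s \<beta> \<epsilon> \<and> 0 < c \<beta> \<epsilon>) \<and>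
    (\<forall>\<beta> \<epsilon>. \<forall>t > 0. \<epsilon>s \<beta> (\<lambda>x. t * \<epsilon> x) = \<epsilon>s \<beta> \<epsilon>) \<and>
    (\<forall>\<beta> \<epsilon> \<theta>.
       bounded (range \<epsilon>) \<and>
       (\<forall>x. (\<theta> has_real_derivative \<beta> + \<epsilon> x) (at x)) \<and>
       (\<forall>x. 0 \<le> \<beta> * \<epsilon> x) \<and> (\<exists>x. \<beta> * \<epsilon> x \<noteq> 0) \<and>
       \<bar>\<beta>\<bar> \<le> \<beta>s \<and> (SUP x. \<bar>\<epsilon> x\<bar>) \<le> \<epsilon>s \<beta> \<epsilon> \<longrightarrow>
       (\<forall>\<psi> \<in> H1_0 (twisted_tube \<omega> \<theta>). \<forall>G. has_weak_gradient (twisted_tube \<omega> \<theta>) \<psi> G \<longrightarrow>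
          (LINT x|lebesgue_on (twisted_tube \<omega> \<theta>). (norm (G x))\<^sup>2)
            - lambda1 \<omega> \<beta> * (LINT x|lebesgue_on (twisted_tube \<omega> \<theta>). (norm (\<psi> x))\<^sup>2)
          \<ge> c \<beta> \<epsilon> * (LINT x|lebesgue_on (twisted_tube \<omega> \<theta>).
                (norm (\<psi> x))\<^sup>2 / (1 + (norm x)\<^sup>2))))"
proof -
  have "\<omega> \<noteq> {}" using assms(4) by (auto simp: rotationally_invariant_def)
  note \<omega> = assms(2,1,3) this
  obtain \<beta>s \<delta> D0 D1 R where pos: "\<beta>s > 0" "\<delta> > 0" "D0 > 0" "D1 > 0" "R > 0" and R: "\<And>x. x \<in> \<omega> \<Longrightarrow> norm x \<le> R"
    and small: "36 * \<beta>s\<^sup>2 * (D1 + R\<^sup>2) \<le> \<delta>"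
    and ground: "\<And>\<beta> \<kappa>. \<bar>\<beta>\<bar> \<le> \<beta>s \<Longrightarrow> \<kappa> > 0 \<Longrightarrow> \<exists>\<xi>\<in>rtest \<omega>. ip \<xi> \<xi> = 1 \<and> D0 \<le> ip (tau \<xi>) (tau \<xi>) \<and> ip (tau \<xi>) (tau \<xi>) \<le> D1 \<and>
       (\<forall>u\<in>rtest \<omega>. \<forall>z. ip \<xi> u = 0 \<longrightarrow> \<delta> * (ip u u + dirichlet u) - \<kappa> * z\<^sup>2 \<le> transverse_form \<omega> \<beta> (\<lambda>x. z * \<xi> x + u x))"
    by (rule transverse_gap[OF \<omega> Ck_boundary_regular[OF assms(5,2)] assms(4)]) blast
  \<comment> \<open>The smallness of \<open>\<epsilon>\<close> is relative to \<open>\<beta>\<close> only. For \<open>\<beta> = 0\<close> there is no admissible \<open>\<epsilon>\<close>, and any positive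
    value serves; the same holds for \<open>c\<close> below when no angle is admissible.\<close>
  define \<epsilon>s :: "real \<Rightarrow> (real \<Rightarrow> real) \<Rightarrow> real" where "\<epsilon>s \<beta> \<epsilon> = (if \<beta> = 0 then 1 else \<bar>\<beta>\<bar> / 16)" for \<beta> \<epsilon>
  define adm where "adm \<beta> \<epsilon> \<theta> \<longleftrightarrow> bounded (range \<epsilon>) \<and> (\<forall>x. (\<theta> has_real_derivative \<beta> + \<epsilon> x) (at x)) \<and>
       (\<forall>x. 0 \<le> \<beta> * \<epsilon> x) \<and> (\<exists>x. \<beta> * \<epsilon> x \<noteq> 0) \<and> \<bar>\<beta>\<bar> \<le> \<beta>s \<and> (SUP x. \<bar>\<epsilon> x\<bar>) \<le> \<epsilon>s \<beta> \<epsilon>"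
    for \<beta> :: real and \<epsilon> \<theta> :: "real \<Rightarrow> real"
  define hardy where "hardy \<beta> \<epsilon> \<theta> c \<longleftrightarrow> (\<forall>\<psi> \<in> H1_0 (twisted_tube \<omega> \<theta>). \<forall>G. has_weak_gradient (twisted_tube \<omega> \<theta>) \<psi> G \<longrightarrow>
          (LINT x|lebesgue_on (twisted_tube \<omega> \<theta>). (norm (G x))\<^sup>2)
            - lambda1 \<omega> \<beta> * (LINT x|lebesgue_on (twisted_tube \<omega> \<theta>). (norm (\<psi> x))\<^sup>2)
          \<ge> c * (LINT x|lebesgue_on (twisted_tube \<omega> \<theta>). (norm (\<psi> x))\<^sup>2 / (1 + (norm x)\<^sup>2)))"
    for \<beta> c :: real and \<epsilon> \<theta> :: "real \<Rightarrow> real"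
  have "\<exists>c>0. \<forall>\<theta>. adm \<beta> \<epsilon> \<theta> \<longrightarrow> hardy \<beta> \<epsilon> \<theta> c" for \<beta> \<epsilon>
  proof (cases "\<exists>\<theta>. adm \<beta> \<epsilon> \<theta>")
    case False
    then show ?thesis by (intro exI[of _ 1]) auto
  next
    case True
    then obtain \<theta>0 where a0: "adm \<beta> \<epsilon> \<theta>0" by blast
    then obtain p where p: "\<beta> * \<epsilon> p \<noteq> 0" by (auto simp: adm_def)
    have \<beta>: "\<bar>\<beta>\<bar> \<le> \<beta>s" and e0: "\<And>s. 0 \<le> \<beta> * \<epsilon> s" using a0 by (auto simp: adm_def)
    have "\<beta> \<noteq> 0" using p by auto
    then have sup: "(SUP x. \<bar>\<epsilon> x\<bar>) \<le> \<bar>\<beta>\<bar> / 16" using a0 by (simp add: adm_def \<epsilon>s_def)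
    obtain b where "\<And>x. \<bar>\<epsilon> x\<bar> \<le> b" using a0 by (auto simp: adm_def bounded_iff)
    then have "bdd_above (range (\<lambda>x. \<bar>\<epsilon> x\<bar>))" by (rule bdd_aboveI2)
    then have e1: "\<bar>\<epsilon> s\<bar> \<le> \<bar>\<beta>\<bar> / 16" for s using cSUP_upper[of s UNIV "\<lambda>x. \<bar>\<epsilon> x\<bar>"] sup by fastforce
    obtain N where N: "0 \<le> N" "0 < (\<integral>s. indicator {-N..N} s * (\<beta> * \<epsilon> s) \<partial>lborel)"
      using twist_mass_positive[of \<theta>0 \<beta> \<epsilon> "\<bar>\<beta>\<bar> / 16" p] a0 e1 e0 p by (auto simp: adm_def)
    define W where "W = (\<integral>s. indicator {-N..N} s * (\<beta> * \<epsilon> s) \<partial>lborel)"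
    define k where "k = 8 * (1 + N)\<^sup>2"
    have W: "W > 0" and k: "k > 0" using N by (simp_all add: W_def k_def)
    \<comment> \<open>The three bounds are those of \<open>tube_inequality_test\<close>: one for the part of a slice orthogonal to
      \<open>\<xi>\<close>, one for the potential term and one for the kinetic term.\<close>
    define c where "c = Min {\<delta> / 2, 3 / 4 * D0 * W / k, 1 / 2 / k}"
    have c: "0 < c" "c \<le> \<delta> / 2" "c \<le> 3 / 4 * D0 * W / k" "c \<le> 1 / 2 / k"
      using pos W k by (auto simp: c_def)
    then have ck: "c * k \<le> 3 / 4 * D0 * W" "c * k \<le> 1 / 2" using k by (simp_all add: pos_le_divide_eq)
    have b2: "36 * \<beta>\<^sup>2 * (D1 + R\<^sup>2) \<le> \<delta>"
    proof -
      have "\<beta>\<^sup>2 \<le> \<beta>s\<^sup>2" using \<beta> by (metis abs_ge_zero power2_abs power_mono)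
      then have "36 * \<beta>\<^sup>2 * (D1 + R\<^sup>2) \<le> 36 * \<beta>s\<^sup>2 * (D1 + R\<^sup>2)" using pos by (intro mult_right_mono) auto
      then show ?thesis using small by linarith
    qed
    have "hardy \<beta> \<epsilon> \<theta> c" if a: "adm \<beta> \<epsilon> \<theta>" for \<theta>
      unfolding hardy_def
    proof (intro ballI allI impI)
      fix \<psi> G assume \<psi>: "\<psi> \<in> H1_0 (twisted_tube \<omega> \<theta>)" and G: "has_weak_gradient (twisted_tube \<omega> \<theta>) \<psi> G"
      have \<theta>: "(\<theta> has_real_derivative \<beta> + \<epsilon> s) (at s)" for s using a by (simp add: adm_def)
      have "continuous_on UNIV \<theta>" using DERIV_isCont[OF \<theta>] by (simp add: continuous_on_eq_continuous_at)
      then have U: "open (twisted_tube \<omega> \<theta>)" by (rule open_twisted_tube[OF assms(2)])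
      show "c * (LINT x|lebesgue_on (twisted_tube \<omega> \<theta>). (norm (\<psi> x))\<^sup>2 / (1 + (norm x)\<^sup>2))
        \<le> (LINT x|lebesgue_on (twisted_tube \<omega> \<theta>). (norm (G x))\<^sup>2)
            - lambda1 \<omega> \<beta> * (LINT x|lebesgue_on (twisted_tube \<omega> \<theta>). (norm (\<psi> x))\<^sup>2)"
      proof (rule H1_0_inequality[OF U \<psi> G])
        fix v assume v: "v \<in> rtest (twisted_tube \<omega> \<theta>)"
        show "c * (\<integral>x. (v x)\<^sup>2 / (1 + (norm x)\<^sup>2) \<partial>lborel) \<le> dirichlet v - lambda1 \<omega> \<beta> * ip v v"
          by (rule tube_inequality_test[OF R pos(3,2) b2 ground[OF \<beta>] \<theta> e1 e0 N(1) W_def[symmetric] W _ _ _ c(2) v])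
            (use c(1) ck in \<open>auto simp: k_def\<close>)
      qed
    qed
    then show ?thesis using c(1) by blast
  qed
  then have "\<exists>c. \<forall>\<beta> \<epsilon>. 0 < c \<beta> \<epsilon> \<and> (\<forall>\<theta>. adm \<beta> \<epsilon> \<theta> \<longrightarrow> hardy \<beta> \<epsilon> \<theta> (c \<beta> \<epsilon>))" by metis
  then obtain c where c: "\<And>\<beta> \<epsilon>. 0 < c \<beta> \<epsilon>" "\<And>\<beta> \<epsilon> \<theta>. adm \<beta> \<epsilon> \<theta> \<Longrightarrow> hardy \<beta> \<epsilon> \<theta> (c \<beta> \<epsilon>)" by blast
  have e1: "0 < \<epsilon>s \<beta> \<epsilon>" for \<beta> \<epsilon> by (simp add: \<epsilon>s_def)
  have e2: "\<epsilon>s \<beta> (\<lambda>x. t * \<epsilon> x) = \<epsilon>s \<beta> \<epsilon>" for \<beta> \<epsilon> t by (simp add: \<epsilon>s_def)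
  have "\<forall>\<beta> \<epsilon>. 0 < \<epsilon>s \<beta> \<epsilon> \<and> 0 < c \<beta> \<epsilon>" using e1 c(1) by blast
  moreover have "\<forall>\<beta> \<epsilon>. \<forall>t>0. \<epsilon>s \<beta> (\<lambda>x. t * \<epsilon> x) = \<epsilon>s \<beta> \<epsilon>" using e2 by blast
  moreover have "\<forall>\<beta> \<epsilon> \<theta>. adm \<beta> \<epsilon> \<theta> \<longrightarrow> hardy \<beta> \<epsilon> \<theta> (c \<beta> \<epsilon>)" using c(2) by blast
  ultimately show ?thesis
    unfolding adm_def hardy_def using pos(1) by blast
qed

end
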